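(* Let $X = X(\Delta)$ be a smooth projective toric surface. If $X$ is isomorphic to an even Hirzebruch surface $\mathbb{F}_{2a}$ for some integer $a \geq 0$, then $X(\mathbb{R})$ is homeomorphic to $S^1 \times S^1$. Otherwise, $X(\mathbb{R})$ is homeomorphic to a connected sum of $\#\Delta(1) - 2$ copies of $\mathbb{R}\mathbb{P}^2$.
   Context: $X(\Delta)$ denotes the (normal) toric variety associated with a fan $\Delta$ in $N_{\mathbb{R}} = N \otimes \mathbb{R}$, where $N$ is a lattice (here of rank $2$), and $\Delta(1)$ is the set of $1$-dimensional cones of $\Delta$. A toric variety is defined over $\mathbb{R}$ in its standard split form (the torus is $\mathbb{G}_m^{\dim X}$ over $\mathbb{R}$), and $X(\mathbb{R})$ is its set of real points with the real analytic (Euclidean) topology. For an integer $a \geq 0$, the Hirzebruch surface $\mathbb{F}_a$ is the toric surface of the complete fan in $\mathbb{R}^2$ (with lattice $\mathbb{Z}^2$, standard basis $e_1, e_2$) whose rays are generated by $e_1$, $e_2$, $-e_2$ and $-e_1 + a e_2$. *)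

theory Defs
  imports "HOL-Analysis.Analysis" "HOL-Library.Function_Algebras"
begin

section \<open>Gluing of topological spaces\<close>

text \<open>The image of \<open>f\<close> with the finest topology making \<open>f\<close> continuous.\<close>

definition quotient_topology :: "'a topology \<Rightarrow> ('a \<Rightarrow> 'b) \<Rightarrow> 'b topology" where
  "quotient_topology X f =
     topology (\<lambda>U. U \<subseteq> f ` topspace X \<and> openin X {x \<in> topspace X. f x \<in> U})"

lemma openin_quotient_topology:
  "openin (quotient_topology X f) U \<longleftrightarrow>
     U \<subseteq> f ` topspace X \<and> openin X {x \<in> topspace X. f x \<in> U}"
proof -
  have *: "{x \<in> topspace X. f x \<in> S \<inter> T} =
      {x \<in> topspace X. f x \<in> S} \<inter> {x \<in> topspace X. f x \<in> T}" for S T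
    by auto
  have **: "{x \<in> topspace X. f x \<in> \<Union>K} = (\<Union>S\<in>K. {x \<in> topspace X. f x \<in> S})" for K
    by auto
  have "istopology (\<lambda>U. U \<subseteq> f ` topspace X \<and> openin X {x \<in> topspace X. f x \<in> U})"
    unfolding istopology_def
  proof (intro conjI allI impI)
    fix S T
    assume "S \<subseteq> f ` topspace X \<and> openin X {x \<in> topspace X. f x \<in> S}"
      and "T \<subseteq> f ` topspace X \<and> openin X {x \<in> topspace X. f x \<in> T}"
    then show "S \<inter> T \<subseteq> f ` topspace X" and "openin X {x \<in> topspace X. f x \<in> S \<inter> T}"
      unfolding * by (blast, simp add: openin_Int)
  next
    fix K
    assume K: "\<forall>S\<in>K. S \<subseteq> f ` topspace X \<and> openin X {x \<in> topspace X. f x \<in> S}"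
    then show "\<Union>K \<subseteq> f ` topspace X"
      by blast
    show "openin X {x \<in> topspace X. f x \<in> \<Union>K}"
      unfolding ** using K by (intro openin_Union) blast
  qed
  then show ?thesis
    by (simp add: quotient_topology_def)
qed

lemma topspace_quotient_topology: "topspace (quotient_topology X f) = f ` topspace X"
proof
  show "topspace (quotient_topology X f) \<subseteq> f ` topspace X"
    using openin_topspace[of "quotient_topology X f"]
    unfolding openin_quotient_topology by (rule conjunct1)
  have "{x \<in> topspace X. f x \<in> f ` topspace X} = topspace X"
    by auto
  then have "openin (quotient_topology X f) (f ` topspace X)"
    by (simp add: openin_quotient_topology)
  then show "f ` topspace X \<subseteq> topspace (quotient_topology X f)"
    by (rule openin_subset)
qed

lemma quotient_map_quotient_topology: "quotient_map X (quotient_topology X f) f"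
  by (simp add: quotient_map_def topspace_quotient_topology openin_quotient_topology)

definition disjoint_sum :: "'a topology \<Rightarrow> 'b topology \<Rightarrow> ('a + 'b) topology" where
  "disjoint_sum X Y = topology (\<lambda>U. openin X (Inl -` U) \<and> openin Y (Inr -` U))"

lemma openin_disjoint_sum:
  "openin (disjoint_sum X Y) U \<longleftrightarrow> openin X (Inl -` U) \<and> openin Y (Inr -` U)"
proof -
  have "istopology (\<lambda>U. openin X (Inl -` U) \<and> openin Y (Inr -` U))"
    unfolding istopology_def vimage_Int vimage_Union
    by (intro conjI allI impI openin_Int openin_Union; blast)
  then show ?thesis
    by (simp add: disjoint_sum_def)
qed


section \<open>Connected sums of surfaces\<close>

definition coordinate_disc :: "'a topology \<Rightarrow> (real^2 \<Rightarrow> 'a) \<Rightarrow> bool" where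
  "coordinate_disc M \<phi> \<longleftrightarrow>
     embedding_map (top_of_set (ball 0 2)) M \<phi> \<and> openin M (\<phi> ` ball 0 2)"

text \<open>The open unit discs are removed, and \<open>\<psi> u\<close> is identified with \<open>\<phi> u\<close> for
  \<open>u\<close> on the unit circle.\<close>

definition connected_sum_along ::
  "'a topology \<Rightarrow> (real^2 \<Rightarrow> 'a) \<Rightarrow> 'b topology \<Rightarrow> (real^2 \<Rightarrow> 'b) \<Rightarrow> ('a + 'b) topology" where
  "connected_sum_along M \<phi> N \<psi> =
     quotient_topology
       (disjoint_sum (subtopology M (topspace M - \<phi> ` ball 0 1))
                     (subtopology N (topspace N - \<psi> ` ball 0 1)))
       (\<lambda>z. case z of
              Inl x \<Rightarrow> Inl x
            | Inr y \<Rightarrow> if y \<in> \<psi> ` sphere 0 1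
                      then Inl (\<phi> (the_inv_into (sphere 0 1) \<psi> y)) else Inr y)"

definition is_connected_sum :: "'a topology \<Rightarrow> 'b topology \<Rightarrow> 'c topology \<Rightarrow> bool" where
  "is_connected_sum M N P \<longleftrightarrow>
     (\<exists>\<phi> \<psi>. coordinate_disc M \<phi> \<and> coordinate_disc N \<psi> \<and>
        P homeomorphic_space connected_sum_along M \<phi> N \<psi>)"

definition real_projective_plane :: "(real^3) set topology" where
  "real_projective_plane = quotient_topology (top_of_set (sphere 0 1)) (\<lambda>x. {x, - x})"

text \<open>The intermediate surfaces of the iteration live on the type \<open>'a\<close> of the final one.
  This loses nothing: a surface has at most continuum many points, so as soon as \<open>'a\<close>
  carries a closed surface at all, every closed surface has a homeomorphic copy in \<open>'a\<close>.\<close>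

inductive connected_sum_of_projective_planes :: "nat \<Rightarrow> 'a topology \<Rightarrow> bool" where
  one: "M homeomorphic_space real_projective_plane \<Longrightarrow>
          connected_sum_of_projective_planes 1 M"
| step: "connected_sum_of_projective_planes k M \<Longrightarrow>
          is_connected_sum M real_projective_plane P \<Longrightarrow>
          connected_sum_of_projective_planes (Suc k) P"


section \<open>Varieties over the reals\<close>

text \<open>A reduced real variety in the classical sense: its complex points with the Zariski
  topology, the complex-valued regular functions on (Zariski) open sets, and complex
  conjugation. Morphisms over the reals are the complex morphisms commuting with conjugation.\<close>

record 'p real_variety =
  zariski :: "'p topology"
  regular_on :: "'p set \<Rightarrow> ('p \<Rightarrow> complex) \<Rightarrow> bool"
  conjugation :: "'p \<Rightarrow> 'p"

definition variety_morphism ::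
  "'p real_variety \<Rightarrow> 'q real_variety \<Rightarrow> ('p \<Rightarrow> 'q) \<Rightarrow> bool" where
  "variety_morphism V W f \<longleftrightarrow>
     continuous_map (zariski V) (zariski W) f \<and>
     (\<forall>U g. openin (zariski W) U \<and> regular_on W U g \<longrightarrow>
        regular_on V {p \<in> topspace (zariski V). f p \<in> U} (g \<circ> f)) \<and>
     (\<forall>p \<in> topspace (zariski V). f (conjugation V p) = conjugation W (f p))"

definition isomorphic_varieties :: "'p real_variety \<Rightarrow> 'q real_variety \<Rightarrow> bool" where
  "isomorphic_varieties V W \<longleftrightarrow>
     (\<exists>f g. variety_morphism V W f \<and> variety_morphism W V g \<and>
        (\<forall>p \<in> topspace (zariski V). g (f p) = p) \<and>
        (\<forall>q \<in> topspace (zariski W). f (g q) = q))"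

definition closed_subvariety :: "'p real_variety \<Rightarrow> 'p set \<Rightarrow> 'p real_variety" where
  "closed_subvariety V Z =
     \<lparr> zariski = subtopology (zariski V) Z,
       regular_on = (\<lambda>U g. \<forall>p\<in>U. \<exists>W h. openin (zariski V) W \<and> p \<in> W \<and>
          regular_on V W h \<and> (\<forall>q \<in> U \<inter> W. g q = h q)),
       conjugation = conjugation V \<rparr>"

text \<open>Projective space, with homogeneous coordinates indexed by \<open>{..n}\<close>; coordinate
  vectors are sequences vanishing beyond \<open>n\<close>.\<close>

definition homogeneous_coordinates :: "nat \<Rightarrow> (nat \<Rightarrow> complex) set" where
  "homogeneous_coordinates n = {x. (\<exists>i\<le>n. x i \<noteq> 0) \<and> (\<forall>i>n. x i = 0)}"

definition proj_point :: "(nat \<Rightarrow> complex) \<Rightarrow> (nat \<Rightarrow> complex) set" where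
  "proj_point x = {(\<lambda>i. c * x i) | c. c \<noteq> 0}"

definition homogeneous_forms :: "nat \<Rightarrow> nat \<Rightarrow> ((nat \<Rightarrow> complex) \<Rightarrow> complex) set" where
  "homogeneous_forms n d =
     {f. \<exists>A c. finite A \<and> (\<forall>\<alpha>\<in>A. (\<Sum>i\<le>n. \<alpha> i) = d) \<and>
          f = (\<lambda>x. \<Sum>\<alpha>\<in>A. c \<alpha> * (\<Prod>i\<le>n. x i ^ \<alpha> i))}"

definition projective_space :: "nat \<Rightarrow> (nat \<Rightarrow> complex) set real_variety" where
  "projective_space n =
     \<lparr> zariski = topology_generated_by
         {proj_point ` {x \<in> homogeneous_coordinates n. f x \<noteq> 0} | f d.
            f \<in> homogeneous_forms n d},
       regular_on = (\<lambda>U g. \<forall>x \<in> homogeneous_coordinates n. proj_point x \<in> U \<longrightarrow>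
         (\<exists>d. \<exists>f \<in> homogeneous_forms n d. \<exists>h \<in> homogeneous_forms n d. h x \<noteq> 0 \<and>
            (\<forall>y \<in> homogeneous_coordinates n. proj_point y \<in> U \<and> h y \<noteq> 0 \<longrightarrow>
               g (proj_point y) = f y / h y))),
       conjugation = (\<lambda>p. (\<lambda>x. cnj \<circ> x) ` p) \<rparr>"

definition projective_variety :: "'p real_variety \<Rightarrow> bool" where
  "projective_variety V \<longleftrightarrow>
     (\<exists>n Z. closedin (zariski (projective_space n)) Z \<and>
        isomorphic_varieties V (closed_subvariety (projective_space n) Z))"


section \<open>Lattices and fans\<close>

text \<open>A lattice \<open>N\<close> is realised inside \<open>N\<^sub>\<real>\<close>, which is the ambient Euclidean space
  \<open>'v\<close>; the inner product serves to identify the dual space with \<open>'v\<close>.\<close>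

definition is_lattice :: "'v::euclidean_space set \<Rightarrow> bool" where
  "is_lattice N \<longleftrightarrow>
     (\<exists>B. independent B \<and> span B = UNIV \<and>
        N = range (\<lambda>c :: 'v \<Rightarrow> int. \<Sum>b\<in>B. of_int (c b) *\<^sub>R b))"

definition dual_lattice :: "'v::euclidean_space set \<Rightarrow> 'v set" where
  "dual_lattice N = {m. \<forall>v\<in>N. m \<bullet> v \<in> \<int>}"

definition rational_cone :: "'v::euclidean_space set \<Rightarrow> 'v set \<Rightarrow> bool" where
  "rational_cone N \<sigma> \<longleftrightarrow> (\<exists>S. finite S \<and> S \<subseteq> N \<and> \<sigma> = convex_cone hull S)"

definition strongly_convex :: "'v::euclidean_space set \<Rightarrow> bool" where
  "strongly_convex \<sigma> \<longleftrightarrow> (\<forall>v. v \<in> \<sigma> \<and> - v \<in> \<sigma> \<longrightarrow> v = 0)"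

text \<open>\<open>face_of\<close> admits the empty face, which is not a cone.\<close>

definition is_fan :: "'v::euclidean_space set \<Rightarrow> 'v set set \<Rightarrow> bool" where
  "is_fan N \<Delta> \<longleftrightarrow>
     finite \<Delta> \<and> \<Delta> \<noteq> {} \<and>
     (\<forall>\<sigma>\<in>\<Delta>. rational_cone N \<sigma> \<and> strongly_convex \<sigma>) \<and>
     (\<forall>\<sigma>\<in>\<Delta>. \<forall>\<tau>. \<tau> face_of \<sigma> \<and> \<tau> \<noteq> {} \<longrightarrow> \<tau> \<in> \<Delta>) \<and>
     (\<forall>\<sigma>\<in>\<Delta>. \<forall>\<tau>\<in>\<Delta>. (\<sigma> \<inter> \<tau>) face_of \<sigma> \<and> (\<sigma> \<inter> \<tau>) face_of \<tau>)"

definition rays :: "'v::euclidean_space set set \<Rightarrow> 'v set set" where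
  "rays \<Delta> = {\<rho>\<in>\<Delta>. dim \<rho> = 1}"


section \<open>Toric varieties\<close>

definition cone_semigroup :: "'v::euclidean_space set \<Rightarrow> 'v set \<Rightarrow> 'v set" where
  "cone_semigroup N \<sigma> = {m \<in> dual_lattice N. \<forall>v\<in>\<sigma>. 0 \<le> m \<bullet> v}"

text \<open>The \<open>'k\<close>-points of the affine chart \<open>Spec 'k[S]\<close>, where \<open>S = cone_semigroup N \<sigma>\<close>:
  monoid homomorphisms from \<open>S\<close> to the multiplicative monoid of \<open>'k\<close>, extended by 0
  outside \<open>S\<close>.\<close>

definition chart_points :: "'v::euclidean_space set \<Rightarrow> 'v set \<Rightarrow> ('v \<Rightarrow> 'k::field) set" where
  "chart_points N \<sigma> =
     {\<xi>. \<xi> 0 = 1 \<and>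
         (\<forall>m \<in> cone_semigroup N \<sigma>. \<forall>m' \<in> cone_semigroup N \<sigma>. \<xi> (m + m') = \<xi> m * \<xi> m') \<and>
         (\<forall>m. m \<notin> cone_semigroup N \<sigma> \<longrightarrow> \<xi> m = 0)}"

definition chart_restrict ::
  "'v::euclidean_space set \<Rightarrow> 'v set \<Rightarrow> ('v \<Rightarrow> 'k::field) \<Rightarrow> ('v \<Rightarrow> 'k)" where
  "chart_restrict N \<sigma> \<xi> = (\<lambda>m. if m \<in> cone_semigroup N \<sigma> then \<xi> m else 0)"

text \<open>The charts of \<open>\<sigma>\<close> and \<open>\<tau>\<close> are glued along the chart of \<open>\<sigma> \<inter> \<tau>\<close>, an open subset of
  both. A point of the toric variety is the class of all its chart representatives.\<close>

definition toric_point ::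
  "'v::euclidean_space set \<Rightarrow> 'v set set \<Rightarrow> 'v set \<times> ('v \<Rightarrow> 'k::field) \<Rightarrow> ('v set \<times> ('v \<Rightarrow> 'k)) set" where
  "toric_point N \<Delta> = (\<lambda>(\<sigma>, \<xi>).
     {(\<tau>, \<psi>). \<tau> \<in> \<Delta> \<and> \<psi> \<in> chart_points N \<tau> \<and>
        (\<exists>\<omega> \<in> chart_points N (\<sigma> \<inter> \<tau>). \<xi> = chart_restrict N \<sigma> \<omega> \<and> \<psi> = chart_restrict N \<tau> \<omega>)})"

definition toric_space ::
  "'v::euclidean_space set \<Rightarrow> 'v set set \<Rightarrow> ('v set \<Rightarrow> ('v \<Rightarrow> 'k::field) topology) \<Rightarrow>
     ('v set \<times> ('v \<Rightarrow> 'k)) set topology" where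
  "toric_space N \<Delta> charts = quotient_topology (sum_topology charts \<Delta>) (toric_point N \<Delta>)"

text \<open>Each chart carries the topology of pointwise convergence, that is, the Euclidean
  topology it inherits from evaluation at any finite set of generators of the semigroup.\<close>

definition toric_real_points ::
  "'v::euclidean_space set \<Rightarrow> 'v set set \<Rightarrow> ('v set \<times> ('v \<Rightarrow> real)) set topology" where
  "toric_real_points N \<Delta> = toric_space N \<Delta> (\<lambda>\<sigma>. top_of_set (chart_points N \<sigma>))"

definition coordinate_ring ::
  "'v::euclidean_space set \<Rightarrow> 'v set \<Rightarrow> (('v \<Rightarrow> complex) \<Rightarrow> complex) set" where
  "coordinate_ring N \<sigma> =
     {f. \<exists>A c. finite A \<and> A \<subseteq> cone_semigroup N \<sigma> \<and> f = (\<lambda>\<xi>. \<Sum>m\<in>A. c m * \<xi> m)}"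

definition toric_variety ::
  "'v::euclidean_space set \<Rightarrow> 'v set set \<Rightarrow> ('v set \<times> ('v \<Rightarrow> complex)) set real_variety" where
  "toric_variety N \<Delta> =
     \<lparr> zariski = toric_space N \<Delta> (\<lambda>\<sigma>. topology_generated_by
         {{\<xi> \<in> chart_points N \<sigma>. f \<xi> \<noteq> 0} | f. f \<in> coordinate_ring N \<sigma>}),
       regular_on = (\<lambda>U g. \<forall>\<sigma>\<in>\<Delta>. \<forall>\<xi> \<in> chart_points N \<sigma>. toric_point N \<Delta> (\<sigma>, \<xi>) \<in> U \<longrightarrow>
         (\<exists>f \<in> coordinate_ring N \<sigma>. \<exists>h \<in> coordinate_ring N \<sigma>. h \<xi> \<noteq> 0 \<and>
            (\<forall>\<psi> \<in> chart_points N \<sigma>. toric_point N \<Delta> (\<sigma>, \<psi>) \<in> U \<and> h \<psi> \<noteq> 0 \<longrightarrow>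
               g (toric_point N \<Delta> (\<sigma>, \<psi>)) = f \<psi> / h \<psi>))),
       conjugation = (\<lambda>p. (\<lambda>(\<sigma>, \<xi>). (\<sigma>, cnj \<circ> \<xi>)) ` p) \<rparr>"

text \<open>The Zariski tangent space of the chart at \<open>\<xi>\<close>: the complex-linear derivations at
  \<open>\<xi>\<close> of the semigroup algebra, given by their values on the basis of characters.\<close>

definition tangent_space ::
  "'v::euclidean_space set \<Rightarrow> 'v set \<Rightarrow> ('v \<Rightarrow> complex) \<Rightarrow> ('v \<Rightarrow> complex) set" where
  "tangent_space N \<sigma> \<xi> =
     {D. (\<forall>m \<in> cone_semigroup N \<sigma>. \<forall>m' \<in> cone_semigroup N \<sigma>.
            D (m + m') = \<xi> m * D m' + \<xi> m' * D m) \<and>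
         (\<forall>m. m \<notin> cone_semigroup N \<sigma> \<longrightarrow> D m = 0)}"

text \<open>A toric variety is irreducible of dimension \<open>DIM('v)\<close>, the rank of the lattice; it is
  smooth if all its Zariski tangent spaces have this complex dimension.\<close>

definition smooth_toric_variety :: "'v::euclidean_space set \<Rightarrow> 'v set set \<Rightarrow> bool" where
  "smooth_toric_variety N \<Delta> \<longleftrightarrow>
     (\<forall>\<sigma>\<in>\<Delta>. \<forall>\<xi> \<in> chart_points N \<sigma>.
        vector_space.dim (\<lambda>(c::complex) D m. c * D m) (tangent_space N \<sigma> \<xi>) = DIM('v))"


section \<open>Hirzebruch surfaces\<close>

definition integer_lattice :: "(real^2) set" where
  "integer_lattice = {v. \<forall>i. v $ i \<in> \<int>}"

definition hirzebruch_fan :: "nat \<Rightarrow> (real^2) set set" where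
  "hirzebruch_fan a =
     (let e1 = vector [1, 0]; e2 = vector [0, 1]; w = - e1 + real a *\<^sub>R e2 in
      (\<lambda>S. convex_cone hull S) `
        {{}, {e1}, {e2}, {w}, {- e2}, {e1, e2}, {e2, w}, {w, - e2}, {- e2, e1}})"

definition hirzebruch_surface :: "nat \<Rightarrow> ((real^2) set \<times> (real^2 \<Rightarrow> complex)) set real_variety" where
  "hirzebruch_surface a = toric_variety integer_lattice (hirzebruch_fan a)"

end

(* A projective toric variety is complete, so the fan is a complete unimodular fan in the plane, that is,
   a cyclic sequence of primitive vectors in which each one times an integer is the sum of its two
   neighbours. A combinatorial descent shows that such a fan is the fan of an even Hirzebruch surface, or
   arises from the fan of the projective plane or of an odd Hirzebruch surface by star subdivisions of
   two-dimensional cones. The real points of the projective plane are the sphere modulo antipodes, and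
   those of a Hirzebruch surface are a quotient of a torus depending only on the parity of its index. A
   star subdivision blows up a real point: the preimage of a closed disc is a Moebius band, so the real
   points change by a connected sum with the projective plane. As F_1 is such a blow-up of the projective
   plane, the second case follows by induction. In the first case, an isomorphism over the reals restricts
   to a homeomorphism of real points, because regular functions are locally quotients of characters. *)

theory Submission
  imports Defs
begin

section \<open>Quotients and compactness\<close>

text \<open>Three obstacles shape the argument. Projectivity is only an abstract isomorphism with a
  closed subvariety, so completeness has to come from analysis: torus points running off in a
  direction \<open>v\<close> have a convergent subsequence in projective space, and the limit pulls
  back to some chart; a character pairing negatively with \<open>v\<close> would be unbounded there,
  while a quotient of forms with nonvanishing denominator converges. Next, the descent must not end
  in a torus. If contracting a ray leads to an even Hirzebruch fan, an elementary transformation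
  helps: the same five-ray fan also contracts to an odd Hirzebruch fan, so the induction can be
  rerouted. Finally, points of different surfaces are classes of representatives over different
  fans. Maps between them are therefore glued from chart formulas, with compatibility checked only
  on the common dense torus, and homeomorphisms come from comparing the fibres of two maps on one
  compact space. The descent itself is driven by extremality: a longest ray, or a highest one for an
  integral form, admits very few relations with its neighbours.\<close>

lemma compact_to_Hausdorff_quotient_map:
  assumes "compact_space X" "Hausdorff_space Y" "continuous_map X Y f" "f ` topspace X = topspace Y"
  shows "quotient_map X Y f"
  using assms by (metis continuous_closed_quotient_map continuous_imp_closed_map)

text \<open>The universal property of quotient maps gives continuous maps in both directions. Later
  identifications of surfaces with model spaces are reduced to a comparison of fibres by this
  lemma.\<close>

lemma homeomorphic_space_of_quotient_maps:
  assumes f: "quotient_map D X f" and g: "quotient_map D Y g"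
    and fib: "\<And>x y. x \<in> topspace D \<Longrightarrow> y \<in> topspace D \<Longrightarrow> f x = f y \<longleftrightarrow> g x = g y"
  shows "X homeomorphic_space Y"
proof -
  obtain h where h: "continuous_map X Y h" "\<And>x. x \<in> topspace D \<Longrightarrow> h (f x) = g x"
    using quotient_map_lift_exists[OF f quotient_imp_continuous_map[OF g]] fib by metis
  obtain k where k: "continuous_map Y X k" "\<And>x. x \<in> topspace D \<Longrightarrow> k (g x) = f x"
    using quotient_map_lift_exists[OF g quotient_imp_continuous_map[OF f]] fib by metis
  have "f ` topspace D = topspace X" "g ` topspace D = topspace Y"
    using f g by (auto simp: quotient_map_def)
  then have "homeomorphic_maps X Y h k"
    unfolding homeomorphic_maps_def using h k by (auto simp flip: \<open>f ` topspace D = topspace X\<close> \<open>g ` topspace D = topspace Y\<close>)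
  then show ?thesis
    unfolding homeomorphic_space_def by blast
qed

section \<open>Separated fans\<close>

lemma cone_semigroup_add:
  "m \<in> cone_semigroup N \<sigma> \<Longrightarrow> m' \<in> cone_semigroup N \<sigma> \<Longrightarrow> m + m' \<in> cone_semigroup N \<sigma>"
  by (auto simp: cone_semigroup_def dual_lattice_def inner_add_left)

lemma cone_semigroup_scale:
  "m \<in> cone_semigroup N \<sigma> \<Longrightarrow> real k *\<^sub>R m \<in> cone_semigroup N \<sigma>"
  by (auto simp: cone_semigroup_def dual_lattice_def)

lemma cone_semigroup_0 [simp]: "0 \<in> cone_semigroup N \<sigma>"
  by (auto simp: cone_semigroup_def dual_lattice_def)

lemma cone_semigroup_antimono:
  "\<sigma> \<subseteq> \<tau> \<Longrightarrow> m \<in> cone_semigroup N \<tau> \<Longrightarrow> m \<in> cone_semigroup N \<sigma>"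
  by (auto simp: cone_semigroup_def)

lemma chart_points_0: "\<xi> \<in> chart_points N \<sigma> \<Longrightarrow> \<xi> 0 = 1"
  by (simp add: chart_points_def)

lemma chart_points_add:
  "\<xi> \<in> chart_points N \<sigma> \<Longrightarrow> m \<in> cone_semigroup N \<sigma> \<Longrightarrow> m' \<in> cone_semigroup N \<sigma> \<Longrightarrow>
    \<xi> (m + m') = \<xi> m * \<xi> m'"
  by (simp add: chart_points_def)

lemma chart_points_outside:
  "\<xi> \<in> chart_points N \<sigma> \<Longrightarrow> m \<notin> cone_semigroup N \<sigma> \<Longrightarrow> \<xi> m = 0"
  by (simp add: chart_points_def)

lemma chart_points_scale:
  assumes "\<xi> \<in> chart_points N \<sigma>" "m \<in> cone_semigroup N \<sigma>"
  shows "\<xi> (real k *\<^sub>R m) = \<xi> m ^ k"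
proof (induction k)
  case 0
  then show ?case using chart_points_0[OF assms(1)] by simp
next
  case (Suc k)
  have "real (Suc k) *\<^sub>R m = m + real k *\<^sub>R m"
    by (simp add: scaleR_add_left)
  then show ?case
    using chart_points_add[OF assms cone_semigroup_scale[OF assms(2)]] Suc by simp
qed

lemma chart_points_unit:
  assumes "\<xi> \<in> chart_points N \<sigma>" "m \<in> cone_semigroup N \<sigma>" "- m \<in> cone_semigroup N \<sigma>"
  shows "\<xi> m * \<xi> (- m) = 1" "\<xi> m \<noteq> 0"
proof -
  show "\<xi> m * \<xi> (- m) = 1"
    using chart_points_add[OF assms] chart_points_0[OF assms(1)] by simp
  then show "\<xi> m \<noteq> 0" by auto
qed

lemma chart_restrict_self:
  "\<xi> \<in> chart_points N \<sigma> \<Longrightarrow> chart_restrict N \<sigma> \<xi> = \<xi>"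
  by (auto simp: chart_restrict_def chart_points_outside)

lemma chart_restrict_in:
  assumes "\<omega> \<in> chart_points N \<tau>" "\<tau> \<subseteq> \<sigma>"
  shows "chart_restrict N \<sigma> \<omega> \<in> chart_points N \<sigma>"
proof -
  have "m \<in> cone_semigroup N \<tau>" if "m \<in> cone_semigroup N \<sigma>" for m
    using cone_semigroup_antimono[OF assms(2) that] .
  then show ?thesis
    using assms(1) by (auto simp: chart_points_def chart_restrict_def cone_semigroup_add)
qed

text \<open>Inverting the character \<open>m0\<close> extends a point of the chart of \<open>\<sigma>\<close> to the chart of a face.\<close>

definition chart_localize ::
  "'v::euclidean_space set \<Rightarrow> 'v set \<Rightarrow> 'v set \<Rightarrow> 'v \<Rightarrow> ('v \<Rightarrow> 'k::field) \<Rightarrow> ('v \<Rightarrow> 'k)" where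
  "chart_localize N \<sigma> \<gamma> m0 \<xi> = (\<lambda>m. if m \<in> cone_semigroup N \<gamma> then
     (let k = (SOME k::nat. m + real k *\<^sub>R m0 \<in> cone_semigroup N \<sigma>) in
        \<xi> (m + real k *\<^sub>R m0) / \<xi> m0 ^ k) else 0)"

text \<open>The quotient does not depend on the exponent: for two exponents \<open>k\<close> and
  \<open>l\<close>, the value at \<open>m + k m0 + l m0\<close> can be expanded in two ways. So the
  arbitrary choice made in the definition is harmless, and exponents may be added to prove
  multiplicativity.\<close>

lemma chart_localize:
  assumes m0: "m0 \<in> cone_semigroup N \<sigma>" "\<And>m. m \<in> cone_semigroup N \<gamma> \<Longrightarrow>
      \<exists>k::nat. m + real k *\<^sub>R m0 \<in> cone_semigroup N \<sigma>"
    and sub: "\<gamma> \<subseteq> \<sigma>"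
    and \<xi>: "\<xi> \<in> chart_points N \<sigma>" "\<xi> m0 \<noteq> 0"
  shows chart_localize_eq: "\<And>m k. m \<in> cone_semigroup N \<gamma> \<Longrightarrow> m + real k *\<^sub>R m0 \<in> cone_semigroup N \<sigma> \<Longrightarrow>
      chart_localize N \<sigma> \<gamma> m0 \<xi> m = \<xi> (m + real k *\<^sub>R m0) / \<xi> m0 ^ k" (is "\<And>m k. _ \<Longrightarrow> _ \<Longrightarrow> ?P m k")
    and chart_localize_in: "chart_localize N \<sigma> \<gamma> m0 \<xi> \<in> chart_points N \<gamma>"
    and chart_localize_restrict: "chart_restrict N \<sigma> (chart_localize N \<sigma> \<gamma> m0 \<xi>) = \<xi>"
proof -
  have eq: "?P m k" if m: "m \<in> cone_semigroup N \<gamma>" and k: "m + real k *\<^sub>R m0 \<in> cone_semigroup N \<sigma>" for m k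
  proof -
    define l where "l = (SOME k::nat. m + real k *\<^sub>R m0 \<in> cone_semigroup N \<sigma>)"
    have l: "m + real l *\<^sub>R m0 \<in> cone_semigroup N \<sigma>"
      unfolding l_def using k by (rule someI)
    have "\<xi> (m + real k *\<^sub>R m0 + real l *\<^sub>R m0) = \<xi> (m + real k *\<^sub>R m0) * \<xi> m0 ^ l"
      "\<xi> (m + real l *\<^sub>R m0 + real k *\<^sub>R m0) = \<xi> (m + real l *\<^sub>R m0) * \<xi> m0 ^ k"
      using k l m0 \<xi> by (simp_all add: chart_points_add cone_semigroup_scale chart_points_scale)
    then have "\<xi> (m + real k *\<^sub>R m0) * \<xi> m0 ^ l = \<xi> (m + real l *\<^sub>R m0) * \<xi> m0 ^ k"
      by (metis add.assoc add.commute)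
    then show ?thesis
      using m \<xi>(2) by (simp add: chart_localize_def l_def[symmetric] Let_def frac_eq_eq)
  qed
  then show "\<And>m k. m \<in> cone_semigroup N \<gamma> \<Longrightarrow> m + real k *\<^sub>R m0 \<in> cone_semigroup N \<sigma> \<Longrightarrow> ?P m k" .
  let ?\<omega> = "chart_localize N \<sigma> \<gamma> m0 \<xi>"
  have eq0: "?\<omega> m = \<xi> m" if "m \<in> cone_semigroup N \<sigma>" for m
    using eq[of m 0] that cone_semigroup_antimono[OF sub] by simp
  show "chart_restrict N \<sigma> ?\<omega> = \<xi>"
    by (auto simp: chart_restrict_def eq0 chart_points_outside[OF \<xi>(1)])
  show "?\<omega> \<in> chart_points N \<gamma>"
    unfolding chart_points_def
  proof (intro CollectI conjI ballI allI impI)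
    show "?\<omega> 0 = 1" using eq0[of 0] \<xi> by (simp add: chart_points_0)
    show "?\<omega> m = 0" if "m \<notin> cone_semigroup N \<gamma>" for m
      using that by (simp add: chart_localize_def)
    fix m m' assume m: "m \<in> cone_semigroup N \<gamma>" "m' \<in> cone_semigroup N \<gamma>"
    obtain k l where kl: "m + real k *\<^sub>R m0 \<in> cone_semigroup N \<sigma>" "m' + real l *\<^sub>R m0 \<in> cone_semigroup N \<sigma>"
      using m0(2) m by meson
    have s: "m + m' + real (k + l) *\<^sub>R m0 = (m + real k *\<^sub>R m0) + (m' + real l *\<^sub>R m0)"
      by (simp add: algebra_simps)
    then have "m + m' + real (k + l) *\<^sub>R m0 \<in> cone_semigroup N \<sigma>"
      using kl by (metis cone_semigroup_add)
    then have "?\<omega> (m + m') = \<xi> (m + m' + real (k + l) *\<^sub>R m0) / \<xi> m0 ^ (k + l)"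
      using m by (intro eq) (auto simp: cone_semigroup_add)
    also have "\<dots> = ?\<omega> m * ?\<omega> m'"
      unfolding s eq[OF m(1) kl(1)] eq[OF m(2) kl(2)]
      using kl \<xi> by (simp add: chart_points_add power_add)
    finally show "?\<omega> (m + m') = ?\<omega> m * ?\<omega> m'" .
  qed
qed

section \<open>Points as glued classes of chart representatives\<close>

lemma toric_point_iff:
  "(\<tau>, \<psi>) \<in> toric_point N \<Delta> (\<sigma>, \<xi>) \<longleftrightarrow> \<tau> \<in> \<Delta> \<and> \<psi> \<in> chart_points N \<tau> \<and>
     (\<exists>\<omega> \<in> chart_points N (\<sigma> \<inter> \<tau>). \<xi> = chart_restrict N \<sigma> \<omega> \<and> \<psi> = chart_restrict N \<tau> \<omega>)"
  by (simp add: toric_point_def)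

lemma toric_point_refl:
  "\<sigma> \<in> \<Delta> \<Longrightarrow> \<xi> \<in> chart_points N \<sigma> \<Longrightarrow> (\<sigma>, \<xi>) \<in> toric_point N \<Delta> (\<sigma>, \<xi>)"
  by (auto simp: toric_point_iff chart_restrict_self intro!: bexI[of _ \<xi>])

lemma toric_point_sym:
  "\<sigma> \<in> \<Delta> \<Longrightarrow> \<xi> \<in> chart_points N \<sigma> \<Longrightarrow> (\<tau>, \<psi>) \<in> toric_point N \<Delta> (\<sigma>, \<xi>) \<Longrightarrow>
    (\<sigma>, \<xi>) \<in> toric_point N \<Delta> (\<tau>, \<psi>)"
  by (auto simp: toric_point_iff Int_commute)

text \<open>The separation lemma for the cones of a fan, taken as an axiom so that gluing is
  independent of the dimension. Because every element of the semigroup of the intersection becomes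
  an element of the larger chart's semigroup after adding a multiple of \<open>m\<close>, the
  overlap of two charts is the locus where the character \<open>m\<close> is invertible.\<close>

locale separated_fan =
  fixes N :: "'v::euclidean_space set" and \<Delta> :: "'v set set"
  assumes separated: "\<And>\<sigma> \<tau>. \<sigma> \<in> \<Delta> \<Longrightarrow> \<tau> \<in> \<Delta> \<Longrightarrow>
    \<exists>m \<in> cone_semigroup N \<sigma>. - m \<in> cone_semigroup N \<tau> \<and>
        (\<forall>m' \<in> cone_semigroup N (\<sigma> \<inter> \<tau>). \<exists>k::nat.
           m' + real k *\<^sub>R m \<in> cone_semigroup N \<sigma> \<and> m' - real k *\<^sub>R m \<in> cone_semigroup N \<tau>)"
begin

abbreviation "S \<equiv> cone_semigroup N"

definition separator :: "'v set \<Rightarrow> 'v set \<Rightarrow> 'v" where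
  "separator \<sigma> \<tau> = (SOME m. m \<in> S \<sigma> \<and> - m \<in> S \<tau> \<and>
        (\<forall>m' \<in> S (\<sigma> \<inter> \<tau>). \<exists>k::nat. m' + real k *\<^sub>R m \<in> S \<sigma> \<and> m' - real k *\<^sub>R m \<in> S \<tau>))"

lemma separator:
  assumes "\<sigma> \<in> \<Delta>" "\<tau> \<in> \<Delta>"
  shows "separator \<sigma> \<tau> \<in> S \<sigma>" "- separator \<sigma> \<tau> \<in> S \<tau>"
    "\<And>m. m \<in> S (\<sigma> \<inter> \<tau>) \<Longrightarrow> \<exists>k::nat. m + real k *\<^sub>R separator \<sigma> \<tau> \<in> S \<sigma>"
    "\<And>m. m \<in> S (\<sigma> \<inter> \<tau>) \<Longrightarrow> \<exists>k::nat. m + real k *\<^sub>R - separator \<sigma> \<tau> \<in> S \<tau>"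
    "separator \<sigma> \<tau> \<in> S (\<sigma> \<inter> \<tau>)" "- separator \<sigma> \<tau> \<in> S (\<sigma> \<inter> \<tau>)"
proof -
  have "\<exists>m. m \<in> S \<sigma> \<and> - m \<in> S \<tau> \<and>
        (\<forall>m' \<in> S (\<sigma> \<inter> \<tau>). \<exists>k::nat. m' + real k *\<^sub>R m \<in> S \<sigma> \<and> m' - real k *\<^sub>R m \<in> S \<tau>)"
    using separated[OF assms] by blast
  from someI_ex[OF this] have *: "separator \<sigma> \<tau> \<in> S \<sigma>" "- separator \<sigma> \<tau> \<in> S \<tau>"
    "\<And>m. m \<in> S (\<sigma> \<inter> \<tau>) \<Longrightarrow> \<exists>k::nat. m + real k *\<^sub>R separator \<sigma> \<tau> \<in> S \<sigma> \<and> m - real k *\<^sub>R separator \<sigma> \<tau> \<in> S \<tau>"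
    unfolding separator_def by blast+
  show "separator \<sigma> \<tau> \<in> S \<sigma>" "- separator \<sigma> \<tau> \<in> S \<tau>" using * by auto
  then show "separator \<sigma> \<tau> \<in> S (\<sigma> \<inter> \<tau>)" "- separator \<sigma> \<tau> \<in> S (\<sigma> \<inter> \<tau>)"
    by (meson cone_semigroup_antimono inf_le1 inf_le2)+
  show "\<exists>k::nat. m + real k *\<^sub>R separator \<sigma> \<tau> \<in> S \<sigma>" if "m \<in> S (\<sigma> \<inter> \<tau>)" for m
    using *(3)[OF that] by auto
  show "\<exists>k::nat. m + real k *\<^sub>R - separator \<sigma> \<tau> \<in> S \<tau>" if "m \<in> S (\<sigma> \<inter> \<tau>)" for m
    using *(3)[OF that] by auto
qed

lemma separator_nonzero:
  assumes "\<sigma> \<in> \<Delta>" "\<tau> \<in> \<Delta>" "\<omega> \<in> chart_points N (\<sigma> \<inter> \<tau>)"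
  shows "\<omega> (separator \<sigma> \<tau>) * \<omega> (- separator \<sigma> \<tau>) = 1" "\<omega> (separator \<sigma> \<tau>) \<noteq> 0" "\<omega> (- separator \<sigma> \<tau>) \<noteq> 0"
  using chart_points_unit[OF assms(3) separator(5,6)[OF assms(1,2)]] by auto

lemma extend_left:
  assumes "\<sigma> \<in> \<Delta>" "\<tau> \<in> \<Delta>" "\<xi> \<in> chart_points N \<sigma>" "\<xi> (separator \<sigma> \<tau>) \<noteq> 0"
  defines "\<omega> \<equiv> chart_localize N \<sigma> (\<sigma> \<inter> \<tau>) (separator \<sigma> \<tau>) \<xi>"
  shows "\<omega> \<in> chart_points N (\<sigma> \<inter> \<tau>)" "chart_restrict N \<sigma> \<omega> = \<xi>"
    "m \<in> S (\<sigma> \<inter> \<tau>) \<Longrightarrow> m + real k *\<^sub>R separator \<sigma> \<tau> \<in> S \<sigma> \<Longrightarrow>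
      \<omega> m = \<xi> (m + real k *\<^sub>R separator \<sigma> \<tau>) / \<xi> (separator \<sigma> \<tau>) ^ k"
  using chart_localize[OF separator(1,3)[OF assms(1,2)] inf_le1 assms(3,4)]
  unfolding \<omega>_def by (blast, blast, meson)

lemma extend_right:
  assumes "\<sigma> \<in> \<Delta>" "\<tau> \<in> \<Delta>" "\<psi> \<in> chart_points N \<tau>" "\<psi> (- separator \<sigma> \<tau>) \<noteq> 0"
  defines "\<omega> \<equiv> chart_localize N \<tau> (\<sigma> \<inter> \<tau>) (- separator \<sigma> \<tau>) \<psi>"
  shows "\<omega> \<in> chart_points N (\<sigma> \<inter> \<tau>)" "chart_restrict N \<tau> \<omega> = \<psi>"
    "m \<in> S (\<sigma> \<inter> \<tau>) \<Longrightarrow> m + real k *\<^sub>R - separator \<sigma> \<tau> \<in> S \<tau> \<Longrightarrow>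
      \<omega> m = \<psi> (m + real k *\<^sub>R - separator \<sigma> \<tau>) / \<psi> (- separator \<sigma> \<tau>) ^ k"
  using chart_localize[OF separator(2,4)[OF assms(1,2)] inf_le2 assms(3,4)]
  unfolding \<omega>_def by (blast, blast, meson)

lemma restrict_apply: "m \<in> S \<sigma> \<Longrightarrow> chart_restrict N \<sigma> \<omega> m = \<omega> m"
  by (simp add: chart_restrict_def)

text \<open>The characters of the two outer charts can be compared on the middle chart \<open>\<tau>\<close>
  after multiplication with powers of separators, which are units there.\<close>

lemma middle_chart_eq:
  assumes \<Delta>: "\<sigma> \<in> \<Delta>" "\<tau> \<in> \<Delta>" "\<upsilon> \<in> \<Delta>"
    and \<omega>: "\<omega>1 \<in> chart_points N (\<sigma> \<inter> \<tau>)" "\<omega>2 \<in> chart_points N (\<tau> \<inter> \<upsilon>)"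
    and mid: "chart_restrict N \<tau> \<omega>1 = chart_restrict N \<tau> \<omega>2"
    and m: "a \<in> S \<sigma>" "b \<in> S \<sigma>" "c \<in> S \<upsilon>" "a = b + c"
  shows "\<omega>1 a = \<omega>1 b * \<omega>2 c"
proof -
  define p where "p = separator \<sigma> \<tau>"
  define q where "q = separator \<tau> \<upsilon>"
  have eq: "\<omega>1 z = \<omega>2 z" if "z \<in> S \<tau>" for z
    using mid that by (metis restrict_apply)
  have l: "z \<in> S (\<sigma> \<inter> \<tau>)" if "z \<in> S \<sigma> \<or> z \<in> S \<tau>" for z
    using that cone_semigroup_antimono by (metis inf_le1 inf_le2)
  have r: "z \<in> S (\<tau> \<inter> \<upsilon>)" if "z \<in> S \<tau> \<or> z \<in> S \<upsilon>" for z
    using that cone_semigroup_antimono by (metis inf_le1 inf_le2)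
  have p: "- p \<in> S \<tau>" "\<omega>1 (- p) \<noteq> 0" "p \<in> S \<sigma>"
    using separator[OF \<Delta>(1,2)] separator_nonzero[OF \<Delta>(1,2) \<omega>(1)] by (auto simp: p_def)
  have q: "q \<in> S \<tau>" "\<omega>2 q \<noteq> 0"
    using separator[OF \<Delta>(2,3)] separator_nonzero[OF \<Delta>(2,3) \<omega>(2)] by (auto simp: q_def)
  obtain i where i: "a + real i *\<^sub>R - p \<in> S \<tau>"
    using separator(4)[OF \<Delta>(1,2)] l m(1) unfolding p_def by meson
  obtain j where j: "b + real j *\<^sub>R - p \<in> S \<tau>"
    using separator(4)[OF \<Delta>(1,2)] l m(2) unfolding p_def by meson
  obtain k where k: "c + real k *\<^sub>R q \<in> S \<tau>"
    using separator(3)[OF \<Delta>(2,3)] r m(3) unfolding q_def by meson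
  have A: "\<omega>1 (a + real i *\<^sub>R - p) = \<omega>1 a * \<omega>1 (- p) ^ i"
    by (simp only: chart_points_add[OF \<omega>(1)] chart_points_scale[OF \<omega>(1)] cone_semigroup_scale l p m(1) simp_thms)
  have B: "\<omega>1 (b + real j *\<^sub>R - p) = \<omega>1 b * \<omega>1 (- p) ^ j"
    by (simp only: chart_points_add[OF \<omega>(1)] chart_points_scale[OF \<omega>(1)] cone_semigroup_scale l p m(2) simp_thms)
  have C: "\<omega>2 (c + real k *\<^sub>R q) = \<omega>2 c * \<omega>2 q ^ k"
    by (simp only: chart_points_add[OF \<omega>(2)] chart_points_scale[OF \<omega>(2)] cone_semigroup_scale r q m(3) simp_thms)
  \<comment> \<open>The relation \<open>a = b + c\<close> is shifted by multiples of
    \<open>- p\<close> and \<open>q\<close> until every bracketed term lies in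
    \<open>S \<tau>\<close>, where \<open>\<omega>1\<close> and \<open>\<omega>2\<close> agree; the
    shifts are units and cancel afterwards.\<close>
  have "(a + real i *\<^sub>R - p) + (real k *\<^sub>R q + real j *\<^sub>R - p) =
      (b + real j *\<^sub>R - p) + ((c + real k *\<^sub>R q) + real i *\<^sub>R - p)"
    by (simp add: m(4))
  then have "\<omega>1 ((a + real i *\<^sub>R - p) + (real k *\<^sub>R q + real j *\<^sub>R - p)) =
     \<omega>1 ((b + real j *\<^sub>R - p) + ((c + real k *\<^sub>R q) + real i *\<^sub>R - p))" by (rule arg_cong)
  then have "\<omega>1 (a + real i *\<^sub>R - p) * (\<omega>1 q ^ k * \<omega>1 (-p) ^ j) =
     \<omega>1 (b + real j *\<^sub>R - p) * (\<omega>1 (c + real k *\<^sub>R q) * \<omega>1 (- p) ^ i)"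
    by (simp only: chart_points_add[OF \<omega>(1)] chart_points_scale[OF \<omega>(1)] cone_semigroup_scale
        cone_semigroup_add l p q i j k simp_thms)
  then show ?thesis
    unfolding A B eq[OF k] C eq[OF q(1)] using p q by (simp add: field_simps)
qed

text \<open>Here separation is indispensable: the two given overlaps produce no point of the chart
  of \<open>\<sigma> \<inter> \<upsilon>\<close> directly. One is built by inverting the separator
  of the outer cones, and its values on the third chart are compared through the middle one.\<close>

lemma toric_point_trans:
  assumes "\<sigma> \<in> \<Delta>" "\<xi> \<in> chart_points N \<sigma>"
    and "(\<tau>, \<psi>) \<in> toric_point N \<Delta> (\<sigma>, \<xi>)" "(\<upsilon>, \<zeta>) \<in> toric_point N \<Delta> (\<tau>, \<psi>)"
  shows "(\<upsilon>, \<zeta>) \<in> toric_point N \<Delta> (\<sigma>, \<xi>)"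
proof -
  have \<Delta>: "\<sigma> \<in> \<Delta>" "\<tau> \<in> \<Delta>" "\<upsilon> \<in> \<Delta>" and \<zeta>: "\<zeta> \<in> chart_points N \<upsilon>"
    using assms by (auto simp: toric_point_iff)
  obtain \<omega>1 where \<omega>1: "\<omega>1 \<in> chart_points N (\<sigma> \<inter> \<tau>)" "\<xi> = chart_restrict N \<sigma> \<omega>1" "\<psi> = chart_restrict N \<tau> \<omega>1"
    using assms(3) by (auto simp: toric_point_iff)
  obtain \<omega>2 where \<omega>2: "\<omega>2 \<in> chart_points N (\<tau> \<inter> \<upsilon>)" "\<psi> = chart_restrict N \<tau> \<omega>2" "\<zeta> = chart_restrict N \<upsilon> \<omega>2"
    using assms(4) by (auto simp: toric_point_iff)
  define p where "p = separator \<sigma> \<upsilon>"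
  note key = middle_chart_eq[OF \<Delta> \<omega>1(1) \<omega>2(1)]
  have mid: "chart_restrict N \<tau> \<omega>1 = chart_restrict N \<tau> \<omega>2"
    using \<omega>1 \<omega>2 by simp
  have p: "p \<in> S \<sigma>" "- p \<in> S \<upsilon>"
    using separator[OF \<Delta>(1,3)] by (auto simp: p_def)
  \<comment> \<open>The relation \<open>0 = p + (- p)\<close>, read across the middle chart, shows
    that the separator takes an invertible value at the first point.\<close>
  have "\<omega>1 0 = \<omega>1 p * \<omega>2 (- p)"
    using key[OF mid, of 0 p "-p"] p by simp
  then have nz: "\<omega>1 p \<noteq> 0"
    using chart_points_0[OF \<omega>1(1)] by auto
  have \<xi>p: "\<xi> p = \<omega>1 p" using p \<omega>1(2) by (simp add: restrict_apply)
  then have "\<xi> (separator \<sigma> \<upsilon>) \<noteq> 0" using nz by (simp add: p_def)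
  note ext = extend_left[OF \<Delta>(1,3) assms(2) this]
  define \<omega> where "\<omega> = chart_localize N \<sigma> (\<sigma> \<inter> \<upsilon>) (separator \<sigma> \<upsilon>) \<xi>"
  have "chart_restrict N \<upsilon> \<omega> m = \<zeta> m" for m
  proof (cases "m \<in> S \<upsilon>")
    case True
    then have m': "m \<in> S (\<sigma> \<inter> \<upsilon>)" by (meson cone_semigroup_antimono inf_le2)
    obtain k where k: "m + real k *\<^sub>R p \<in> S \<sigma>"
      using separator(3)[OF \<Delta>(1,3) m'] unfolding p_def by blast
    have "\<omega> m = \<xi> (m + real k *\<^sub>R p) / \<xi> p ^ k"
      using ext(3)[OF m'] k unfolding \<omega>_def p_def by blast
    moreover have "\<xi> (m + real k *\<^sub>R p) = \<omega>1 (m + real k *\<^sub>R p)"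
      using k by (simp add: \<omega>1(2) restrict_apply)
    moreover have "\<omega>1 (m + real k *\<^sub>R p) = \<omega>1 (real k *\<^sub>R p) * \<omega>2 m"
      using key[OF mid k _ True] p by (simp add: cone_semigroup_scale)
    moreover have "\<omega>1 (real k *\<^sub>R p) = \<omega>1 p ^ k"
      using p by (intro chart_points_scale[OF \<omega>1(1)]) (meson cone_semigroup_antimono inf_le1)
    ultimately have "\<omega> m = \<omega>2 m" using nz \<xi>p by simp
    then show ?thesis using True \<omega>2(3) by (simp add: restrict_apply)
  next
    case False
    then show ?thesis using \<zeta> by (simp add: chart_restrict_def chart_points_outside)
  qed
  then have "chart_restrict N \<upsilon> \<omega> = \<zeta>" by auto
  then show ?thesis
    using \<Delta> \<zeta> ext(1,2) unfolding toric_point_iff \<omega>_def by metis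
qed

lemma toric_point_eq_iff:
  assumes "\<sigma> \<in> \<Delta>" "\<xi> \<in> chart_points N \<sigma>" "\<tau> \<in> \<Delta>" "\<psi> \<in> chart_points N \<tau>"
  shows "toric_point N \<Delta> (\<sigma>, \<xi>) = toric_point N \<Delta> (\<tau>, \<psi>) \<longleftrightarrow>
    (\<exists>\<omega> \<in> chart_points N (\<sigma> \<inter> \<tau>). \<xi> = chart_restrict N \<sigma> \<omega> \<and> \<psi> = chart_restrict N \<tau> \<omega>)"
    (is "?l = ?r")
proof
  assume ?l
  then have "(\<tau>, \<psi>) \<in> toric_point N \<Delta> (\<sigma>, \<xi>)"
    using toric_point_refl assms by metis
  then show ?r by (simp add: toric_point_iff)
next
  assume ?r
  then have 1: "(\<tau>, \<psi>) \<in> toric_point N \<Delta> (\<sigma>, \<xi>)"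
    using assms by (simp add: toric_point_iff)
  have 2: "(\<sigma>, \<xi>) \<in> toric_point N \<Delta> (\<tau>, \<psi>)"
    using toric_point_sym[OF assms(1,2) 1] .
  show ?l
    using toric_point_trans[OF assms(1,2) 1] toric_point_trans[OF assms(3,4) 2] by auto
qed

lemma toric_point_mem_imp_eq:
  assumes "\<sigma> \<in> \<Delta>" "\<xi> \<in> chart_points N \<sigma>" "(\<tau>, \<psi>) \<in> toric_point N \<Delta> (\<sigma>, \<xi>)"
  shows "toric_point N \<Delta> (\<tau>, \<psi>) = toric_point N \<Delta> (\<sigma>, \<xi>)"
proof -
  have "\<tau> \<in> \<Delta>" "\<psi> \<in> chart_points N \<tau>" using assms by (auto simp: toric_point_iff)
  then show ?thesis
    using assms toric_point_eq_iff[OF assms(1,2)] by (metis toric_point_iff)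
qed

lemma toric_point_inj:
  assumes "\<sigma> \<in> \<Delta>" "\<xi> \<in> chart_points N \<sigma>" "\<psi> \<in> chart_points N \<sigma>"
    "toric_point N \<Delta> (\<sigma>, \<xi>) = toric_point N \<Delta> (\<sigma>, \<psi>)"
  shows "\<xi> = \<psi>"
  using toric_point_eq_iff[OF assms(1,2,1,3)] assms(4) by auto

text \<open>The overlap is a principal open subset of the chart of \<open>\<tau>\<close>: the
  separator is a unit on the overlap, and conversely a nonzero value allows localization.\<close>

lemma toric_point_in_chart_iff:
  assumes "\<sigma> \<in> \<Delta>" "\<tau> \<in> \<Delta>" "\<psi> \<in> chart_points N \<tau>"
  shows "(\<exists>\<xi> \<in> chart_points N \<sigma>. toric_point N \<Delta> (\<tau>, \<psi>) = toric_point N \<Delta> (\<sigma>, \<xi>)) \<longleftrightarrow>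
    \<psi> (- separator \<sigma> \<tau>) \<noteq> 0" (is "?l = ?r")
proof
  assume ?l
  then obtain \<xi> where \<xi>: "\<xi> \<in> chart_points N \<sigma>"
    "toric_point N \<Delta> (\<sigma>, \<xi>) = toric_point N \<Delta> (\<tau>, \<psi>)" by metis
  then obtain \<omega> where "\<omega> \<in> chart_points N (\<sigma> \<inter> \<tau>)" "\<psi> = chart_restrict N \<tau> \<omega>"
    using toric_point_eq_iff[OF assms(1) \<xi>(1) assms(2,3)] by auto
  then show ?r
    using separator_nonzero[OF assms(1,2)] separator(2)[OF assms(1,2)] by (simp add: restrict_apply)
next
  assume ?r
  note ext = extend_right[OF assms this]
  define \<omega> where "\<omega> = chart_localize N \<tau> (\<sigma> \<inter> \<tau>) (- separator \<sigma> \<tau>) \<psi>"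
  have "chart_restrict N \<sigma> \<omega> \<in> chart_points N \<sigma>"
    using ext(1) unfolding \<omega>_def by (intro chart_restrict_in) auto
  moreover have "toric_point N \<Delta> (\<sigma>, chart_restrict N \<sigma> \<omega>) = toric_point N \<Delta> (\<tau>, \<psi>)"
    using toric_point_eq_iff[OF assms(1) calculation assms(2,3)] ext unfolding \<omega>_def by metis
  ultimately show ?l by metis
qed

text \<open>The change of charts as an explicit quotient of two characters; regularity of characters
  on foreign charts rests on this formula.\<close>

lemma toric_point_chart_value:
  assumes "\<sigma> \<in> \<Delta>" "\<xi> \<in> chart_points N \<sigma>" "\<tau> \<in> \<Delta>" "\<psi> \<in> chart_points N \<tau>"
    "toric_point N \<Delta> (\<tau>, \<psi>) = toric_point N \<Delta> (\<sigma>, \<xi>)"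
    and m: "m \<in> S \<sigma>" "m + real k *\<^sub>R - separator \<sigma> \<tau> \<in> S \<tau>"
  shows "\<xi> m = \<psi> (m + real k *\<^sub>R - separator \<sigma> \<tau>) / \<psi> (- separator \<sigma> \<tau>) ^ k"
proof -
  obtain \<omega> where \<omega>: "\<omega> \<in> chart_points N (\<sigma> \<inter> \<tau>)" "\<xi> = chart_restrict N \<sigma> \<omega>" "\<psi> = chart_restrict N \<tau> \<omega>"
    using toric_point_eq_iff[OF assms(1-4)] assms(5) by auto
  have "m \<in> S (\<sigma> \<inter> \<tau>)" using m(1) by (meson cone_semigroup_antimono inf_le1)
  then have "\<omega> (m + real k *\<^sub>R - separator \<sigma> \<tau>) = \<omega> m * \<omega> (- separator \<sigma> \<tau>) ^ k"
    using separator[OF assms(1,3)]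
    by (simp only: chart_points_add[OF \<omega>(1)] chart_points_scale[OF \<omega>(1)] cone_semigroup_scale)
  moreover have "\<psi> (- separator \<sigma> \<tau>) = \<omega> (- separator \<sigma> \<tau>)" "\<psi> (m + real k *\<^sub>R - separator \<sigma> \<tau>) = \<omega> (m + real k *\<^sub>R - separator \<sigma> \<tau>)"
    unfolding \<omega>(3) using m(2) separator(2)[OF assms(1,3)] by (simp_all only: restrict_apply)
  moreover have "\<xi> m = \<omega> m" using m(1) by (simp add: \<omega>(2) restrict_apply)
  ultimately show ?thesis
    using separator_nonzero[OF assms(1,3) \<omega>(1)] by simp
qed

end

section \<open>Toric spaces\<close>

lemma topspace_toric_space:
  "topspace (toric_space N \<Delta> charts) = {toric_point N \<Delta> (\<sigma>, \<xi>) | \<sigma> \<xi>. \<sigma> \<in> \<Delta> \<and> \<xi> \<in> topspace (charts \<sigma>)}"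
  unfolding toric_space_def topspace_quotient_topology topspace_sum_topology by (auto simp only: o_apply) blast+

lemma openin_toric_space:
  "openin (toric_space N \<Delta> charts) U \<longleftrightarrow> U \<subseteq> topspace (toric_space N \<Delta> charts) \<and>
    (\<forall>\<sigma>\<in>\<Delta>. openin (charts \<sigma>) {\<xi> \<in> topspace (charts \<sigma>). toric_point N \<Delta> (\<sigma>, \<xi>) \<in> U})"
proof -
  have "Pair \<sigma> -` {x \<in> Sigma \<Delta> (topspace \<circ> charts). toric_point N \<Delta> x \<in> U} =
      {\<xi> \<in> topspace (charts \<sigma>). toric_point N \<Delta> (\<sigma>, \<xi>) \<in> U}" if "\<sigma> \<in> \<Delta>" for \<sigma>
    using that by auto
  then show ?thesis
    by (auto simp: toric_space_def openin_quotient_topology openin_sum_topology topspace_quotient_topology)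
qed

lemma continuous_map_toric_space:
  "continuous_map (toric_space N \<Delta> charts) Y f \<longleftrightarrow>
    (\<forall>\<sigma>\<in>\<Delta>. continuous_map (charts \<sigma>) Y (\<lambda>\<xi>. f (toric_point N \<Delta> (\<sigma>, \<xi>))))"
proof -
  have "continuous_map (sum_topology charts \<Delta>) Y (f \<circ> toric_point N \<Delta>) \<longleftrightarrow>
      continuous_map (toric_space N \<Delta> charts) Y f"
    unfolding toric_space_def
    by (rule continuous_compose_quotient_map_eq[OF quotient_map_quotient_topology])
  moreover have "continuous_map (sum_topology charts \<Delta>) Y g \<longleftrightarrow>
      (\<forall>\<sigma>\<in>\<Delta>. continuous_map (charts \<sigma>) Y (\<lambda>\<xi>. g (\<sigma>, \<xi>)))" (is "?l = ?r") for g
  proof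
    assume ?l
    then show ?r
      using continuous_map_compose[OF continuous_map_component_injection, of _ \<Delta> charts Y g]
      by (auto simp: o_def)
  next
    assume r: ?r
    have "openin (charts \<sigma>) {x. (\<sigma>, x) \<in> {x \<in> Sigma \<Delta> (topspace \<circ> charts). g x \<in> U}}"
      if "openin Y U" "\<sigma> \<in> \<Delta>" for U \<sigma>
    proof -
      have "{x. (\<sigma>, x) \<in> {x \<in> Sigma \<Delta> (topspace \<circ> charts). g x \<in> U}} = {x \<in> topspace (charts \<sigma>). g (\<sigma>, x) \<in> U}"
        using that by auto
      then show ?thesis using r that by (auto simp: continuous_map_def)
    qed
    moreover have "g x \<in> topspace Y" if "x \<in> Sigma \<Delta> (topspace \<circ> charts)" for x
      using r that by (cases x) (auto simp: continuous_map_def Pi_iff)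
    ultimately show ?l
      unfolding continuous_map_def openin_sum_topology by auto
  qed
  ultimately show ?thesis by (simp add: o_def)
qed

lemma continuous_map_toric_point:
  "\<sigma> \<in> \<Delta> \<Longrightarrow> continuous_map (charts \<sigma>) (toric_space N \<Delta> charts) (\<lambda>\<xi>. toric_point N \<Delta> (\<sigma>, \<xi>))"
  using continuous_map_toric_space[of N \<Delta> charts "toric_space N \<Delta> charts" id] by auto

lemma toric_real_points_continuous:
  "\<sigma> \<in> \<Delta> \<Longrightarrow> continuous_map (top_of_set (chart_points N \<sigma>)) (toric_real_points N \<Delta>)
     (\<lambda>\<xi>. toric_point N \<Delta> (\<sigma>, \<xi>))"
  unfolding toric_real_points_def
  by (rule continuous_map_toric_point[of \<sigma> \<Delta> "\<lambda>\<sigma>. top_of_set (chart_points N \<sigma>)"])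

lemma topspace_toric_real_points:
  "topspace (toric_real_points N \<Delta>) = {toric_point N \<Delta> (\<sigma>, \<xi>) | \<sigma> \<xi>. \<sigma> \<in> \<Delta> \<and> \<xi> \<in> chart_points N \<sigma>}"
  by (auto simp: toric_real_points_def topspace_toric_space)

section \<open>Zariski topology of the charts and its trace on real points\<close>

lemma monomial_in_coordinate_ring: "m \<in> cone_semigroup N \<sigma> \<Longrightarrow> (\<lambda>\<xi>. \<xi> m) \<in> coordinate_ring N \<sigma>"
  unfolding coordinate_ring_def
  by (intro CollectI exI[of _ "{m}"] exI[of _ "\<lambda>_. 1"]) auto

abbreviation zariski_chart :: "'v::euclidean_space set \<Rightarrow> 'v set \<Rightarrow> ('v \<Rightarrow> complex) topology" where
  "zariski_chart N \<sigma> \<equiv> topology_generated_by {{\<xi> \<in> chart_points N \<sigma>. f \<xi> \<noteq> 0} | f. f \<in> coordinate_ring N \<sigma>}"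

lemma topspace_zariski_chart: "topspace (zariski_chart N \<sigma>) = chart_points N \<sigma>"
proof -
  have "chart_points N \<sigma> = {\<xi> \<in> chart_points N \<sigma>. \<xi> 0 \<noteq> (0::complex)}"
    by (auto simp: chart_points_0)
  then have "chart_points N \<sigma> \<in> {{\<xi> \<in> chart_points N \<sigma>. f \<xi> \<noteq> 0} | f. f \<in> coordinate_ring N \<sigma>}"
    using monomial_in_coordinate_ring[OF cone_semigroup_0]
    by (intro CollectI exI[of _ "\<lambda>\<xi>. \<xi> 0"] conjI)
  then show ?thesis
    unfolding topology_generated_by_topspace by (intro equalityI Union_upper Union_least) auto
qed

lemma topspace_toric_variety:
  "topspace (zariski (toric_variety N \<Delta>)) =
    {toric_point N \<Delta> (\<sigma>, \<xi>) | \<sigma> \<xi>. \<sigma> \<in> \<Delta> \<and> \<xi> \<in> chart_points N \<sigma>}"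
  by (simp only: toric_variety_def real_variety.simps topspace_toric_space topspace_zariski_chart)

lemma openin_toric_variety:
  "openin (zariski (toric_variety N \<Delta>)) U \<longleftrightarrow> U \<subseteq> topspace (zariski (toric_variety N \<Delta>)) \<and>
    (\<forall>\<sigma>\<in>\<Delta>. openin (zariski_chart N \<sigma>) {\<xi> \<in> chart_points N \<sigma>. toric_point N \<Delta> (\<sigma>, \<xi>) \<in> U})"
  by (simp only: toric_variety_def real_variety.simps openin_toric_space topspace_zariski_chart)

lemma complex_chart_points_iff:
  "complex_of_real \<circ> \<xi> \<in> chart_points N \<sigma> \<longleftrightarrow> \<xi> \<in> chart_points N \<sigma>"
  by (auto simp: chart_points_def simp flip: of_real_mult)

lemma cnj_chart_points: "\<xi> \<in> chart_points N \<sigma> \<Longrightarrow> cnj \<circ> \<xi> \<in> chart_points N \<sigma>"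
  by (auto simp: chart_points_def)

lemma coordinate_ring_continuous:
  assumes "f \<in> coordinate_ring N \<sigma>"
  shows "continuous_on UNIV (\<lambda>\<xi>::'v::euclidean_space \<Rightarrow> real. f (complex_of_real \<circ> \<xi>))"
proof -
  obtain A c where "finite A" "f = (\<lambda>\<xi>. \<Sum>m\<in>A. c m * \<xi> m)"
    using assms by (auto simp: coordinate_ring_def)
  then show ?thesis
    by (auto intro!: continuous_intros continuous_on_product_coordinates)
qed

text \<open>Induction over the generated topology. A basic open set is the nonvanishing locus of a
  finite sum of characters, and such sums are continuous for pointwise convergence of real
  points.\<close>

lemma zariski_chart_real_open:
  assumes "openin (zariski_chart N \<sigma>) W"
  shows "openin (top_of_set (chart_points N \<sigma>)) {\<xi> \<in> chart_points N \<sigma>. complex_of_real \<circ> \<xi> \<in> W}"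
proof -
  have "generate_topology_on {{\<xi> \<in> chart_points N \<sigma>. f \<xi> \<noteq> 0} | f. f \<in> coordinate_ring N \<sigma>} W"
    using assms by (rule openin_topology_generated_by)
  then show ?thesis
  proof (induction rule: generate_topology_on.induct)
    case Empty
    then show ?case by simp
  next
    case (Int a b)
    have "{\<xi> \<in> chart_points N \<sigma>. complex_of_real \<circ> \<xi> \<in> a \<inter> b} =
       {\<xi> \<in> chart_points N \<sigma>. complex_of_real \<circ> \<xi> \<in> a} \<inter> {\<xi> \<in> chart_points N \<sigma>. complex_of_real \<circ> \<xi> \<in> b}"
      by auto
    then show ?case using Int by (simp only: openin_Int)
  next
    case (UN K)
    have "{\<xi> \<in> chart_points N \<sigma>. complex_of_real \<circ> \<xi> \<in> \<Union>K} =
       (\<Union>k\<in>K. {\<xi> \<in> chart_points N \<sigma>. complex_of_real \<circ> \<xi> \<in> k})"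
      by auto
    then show ?case using UN by (metis (no_types, lifting) openin_Union imageE)
  next
    case (Basis s)
    then obtain f where f: "f \<in> coordinate_ring N \<sigma>" "s = {\<xi> \<in> chart_points N \<sigma>. f \<xi> \<noteq> 0}" by auto
    have "open {\<xi>::'a \<Rightarrow> real. f (complex_of_real \<circ> \<xi>) \<noteq> 0}"
      by (intro open_Collect_neq coordinate_ring_continuous[OF f(1)] continuous_on_const)
    moreover have "{\<xi> \<in> chart_points N \<sigma>. complex_of_real \<circ> \<xi> \<in> s} =
       chart_points N \<sigma> \<inter> {\<xi>. f (complex_of_real \<circ> \<xi>) \<noteq> 0}"
      using f(2) by (auto simp: complex_chart_points_iff)
    ultimately show ?case by (metis openin_open_Int)
  qed
qed

section \<open>Open charts and the Hausdorff property of the real points\<close>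

context separated_fan
begin

text \<open>On the locus \<open>D\<close> where the separator is nonzero, the transition
  \<open>L\<close> from the chart of \<open>\<tau>\<close> to that of \<open>\<sigma>\<close> is
  coordinatewise a quotient of characters, hence continuous. The trace of the image of
  \<open>W\<close> on the chart of \<open>\<tau>\<close> is the preimage of \<open>W\<close> under
  \<open>L\<close>.\<close>

lemma chart_open_map:
  assumes \<sigma>: "\<sigma> \<in> \<Delta>"
  shows "open_map (top_of_set (chart_points N \<sigma>)) (toric_real_points N \<Delta>) (\<lambda>\<xi>. toric_point N \<Delta> (\<sigma>, \<xi>))"
  unfolding open_map_def toric_real_points_def
proof (intro allI impI)
  fix W :: "('v \<Rightarrow> real) set"
  assume W: "openin (top_of_set (chart_points N \<sigma>)) W"
  then have sub: "W \<subseteq> chart_points N \<sigma>" by (simp add: openin_imp_subset)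
  show "openin (toric_space N \<Delta> (\<lambda>\<sigma>. top_of_set (chart_points N \<sigma>))) ((\<lambda>\<xi>. toric_point N \<Delta> (\<sigma>, \<xi>)) ` W)"
    unfolding openin_toric_space
  proof (intro conjI ballI)
    show "(\<lambda>\<xi>. toric_point N \<Delta> (\<sigma>, \<xi>)) ` W \<subseteq> topspace (toric_space N \<Delta> (\<lambda>\<sigma>. top_of_set (chart_points N \<sigma>)))"
      using sub \<sigma> by (auto simp: topspace_toric_space)
    fix \<tau> assume \<tau>: "\<tau> \<in> \<Delta>"
    define s where "s = - separator \<sigma> \<tau>"
    define D where "D = {\<psi> \<in> chart_points N \<tau>. \<psi> s \<noteq> (0::real)}"
    define L where "L \<psi> = chart_restrict N \<sigma> (chart_localize N \<tau> (\<sigma> \<inter> \<tau>) s \<psi>)" for \<psi> :: "'v \<Rightarrow> real"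
    have D: "openin (top_of_set (chart_points N \<tau>)) D"
    proof -
      have "open {\<psi>::'v \<Rightarrow> real. \<psi> s \<noteq> 0}"
        by (intro open_Collect_neq continuous_on_product_coordinates continuous_on_const)
      moreover have "D = chart_points N \<tau> \<inter> {\<psi>. \<psi> s \<noteq> 0}" by (auto simp: D_def)
      ultimately show ?thesis by (simp add: openin_open_Int)
    qed
    have L: "L \<psi> \<in> chart_points N \<sigma>" "toric_point N \<Delta> (\<tau>, \<psi>) = toric_point N \<Delta> (\<sigma>, L \<psi>)" if "\<psi> \<in> D" for \<psi>
    proof -
      have \<psi>: "\<psi> \<in> chart_points N \<tau>" "\<psi> (- separator \<sigma> \<tau>) \<noteq> 0" using that by (auto simp: D_def s_def)
      note ext = extend_right[OF \<sigma> \<tau> \<psi>]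
      show 1: "L \<psi> \<in> chart_points N \<sigma>"
        unfolding L_def s_def using ext(1) by (intro chart_restrict_in) auto
      show "toric_point N \<Delta> (\<tau>, \<psi>) = toric_point N \<Delta> (\<sigma>, L \<psi>)"
        using toric_point_eq_iff[OF \<sigma> 1 \<tau> \<psi>(1)] ext unfolding L_def s_def by metis
    qed
    have "continuous_on D L"
    proof (rule continuous_on_coordinatewise_then_product)
      fix m
      show "continuous_on D (\<lambda>\<psi>. L \<psi> m)"
      proof (cases "m \<in> S \<sigma>")
        case True
        then have m': "m \<in> S (\<sigma> \<inter> \<tau>)" by (meson cone_semigroup_antimono inf_le1)
        obtain k where k: "m + real k *\<^sub>R s \<in> S \<tau>"
          using separator(4)[OF \<sigma> \<tau> m'] unfolding s_def by blast
        have "L \<psi> m = \<psi> (m + real k *\<^sub>R s) / \<psi> s ^ k" if "\<psi> \<in> D" for \<psi>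
        proof -
          have \<psi>: "\<psi> \<in> chart_points N \<tau>" "\<psi> (- separator \<sigma> \<tau>) \<noteq> 0" using that by (auto simp: D_def s_def)
          show ?thesis
            using extend_right(3)[OF \<sigma> \<tau> \<psi> m' k[unfolded s_def]] True
            unfolding L_def s_def by (simp only: restrict_apply)
        qed
        moreover have "continuous_on D (\<lambda>\<psi>. \<psi> (m + real k *\<^sub>R s) / \<psi> s ^ k)"
          by (intro continuous_intros continuous_on_subset[OF continuous_on_product_coordinates subset_UNIV])
            (auto simp: D_def)
        ultimately show ?thesis by (metis (no_types, lifting) continuous_on_cong)
      next
        case False
        then show ?thesis by (simp add: L_def chart_restrict_def)
      qed
    qed
    moreover have "L ` D \<subseteq> chart_points N \<sigma>" using L(1) by auto
    ultimately have "openin (top_of_set D) (D \<inter> L -` W)"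
      using W by (meson continuous_openin_preimage image_subset_iff_funcset)
    then have "openin (top_of_set (chart_points N \<tau>)) (D \<inter> L -` W)"
      using D openin_trans by blast
    moreover have "{\<psi> \<in> chart_points N \<tau>. toric_point N \<Delta> (\<tau>, \<psi>) \<in> (\<lambda>\<xi>. toric_point N \<Delta> (\<sigma>, \<xi>)) ` W} = D \<inter> L -` W"
    proof (intro equalityI subsetI)
      fix \<psi> assume "\<psi> \<in> {\<psi> \<in> chart_points N \<tau>. toric_point N \<Delta> (\<tau>, \<psi>) \<in> (\<lambda>\<xi>. toric_point N \<Delta> (\<sigma>, \<xi>)) ` W}"
      then obtain \<xi> where \<psi>: "\<psi> \<in> chart_points N \<tau>" and \<xi>: "\<xi> \<in> W" "toric_point N \<Delta> (\<tau>, \<psi>) = toric_point N \<Delta> (\<sigma>, \<xi>)"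
        by auto
      then have "\<psi> \<in> D"
        using toric_point_in_chart_iff[OF \<sigma> \<tau> \<psi>] sub by (auto simp: D_def s_def)
      moreover have "\<xi> = L \<psi>"
        using L[OF calculation] \<xi> sub by (intro toric_point_inj[OF \<sigma>]) auto
      ultimately show "\<psi> \<in> D \<inter> L -` W" using \<xi> by auto
    next
      fix \<psi> assume "\<psi> \<in> D \<inter> L -` W"
      then show "\<psi> \<in> {\<psi> \<in> chart_points N \<tau>. toric_point N \<Delta> (\<tau>, \<psi>) \<in> (\<lambda>\<xi>. toric_point N \<Delta> (\<sigma>, \<xi>)) ` W}"
        using L by (auto simp: D_def)
    qed
    ultimately show "openin (top_of_set (chart_points N \<tau>))
      {\<xi> \<in> topspace (top_of_set (chart_points N \<tau>)). toric_point N \<Delta> (\<tau>, \<xi>) \<in> (\<lambda>\<xi>. toric_point N \<Delta> (\<sigma>, \<xi>)) ` W}"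
      by simp
  qed
qed

text \<open>The diagonal is closed because on the overlap of two charts the values of a separator
  and of its negative multiply to 1.\<close>

lemma Hausdorff_toric_real_points: "Hausdorff_space (toric_real_points N \<Delta>)"
  unfolding Hausdorff_space_def
proof (intro allI impI, elim conjE)
  fix P Q :: "('v set \<times> ('v \<Rightarrow> real)) set"
  assume P: "P \<in> topspace (toric_real_points N \<Delta>)" and Q: "Q \<in> topspace (toric_real_points N \<Delta>)" and "P \<noteq> Q"
  obtain \<tau> \<psi> where \<tau>: "\<tau> \<in> \<Delta>" "\<psi> \<in> chart_points N \<tau>" "Q = toric_point N \<Delta> (\<tau>, \<psi>)"
    using Q by (auto simp: topspace_toric_real_points)
  have same: "\<exists>U V. openin (toric_real_points N \<Delta>) U \<and> openin (toric_real_points N \<Delta>) V \<and> P \<in> U \<and> Q \<in> V \<and> disjnt U V"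
    if "\<xi> \<in> chart_points N \<tau>" "P = toric_point N \<Delta> (\<tau>, \<xi>)" for \<xi>
  proof -
    have "\<xi> \<noteq> \<psi>" using that \<tau> \<open>P \<noteq> Q\<close> by auto
    then obtain m where "\<xi> m \<noteq> \<psi> m" by auto
    then obtain U V where UV: "open U" "open V" "\<xi> m \<in> U" "\<psi> m \<in> V" "U \<inter> V = {}"
      by (meson hausdorff)
    define A where "A = {\<xi>::'v \<Rightarrow> real. \<xi> m \<in> U}"
    define B where "B = {\<xi>::'v \<Rightarrow> real. \<xi> m \<in> V}"
    have AB: "open A" "open B" "\<xi> \<in> A" "\<psi> \<in> B" "A \<inter> B = {}"
      using open_vimage[OF UV(1) continuous_on_product_coordinates[of m]] UV
        open_vimage[OF UV(2) continuous_on_product_coordinates[of m]]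
      by (auto simp: A_def B_def vimage_def)
    let ?i = "\<lambda>\<xi>. toric_point N \<Delta> (\<tau>, \<xi>)"
    have "openin (toric_real_points N \<Delta>) (?i ` (chart_points N \<tau> \<inter> A))"
      "openin (toric_real_points N \<Delta>) (?i ` (chart_points N \<tau> \<inter> B))"
      using chart_open_map[OF \<tau>(1)] AB unfolding open_map_def by (simp_all add: openin_open_Int)
    moreover have "disjnt (?i ` (chart_points N \<tau> \<inter> A)) (?i ` (chart_points N \<tau> \<inter> B))"
      using toric_point_inj[OF \<tau>(1)] AB(5) unfolding disjnt_def by blast
    ultimately show ?thesis using that \<tau> AB by blast
  qed
  obtain \<sigma> \<xi> where \<sigma>: "\<sigma> \<in> \<Delta>" "\<xi> \<in> chart_points N \<sigma>" "P = toric_point N \<Delta> (\<sigma>, \<xi>)"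
    using P by (auto simp: topspace_toric_real_points)
  define s where "s = separator \<sigma> \<tau>"
  show "\<exists>U V. openin (toric_real_points N \<Delta>) U \<and> openin (toric_real_points N \<Delta>) V \<and> P \<in> U \<and> Q \<in> V \<and> disjnt U V"
  proof (cases "\<xi> s * \<psi> (- s) = 1")
    case True
    \<comment> \<open>A nonzero value moves \<open>P\<close> into the chart of
      \<open>\<tau>\<close>, where a single coordinate already separates two distinct
      points.\<close>
    then have "\<xi> (separator \<sigma> \<tau>) \<noteq> 0" by (auto simp: s_def)
    note ext = extend_left[OF \<sigma>(1) \<tau>(1) \<sigma>(2) this]
    define \<omega> where "\<omega> = chart_localize N \<sigma> (\<sigma> \<inter> \<tau>) (separator \<sigma> \<tau>) \<xi>"
    have 1: "chart_restrict N \<tau> \<omega> \<in> chart_points N \<tau>"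
      using ext(1) unfolding \<omega>_def by (intro chart_restrict_in) auto
    have "P = toric_point N \<Delta> (\<tau>, chart_restrict N \<tau> \<omega>)"
      using toric_point_eq_iff[OF \<sigma>(1,2) \<tau>(1) 1] ext \<sigma>(3) unfolding \<omega>_def by metis
    with 1 show ?thesis by (rule same)
  next
    case False
    have "open {z :: real \<times> real. fst z * snd z \<noteq> 1}"
      by (intro open_Collect_neq continuous_intros)
    moreover have "(\<xi> s, \<psi> (- s)) \<in> {z :: real \<times> real. fst z * snd z \<noteq> 1}" using False by simp
    ultimately obtain A B where AB: "open A" "open B" "\<xi> s \<in> A" "\<psi> (- s) \<in> B" "A \<times> B \<subseteq> {z. fst z * snd z \<noteq> 1}"
      by (rule open_prod_elim) (metis mem_Sigma_iff)
    define A' where "A' = {\<xi>::'v \<Rightarrow> real. \<xi> s \<in> A}"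
    define B' where "B' = {\<xi>::'v \<Rightarrow> real. \<xi> (- s) \<in> B}"
    have op: "open A'" "open B'"
      using open_vimage[OF AB(1) continuous_on_product_coordinates[of s]]
        open_vimage[OF AB(2) continuous_on_product_coordinates[of "- s"]]
      by (simp_all add: A'_def B'_def vimage_def)
    have "openin (toric_real_points N \<Delta>) ((\<lambda>\<xi>. toric_point N \<Delta> (\<sigma>, \<xi>)) ` (chart_points N \<sigma> \<inter> A'))"
      "openin (toric_real_points N \<Delta>) ((\<lambda>\<xi>. toric_point N \<Delta> (\<tau>, \<xi>)) ` (chart_points N \<tau> \<inter> B'))"
      using chart_open_map[OF \<tau>(1)] chart_open_map[OF \<sigma>(1)] op unfolding open_map_def
      by (simp_all add: openin_open_Int)
    moreover have "toric_point N \<Delta> (\<sigma>, x) \<noteq> toric_point N \<Delta> (\<tau>, y)"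
      if x: "x \<in> chart_points N \<sigma> \<inter> A'" and y: "y \<in> chart_points N \<tau> \<inter> B'" for x y
    proof
      assume "toric_point N \<Delta> (\<sigma>, x) = toric_point N \<Delta> (\<tau>, y)"
      then obtain \<omega> where \<omega>: "\<omega> \<in> chart_points N (\<sigma> \<inter> \<tau>)" "x = chart_restrict N \<sigma> \<omega>" "y = chart_restrict N \<tau> \<omega>"
        using toric_point_eq_iff[OF \<sigma>(1) _ \<tau>(1)] x y by blast
      have "x s * y (- s) = 1"
        using separator_nonzero[OF \<sigma>(1) \<tau>(1) \<omega>(1)] separator[OF \<sigma>(1) \<tau>(1)]
        by (simp add: \<omega> restrict_apply s_def)
      moreover have "(x s, y (- s)) \<in> A \<times> B" using x y by (auto simp: A'_def B'_def)
      ultimately show False using AB(5) by auto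
    qed
    then have "disjnt ((\<lambda>\<xi>. toric_point N \<Delta> (\<sigma>, \<xi>)) ` (chart_points N \<sigma> \<inter> A'))
        ((\<lambda>\<xi>. toric_point N \<Delta> (\<tau>, \<xi>)) ` (chart_points N \<tau> \<inter> B'))"
      unfolding disjnt_def by blast
    moreover have "P \<in> (\<lambda>\<xi>. toric_point N \<Delta> (\<sigma>, \<xi>)) ` (chart_points N \<sigma> \<inter> A')"
      "Q \<in> (\<lambda>\<xi>. toric_point N \<Delta> (\<tau>, \<xi>)) ` (chart_points N \<tau> \<inter> B')"
      using \<sigma> \<tau> AB by (auto simp: A'_def B'_def)
    ultimately show ?thesis by blast
  qed
qed

end

section \<open>Isomorphisms over the reals and real points\<close>

lemma continuous_map_locally:
  assumes "\<And>x. x \<in> topspace X \<Longrightarrow> \<exists>T. openin X T \<and> x \<in> T \<and> continuous_map (subtopology X T) Y g"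
  shows "continuous_map X Y g"
proof -
  obtain T where "\<And>x. x \<in> topspace X \<Longrightarrow>
      openin X (T x) \<and> x \<in> T x \<and> continuous_map (subtopology X (T x)) Y g"
    using assms by metis
  then show ?thesis
    by (intro pasting_lemma[of "topspace X" X T Y "\<lambda>_. g" g]) auto
qed

section \<open>Real points as fixed points of conjugation\<close>

lemma real_toric_point_in_variety:
  assumes "\<sigma> \<in> \<Delta>" "\<xi> \<in> chart_points N \<sigma>"
  shows "toric_point N \<Delta> (\<sigma>, complex_of_real \<circ> \<xi>) \<in> topspace (zariski (toric_variety N \<Delta>))"
  using assms complex_chart_points_iff unfolding topspace_toric_variety by blast

context separated_fan
begin

text \<open>An identification over the complex numbers supplies a common extension that is not known
  to be real. Therefore the real point is first moved into the chart of \<open>\<sigma>\<close>,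
  which only needs a nonzero value, and then injectivity of that one chart is used.\<close>

lemma real_toric_point_eq_iff:
  assumes "\<sigma> \<in> \<Delta>" "\<xi> \<in> chart_points N \<sigma>" "\<tau> \<in> \<Delta>" "\<psi> \<in> chart_points N \<tau>"
  shows "toric_point N \<Delta> (\<sigma>, complex_of_real \<circ> \<xi>) = toric_point N \<Delta> (\<tau>, complex_of_real \<circ> \<psi>) \<longleftrightarrow>
    toric_point N \<Delta> (\<sigma>, \<xi>) = toric_point N \<Delta> (\<tau>, \<psi>)" (is "?l \<longleftrightarrow> ?r")
proof -
  have C: "complex_of_real \<circ> \<xi> \<in> chart_points N \<sigma>" "complex_of_real \<circ> \<psi> \<in> chart_points N \<tau>"
    using assms by (auto simp: complex_chart_points_iff)
  have imp: "toric_point N \<Delta> (\<sigma>, complex_of_real \<circ> \<xi>) = toric_point N \<Delta> (\<tau>, complex_of_real \<circ> \<psi>)"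
    if \<xi>: "\<xi> \<in> chart_points N \<sigma>" and r: "toric_point N \<Delta> (\<sigma>, \<xi>) = toric_point N \<Delta> (\<tau>, \<psi>)" for \<xi>
  proof -
    obtain \<omega> where \<omega>: "\<omega> \<in> chart_points N (\<sigma> \<inter> \<tau>)" "\<xi> = chart_restrict N \<sigma> \<omega>" "\<psi> = chart_restrict N \<tau> \<omega>"
      using r toric_point_eq_iff[OF assms(1) \<xi> assms(3,4)] by auto
    have "complex_of_real \<circ> \<xi> = chart_restrict N \<sigma> (complex_of_real \<circ> \<omega>)"
      "complex_of_real \<circ> \<psi> = chart_restrict N \<tau> (complex_of_real \<circ> \<omega>)"
      using \<omega> by (auto simp: chart_restrict_def)
    moreover have "complex_of_real \<circ> \<omega> \<in> chart_points N (\<sigma> \<inter> \<tau>)"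
      using \<omega> complex_chart_points_iff by blast
    moreover have "complex_of_real \<circ> \<xi> \<in> chart_points N \<sigma>"
      using \<xi> complex_chart_points_iff by blast
    ultimately show ?thesis
      using toric_point_eq_iff[OF assms(1) _ assms(3) C(2)] by metis
  qed
  have ?r if l: ?l
  proof -
    have "\<exists>\<zeta>\<in>chart_points N \<sigma>. toric_point N \<Delta> (\<tau>, complex_of_real \<circ> \<psi>) = toric_point N \<Delta> (\<sigma>, \<zeta>)"
      using l C(1) by metis
    then have "(complex_of_real \<circ> \<psi>) (- separator \<sigma> \<tau>) \<noteq> 0"
      using toric_point_in_chart_iff[OF assms(1,3) C(2)] by blast
    then have "\<psi> (- separator \<sigma> \<tau>) \<noteq> 0" by simp
    then obtain \<xi>' where \<xi>': "\<xi>' \<in> chart_points N \<sigma>" "toric_point N \<Delta> (\<sigma>, \<xi>') = toric_point N \<Delta> (\<tau>, \<psi>)"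
      using toric_point_in_chart_iff[OF assms(1,3,4)] by metis
    have "complex_of_real \<circ> \<xi>' = complex_of_real \<circ> \<xi>"
      using imp[OF \<xi>'] l C(1) \<xi>'(1) by (intro toric_point_inj[OF assms(1)]) (auto simp: complex_chart_points_iff)
    then have "\<xi>' = \<xi>" by (auto simp: fun_eq_iff)
    then show ?r using \<xi>'(2) by simp
  qed
  then show ?thesis using imp[OF assms(2)] by blast
qed

lemma conjugation_real_point:
  assumes "\<sigma> \<in> \<Delta>" "\<xi> \<in> chart_points N \<sigma>"
  shows "conjugation (toric_variety N \<Delta>) (toric_point N \<Delta> (\<sigma>, complex_of_real \<circ> \<xi>)) =
    toric_point N \<Delta> (\<sigma>, complex_of_real \<circ> \<xi>)" (is "_ = ?p")
proof -
  have sub: "(\<tau>, cnj \<circ> \<psi>) \<in> ?p" if mem: "(\<tau>, \<psi>) \<in> ?p" for \<tau> \<psi>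
  proof -
    obtain \<omega> where \<omega>: "\<tau> \<in> \<Delta>" "\<psi> \<in> chart_points N \<tau>" "\<omega> \<in> chart_points N (\<sigma> \<inter> \<tau>)"
      "complex_of_real \<circ> \<xi> = chart_restrict N \<sigma> \<omega>" "\<psi> = chart_restrict N \<tau> \<omega>"
      using mem unfolding toric_point_iff by blast
    have "complex_of_real \<circ> \<xi> = cnj \<circ> (complex_of_real \<circ> \<xi>)" by auto
    also have "\<dots> = chart_restrict N \<sigma> (cnj \<circ> \<omega>)" unfolding \<omega>(4) by (auto simp: chart_restrict_def)
    finally have "complex_of_real \<circ> \<xi> = chart_restrict N \<sigma> (cnj \<circ> \<omega>)" .
    moreover have "cnj \<circ> \<psi> = chart_restrict N \<tau> (cnj \<circ> \<omega>)" unfolding \<omega>(5) by (auto simp: chart_restrict_def)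
    ultimately show ?thesis
      unfolding toric_point_iff using \<omega>(1-3) cnj_chart_points by metis
  qed
  have "(\<tau>, \<psi>) \<in> (\<lambda>(\<sigma>, \<xi>). (\<sigma>, cnj \<circ> \<xi>)) ` ?p" if "(\<tau>, \<psi>) \<in> ?p" for \<tau> \<psi>
    using sub[OF that] by (auto simp: image_iff fun_eq_iff intro!: bexI[of _ "(\<tau>, cnj \<circ> \<psi>)"])
  then show ?thesis
    unfolding toric_variety_def real_variety.simps using sub by auto
qed

text \<open>A point and its conjugate have representatives in the same chart. Charts are injective,
  so all character values of a fixed point equal their conjugates.\<close>

lemma conjugation_fixed_imp_real:
  assumes p: "p \<in> topspace (zariski (toric_variety N \<Delta>))" and fixed: "conjugation (toric_variety N \<Delta>) p = p"
  obtains \<sigma> \<xi> where "\<sigma> \<in> \<Delta>" "\<xi> \<in> chart_points N \<sigma>" "p = toric_point N \<Delta> (\<sigma>, complex_of_real \<circ> \<xi>)"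
proof -
  obtain \<sigma> \<zeta> where \<sigma>: "\<sigma> \<in> \<Delta>" "\<zeta> \<in> chart_points N \<sigma>" "p = toric_point N \<Delta> (\<sigma>, \<zeta>)"
    using p by (auto simp: topspace_toric_variety)
  have "(\<sigma>, cnj \<circ> \<zeta>) \<in> conjugation (toric_variety N \<Delta>) p"
    unfolding toric_variety_def real_variety.simps
    using toric_point_refl[OF \<sigma>(1,2)] \<sigma>(3) by (auto simp: image_iff intro!: bexI[of _ "(\<sigma>, \<zeta>)"])
  then have "(\<sigma>, cnj \<circ> \<zeta>) \<in> toric_point N \<Delta> (\<sigma>, \<zeta>)"
    using fixed \<sigma>(3) by simp
  then have "toric_point N \<Delta> (\<sigma>, cnj \<circ> \<zeta>) = toric_point N \<Delta> (\<sigma>, \<zeta>)"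
    by (rule toric_point_mem_imp_eq[OF \<sigma>(1,2)])
  then have "cnj \<circ> \<zeta> = \<zeta>"
    using \<sigma> by (intro toric_point_inj[OF \<sigma>(1) cnj_chart_points]) auto
  then have "\<zeta> m \<in> \<real>" for m
    by (metis Reals_cnj_iff comp_apply)
  then have "\<zeta> = complex_of_real \<circ> (Re \<circ> \<zeta>)"
    by (auto simp: fun_eq_iff of_real_Re)
  with \<sigma> that[of \<sigma> "Re \<circ> \<zeta>"] show ?thesis
    by (metis complex_chart_points_iff)
qed

section \<open>Characters as regular functions on charts\<close>

definition chart_image :: "'v set \<Rightarrow> ('v set \<times> ('v \<Rightarrow> complex)) set set" where
  "chart_image \<tau> = (\<lambda>\<zeta>. toric_point N \<Delta> (\<tau>, \<zeta>)) ` chart_points N \<tau>"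

definition character :: "'v set \<Rightarrow> 'v \<Rightarrow> ('v set \<times> ('v \<Rightarrow> complex)) set \<Rightarrow> complex" where
  "character \<tau> m q = (SOME \<zeta>. \<zeta> \<in> chart_points N \<tau> \<and> q = toric_point N \<Delta> (\<tau>, \<zeta>)) m"

lemma character_toric_point:
  assumes "\<tau> \<in> \<Delta>" "\<zeta> \<in> chart_points N \<tau>"
  shows "character \<tau> m (toric_point N \<Delta> (\<tau>, \<zeta>)) = \<zeta> m"
proof -
  have "(SOME \<zeta>'. \<zeta>' \<in> chart_points N \<tau> \<and> toric_point N \<Delta> (\<tau>, \<zeta>) = toric_point N \<Delta> (\<tau>, \<zeta>')) = \<zeta>"
    using assms toric_point_inj[OF assms(1)] by (intro some_equality) auto
  then show ?thesis by (simp add: character_def)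
qed

lemma openin_chart_image:
  assumes "\<tau> \<in> \<Delta>"
  shows "openin (zariski (toric_variety N \<Delta>)) (chart_image \<tau>)"
  unfolding openin_toric_variety
proof (intro conjI ballI)
  show "chart_image \<tau> \<subseteq> topspace (zariski (toric_variety N \<Delta>))"
    using assms by (auto simp: chart_image_def topspace_toric_variety)
  fix \<sigma> assume \<sigma>: "\<sigma> \<in> \<Delta>"
  have "{\<xi> \<in> chart_points N \<sigma>. toric_point N \<Delta> (\<sigma>, \<xi>) \<in> chart_image \<tau>} =
      {\<xi> \<in> chart_points N \<sigma>. \<xi> (- separator \<tau> \<sigma>) \<noteq> 0}"
    using toric_point_in_chart_iff[OF assms \<sigma>] unfolding chart_image_def image_iff by blast
  moreover have "(\<lambda>\<xi>. \<xi> (- separator \<tau> \<sigma>)) \<in> coordinate_ring N \<sigma>"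
    using separator(2)[OF assms \<sigma>] by (rule monomial_in_coordinate_ring)
  ultimately show "openin (zariski_chart N \<sigma>) {\<xi> \<in> chart_points N \<sigma>. toric_point N \<Delta> (\<sigma>, \<xi>) \<in> chart_image \<tau>}"
    unfolding openin_topology_generated_by_iff by (intro generate_topology_on.Basis CollectI) metis
qed

text \<open>On another chart the character is the quotient of the characters \<open>m + k s\<close>
  and \<open>k s\<close>, where \<open>s\<close> is a negated separator and hence nonzero on the
  overlap.\<close>

lemma regular_character:
  assumes \<tau>: "\<tau> \<in> \<Delta>" and m: "m \<in> S \<tau>"
  shows "regular_on (toric_variety N \<Delta>) (chart_image \<tau>) (character \<tau> m)"
  unfolding toric_variety_def real_variety.simps
proof (intro ballI impI)
  fix \<sigma> and \<xi> :: "'v \<Rightarrow> complex"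
  assume \<sigma>: "\<sigma> \<in> \<Delta>" and \<xi>: "\<xi> \<in> chart_points N \<sigma>" "toric_point N \<Delta> (\<sigma>, \<xi>) \<in> chart_image \<tau>"
  define s where "s = - separator \<tau> \<sigma>"
  have s: "s \<in> S \<sigma>" using separator(2)[OF \<tau> \<sigma>] by (simp add: s_def)
  have "m \<in> S (\<tau> \<inter> \<sigma>)" using m by (meson cone_semigroup_antimono inf_le1)
  then obtain k where k: "m + real k *\<^sub>R s \<in> S \<sigma>"
    using separator(4)[OF \<tau> \<sigma>] unfolding s_def by blast
  have nz: "\<psi> (real k *\<^sub>R s) \<noteq> 0" "character \<tau> m (toric_point N \<Delta> (\<sigma>, \<psi>)) = \<psi> (m + real k *\<^sub>R s) / \<psi> (real k *\<^sub>R s)"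
    if \<psi>: "\<psi> \<in> chart_points N \<sigma>" "toric_point N \<Delta> (\<sigma>, \<psi>) \<in> chart_image \<tau>" for \<psi> :: "'v \<Rightarrow> complex"
  proof -
    obtain \<zeta> where \<zeta>: "\<zeta> \<in> chart_points N \<tau>" "toric_point N \<Delta> (\<sigma>, \<psi>) = toric_point N \<Delta> (\<tau>, \<zeta>)"
      using \<psi>(2) by (auto simp: chart_image_def)
    have "\<psi> s \<noteq> 0"
      using toric_point_in_chart_iff[OF \<tau> \<sigma> \<psi>(1)] \<zeta> unfolding s_def by blast
    then show "\<psi> (real k *\<^sub>R s) \<noteq> 0"
      by (simp add: chart_points_scale[OF \<psi>(1) s])
    show "character \<tau> m (toric_point N \<Delta> (\<sigma>, \<psi>)) = \<psi> (m + real k *\<^sub>R s) / \<psi> (real k *\<^sub>R s)"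
      using toric_point_chart_value[OF \<tau> \<zeta>(1) \<sigma> \<psi>(1) \<zeta>(2) m k[unfolded s_def]]
      unfolding \<zeta>(2) character_toric_point[OF \<tau> \<zeta>(1)] chart_points_scale[OF \<psi>(1) s]
      by (simp only: s_def)
  qed
  show "\<exists>f\<in>coordinate_ring N \<sigma>. \<exists>h\<in>coordinate_ring N \<sigma>. h \<xi> \<noteq> 0 \<and>
      (\<forall>\<psi>\<in>chart_points N \<sigma>. toric_point N \<Delta> (\<sigma>, \<psi>) \<in> chart_image \<tau> \<and> h \<psi> \<noteq> 0 \<longrightarrow>
         character \<tau> m (toric_point N \<Delta> (\<sigma>, \<psi>)) = f \<psi> / h \<psi>)"
    using nz \<xi> monomial_in_coordinate_ring[OF k] monomial_in_coordinate_ring[OF cone_semigroup_scale[OF s, of k]]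
    by (intro bexI[of _ "\<lambda>\<xi>. \<xi> (m + real k *\<^sub>R s)"] bexI[of _ "\<lambda>\<xi>. \<xi> (real k *\<^sub>R s)"]) auto
qed

end

text \<open>A real point is a class of real representatives, whereas \<open>f\<close> acts on
  classes of complex ones. The only passage between the two types is through a representative, so
  the image is described by a choice and shown to be unique afterwards.\<close>

definition real_points_map ::
  "'v::euclidean_space set \<Rightarrow> 'v set set \<Rightarrow> 'w::euclidean_space set \<Rightarrow> 'w set set \<Rightarrow>
   (('v set \<times> ('v \<Rightarrow> complex)) set \<Rightarrow> ('w set \<times> ('w \<Rightarrow> complex)) set) \<Rightarrow>
   ('v set \<times> ('v \<Rightarrow> real)) set \<Rightarrow> ('w set \<times> ('w \<Rightarrow> real)) set" where
  "real_points_map N \<Delta> N' \<Delta>' f P = (SOME Q. \<exists>\<sigma>\<in>\<Delta>. \<exists>\<xi>\<in>chart_points N \<sigma>. \<exists>\<tau>\<in>\<Delta>'. \<exists>\<psi>\<in>chart_points N' \<tau>.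
     P = toric_point N \<Delta> (\<sigma>, \<xi>) \<and> Q = toric_point N' \<Delta>' (\<tau>, \<psi>) \<and>
     f (toric_point N \<Delta> (\<sigma>, complex_of_real \<circ> \<xi>)) = toric_point N' \<Delta>' (\<tau>, complex_of_real \<circ> \<psi>))"

locale toric_morphism = V: separated_fan N \<Delta> + W: separated_fan N' \<Delta>'
  for N :: "'v::euclidean_space set" and \<Delta> and N' :: "'w::euclidean_space set" and \<Delta>' +
  fixes f
  assumes morphism: "variety_morphism (toric_variety N \<Delta>) (toric_variety N' \<Delta>') f"
begin

abbreviation "fR \<equiv> real_points_map N \<Delta> N' \<Delta>' f"

lemma real_points_map_eq:
  assumes "\<sigma> \<in> \<Delta>" "\<xi> \<in> chart_points N \<sigma>" "\<tau> \<in> \<Delta>'" "\<psi> \<in> chart_points N' \<tau>"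
    and "f (toric_point N \<Delta> (\<sigma>, complex_of_real \<circ> \<xi>)) = toric_point N' \<Delta>' (\<tau>, complex_of_real \<circ> \<psi>)"
  shows "fR (toric_point N \<Delta> (\<sigma>, \<xi>)) = toric_point N' \<Delta>' (\<tau>, \<psi>)"
  unfolding real_points_map_def
proof (rule some_equality)
  show "\<exists>\<sigma>'\<in>\<Delta>. \<exists>\<xi>'\<in>chart_points N \<sigma>'. \<exists>\<tau>'\<in>\<Delta>'. \<exists>\<psi>'\<in>chart_points N' \<tau>'.
     toric_point N \<Delta> (\<sigma>, \<xi>) = toric_point N \<Delta> (\<sigma>', \<xi>') \<and> toric_point N' \<Delta>' (\<tau>, \<psi>) = toric_point N' \<Delta>' (\<tau>', \<psi>') \<and>
     f (toric_point N \<Delta> (\<sigma>', complex_of_real \<circ> \<xi>')) = toric_point N' \<Delta>' (\<tau>', complex_of_real \<circ> \<psi>')"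
    using assms by blast
next
  fix Q assume "\<exists>\<sigma>'\<in>\<Delta>. \<exists>\<xi>'\<in>chart_points N \<sigma>'. \<exists>\<tau>'\<in>\<Delta>'. \<exists>\<psi>'\<in>chart_points N' \<tau>'.
     toric_point N \<Delta> (\<sigma>, \<xi>) = toric_point N \<Delta> (\<sigma>', \<xi>') \<and> Q = toric_point N' \<Delta>' (\<tau>', \<psi>') \<and>
     f (toric_point N \<Delta> (\<sigma>', complex_of_real \<circ> \<xi>')) = toric_point N' \<Delta>' (\<tau>', complex_of_real \<circ> \<psi>')"
  then obtain \<sigma>' \<xi>' \<tau>' \<psi>' where *: "\<sigma>' \<in> \<Delta>" "\<xi>' \<in> chart_points N \<sigma>'" "\<tau>' \<in> \<Delta>'" "\<psi>' \<in> chart_points N' \<tau>'"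
    "toric_point N \<Delta> (\<sigma>, \<xi>) = toric_point N \<Delta> (\<sigma>', \<xi>')" "Q = toric_point N' \<Delta>' (\<tau>', \<psi>')"
    "f (toric_point N \<Delta> (\<sigma>', complex_of_real \<circ> \<xi>')) = toric_point N' \<Delta>' (\<tau>', complex_of_real \<circ> \<psi>')"
    by blast
  have "toric_point N' \<Delta>' (\<tau>', complex_of_real \<circ> \<psi>') = toric_point N' \<Delta>' (\<tau>, complex_of_real \<circ> \<psi>)"
    using V.real_toric_point_eq_iff[OF assms(1,2) *(1,2)] assms(5) * by metis
  then show "Q = toric_point N' \<Delta>' (\<tau>, \<psi>)"
    using W.real_toric_point_eq_iff[OF *(3,4) assms(3,4)] * by simp
qed

text \<open>Morphisms commute with conjugation and hence preserve its fixed points, which are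
  exactly the complexified real points.\<close>

lemma real_point_image:
  assumes "\<sigma> \<in> \<Delta>" "\<xi> \<in> chart_points N \<sigma>"
  obtains \<tau> \<psi> where "\<tau> \<in> \<Delta>'" "\<psi> \<in> chart_points N' \<tau>"
    "f (toric_point N \<Delta> (\<sigma>, complex_of_real \<circ> \<xi>)) = toric_point N' \<Delta>' (\<tau>, complex_of_real \<circ> \<psi>)"
proof -
  let ?p = "toric_point N \<Delta> (\<sigma>, complex_of_real \<circ> \<xi>)"
  have p: "?p \<in> topspace (zariski (toric_variety N \<Delta>))"
    using assms by (rule real_toric_point_in_variety)
  have "f ?p \<in> topspace (zariski (toric_variety N' \<Delta>'))"
    using morphism p by (auto simp: variety_morphism_def continuous_map_def)
  moreover have "conjugation (toric_variety N' \<Delta>') (f ?p) = f ?p"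
    using morphism p V.conjugation_real_point[OF assms] by (metis variety_morphism_def)
  ultimately show ?thesis
    using W.conjugation_fixed_imp_real that by metis
qed

text \<open>Continuity is local. Near a real point the map stays in one target chart, whose
  coordinates are pulled back regular characters; these are locally quotients of sums of characters
  and thus continuous in the Euclidean topology.\<close>

lemma continuous_map_real_points_map:
  "continuous_map (toric_real_points N \<Delta>) (toric_real_points N' \<Delta>') fR"
  unfolding toric_real_points_def[of N \<Delta>] continuous_map_toric_space
proof
  fix \<sigma> assume \<sigma>: "\<sigma> \<in> \<Delta>"
  let ?X = "top_of_set (chart_points N \<sigma>) :: ('v \<Rightarrow> real) topology"
  let ?g = "\<lambda>\<xi>. fR (toric_point N \<Delta> (\<sigma>, \<xi>))"
  have "\<exists>T. openin ?X T \<and> \<xi>0 \<in> T \<and> continuous_map (subtopology ?X T) (toric_real_points N' \<Delta>') ?g"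
    if \<xi>0: "\<xi>0 \<in> chart_points N \<sigma>" for \<xi>0
  proof -
    obtain \<tau> \<psi>0 where \<tau>: "\<tau> \<in> \<Delta>'" "\<psi>0 \<in> chart_points N' \<tau>"
      "f (toric_point N \<Delta> (\<sigma>, complex_of_real \<circ> \<xi>0)) = toric_point N' \<Delta>' (\<tau>, complex_of_real \<circ> \<psi>0)"
      using real_point_image[OF \<sigma> \<xi>0] .
    define U where "U = {p \<in> topspace (zariski (toric_variety N \<Delta>)). f p \<in> W.chart_image \<tau>}"
    define O' where "O' = {\<xi> \<in> chart_points N \<sigma>. toric_point N \<Delta> (\<sigma>, complex_of_real \<circ> \<xi>) \<in> U}"
    have "openin (zariski (toric_variety N \<Delta>)) U"
      using morphism W.openin_chart_image[OF \<tau>(1)] by (auto simp: variety_morphism_def continuous_map_def U_def)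
    then have "openin (zariski_chart N \<sigma>) {\<xi> \<in> chart_points N \<sigma>. toric_point N \<Delta> (\<sigma>, \<xi>) \<in> U}"
      using \<sigma> unfolding openin_toric_variety by blast
    from zariski_chart_real_open[OF this]
    have O': "openin ?X O'"
      by (simp only: O'_def mem_Collect_eq complex_chart_points_iff) (metis (no_types, lifting) Collect_cong)
    \<comment> \<open>\<open>G\<close> is the chart expression of the map on real points. The pulled
      back characters take real values there, so \<open>Re\<close> loses nothing.\<close>
    define G where "G \<xi> m = (if m \<in> cone_semigroup N' \<tau> then
       Re (W.character \<tau> m (f (toric_point N \<Delta> (\<sigma>, complex_of_real \<circ> \<xi>)))) else 0)" for \<xi> m
    have G: "G \<xi> \<in> chart_points N' \<tau>" "?g \<xi> = toric_point N' \<Delta>' (\<tau>, G \<xi>)"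
      "m \<in> cone_semigroup N' \<tau> \<Longrightarrow> complex_of_real (G \<xi> m) = W.character \<tau> m (f (toric_point N \<Delta> (\<sigma>, complex_of_real \<circ> \<xi>)))"
      if "\<xi> \<in> O'" for \<xi> m
    proof -
      have \<xi>: "\<xi> \<in> chart_points N \<sigma>" "toric_point N \<Delta> (\<sigma>, complex_of_real \<circ> \<xi>) \<in> U"
        using that by (auto simp: O'_def)
      then obtain \<zeta> where \<zeta>: "\<zeta> \<in> chart_points N' \<tau>" "f (toric_point N \<Delta> (\<sigma>, complex_of_real \<circ> \<xi>)) = toric_point N' \<Delta>' (\<tau>, \<zeta>)"
        by (auto simp: U_def W.chart_image_def)
      obtain \<tau>' \<psi>' where \<tau>': "\<tau>' \<in> \<Delta>'" "\<psi>' \<in> chart_points N' \<tau>'"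
        "f (toric_point N \<Delta> (\<sigma>, complex_of_real \<circ> \<xi>)) = toric_point N' \<Delta>' (\<tau>', complex_of_real \<circ> \<psi>')"
        using real_point_image[OF \<sigma> \<xi>(1)] .
      have c: "complex_of_real \<circ> \<psi>' \<in> chart_points N' \<tau>'"
        using \<tau>' complex_chart_points_iff by blast
      have "(complex_of_real \<circ> \<psi>') (- W.separator \<tau> \<tau>') \<noteq> 0"
        using W.toric_point_in_chart_iff[OF \<tau>(1) \<tau>'(1) c] \<zeta> \<tau>'(3) by metis
      then have "\<psi>' (- W.separator \<tau> \<tau>') \<noteq> 0" by simp
      then obtain \<psi> where \<psi>: "\<psi> \<in> chart_points N' \<tau>" "toric_point N' \<Delta>' (\<tau>, \<psi>) = toric_point N' \<Delta>' (\<tau>', \<psi>')"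
        using W.toric_point_in_chart_iff[OF \<tau>(1) \<tau>'(1,2)] by metis
      then have fe: "f (toric_point N \<Delta> (\<sigma>, complex_of_real \<circ> \<xi>)) = toric_point N' \<Delta>' (\<tau>, complex_of_real \<circ> \<psi>)"
        using W.real_toric_point_eq_iff[OF \<tau>(1) \<psi>(1) \<tau>'(1,2)] \<tau>'(3) by simp
      have c\<psi>: "complex_of_real \<circ> \<psi> \<in> chart_points N' \<tau>"
        using \<psi> complex_chart_points_iff by blast
      have "G \<xi> = \<psi>"
        using chart_points_outside[OF \<psi>(1)] by (auto simp: G_def fe W.character_toric_point[OF \<tau>(1) c\<psi>])
      then show "G \<xi> \<in> chart_points N' \<tau>" "?g \<xi> = toric_point N' \<Delta>' (\<tau>, G \<xi>)"
        "m \<in> cone_semigroup N' \<tau> \<Longrightarrow> complex_of_real (G \<xi> m) = W.character \<tau> m (f (toric_point N \<Delta> (\<sigma>, complex_of_real \<circ> \<xi>)))"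
        using \<psi>(1) real_points_map_eq[OF \<sigma> \<xi>(1) \<tau>(1) \<psi>(1) fe]
        by (auto simp: fe W.character_toric_point[OF \<tau>(1) c\<psi>])
    qed
    have "continuous_on O' G"
    proof (rule continuous_on_coordinatewise_then_product)
      fix m
      show "continuous_on O' (\<lambda>\<xi>. G \<xi> m)"
      proof (cases "m \<in> cone_semigroup N' \<tau>")
        case True
        have "regular_on (toric_variety N \<Delta>) U (W.character \<tau> m \<circ> f)"
          using morphism W.openin_chart_image[OF \<tau>(1)] W.regular_character[OF \<tau>(1) True]
          unfolding variety_morphism_def U_def by blast
        note reg = this[unfolded toric_variety_def real_variety.simps, rule_format]
        let ?c = "\<lambda>\<xi>. W.character \<tau> m (f (toric_point N \<Delta> (\<sigma>, complex_of_real \<circ> \<xi>)))"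
        have "(?c \<longlongrightarrow> ?c \<xi>) (at \<xi> within O')"
          if \<xi>: "\<xi> \<in> O'" for \<xi>
        proof -
          have "complex_of_real \<circ> \<xi> \<in> chart_points N \<sigma>" "toric_point N \<Delta> (\<sigma>, complex_of_real \<circ> \<xi>) \<in> U"
            using \<xi> complex_chart_points_iff by (auto simp: O'_def)
          then obtain F h where Fh: "F \<in> coordinate_ring N \<sigma>" "h \<in> coordinate_ring N \<sigma>" "h (complex_of_real \<circ> \<xi>) \<noteq> 0"
            "\<And>\<psi>. \<psi> \<in> chart_points N \<sigma> \<Longrightarrow> toric_point N \<Delta> (\<sigma>, \<psi>) \<in> U \<Longrightarrow> h \<psi> \<noteq> 0 \<Longrightarrow>
               (W.character \<tau> m \<circ> f) (toric_point N \<Delta> (\<sigma>, \<psi>)) = F \<psi> / h \<psi>"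
            using reg[OF \<sigma>] by blast
          note cont = continuous_on_subset[OF coordinate_ring_continuous subset_UNIV]
          \<comment> \<open>The denominator \<open>h\<close> was obtained for this one point, so
            continuity is shown pointwise, on the open set where this particular denominator does
            not vanish.\<close>
          define H where "H = {\<xi>::'v \<Rightarrow> real. h (complex_of_real \<circ> \<xi>) \<noteq> 0}"
          have H: "open H" "\<xi> \<in> H"
            unfolding H_def using Fh(3)
            by (auto intro!: open_Collect_neq coordinate_ring_continuous[OF Fh(2)] continuous_on_const)
          have "continuous_on (O' \<inter> H) (\<lambda>\<xi>. F (complex_of_real \<circ> \<xi>) / h (complex_of_real \<circ> \<xi>))"
            using cont[OF Fh(1)] cont[OF Fh(2)] by (intro continuous_on_divide) (auto simp: H_def)
          moreover have "(W.character \<tau> m \<circ> f) (toric_point N \<Delta> (\<sigma>, complex_of_real \<circ> \<xi>)) =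
              F (complex_of_real \<circ> \<xi>) / h (complex_of_real \<circ> \<xi>)" if "\<xi> \<in> O' \<inter> H" for \<xi>
            using that complex_chart_points_iff by (intro Fh(4)) (auto simp: O'_def H_def)
          ultimately have "continuous_on (O' \<inter> H) (\<lambda>\<xi>. (W.character \<tau> m \<circ> f) (toric_point N \<Delta> (\<sigma>, complex_of_real \<circ> \<xi>)))"
            by (metis (no_types, lifting) continuous_on_cong)
          then have "(?c \<longlongrightarrow> ?c \<xi>) (at \<xi> within (O' \<inter> H))"
            using \<xi> H(2) by (auto simp: continuous_on_def)
          moreover have "at \<xi> within (O' \<inter> H) = at \<xi> within O'"
            by (rule at_within_nhd[OF H(2,1)]) auto
          ultimately show ?thesis by simp
        qed
        then have "continuous_on O' (\<lambda>\<xi>. Re (W.character \<tau> m (f (toric_point N \<Delta> (\<sigma>, complex_of_real \<circ> \<xi>)))))"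
          by (intro continuous_on_Re) (auto simp: continuous_on_def)
        then show ?thesis using True by (simp add: G_def)
      next
        case False
        then show ?thesis by (simp add: G_def)
      qed
    qed
    then have "continuous_map (subtopology ?X O') (top_of_set (chart_points N' \<tau>)) G"
      using G(1) openin_imp_subset[OF O'] by (auto simp: subtopology_subtopology inf.absorb2)
    from continuous_map_compose[OF this toric_real_points_continuous[OF \<tau>(1)]]
    have "continuous_map (subtopology ?X O') (toric_real_points N' \<Delta>') ?g"
      by (rule continuous_map_eq) (auto simp: G(2))
    moreover have "\<xi>0 \<in> O'"
    proof -
      have "complex_of_real \<circ> \<psi>0 \<in> chart_points N' \<tau>"
        using \<tau>(2) complex_chart_points_iff by blast
      then show ?thesis
        using \<xi>0 \<tau>(3) real_toric_point_in_variety[OF \<sigma> \<xi>0]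
        unfolding O'_def U_def W.chart_image_def by blast
    qed
    ultimately show ?thesis using O' by blast
  qed
  then show "continuous_map ?X (toric_real_points N' \<Delta>') ?g"
    by (intro continuous_map_locally) auto
qed

end

theorem isomorphic_imp_real_points_homeomorphic:
  assumes "separated_fan N \<Delta>" "separated_fan N' \<Delta>'"
    and "isomorphic_varieties (toric_variety N \<Delta>) (toric_variety N' \<Delta>')"
  shows "toric_real_points N \<Delta> homeomorphic_space toric_real_points N' \<Delta>'"
proof -
  interpret V: separated_fan N \<Delta> by fact
  interpret W: separated_fan N' \<Delta>' by fact
  obtain f g where fg: "variety_morphism (toric_variety N \<Delta>) (toric_variety N' \<Delta>') f"
    "variety_morphism (toric_variety N' \<Delta>') (toric_variety N \<Delta>) g"
    "\<And>p. p \<in> topspace (zariski (toric_variety N \<Delta>)) \<Longrightarrow> g (f p) = p"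
    "\<And>q. q \<in> topspace (zariski (toric_variety N' \<Delta>')) \<Longrightarrow> f (g q) = q"
    using assms(3) by (auto simp: isomorphic_varieties_def)
  interpret F: toric_morphism N \<Delta> N' \<Delta>' f by unfold_locales (rule fg)
  interpret G: toric_morphism N' \<Delta>' N \<Delta> g by unfold_locales (rule fg)
  have "G.fR (F.fR p) = p" if mem: "p \<in> topspace (toric_real_points N \<Delta>)" for p
  proof -
    obtain \<sigma> \<xi> where p: "\<sigma> \<in> \<Delta>" "\<xi> \<in> chart_points N \<sigma>" "p = toric_point N \<Delta> (\<sigma>, \<xi>)"
      using mem by (auto simp: topspace_toric_real_points)
    obtain \<tau> \<psi> where q: "\<tau> \<in> \<Delta>'" "\<psi> \<in> chart_points N' \<tau>"
      "f (toric_point N \<Delta> (\<sigma>, complex_of_real \<circ> \<xi>)) = toric_point N' \<Delta>' (\<tau>, complex_of_real \<circ> \<psi>)"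
      using F.real_point_image[OF p(1,2)] .
    have "toric_point N \<Delta> (\<sigma>, complex_of_real \<circ> \<xi>) \<in> topspace (zariski (toric_variety N \<Delta>))"
      using p(1,2) by (rule real_toric_point_in_variety)
    then have "g (toric_point N' \<Delta>' (\<tau>, complex_of_real \<circ> \<psi>)) = toric_point N \<Delta> (\<sigma>, complex_of_real \<circ> \<xi>)"
      using fg(3) q(3) by metis
    then show ?thesis
      using G.real_points_map_eq[OF q(1,2) p(1,2)] F.real_points_map_eq[OF p(1,2) q] p(3) by simp
  qed
  moreover have "F.fR (G.fR q) = q" if mem: "q \<in> topspace (toric_real_points N' \<Delta>')" for q
  proof -
    obtain \<tau> \<psi> where q: "\<tau> \<in> \<Delta>'" "\<psi> \<in> chart_points N' \<tau>" "q = toric_point N' \<Delta>' (\<tau>, \<psi>)"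
      using mem by (auto simp: topspace_toric_real_points)
    obtain \<sigma> \<xi> where p: "\<sigma> \<in> \<Delta>" "\<xi> \<in> chart_points N \<sigma>"
      "g (toric_point N' \<Delta>' (\<tau>, complex_of_real \<circ> \<psi>)) = toric_point N \<Delta> (\<sigma>, complex_of_real \<circ> \<xi>)"
      using G.real_point_image[OF q(1,2)] .
    have "toric_point N' \<Delta>' (\<tau>, complex_of_real \<circ> \<psi>) \<in> topspace (zariski (toric_variety N' \<Delta>'))"
      using q(1,2) by (rule real_toric_point_in_variety)
    then have "f (toric_point N \<Delta> (\<sigma>, complex_of_real \<circ> \<xi>)) = toric_point N' \<Delta>' (\<tau>, complex_of_real \<circ> \<psi>)"
      using fg(4) p(3) by metis
    then show ?thesis
      using F.real_points_map_eq[OF p(1,2) q(1,2)] G.real_points_map_eq[OF q(1,2) p] q(3) by simp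
  qed
  ultimately have "homeomorphic_maps (toric_real_points N \<Delta>) (toric_real_points N' \<Delta>') F.fR G.fR"
    using F.continuous_map_real_points_map G.continuous_map_real_points_map
    by (simp add: homeomorphic_maps_def)
  then show ?thesis by (auto simp: homeomorphic_space_def)
qed

section \<open>Isomorphisms of lattices\<close>

text \<open>\<open>A\<close> and \<open>B\<close> are the transposes of \<open>T\<close> and of its inverse \<open>U\<close>.\<close>

locale fan_isomorphism =
  fixes N :: "'v::euclidean_space set" and \<Delta> and N' :: "'w::euclidean_space set" and \<Delta>'
    and T U A B
  assumes UT: "\<And>v. U (T v) = v" and TU: "\<And>w. T (U w) = w"
    and AB: "\<And>m. A (B m) = m" and BA: "\<And>m. B (A m) = m"
    and A: "\<And>m v. A m \<bullet> v = m \<bullet> T v" and B: "\<And>m v. B m \<bullet> v = m \<bullet> U v"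
    and linear_A: "linear A" and linear_B: "linear B"
    and TN: "T ` N = N'" and T\<Delta>: "(`) T ` \<Delta> = \<Delta>'"
begin

lemma inverse: "fan_isomorphism N' \<Delta>' N \<Delta> U T B A"
proof
  show "U ` N' = N" using UT by (auto simp: TN[symmetric] image_iff)
  show "(`) U ` \<Delta>' = \<Delta>"
    using UT by (auto simp: T\<Delta>[symmetric] image_image)
qed (simp_all only: UT TU AB BA A B linear_add[OF linear_A] linear_add[OF linear_B]
    linear_scale[OF linear_A] linear_scale[OF linear_B])

lemma cone_semigroup_image: "m \<in> cone_semigroup N' (T ` \<sigma>) \<longleftrightarrow> A m \<in> cone_semigroup N \<sigma>"
  by (auto simp: cone_semigroup_def dual_lattice_def A TN[symmetric])

lemma chart_points_image:
  assumes "\<xi> \<in> chart_points N \<sigma>"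
  shows "\<xi> \<circ> A \<in> chart_points N' (T ` \<sigma>)"
  using assms by (auto simp: chart_points_def cone_semigroup_image linear_0[OF linear_A] linear_add[OF linear_A])

lemma chart_restrict_image: "chart_restrict N' (T ` \<sigma>) (\<omega> \<circ> A) = chart_restrict N \<sigma> \<omega> \<circ> A"
  by (auto simp: chart_restrict_def cone_semigroup_image)

definition point_map :: "('v set \<times> ('v \<Rightarrow> 'k)) set \<Rightarrow> ('w set \<times> ('w \<Rightarrow> 'k)) set" where
  "point_map p = (\<lambda>(\<sigma>, \<xi>). (T ` \<sigma>, \<xi> \<circ> A)) ` p"

lemma T_Int: "T ` (\<sigma> \<inter> \<tau>) = T ` \<sigma> \<inter> T ` \<tau>"
  by (rule image_Int) (metis UT injI)

lemma toric_point_image_subset: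
  assumes "(\<tau>, \<psi>) \<in> toric_point N \<Delta> (\<sigma>, \<xi>)"
  shows "(T ` \<tau>, \<psi> \<circ> A) \<in> toric_point N' \<Delta>' (T ` \<sigma>, \<xi> \<circ> A)"
proof -
  obtain \<omega> where \<omega>: "\<tau> \<in> \<Delta>" "\<psi> \<in> chart_points N \<tau>" "\<omega> \<in> chart_points N (\<sigma> \<inter> \<tau>)"
    "\<xi> = chart_restrict N \<sigma> \<omega>" "\<psi> = chart_restrict N \<tau> \<omega>"
    using assms unfolding toric_point_iff by blast
  then show ?thesis
    unfolding toric_point_iff T_Int[symmetric] using chart_points_image T\<Delta>
    by (metis chart_restrict_image imageI)
qed

end

context fan_isomorphism
begin

interpretation inv: fan_isomorphism N' \<Delta>' N \<Delta> U T B A by (rule inverse)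

lemma point_map_inverse: "inv.point_map (point_map p) = p"
  unfolding point_map_def inv.point_map_def image_image
  by (rule trans[OF image_cong[OF refl, of _ _ "\<lambda>x. x"] image_ident])
    (auto simp: image_image UT AB fun_eq_iff)

lemma point_map_toric_point:
  "point_map (toric_point N \<Delta> (\<sigma>, \<xi>)) = toric_point N' \<Delta>' (T ` \<sigma>, \<xi> \<circ> A)"
proof
  show "point_map (toric_point N \<Delta> (\<sigma>, \<xi>)) \<subseteq> toric_point N' \<Delta>' (T ` \<sigma>, \<xi> \<circ> A)"
    using toric_point_image_subset by (auto simp: point_map_def)
  have "(\<tau>, \<psi>) \<in> point_map (toric_point N \<Delta> (\<sigma>, \<xi>))"
    if "(\<tau>, \<psi>) \<in> toric_point N' \<Delta>' (T ` \<sigma>, \<xi> \<circ> A)" for \<tau> \<psi>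
  proof -
    have "U ` T ` \<sigma> = \<sigma>" "\<xi> \<circ> A \<circ> B = \<xi>" "T ` U ` \<tau> = \<tau>" "\<psi> \<circ> B \<circ> A = \<psi>"
      by (auto simp: image_image UT TU AB BA fun_eq_iff)
    then have "(U ` \<tau>, \<psi> \<circ> B) \<in> toric_point N \<Delta> (\<sigma>, \<xi>)" "(\<tau>, \<psi>) = (T ` U ` \<tau>, \<psi> \<circ> B \<circ> A)"
      using inv.toric_point_image_subset[OF that] by auto
    then show ?thesis
      unfolding point_map_def by (intro image_eqI[of _ _ "(U ` \<tau>, \<psi> \<circ> B)"]) auto
  qed
  then show "toric_point N' \<Delta>' (T ` \<sigma>, \<xi> \<circ> A) \<subseteq> point_map (toric_point N \<Delta> (\<sigma>, \<xi>))"
    by auto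
qed

lemma coordinate_ring_pullback:
  assumes "f \<in> coordinate_ring N' (T ` \<sigma>)"
  shows "(\<lambda>\<xi>. f (\<xi> \<circ> A)) \<in> coordinate_ring N \<sigma>"
proof -
  obtain M c where M: "finite M" "M \<subseteq> cone_semigroup N' (T ` \<sigma>)" "f = (\<lambda>\<xi>. \<Sum>m\<in>M. c m * \<xi> m)"
    using assms by (auto simp: coordinate_ring_def)
  have "inj_on A M" by (metis BA inj_onI)
  then have "(\<Sum>m\<in>A ` M. c (B m) * \<xi> m) = f (\<xi> \<circ> A)" for \<xi>
    by (simp add: M(3) sum.reindex BA)
  then show ?thesis
    unfolding coordinate_ring_def using M
    by (intro CollectI exI[of _ "A ` M"] exI[of _ "\<lambda>m. c (B m)"]) (auto simp: cone_semigroup_image)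
qed

lemma continuous_map_zariski_chart:
  "continuous_map (zariski_chart N \<sigma>) (zariski_chart N' (T ` \<sigma>)) (\<lambda>\<xi>. \<xi> \<circ> A)"
proof (rule continuous_on_generated_topo)
  fix W assume "W \<in> {{\<xi> \<in> chart_points N' (T ` \<sigma>). f \<xi> \<noteq> 0} | f. f \<in> coordinate_ring N' (T ` \<sigma>)}"
  then obtain f where f: "f \<in> coordinate_ring N' (T ` \<sigma>)" "W = {\<xi> \<in> chart_points N' (T ` \<sigma>). f \<xi> \<noteq> 0}"
    by auto
  have "(\<lambda>\<xi>. \<xi> \<circ> A) -` W \<inter> topspace (zariski_chart N \<sigma>) = {\<xi> \<in> chart_points N \<sigma>. f (\<xi> \<circ> A) \<noteq> 0}"
    using chart_points_image unfolding topspace_zariski_chart f(2) by blast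
  then show "openin (zariski_chart N \<sigma>) ((\<lambda>\<xi>. \<xi> \<circ> A) -` W \<inter> topspace (zariski_chart N \<sigma>))"
    unfolding openin_topology_generated_by_iff using coordinate_ring_pullback[OF f(1)]
    by (intro generate_topology_on.Basis CollectI) metis
next
  show "(\<lambda>\<xi>. \<xi> \<circ> A) ` topspace (zariski_chart N \<sigma>) \<subseteq>
      \<Union>{{\<xi> \<in> chart_points N' (T ` \<sigma>). f \<xi> \<noteq> 0} | f. f \<in> coordinate_ring N' (T ` \<sigma>)}"
    unfolding topology_generated_by_topspace[symmetric] unfolding topspace_zariski_chart
    using chart_points_image by auto
qed

lemma point_map_morphism:
  "variety_morphism (toric_variety N \<Delta>) (toric_variety N' \<Delta>') point_map"
  unfolding variety_morphism_def
proof (intro conjI allI impI ballI)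
  show "continuous_map (zariski (toric_variety N \<Delta>)) (zariski (toric_variety N' \<Delta>')) point_map"
  proof -
    have "continuous_map (zariski_chart N \<sigma>) (zariski (toric_variety N' \<Delta>'))
        (\<lambda>\<xi>. point_map (toric_point N \<Delta> (\<sigma>, \<xi>)))" if "\<sigma> \<in> \<Delta>" for \<sigma>
    proof -
      have "T ` \<sigma> \<in> \<Delta>'" using that T\<Delta> by auto
      from continuous_map_compose[OF continuous_map_zariski_chart continuous_map_toric_point[OF this, of "zariski_chart N'" N']]
      show ?thesis by (simp add: o_def point_map_toric_point toric_variety_def)
    qed
    then show ?thesis
      by (simp add: toric_variety_def[of N \<Delta>] continuous_map_toric_space)
  qed
next
  fix W g assume Wg: "openin (zariski (toric_variety N' \<Delta>')) W \<and> regular_on (toric_variety N' \<Delta>') W g"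
  then have reg: "\<And>\<sigma> \<xi>. \<sigma> \<in> \<Delta>' \<Longrightarrow> \<xi> \<in> chart_points N' \<sigma> \<Longrightarrow> toric_point N' \<Delta>' (\<sigma>, \<xi>) \<in> W \<Longrightarrow>
         (\<exists>f \<in> coordinate_ring N' \<sigma>. \<exists>h \<in> coordinate_ring N' \<sigma>. h \<xi> \<noteq> 0 \<and>
            (\<forall>\<psi> \<in> chart_points N' \<sigma>. toric_point N' \<Delta>' (\<sigma>, \<psi>) \<in> W \<and> h \<psi> \<noteq> 0 \<longrightarrow>
               g (toric_point N' \<Delta>' (\<sigma>, \<psi>)) = f \<psi> / h \<psi>))"
    by (simp add: toric_variety_def)
  show "regular_on (toric_variety N \<Delta>) {p \<in> topspace (zariski (toric_variety N \<Delta>)). point_map p \<in> W} (g \<circ> point_map)"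
    (is "regular_on _ ?W _")
    unfolding toric_variety_def[of N \<Delta>] real_variety.simps
  proof (intro ballI impI)
    fix \<sigma> and \<xi> :: "'v \<Rightarrow> complex"
    assume \<sigma>: "\<sigma> \<in> \<Delta>" "\<xi> \<in> chart_points N \<sigma>"
      "toric_point N \<Delta> (\<sigma>, \<xi>) \<in> {p \<in> topspace (toric_space N \<Delta> (zariski_chart N)). point_map p \<in> W}"
    have "T ` \<sigma> \<in> \<Delta>'" using \<sigma> T\<Delta> by auto
    then obtain f h where fh: "f \<in> coordinate_ring N' (T ` \<sigma>)" "h \<in> coordinate_ring N' (T ` \<sigma>)" "h (\<xi> \<circ> A) \<noteq> 0"
      "\<And>\<psi>. \<psi> \<in> chart_points N' (T ` \<sigma>) \<Longrightarrow> toric_point N' \<Delta>' (T ` \<sigma>, \<psi>) \<in> W \<Longrightarrow> h \<psi> \<noteq> 0 \<Longrightarrow>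
         g (toric_point N' \<Delta>' (T ` \<sigma>, \<psi>)) = f \<psi> / h \<psi>"
      using reg[of "T ` \<sigma>" "\<xi> \<circ> A"] \<sigma> chart_points_image[of \<xi> \<sigma>] unfolding point_map_toric_point[symmetric] by blast
    have "(g \<circ> point_map) (toric_point N \<Delta> (\<sigma>, \<psi>)) = f (\<psi> \<circ> A) / h (\<psi> \<circ> A)"
      if "\<psi> \<in> chart_points N \<sigma>" "point_map (toric_point N \<Delta> (\<sigma>, \<psi>)) \<in> W" "h (\<psi> \<circ> A) \<noteq> 0" for \<psi>
      using fh(4)[OF chart_points_image[OF that(1)]] that(2,3) by (simp add: point_map_toric_point)
    then show "\<exists>f\<in>coordinate_ring N \<sigma>. \<exists>h\<in>coordinate_ring N \<sigma>. h \<xi> \<noteq> 0 \<and>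
        (\<forall>\<psi>\<in>chart_points N \<sigma>. toric_point N \<Delta> (\<sigma>, \<psi>) \<in>
            {p \<in> topspace (toric_space N \<Delta> (zariski_chart N)). point_map p \<in> W} \<and> h \<psi> \<noteq> 0 \<longrightarrow>
           (g \<circ> point_map) (toric_point N \<Delta> (\<sigma>, \<psi>)) = f \<psi> / h \<psi>)"
      using coordinate_ring_pullback[OF fh(1)] coordinate_ring_pullback[OF fh(2)] fh(3)
      by (intro bexI[of _ "\<lambda>\<xi>. f (\<xi> \<circ> A)"] bexI[of _ "\<lambda>\<xi>. h (\<xi> \<circ> A)"]) blast+
  qed
next
  fix p
  show "point_map (conjugation (toric_variety N \<Delta>) p) = conjugation (toric_variety N' \<Delta>') (point_map p)"
    unfolding toric_variety_def real_variety.simps point_map_def image_image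
    by (intro image_cong refl) (auto simp: fun_eq_iff)
qed

end

theorem (in fan_isomorphism) isomorphic_toric_varieties:
  "isomorphic_varieties (toric_variety N \<Delta>) (toric_variety N' \<Delta>')"
proof -
  interpret inv: fan_isomorphism N' \<Delta>' N \<Delta> U T B A by (rule inverse)
  show ?thesis
    unfolding isomorphic_varieties_def
    using point_map_morphism inv.point_map_morphism point_map_inverse inv.point_map_inverse by blast
qed

section \<open>Lattices in the plane\<close>

abbreviation cone_of :: "'v::euclidean_space set \<Rightarrow> 'v set" where
  "cone_of A \<equiv> convex_cone hull A"

lemma cone_of_pair: "cone_of {a, b} = {x *\<^sub>R a + y *\<^sub>R b | x y. 0 \<le> x \<and> 0 \<le> y}" (is "_ = ?R")
proof (rule hull_unique)
  have "a = 1 *\<^sub>R a + 0 *\<^sub>R b" "b = 0 *\<^sub>R a + 1 *\<^sub>R b" by auto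
  then show "{a, b} \<subseteq> ?R" by (smt (verit) insert_subset empty_subsetI mem_Collect_eq)
  show "convex_cone ?R"
    unfolding convex_cone_iff
  proof (intro conjI allI ballI impI)
    show "0 \<in> ?R" by force
    fix u v assume "u \<in> ?R" "v \<in> ?R"
    then obtain x y x' y' where "u = x *\<^sub>R a + y *\<^sub>R b" "v = x' *\<^sub>R a + y' *\<^sub>R b" "0 \<le> x" "0 \<le> y" "0 \<le> x'" "0 \<le> y'"
      by auto
    then show "u + v \<in> ?R"
      by (intro CollectI exI[of _ "x + x'"] exI[of _ "y + y'"]) (simp add: algebra_simps)
  next
    fix u and c :: real assume "u \<in> ?R" "0 \<le> c"
    then obtain x y where "u = x *\<^sub>R a + y *\<^sub>R b" "0 \<le> x" "0 \<le> y" "0 \<le> c"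
      by auto
    then show "c *\<^sub>R u \<in> ?R"
      by (intro CollectI exI[of _ "c * x"] exI[of _ "c * y"]) (simp add: algebra_simps)
  qed
  fix T assume T: "{a, b} \<subseteq> T" "convex_cone T"
  then show "?R \<subseteq> T"
    by (auto intro!: convex_cone_add convex_cone_scaleR)
qed

lemma cone_of_single: "cone_of {a} = {x *\<^sub>R a | x. 0 \<le> x}"
proof -
  have "\<exists>z. x *\<^sub>R a + y *\<^sub>R a = z *\<^sub>R a \<and> 0 \<le> z" if "0 \<le> x" "0 \<le> y" for x y
    using that by (intro exI[of _ "x + y"]) (simp add: algebra_simps)
  moreover have "\<exists>x' y. x *\<^sub>R a = x' *\<^sub>R a + y *\<^sub>R a \<and> 0 \<le> x' \<and> 0 \<le> y" if "0 \<le> x" for x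
    using that by (intro exI[of _ x] exI[of _ 0]) simp
  ultimately show ?thesis using cone_of_pair[of a a] by auto
qed

lemma cone_of_sum: "(\<And>x. x \<in> A \<Longrightarrow> f x \<in> cone_of S) \<Longrightarrow> sum f A \<in> cone_of S"
  by (induction A rule: infinite_finite_induct) (auto simp: convex_cone_hull_contains_0 intro!: convex_cone_hull_add)

text \<open>Rounding large multiples approximates a real direction by integral ones; it turns a real
  separating form into a lattice form.\<close>

lemma floor_multiple_tendsto: "(\<lambda>n. of_int \<lfloor>real n * c\<rfloor> / real n) \<longlonglongrightarrow> c"
proof (rule tendsto_sandwich)
  have "\<forall>\<^sub>F n in sequentially. 0 < n" by (rule eventually_gt_at_top)
  then show "\<forall>\<^sub>F n in sequentially. c - 1 / real n \<le> of_int \<lfloor>real n * c\<rfloor> / real n"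
  proof eventually_elim
    case (elim n)
    have "real n * c - 1 \<le> of_int \<lfloor>real n * c\<rfloor>" by linarith
    then have "(real n * c - 1) / real n \<le> of_int \<lfloor>real n * c\<rfloor> / real n" by (simp add: divide_right_mono)
    then show ?case using elim by (simp add: diff_divide_distrib)
  qed
  have "\<forall>\<^sub>F n in sequentially. 0 < n" by (rule eventually_gt_at_top)
  then show "\<forall>\<^sub>F n in sequentially. of_int \<lfloor>real n * c\<rfloor> / real n \<le> c"
    by eventually_elim (simp add: field_simps)
  show "(\<lambda>n. c - 1 / real n) \<longlonglongrightarrow> c"
    using tendsto_diff[OF tendsto_const[of c] lim_1_over_n] by simp
qed simp

lemma Ints_pos_ge_1: "z \<in> \<int> \<Longrightarrow> 0 < z \<Longrightarrow> 1 \<le> (z::real)"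
  by (auto elim!: Ints_cases)

lemma cone_semigroup_cone_of:
  "cone_semigroup N (cone_of A) = {m \<in> dual_lattice N. \<forall>a\<in>A. 0 \<le> m \<bullet> a}"
proof -
  have "convex_cone {v. 0 \<le> m \<bullet> v}" for m :: 'a
    unfolding convex_cone_iff by (auto simp: inner_add_right)
  then have "0 \<le> m \<bullet> v" if "\<forall>a\<in>A. 0 \<le> m \<bullet> a" "v \<in> cone_of A" for m v
    using that hull_minimal[of A "{v. 0 \<le> m \<bullet> v}" convex_cone] by blast
  then show ?thesis
    by (auto simp: cone_semigroup_def hull_inc)
qed

text \<open>\<open>J x \<bullet> y\<close> is the determinant of \<open>x\<close> and \<open>y\<close> with respect to a lattice basis.\<close>

locale plane_lattice =
  fixes N :: "'v::euclidean_space set" and J :: "'v \<Rightarrow> 'v" and e1 e2 :: 'v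
  assumes linear_J: "linear J"
    and skew: "J x \<bullet> y = - (J y \<bullet> x)"
    and e12: "J e1 \<bullet> e2 = 1"
    and expand_e: "v = (J v \<bullet> e2) *\<^sub>R e1 + (J e1 \<bullet> v) *\<^sub>R e2"
    and N_eq: "N = {v. J v \<bullet> e2 \<in> \<int> \<and> J e1 \<bullet> v \<in> \<int>}"
    and dual_eq: "dual_lattice N = J ` N"
begin

lemma N_iff: "v \<in> N \<longleftrightarrow> J v \<bullet> e2 \<in> \<int> \<and> J e1 \<bullet> v \<in> \<int>"
  by (subst N_eq) simp

abbreviation area :: "'v \<Rightarrow> 'v \<Rightarrow> real" where
  "area x y \<equiv> J x \<bullet> y"

lemma area_simps [simp]:
  "area (x + y) z = area x z + area y z" "area z (x + y) = area z x + area z y"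
  "area (x - y) z = area x z - area y z" "area z (x - y) = area z x - area z y"
  "area (c *\<^sub>R x) z = c * area x z" "area z (c *\<^sub>R x) = c * area z x"
  "area (- x) z = - area x z" "area z (- x) = - area z x"
  "area x x = 0" "area 0 x = 0" "area x 0 = 0"
  using skew[of x x] linear_add[OF linear_J] linear_diff[OF linear_J] linear_scale[OF linear_J]
    linear_neg[OF linear_J] linear_0[OF linear_J]
  by (auto simp: inner_add_left inner_add_right inner_diff_left inner_diff_right)

lemma area_expand: "area x y = area x e2 * area e1 y - area e1 x * area y e2"
proof -
  have "area x y = area x ((area y e2) *\<^sub>R e1 + (area e1 y) *\<^sub>R e2)"
    using expand_e[of y] by simp
  then show ?thesis using skew[of x e1] by (simp add: algebra_simps)
qed

text \<open>Cramer's rule in the plane. Pairing it with a fourth vector gives the three-term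
  Pluecker relation of the next lemma.\<close>

lemma pluecker: "area x y *\<^sub>R v = area v y *\<^sub>R x + area x v *\<^sub>R y"
proof -
  have e: "u = w" if "area u e2 = area w e2" "area e1 u = area e1 w" for u w
    using expand_e[of u] expand_e[of w] that by simp
  show ?thesis
    by (rule e) (simp_all add: area_expand[of x y] area_expand[of v y] area_expand[of x v] algebra_simps)
qed

lemma area_exchange: "area x y * area v w = area v y * area x w + area x v * area y w"
  using arg_cong[OF pluecker[of x y v], of "\<lambda>u. area u w"] by simp

definition basis :: "'v \<Rightarrow> 'v \<Rightarrow> bool" where
  "basis a b \<longleftrightarrow> a \<in> N \<and> b \<in> N \<and> area a b = 1"

lemma basis_expand: "basis a b \<Longrightarrow> v = area v b *\<^sub>R a + area a v *\<^sub>R b"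
  using pluecker[of a b v] by (simp add: basis_def)

lemma e_basis: "basis e1 e2"
  by (simp add: basis_def N_iff e12)

lemma N_add: "x \<in> N \<Longrightarrow> y \<in> N \<Longrightarrow> x + y \<in> N"
  and N_diff: "x \<in> N \<Longrightarrow> y \<in> N \<Longrightarrow> x - y \<in> N"
  and N_neg: "x \<in> N \<Longrightarrow> - x \<in> N"
  and N_scale: "c \<in> \<int> \<Longrightarrow> x \<in> N \<Longrightarrow> c *\<^sub>R x \<in> N"
  by (auto simp: N_iff)

lemma N_area: "x \<in> N \<Longrightarrow> y \<in> N \<Longrightarrow> area x y \<in> \<int>"
  using area_expand[of x y] by (auto simp: N_iff)

lemma mem_dual: "x \<in> N \<Longrightarrow> J x \<in> dual_lattice N"
  using dual_eq by simp

lemma dual_int: "m \<in> dual_lattice N \<Longrightarrow> v \<in> N \<Longrightarrow> m \<bullet> v \<in> \<int>"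
  by (simp add: dual_lattice_def)

lemma mem_cone_iff:
  assumes "basis a b" "A \<subseteq> {a, b}"
  shows "v \<in> cone_of A \<longleftrightarrow> 0 \<le> area v b \<and> 0 \<le> area a v \<and>
    (a \<notin> A \<longrightarrow> area v b = 0) \<and> (b \<notin> A \<longrightarrow> area a v = 0)"
proof -
  have ab: "area a b = 1" "area b a = - 1" "a \<noteq> b"
    using assms(1) skew[of b a] by (auto simp: basis_def)
  note ex = basis_expand[OF assms(1), of v]
  consider "A = {}" | "A = {a}" | "A = {b}" | "A = {a, b}" using assms(2) by blast
  then show ?thesis
  proof cases
    case 1 then show ?thesis using ex by auto
  next
    case 2 
    have "v \<in> {x *\<^sub>R a | x. 0 \<le> x}" if "0 \<le> area v b" "area a v = 0"
      using ex that by auto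
    then show ?thesis unfolding 2 cone_of_single using ab by auto
  next
    case 3
    have "v \<in> {x *\<^sub>R b | x. 0 \<le> x}" if "area v b = 0" "0 \<le> area a v"
      using ex that by auto
    then show ?thesis unfolding 3 cone_of_single using ab by auto
  next
    case 4
    have "v \<in> {x *\<^sub>R a + y *\<^sub>R b | x y. 0 \<le> x \<and> 0 \<le> y}" if "0 \<le> area v b" "0 \<le> area a v"
      using ex that by auto
    then show ?thesis unfolding 4 cone_of_pair using ab by auto
  qed
qed

section \<open>Unimodular cones and their separation\<close>

definition gens :: "'v set \<Rightarrow> bool" where
  "gens A \<longleftrightarrow> (\<exists>a b. basis a b \<and> A \<subseteq> {a, b})"

lemma gens_subset: "gens A \<Longrightarrow> B \<subseteq> A \<Longrightarrow> gens B"
  unfolding gens_def by blast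

lemma gens_N: "gens A \<Longrightarrow> A \<subseteq> N"
  unfolding gens_def basis_def by blast

lemma gens_finite: "gens A \<Longrightarrow> finite A"
  unfolding gens_def by (metis finite.emptyI finite.insertI finite_subset)

text \<open>A fan all of whose cones are generated by parts of lattice bases, given by the sets of
  primitive ray generators of its cones.\<close>

definition unimodular_fan :: "'v set set \<Rightarrow> bool" where
  "unimodular_fan K \<longleftrightarrow> (\<forall>A\<in>K. gens A) \<and> (\<forall>A\<in>K. \<forall>B\<in>K. cone_of A \<inter> cone_of B = cone_of (A \<inter> B))"

lemma gens_positive_functional:
  assumes "gens A"
  obtains f where "linear f" "\<And>a. a \<in> A \<Longrightarrow> f a = (1::real)"
proof -
  obtain a b where ab: "basis a b" "A \<subseteq> {a, b}" using assms by (auto simp: gens_def)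
  have "linear (\<lambda>v. area v b + area a v)"
    by (rule linearI) (auto simp: algebra_simps)
  moreover have "area v b + area a v = 1" if "v \<in> A" for v
    using ab that by (auto simp: basis_def)
  ultimately show ?thesis using that by blast
qed

text \<open>Finitely many strict inequalities survive a small perturbation. The coordinates of
  \<open>w\<close> are rounded after multiplication by \<open>n\<close>; divided by
  \<open>n\<close>, the resulting lattice forms converge to \<open>w\<close>.\<close>

lemma dual_lattice_approx:
  assumes "finite F" "\<And>x. x \<in> F \<Longrightarrow> 0 < w \<bullet> x"
  obtains m where "m \<in> dual_lattice N" "\<And>x. x \<in> F \<Longrightarrow> 0 < m \<bullet> x"
proof -
  define p q where "p = w \<bullet> e1" and "q = w \<bullet> e2"
  define z where "z n = of_int \<lfloor>real n * q\<rfloor> *\<^sub>R e1 - of_int \<lfloor>real n * p\<rfloor> *\<^sub>R e2" for n :: nat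
  have "\<forall>\<^sub>F n in sequentially. 0 < area (z n) x" if "x \<in> F" for x
  proof -
    have "w \<bullet> x = w \<bullet> (area x e2 *\<^sub>R e1 + area e1 x *\<^sub>R e2)" using expand_e[of x] by simp
    then have wx: "w \<bullet> x = q * area e1 x - p * area e2 x"
      using skew[of x e2] by (simp add: p_def q_def inner_add_right inner_diff_right)
    have "(\<lambda>n. of_int \<lfloor>real n * q\<rfloor> / real n * area e1 x - of_int \<lfloor>real n * p\<rfloor> / real n * area e2 x) \<longlonglongrightarrow> w \<bullet> x"
      unfolding wx by (intro tendsto_intros floor_multiple_tendsto)
    then have "\<forall>\<^sub>F n in sequentially. 0 < of_int \<lfloor>real n * q\<rfloor> / real n * area e1 x - of_int \<lfloor>real n * p\<rfloor> / real n * area e2 x"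
      using assms(2)[OF that] by (rule order_tendstoD)
    then show ?thesis
      using eventually_gt_at_top[of 0]
    proof eventually_elim
      case (elim n)
      then have "0 < real n * (of_int \<lfloor>real n * q\<rfloor> / real n * area e1 x - of_int \<lfloor>real n * p\<rfloor> / real n * area e2 x)"
        by simp
      also have "\<dots> = area (z n) x" using elim by (simp add: z_def field_simps)
      finally show ?case .
    qed
  qed
  then have "\<forall>\<^sub>F n in sequentially. \<forall>x\<in>F. 0 < area (z n) x"
    using assms(1) by (simp add: eventually_ball_finite_distrib)
  then obtain n where "\<forall>x\<in>F. 0 < area (z n) x"
    using eventually_happens by fastforce
  moreover have "J (z n) \<in> dual_lattice N"
    using e_basis by (intro mem_dual) (auto simp: z_def basis_def intro!: N_diff N_scale)
  ultimately show ?thesis using that by blast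
qed

text \<open>Separates two cones by a lattice form that vanishes exactly on the common generators.
  With no common generator this is the hyperplane theorem for the hull of \<open>A\<close> and
  \<open>- B\<close>, followed by rounding; with one common generator \<open>c\<close>, the form
  \<open>area c\<close> serves up to sign; with two, the cones coincide.\<close>

lemma unimodular_separator:
  assumes K: "unimodular_fan K" "A \<in> K" "B \<in> K"
  obtains m where "m \<in> dual_lattice N" "\<And>a. a \<in> A - B \<Longrightarrow> 0 < m \<bullet> a"
    "\<And>a. a \<in> A \<inter> B \<Longrightarrow> m \<bullet> a = 0" "\<And>b. b \<in> B - A \<Longrightarrow> m \<bullet> b < 0"
proof -
  have gA: "gens A" and gB: "gens B" and int: "cone_of A \<inter> cone_of B = cone_of (A \<inter> B)"
    using K by (auto simp: unimodular_fan_def)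
  have fin: "finite A" "finite B" using gA gB gens_finite by auto
  \<comment> \<open>If the remaining generators \<open>a\<close> and \<open>d\<close> lay on the
    same side of the common ray, they would differ by a multiple of \<open>c\<close>. Then one of
    the cones would contain a generator of the other outside their common ray.\<close>
  have sides: False
    if c: "c \<in> A \<inter> B" and a: "a \<in> A" "a \<notin> B" and d: "d \<in> B" "d \<notin> A" and eq: "area c a = area c d"
      and one: "A \<inter> B = {c}" and nz: "area c a \<noteq> 0" for a c d
  proof -
    obtain a' b' where ab: "basis a' b'" "A \<subseteq> {a', b'}" using gA by (auto simp: gens_def)
    have "area c a = 1 \<or> area c a = - 1"
      using ab c a nz skew[of b' a'] by (auto simp: basis_def)
    then have sq: "area c a * area c a = 1" by auto
    obtain k where k: "d = a + k *\<^sub>R c"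
    proof
      have "d = (area c a * area c a) *\<^sub>R d" by (simp add: sq)
      also have "\<dots> = area c a *\<^sub>R (area d a *\<^sub>R c + area c d *\<^sub>R a)"
        using pluecker[of c a d] by (metis scaleR_scaleR)
      also have "\<dots> = (area c a * area c a) *\<^sub>R a + (area c a * area d a) *\<^sub>R c"
        by (simp add: eq[symmetric] algebra_simps)
      finally show "d = a + (area c a * area d a) *\<^sub>R c" by (simp add: sq)
    qed
    have "d \<in> cone_of A \<inter> cone_of B \<or> a \<in> cone_of A \<inter> cone_of B"
    proof (cases "0 \<le> k")
      case True
      then have "d \<in> cone_of A" unfolding k using a c
        by (intro convex_cone_hull_add convex_cone_hull_mul) (auto simp: hull_inc)
      then show ?thesis using d by (simp add: hull_inc)
    next
      case False
      have "a = d + (- k) *\<^sub>R c" by (simp add: k)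
      moreover have "d + (- k) *\<^sub>R c \<in> cone_of B" using d c False
        by (intro convex_cone_hull_add convex_cone_hull_mul) (auto simp: hull_inc)
      ultimately show ?thesis using a by (simp add: hull_inc)
    qed
    then have "d \<in> cone_of {c} \<or> a \<in> cone_of {c}" using int one by auto
    then show False using nz eq by (auto simp: cone_of_single)
  qed
  consider "A \<inter> B = {}" | c where "A \<inter> B = {c}" | "A - B = {} \<and> B - A = {}"
  proof -
    have two: "X = {c, c'}" if X: "gens X" "c \<in> X" "c' \<in> X" "c \<noteq> c'" for X c c'
    proof -
      obtain a b where "X \<subseteq> {a, b}" using X(1) by (auto simp: gens_def)
      then show ?thesis using X(2-4) by blast
    qed
    have "A - B = {} \<and> B - A = {}" if "c \<in> A \<inter> B" "c' \<in> A \<inter> B" "c \<noteq> c'" for c c'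
      using two[OF gA, of c c'] two[OF gB, of c c'] that by auto
    then have "A \<inter> B = {} \<or> (\<exists>c. A \<inter> B = {c}) \<or> (A - B = {} \<and> B - A = {})"
      by blast
    then show ?thesis using that by blast
  qed
  then show ?thesis
  proof cases
    case 3
    show ?thesis
    proof (rule that[of 0])
      show "0 \<in> dual_lattice N" by (simp add: dual_lattice_def)
    qed (use 3 in auto)
  next
    case 1
    define F where "F = A \<union> uminus ` B"
    have "finite F" using fin by (simp add: F_def)
    \<comment> \<open>A convex combination equal to 0 yields equal points of the two cones, hence
      the apex. The functionals that are 1 on all generators then force every coefficient to
      vanish.\<close>
    have "0 \<notin> convex hull F"
    proof
      assume "0 \<in> convex hull F"
      then obtain u where u: "\<forall>x\<in>F. 0 \<le> u x" "sum u F = 1" "(\<Sum>x\<in>F. u x *\<^sub>R x) = 0"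
        unfolding convex_hull_finite[OF \<open>finite F\<close>] by auto
      \<comment> \<open>A vector may belong both to \<open>A\<close> and to the negatives of
        \<open>B\<close>; removing \<open>A\<close> avoids counting its coefficient twice.\<close>
      define B' where "B' = uminus ` B - A"
      have F: "F = A \<union> B'" "A \<inter> B' = {}" "finite B'" using fin by (auto simp: F_def B'_def)
      define P where "P = (\<Sum>x\<in>A. u x *\<^sub>R x)"
      define Q where "Q = (\<Sum>x\<in>B'. u x *\<^sub>R (- x))"
      have PQ: "P = Q"
        using u(3) unfolding F(1) P_def Q_def
        by (simp add: sum.union_disjoint[OF fin(1) F(3,2)] sum_negf eq_neg_iff_add_eq_0)
      have "P \<in> cone_of A" unfolding P_def using u(1) F(1)
        by (intro cone_of_sum convex_cone_hull_mul) (auto simp: hull_inc)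
      moreover have "Q \<in> cone_of B" unfolding Q_def using u(1) F(1)
        by (intro cone_of_sum convex_cone_hull_mul) (auto simp: B'_def hull_inc)
      ultimately have "P \<in> cone_of (A \<inter> B)" using PQ int by auto
      then have P0: "P = 0" "Q = 0" using 1 PQ by auto
      obtain f where f: "linear f" "\<And>a. a \<in> A \<Longrightarrow> f a = (1::real)" using gens_positive_functional[OF gA] by blast
      obtain g where g: "linear g" "\<And>a. a \<in> B \<Longrightarrow> g a = (1::real)" using gens_positive_functional[OF gB] by blast
      have "f P = sum u A" unfolding P_def using f by (simp add: linear_sum[OF f(1)] linear_scale[OF f(1)])
      moreover have "g Q = sum u B'" unfolding Q_def linear_sum[OF g(1)]
        using g by (intro sum.cong) (auto simp: linear_scale[OF g(1)] B'_def)
      ultimately have "sum u A + sum u B' = 0" using P0 linear_0[OF f(1)] linear_0[OF g(1)] by simp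
      then show False using u(2) F fin by (simp add: sum.union_disjoint)
    qed
    then obtain w b where "0 < b" "\<forall>x\<in>convex hull F. w \<bullet> x > b"
      using separating_hyperplane_closed_0[of "convex hull F"] \<open>finite F\<close>
      by (auto simp: compact_imp_closed finite_imp_compact_convex_hull)
    then have "0 < w \<bullet> x" if "x \<in> F" for x using that by (meson hull_inc order_less_trans)
    then obtain m where m: "m \<in> dual_lattice N" "\<And>x. x \<in> F \<Longrightarrow> 0 < m \<bullet> x"
      using dual_lattice_approx[OF \<open>finite F\<close>] by blast
    show ?thesis
      by (rule that[OF m(1)]) (use m(2) 1 in \<open>force simp: F_def\<close>)+
  next
    case (2 c)
    have cN: "c \<in> N" using gens_N[OF gA] 2 by auto
    have pair: "area c x = 1 \<or> area c x = - 1" if X: "gens X" "c \<in> X" "x \<in> X" "x \<noteq> c" for X x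
    proof -
      obtain a b where "basis a b" "X \<subseteq> {a, b}" using X(1) by (auto simp: gens_def)
      then show ?thesis using X(2-4) skew[of b a] by (auto simp: basis_def)
    qed
    have unit: "area c a = 1 \<or> area c a = - 1" if "a \<in> A \<and> a \<noteq> c \<or> a \<in> B \<and> a \<noteq> c" for a
      using pair[OF gA, of a] pair[OF gB, of a] that 2 by blast
    then have nz: "area c a \<noteq> 0" if "a \<in> A \<and> a \<noteq> c \<or> a \<in> B \<and> a \<noteq> c" for a
      using that by force
    have single: "x = y" if X: "gens X" "c \<in> X" "x \<in> X" "y \<in> X" "x \<noteq> c" "y \<noteq> c" for X x y
    proof -
      obtain a b where "X \<subseteq> {a, b}" using X(1) by (auto simp: gens_def)
      then show ?thesis using X(2-6) by auto
    qed
    have uniq: "x = y" if "x \<in> A - B" "y \<in> A - B" for x y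
      using single[OF gA, of x y] that 2 by blast
    have uniq': "x = y" if "x \<in> B - A" "y \<in> B - A" for x y
      using single[OF gB, of x y] that 2 by blast
    have mem: "J c \<in> dual_lattice N" "J (- c) \<in> dual_lattice N" using cN by (auto intro!: mem_dual N_neg)
    have opp: "area c a = - area c d" if ad: "a \<in> A - B" "d \<in> B - A" for a d
    proof (rule ccontr)
      assume ne: "area c a \<noteq> - area c d"
      have ac: "a \<noteq> c" "d \<noteq> c" using ad 2 by blast+
      then have "area c a = area c d" using ne unit[of a] unit[of d] ad by fastforce
      moreover have "c \<in> A \<inter> B" using 2 by blast
      ultimately show False
        using sides[of c a d] ad 2 nz[of a] ac by blast
    qed
    have off: "x \<noteq> c" if "x \<in> A - B \<or> x \<in> B - A" for x
      using that 2 by blast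
    show ?thesis
    proof (cases "(\<forall>a\<in>A - B. 0 < area c a) \<and> (\<forall>a\<in>B - A. area c a < 0)")
      case True
      then show ?thesis unfolding 2 by (intro that[OF mem(1)]) (auto simp: 2)
    next
      case False
      have "(\<forall>a\<in>A - B. area c a < 0) \<and> (\<forall>a\<in>B - A. 0 < area c a)"
      proof -
        consider x where "x \<in> A - B" "\<not> 0 < area c x" | x where "x \<in> B - A" "\<not> area c x < 0"
          using False by auto
        then show ?thesis
        proof cases
          case (1 x)
          then have "area c x < 0" using nz[of x] off[of x] by force
          moreover have "0 < area c d" if "d \<in> B - A" for d using opp[OF 1(1) that] calculation by simp
          ultimately show ?thesis using uniq[OF _ 1(1)] by auto
        next
          case (2 x)
          then have "0 < area c x" using nz[of x] off[of x] by force
          moreover have "area c a < 0" if "a \<in> A - B" for a using opp[OF that 2(1)] calculation by simp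
          ultimately show ?thesis using uniq'[OF _ 2(1)] by auto
        qed
      qed
      then show ?thesis unfolding 2 by (intro that[OF mem(2)]) (auto simp: 2)
    qed
  qed
qed

lemma unimodular_separated:
  assumes K: "unimodular_fan K"
  shows "separated_fan N (cone_of ` K)"
proof
  fix \<sigma> \<tau> assume "\<sigma> \<in> cone_of ` K" "\<tau> \<in> cone_of ` K"
  then obtain A B where AB: "A \<in> K" "B \<in> K" "\<sigma> = cone_of A" "\<tau> = cone_of B" by auto
  have g: "gens A" "gens B" and int: "\<sigma> \<inter> \<tau> = cone_of (A \<inter> B)"
    using K AB by (auto simp: unimodular_fan_def)
  obtain m where m: "m \<in> dual_lattice N" "\<And>a. a \<in> A - B \<Longrightarrow> 0 < m \<bullet> a"
    "\<And>a. a \<in> A \<inter> B \<Longrightarrow> m \<bullet> a = 0" "\<And>b. b \<in> B - A \<Longrightarrow> m \<bullet> b < 0"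
    using unimodular_separator[OF K AB(1,2)] by blast
  have ge1: "1 \<le> m \<bullet> a" if "a \<in> A - B" for a
    using m(2)[OF that] dual_int[OF m(1), of a] gens_N[OF g(1)] that by (intro Ints_pos_ge_1) auto
  have le1: "m \<bullet> a \<le> - 1" if "a \<in> B - A" for a
    using m(4)[OF that] dual_int[OF m(1), of a] gens_N[OF g(2)] that Ints_pos_ge_1[of "- (m \<bullet> a)"] by auto
  have nn: "0 \<le> m \<bullet> a" if "a \<in> A" for a using m(2,3) that by (cases "a \<in> B") force+
  have np: "m \<bullet> a \<le> 0" if "a \<in> B" for a using m(3,4) that by (cases "a \<in> A") force+
  have dual: "x + c *\<^sub>R m \<in> dual_lattice N" "x - c *\<^sub>R m \<in> dual_lattice N" if "x \<in> dual_lattice N" "c \<in> \<int>" for x c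
    using that m(1) by (auto simp: dual_lattice_def inner_add_left inner_diff_left)
  show "\<exists>m\<in>cone_semigroup N \<sigma>. - m \<in> cone_semigroup N \<tau> \<and>
          (\<forall>m'\<in>cone_semigroup N (\<sigma> \<inter> \<tau>). \<exists>k::nat.
              m' + real k *\<^sub>R m \<in> cone_semigroup N \<sigma> \<and> m' - real k *\<^sub>R m \<in> cone_semigroup N \<tau>)"
  proof (intro bexI[of _ m] conjI ballI)
    show "m \<in> cone_semigroup N \<sigma>" using m nn by (auto simp: AB cone_semigroup_cone_of)
    show "- m \<in> cone_semigroup N \<tau>" using m np by (auto simp: AB cone_semigroup_cone_of dual_lattice_def)
    fix m' assume m': "m' \<in> cone_semigroup N (\<sigma> \<inter> \<tau>)"
    \<comment> \<open>By integrality \<open>m\<close> is at least 1 on \<open>A - B\<close> and at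
      most -1 on \<open>B - A\<close>, so this multiple of \<open>m\<close> outweighs
      \<open>m'\<close> on every generator.\<close>
    define k where "k = nat \<lceil>\<Sum>a\<in>A \<union> B. \<bar>m' \<bullet> a\<bar>\<rceil>"
    have k: "\<bar>m' \<bullet> a\<bar> \<le> real k" if "a \<in> A \<union> B" for a
    proof -
      have "\<bar>m' \<bullet> a\<bar> \<le> (\<Sum>a\<in>A \<union> B. \<bar>m' \<bullet> a\<bar>)"
        using that g gens_finite by (intro member_le_sum) auto
      also have "\<dots> \<le> real k" unfolding k_def by linarith
      finally show ?thesis .
    qed
    have "0 \<le> m' \<bullet> a + real k * (m \<bullet> a)" if "a \<in> A" for a
    proof (cases "a \<in> B")
      case True
      then show ?thesis using m' m(3)[of a] that by (auto simp: int cone_semigroup_cone_of)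
    next
      case False
      then have "real k * 1 \<le> real k * (m \<bullet> a)" using ge1[of a] that by (intro mult_left_mono) auto
      then show ?thesis using k[of a] that by auto
    qed
    moreover have "0 \<le> m' \<bullet> a - real k * (m \<bullet> a)" if "a \<in> B" for a
    proof (cases "a \<in> A")
      case True
      then show ?thesis using m' m(3)[of a] that by (auto simp: int cone_semigroup_cone_of)
    next
      case False
      then have "real k * (m \<bullet> a) \<le> real k * (- 1)" using le1[of a] that by (intro mult_left_mono) auto
      then show ?thesis using k[of a] that by auto
    qed
    moreover have "m' \<in> dual_lattice N" using m' by (simp add: cone_semigroup_def)
    ultimately show "\<exists>k::nat. m' + real k *\<^sub>R m \<in> cone_semigroup N \<sigma> \<and> m' - real k *\<^sub>R m \<in> cone_semigroup N \<tau>"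
      using dual[of m' "real k"]
      by (intro exI[of _ k]) (auto simp: AB cone_semigroup_cone_of inner_add_left inner_diff_left)
  qed
qed

end

section \<open>Smooth fans in the plane\<close>

text \<open>The inner product is not adapted to the lattice, so a rotation would not do. Instead
  \<open>J\<close> is assembled from the vectors \<open>f1\<close>, \<open>f2\<close> representing
  the coordinate functionals of a lattice basis, which makes \<open>J x \<bullet> y\<close> the
  determinant in these coordinates.\<close>

lemma plane_lattice_exists:
  fixes N :: "'v::euclidean_space set"
  assumes dim: "DIM('v) = 2" and N: "is_lattice N"
  obtains J e1 e2 where "plane_lattice N J e1 e2"
proof -
  obtain B where B: "independent B" "span B = UNIV" "N = range (\<lambda>c :: 'v \<Rightarrow> int. \<Sum>b\<in>B. of_int (c b) *\<^sub>R b)"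
    using N unfolding is_lattice_def by blast
  have "card B = 2"
    using B dim by (metis dim_UNIV dim_span_eq_card_independent)
  then obtain e1 e2 where e: "B = {e1, e2}" "e1 \<noteq> e2" by (meson card_2_iff)
  obtain g1 where g1: "linear g1" "g1 e1 = (1::real)" "g1 e2 = 0"
    using linear_independent_extend[OF B(1), of "\<lambda>b. if b = e1 then 1 else 0"] e by auto
  obtain g2 where g2: "linear g2" "g2 e1 = (0::real)" "g2 e2 = 1"
    using linear_independent_extend[OF B(1), of "\<lambda>b. if b = e2 then 1 else 0"] e by auto
  define f1 f2 where "f1 = adjoint g1 1" and "f2 = adjoint g2 1"
  have f: "f1 \<bullet> v = g1 v" "f2 \<bullet> v = g2 v" for v
    using adjoint_works[OF g1(1), of v 1] adjoint_works[OF g2(1), of v 1]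
    by (simp_all add: f1_def f2_def inner_commute)
  have ex: "v = g1 v *\<^sub>R e1 + g2 v *\<^sub>R e2" for v
  proof -
    have "v \<in> span {e1, e2}" using B(2) e by auto
    then obtain x y where "v = x *\<^sub>R e1 + y *\<^sub>R e2"
      by (auto simp: span_breakdown_eq) (metis add.commute diff_add_cancel)
    then show ?thesis using g1 g2 by (simp add: linear_add linear_scale)
  qed
  define J where "J x = (f1 \<bullet> x) *\<^sub>R f2 - (f2 \<bullet> x) *\<^sub>R f1" for x
  have J: "J x \<bullet> y = g1 x * g2 y - g2 x * g1 y" for x y
    by (simp add: J_def f inner_diff_left)
  have N': "N = {v. g1 v \<in> \<int> \<and> g2 v \<in> \<int>}"
  proof (intro equalityI subsetI)
    fix v assume "v \<in> N"
    then show "v \<in> {v. g1 v \<in> \<int> \<and> g2 v \<in> \<int>}"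
      unfolding B(3) e(1) using e(2) g1 g2 by (auto simp: linear_add linear_scale)
  next
    fix v assume "v \<in> {v. g1 v \<in> \<int> \<and> g2 v \<in> \<int>}"
    then obtain p q where "g1 v = of_int p" "g2 v = of_int q" by (auto elim!: Ints_cases)
    then have "v = (\<Sum>b\<in>B. of_int (if b = e1 then p else q) *\<^sub>R b)"
      using ex[of v] e by simp
    then show "v \<in> N" unfolding B(3) by (rule image_eqI[where x = "\<lambda>b. if b = e1 then p else q"]) simp
  qed
  have "plane_lattice N J e1 e2"
  proof
    show "J (x + y) = J x + J y" "J (c *\<^sub>R x) = c *\<^sub>R J x" for x y c
      by (auto simp: J_def inner_add_right algebra_simps)
    show "dual_lattice N = J ` N"
    proof (intro equalityI subsetI)
      fix m assume m: "m \<in> dual_lattice N"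
      define n where "n = (m \<bullet> e2) *\<^sub>R e1 - (m \<bullet> e1) *\<^sub>R e2"
      have gn: "g1 n = m \<bullet> e2" "g2 n = - (m \<bullet> e1)"
        using g1 g2 by (simp_all add: n_def linear_diff linear_scale)
      have "m \<bullet> v = J n \<bullet> v" for v
      proof -
        have "m \<bullet> v = m \<bullet> (g1 v *\<^sub>R e1 + g2 v *\<^sub>R e2)" using ex[of v] by simp
        then show ?thesis by (simp add: J gn inner_add_right)
      qed
      then have "m = J n" by (metis vector_eq_rdot)
      moreover have "e1 \<in> N" "e2 \<in> N" using g1 g2 by (auto simp: N')
      then have "n \<in> N" using m gn by (auto simp: N' dual_lattice_def)
      ultimately show "m \<in> J ` N" by blast
    next
      fix m assume "m \<in> J ` N"
      then show "m \<in> dual_lattice N" by (auto simp: dual_lattice_def J N')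
    qed
  qed (use ex g1 g2 in \<open>auto simp: J N'\<close>)
  then show ?thesis by (rule that)
qed

lemma sum_fun_apply: "sum f A x = (\<Sum>a\<in>A. (f a x :: 'a::comm_monoid_add))"
  by (induction A rule: infinite_finite_induct) auto

lemma cone_of_scaled: "x \<in> A \<Longrightarrow> 0 \<le> c \<Longrightarrow> c *\<^sub>R x \<in> cone_of A"
  by (simp add: convex_cone_hull_mul hull_inc)

context plane_lattice
begin

section \<open>Normal form of rational cones and the smoothness criterion\<close>

lemma area_zero_multiple:
  assumes "u \<noteq> 0" "area u s = 0"
  obtains k where "s = k *\<^sub>R u"
proof -
  have "\<exists>x. area u x \<noteq> 0"
    using expand_e[of u] assms(1) skew[of u e1] by (metis add.right_neutral neg_equal_0_iff_equal scale_zero_left)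
  then obtain x where x: "area u x \<noteq> 0" by blast
  have "area u x *\<^sub>R s = area s x *\<^sub>R u"
    using pluecker[of u x s] assms(2) by simp
  then have "s = (area s x / area u x) *\<^sub>R u"
    using x by (metis divide_inverse mult.commute right_inverse scaleR_one scaleR_scaleR)
  then show ?thesis using that by blast
qed

text \<open>Dividing the coordinates by their greatest common divisor gives a primitive vector; the
  Bezout coefficients complete it to a lattice basis.\<close>

lemma primitive_multiple:
  assumes "u \<in> N" "u \<noteq> 0"
  obtains a b t where "basis a b" "0 < t" "u = t *\<^sub>R a"
proof -
  obtain X Y where XY: "area u e2 = of_int X" "area e1 u = of_int Y"
    using assms(1) by (auto simp: N_iff elim!: Ints_cases)
  define g where "g = gcd X Y"
  have "g > 0"
    using XY expand_e[of u] assms(2) by (auto simp: g_def)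
  obtain p q where pq: "p * X + q * Y = g" using bezout_int g_def by metis
  obtain X' Y' where X': "X = g * X'" "Y = g * Y'" by (metis dvdE g_def gcd_dvd1 gcd_dvd2)
  have "p * X' + q * Y' = 1" 
  proof -
    have "g * (p * X' + q * Y') = g * 1" using pq X' by (simp add: algebra_simps)
    then show ?thesis using \<open>g > 0\<close> by simp
  qed
  then have 1: "of_int X' * of_int p + of_int Y' * of_int q = (1::real)"
    by (metis mult.commute of_int_1 of_int_add of_int_mult)
  define a where "a = of_int X' *\<^sub>R e1 + of_int Y' *\<^sub>R e2"
  define b where "b = - of_int q *\<^sub>R e1 + of_int p *\<^sub>R e2"
  have "basis a b"
    using e_basis 1 skew[of e2 e1] by (auto simp: basis_def a_def b_def N_add N_scale e12 N_iff algebra_simps)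
  moreover have "u = of_int g *\<^sub>R a"
    using expand_e[of u] XY X' by (simp add: a_def algebra_simps)
  ultimately show ?thesis using that[of a b "of_int g"] \<open>g > 0\<close> by simp
qed

lemma cone_insert_redundant: "s \<in> cone_of A \<Longrightarrow> cone_of (insert s A) = cone_of A"
  by (rule hull_redundant)

definition oriented_gens :: "'v set \<Rightarrow> bool" where
  "oriented_gens A \<longleftrightarrow> A \<subseteq> N \<and> (A = {} \<or> (\<exists>u. A = {u} \<and> u \<noteq> 0) \<or> (\<exists>u w. A = {u, w} \<and> 0 < area u w))"

text \<open>The signs of the coordinates \<open>\<alpha>\<close>, \<open>\<beta>\<close> of the new
  vector decide: it is redundant, it makes one old generator redundant, or the cone contains a line,
  which strong convexity forbids.\<close>

lemma oriented_gens_insert: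
  assumes A: "oriented_gens A" and s: "s \<in> N" and sc: "strongly_convex (cone_of (insert s A))"
  shows "\<exists>A'. oriented_gens A' \<and> cone_of (insert s A) = cone_of A'"
proof -
  have scD: False if "v \<in> cone_of (insert s A)" "- v \<in> cone_of (insert s A)" "v \<noteq> 0" for v
    using sc that unfolding strongly_convex_def by blast
  have inc: "x \<in> cone_of (insert s A)" if "x \<in> insert s A" for x
    using that by (rule hull_inc)
  note mul = convex_cone_hull_mul and add = convex_cone_hull_add
  show ?thesis
  proof (cases "s \<in> cone_of A")
    case True
    then show ?thesis using A cone_insert_redundant by blast
  next
    case out: False
    then have s0: "s \<noteq> 0" using convex_cone_hull_contains_0 by metis
    consider "A = {}" | u where "A = {u}" "u \<noteq> 0" | u w where "A = {u, w}" "0 < area u w"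
      using A by (auto simp: oriented_gens_def)
    then show ?thesis
    proof cases
      case 1
      then show ?thesis using s s0 by (auto simp: oriented_gens_def)
    next
      case (2 u)
      consider "0 < area u s" | "area u s < 0" | "area u s = 0" by linarith
      then show ?thesis
      proof cases
        case 1
        then have "oriented_gens {u, s}" using A s 2 by (auto simp: oriented_gens_def)
        then show ?thesis using 2 by (metis insert_commute)
      next
        case i: 2
        then have "0 < area s u" using skew[of s u] by simp
        then have "oriented_gens {s, u}" using A s 2 by (auto simp: oriented_gens_def)
        then show ?thesis using 2 by blast
      next
        case 3
        then obtain k where k: "s = k *\<^sub>R u" using area_zero_multiple 2 by metis
        show ?thesis
        proof (cases "0 \<le> k")
          case True
          then show ?thesis using out 2 k by (auto simp: cone_of_single)
        next
          case False
          then have "(- k) *\<^sub>R u \<in> cone_of (insert s A)" using 2 by (intro mul inc) auto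
          then have "- s \<in> cone_of (insert s A)" using k by simp
          then show ?thesis using scD[of s] inc[of s] s0 by auto
        qed
      qed
    next
      case (3 u w)
      define D where "D = area u w"
      define \<alpha> \<beta> where "\<alpha> = area s w / D" and "\<beta> = area u s / D"
      have D: "0 < D" using 3 by (simp add: D_def)
      have as: "area s w = \<alpha> * D" "area u s = \<beta> * D" using D by (auto simp: \<alpha>_def \<beta>_def)
      have "D *\<^sub>R s = D *\<^sub>R (\<alpha> *\<^sub>R u + \<beta> *\<^sub>R w)"
        using pluecker[of u w s] as by (simp add: D_def[symmetric] algebra_simps)
      then have eq: "s = \<alpha> *\<^sub>R u + \<beta> *\<^sub>R w" using D by simp
      have uw: "u \<noteq> 0" "w \<noteq> 0" using 3 by auto
      consider "0 \<le> \<alpha>" "0 \<le> \<beta>" | "\<alpha> < 0" "0 < \<beta>" | "\<alpha> < 0" "\<beta> \<le> 0" | "0 < \<alpha>" "\<beta> < 0" | "\<alpha> = 0" "\<beta> < 0"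
        by linarith
      then show ?thesis
      proof cases
        case 1
        then show ?thesis using out eq 3 by (auto simp: cone_of_pair)
      next
        case 2
        have "(1 / \<beta>) *\<^sub>R s + (- \<alpha> / \<beta>) *\<^sub>R u \<in> cone_of {u, s}"
          using 2 by (intro add mul hull_inc) (auto simp: divide_nonpos_pos)
        moreover have "(1 / \<beta>) *\<^sub>R s + (- \<alpha> / \<beta>) *\<^sub>R u = w"
          using 2 by (simp add: eq scaleR_add_right)
        ultimately have "cone_of (insert w {u, s}) = cone_of {u, s}"
          using cone_insert_redundant by metis
        moreover have "0 < area u s" "{u, s} \<subseteq> N"
          using A s 2 as D 3(1) by (auto simp: oriented_gens_def)
        then have "oriented_gens {u, s}" unfolding oriented_gens_def by blast
        moreover have "insert s A = insert w {u, s}" using 3 by auto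
        ultimately show ?thesis by metis
      next
        case i: 3
        have "(- \<alpha>) *\<^sub>R u \<in> cone_of (insert s A)" using i 3 by (intro mul inc) auto
        moreover have "s + (- \<beta>) *\<^sub>R w \<in> cone_of (insert s A)" using i 3 by (intro add mul inc) auto
        then have "- ((- \<alpha>) *\<^sub>R u) \<in> cone_of (insert s A)" by (simp add: eq)
        ultimately show ?thesis using scD[of "(- \<alpha>) *\<^sub>R u"] i uw by auto
      next
        case 4
        have "(1 / \<alpha>) *\<^sub>R s + (- \<beta> / \<alpha>) *\<^sub>R w \<in> cone_of {s, w}"
          using 4 by (intro add mul hull_inc) (auto simp: divide_nonpos_pos)
        moreover have "(1 / \<alpha>) *\<^sub>R s + (- \<beta> / \<alpha>) *\<^sub>R w = u"
          using 4 by (simp add: eq scaleR_add_right)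
        ultimately have "cone_of (insert u {s, w}) = cone_of {s, w}"
          using cone_insert_redundant by metis
        moreover have "0 < area s w" "{s, w} \<subseteq> N"
          using A s 4 as D 3(1) by (auto simp: oriented_gens_def)
        then have "oriented_gens {s, w}" unfolding oriented_gens_def by blast
        moreover have "insert s A = insert u {s, w}" using 3 by auto
        ultimately show ?thesis by metis
      next
        case 5
        have "(- \<beta>) *\<^sub>R w \<in> cone_of (insert s A)" using 5 3 by (intro mul inc) auto
        then have "- s \<in> cone_of (insert s A)" using 5 by (simp add: eq)
        then show ?thesis using scD[of s] inc[of s] s0 by auto
      qed
    qed
  qed
qed

lemma oriented_gens_exists:
  assumes "finite S" "S \<subseteq> N" "strongly_convex (cone_of S)"
  shows "\<exists>A. oriented_gens A \<and> cone_of S = cone_of A"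
  using assms
proof (induction S rule: finite_induct)
  case empty
  then show ?case by (intro exI[of _ "{}"]) (auto simp: oriented_gens_def)
next
  case (insert s S)
  have "strongly_convex (cone_of S)"
    using insert.prems(2) hull_mono[OF subset_insertI[of S s]] unfolding strongly_convex_def by blast
  then obtain A where A: "oriented_gens A" "cone_of S = cone_of A" using insert by auto
  have "cone_of (insert s S) = cone_of (insert s A)"
    by (metis A(2) hull_insert)
  then show ?case using oriented_gens_insert[OF A(1), of s] insert.prems by auto
qed

text \<open>At the fixed point of the chart every indecomposable element of the semigroup gives an
  independent tangent vector. If the area \<open>D\<close> exceeded 1, then besides the two edge
  elements \<open>J a\<close> and \<open>J (- c)\<close> there would be a third indecomposable one,
  and the tangent space would have dimension at least 3.\<close>

lemma smooth_imp_area_1: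
  assumes a: "basis a b" and c: "basis c d" and pos: "0 < area a c"
    and smooth: "\<And>\<xi>. \<xi> \<in> chart_points N (cone_of {a, c}) \<Longrightarrow>
      vector_space.dim (\<lambda>(c::complex) D m. c * D m) (tangent_space N (cone_of {a, c}) \<xi>) = 2"
  shows "area a c = 1"
proof (rule ccontr)
  assume ne: "area a c \<noteq> 1"
  define D where "D = area a c"
  have N: "a \<in> N" "b \<in> N" "c \<in> N" "area a b = 1" using a c by (auto simp: basis_def)
  have Dint: "D \<in> \<int>" using N_area N by (auto simp: D_def)
  obtain Di where Di: "D = of_int Di" using Dint by (auto elim: Ints_cases)
  have D2: "2 \<le> Di" using ne pos Di by (auto simp: D_def[symmetric])
  let ?S = "cone_semigroup N (cone_of {a, c})"
  have S: "m \<in> ?S \<longleftrightarrow> (\<exists>x\<in>N. m = J x \<and> 0 \<le> area x a \<and> 0 \<le> area x c)" for m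
    by (auto simp: cone_semigroup_cone_of dual_eq)
  have inta: "m \<in> ?S \<Longrightarrow> m \<bullet> a \<in> \<int>" "m \<in> ?S \<Longrightarrow> m \<bullet> c \<in> \<int>" for m
    using N by (auto simp: S intro: N_area)
  have pos_S: "m \<in> ?S \<Longrightarrow> 0 \<le> m \<bullet> a" "m \<in> ?S \<Longrightarrow> 0 \<le> m \<bullet> c" for m
    by (auto simp: S)
  have zero: "m = 0" if m: "m \<in> ?S" "m \<bullet> a = 0" "m \<bullet> c = 0" for m
  proof -
    obtain x where x: "x \<in> N" "m = J x" using m by (auto simp: S)
    have "D *\<^sub>R x = area x c *\<^sub>R a + area a x *\<^sub>R c" using pluecker[of a c x] by (simp add: D_def)
    then have "x = 0" using m x pos skew[of a x] by (simp add: D_def)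
    then show ?thesis using x linear_0[OF linear_J] by simp
  qed
  have along_a: "\<exists>k::nat. m = real k *\<^sub>R J a" if m: "m \<in> ?S" "m \<bullet> a = 0" for m
  proof -
    obtain x where x: "x \<in> N" "m = J x" "0 \<le> area x c" using m by (auto simp: S)
    have "x = area x b *\<^sub>R a" using basis_expand[OF a, of x] m x skew[of a x] by simp
    moreover obtain k where k: "area x b = of_int k" using N_area[OF x(1) N(2)] by (auto elim: Ints_cases)
    ultimately have xa: "x = of_int k *\<^sub>R a" by simp
    then have "0 \<le> k" using x(3) pos by (simp add: zero_le_mult_iff)
    then show ?thesis using x(2) xa linear_scale[OF linear_J] by (intro exI[of _ "nat k"]) simp
  qed
  have along_c: "\<exists>k::nat. m = real k *\<^sub>R J (- c)" if m: "m \<in> ?S" "m \<bullet> c = 0" for m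
  proof -
    obtain x where x: "x \<in> N" "m = J x" "0 \<le> area x a" using m by (auto simp: S)
    have "d \<in> N" using c by (simp add: basis_def)
    have "x = area x d *\<^sub>R c" using basis_expand[OF c, of x] m x skew[of c x] by simp
    moreover obtain k where k: "area x d = of_int k" using N_area[OF x(1) \<open>d \<in> N\<close>] by (auto elim: Ints_cases)
    ultimately have xa: "x = of_int k *\<^sub>R c" by simp
    then have "0 \<le> - k" using x(3) pos skew[of c a] by (simp add: mult_le_0_iff zero_le_mult_iff)
    then show ?thesis using x(2) xa linear_scale[OF linear_J] linear_neg[OF linear_J]
      by (intro exI[of _ "nat (- k)"]) simp
  qed
  \<comment> \<open>Every \<open>J (- b + j a)\<close> pairs to 1 with \<open>a\<close>. This
    \<open>j\<close> reduces its pairing with \<open>c\<close> modulo \<open>D\<close> to a value in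
    the half-open interval from 0 to \<open>D\<close>.\<close>
  define j where "j = - \<lfloor>- area b c / D\<rfloor>"
  define h3 where "h3 = J (- b + of_int j *\<^sub>R a)"
  have h3a: "h3 \<bullet> a = 1" using N skew[of b a] by (simp add: h3_def)
  have h3c: "0 \<le> h3 \<bullet> c" "h3 \<bullet> c < D"
  proof -
    define t where "t = - area b c"
    have e: "h3 \<bullet> c = t - of_int \<lfloor>t / D\<rfloor> * D" by (simp add: h3_def j_def D_def t_def)
    have "of_int \<lfloor>t / D\<rfloor> \<le> t / D" "t / D < of_int \<lfloor>t / D\<rfloor> + 1" by linarith+
    then have "of_int \<lfloor>t / D\<rfloor> * D \<le> t / D * D" "t / D * D < (of_int \<lfloor>t / D\<rfloor> + 1) * D"
      using pos by (auto simp only: D_def[symmetric] intro!: mult_right_mono mult_strict_right_mono)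
    then have "of_int \<lfloor>t / D\<rfloor> * D \<le> t" "t < (of_int \<lfloor>t / D\<rfloor> + 1) * D"
      using pos by (simp_all add: D_def[symmetric])
    then show "0 \<le> h3 \<bullet> c" "h3 \<bullet> c < D" unfolding e by (simp_all add: algebra_simps)
  qed
  have h3S: "h3 \<in> ?S"
    unfolding S using h3a h3c
    by (intro bexI[of _ "- b + of_int j *\<^sub>R a"] conjI N_add N_neg N_scale N) (auto simp: h3_def)
  have h1S: "J a \<in> ?S" unfolding S using N pos by (intro bexI[of _ a]) auto
  have h2S: "J (- c) \<in> ?S" unfolding S using N pos skew[of c a] by (intro bexI[of _ "- c"]) (auto intro: N_neg)
  define irr where "irr h \<longleftrightarrow> h \<in> ?S \<and> h \<noteq> 0 \<and> (\<forall>m\<in>?S. \<forall>m'\<in>?S. h = m + m' \<longrightarrow> m = 0 \<or> m' = 0)" for h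
  have split0: "m \<bullet> v = 0 \<and> m' \<bullet> v = 0" if "0 \<le> m \<bullet> v" "0 \<le> m' \<bullet> v" "(m + m') \<bullet> v = 0" for m m' v :: 'v
    using that by (auto simp: inner_add_left)
  have nat1: "k = 0 \<or> l = 0" if "real k + real l = 1" for k l :: nat
    using that by linarith
  have i1: "irr (J a)"
    unfolding irr_def
  proof (intro conjI ballI impI h1S)
    show "J a \<noteq> 0" using pos by auto
    fix m m' assume m: "m \<in> ?S" "m' \<in> ?S" "J a = m + m'"
    have "m \<bullet> a = 0 \<and> m' \<bullet> a = 0"
      using pos_S m by (intro split0) (auto simp: m(3)[symmetric])
    then obtain k l where kl: "m = real k *\<^sub>R J a" "m' = real l *\<^sub>R J a" using along_a m by metis
    have "J a \<bullet> c = real k * area a c + real l * area a c"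
      using m(3) kl by (metis inner_add_left inner_scaleR_left)
    then have "(real k + real l) * area a c = 1 * area a c" by (simp add: algebra_simps)
    then have "real k + real l = 1" using pos by simp
    then show "m = 0 \<or> m' = 0" using nat1 kl by fastforce
  qed
  have i2: "irr (J (- c))"
    unfolding irr_def
  proof (intro conjI ballI impI h2S)
    have ca: "J (- c) \<bullet> a = D" using skew[of c a] by (simp add: D_def)
    then show "J (- c) \<noteq> 0" using pos by (metis D_def inner_zero_left less_irrefl)
    fix m m' assume m: "m \<in> ?S" "m' \<in> ?S" "J (- c) = m + m'"
    have "m \<bullet> c = 0 \<and> m' \<bullet> c = 0"
      using pos_S m by (intro split0) (auto simp: m(3)[symmetric])
    then obtain k l where kl: "m = real k *\<^sub>R J (- c)" "m' = real l *\<^sub>R J (- c)" using along_c m by metis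
    have "J (- c) \<bullet> a = real k * (J (- c) \<bullet> a) + real l * (J (- c) \<bullet> a)"
      using m(3) kl by (metis inner_add_left inner_scaleR_left)
    then have "(real k + real l) * D = 1 * D" unfolding ca by (simp add: algebra_simps)
    then have "real k + real l = 1" using pos by (simp add: D_def)
    then show "m = 0 \<or> m' = 0" using nat1 kl by fastforce
  qed
  have i3: "irr h3"
    unfolding irr_def
  proof (intro conjI ballI impI h3S)
    show "h3 \<noteq> 0" using h3a by auto
    fix m m' assume m: "m \<in> ?S" "m' \<in> ?S" "h3 = m + m'"
    \<comment> \<open>Since \<open>h3\<close> pairs to 1 with \<open>a\<close>, one summand pairs to
      0 and is a multiple of \<open>J a\<close>. A nonzero multiple pairs to at least
      \<open>D\<close> with \<open>c\<close>, more than \<open>h3\<close> does.\<close>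
    have small: "m = 0" if m: "m \<in> ?S" "m' \<in> ?S" "h3 = m + m'" "m \<bullet> a = 0" for m m'
    proof -
      obtain k where k: "m = real k *\<^sub>R J a" using along_a[OF m(1,4)] by blast
      have "real k * D \<le> h3 \<bullet> c" using pos_S(2)[OF m(2)] m(3) k by (simp add: inner_add_left D_def)
      then have "real k * D < 1 * D" using h3c by linarith
      then have "real k < 1" by (rule mult_right_less_imp_less) (use pos in \<open>simp add: D_def\<close>)
      then show ?thesis using k by simp
    qed
    have "m \<bullet> a = 0 \<or> m' \<bullet> a = 0"
    proof -
      obtain p q where "m \<bullet> a = of_int p" "m' \<bullet> a = of_int q" using inta m by (meson Ints_cases)
      moreover have "m \<bullet> a + m' \<bullet> a = 1" using h3a m(3) by (simp add: inner_add_left)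
      moreover have "0 \<le> m \<bullet> a" "0 \<le> m' \<bullet> a" using pos_S m by auto
      ultimately show ?thesis by (simp, linarith)
    qed
    then show "m = 0 \<or> m' = 0"
      using small[OF m] small[of m' m] m by (auto simp: add.commute)
  qed
  define H where "H = {J a, J (- c), h3}"
  have card: "card H = 3"
  proof -
    have v: "J a \<bullet> a = 0" "J (- c) \<bullet> a = D" "h3 \<bullet> a = 1" using h3a skew[of c a] by (auto simp: D_def)
    \<comment> \<open>The pairings 0, \<open>D\<close> and 1 with \<open>a\<close> tell the three
      elements apart; for area 1 the last two would agree.\<close>
    have "D \<noteq> 0" "D \<noteq> 1" using D2 Di by auto
    then have "J a \<noteq> J (- c)" "J a \<noteq> h3" "J (- c) \<noteq> h3" using v by (metis zero_neq_one)+
    then show ?thesis by (simp add: H_def)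
  qed
  have finH: "finite H" by (simp add: H_def)
  have irrH: "irr h" if "h \<in> H" for h using that i1 i2 i3 by (auto simp: H_def)
  \<comment> \<open>The torus fixed point of the chart, at which all nontrivial characters
    vanish.\<close>
  define \<xi> :: "'v \<Rightarrow> complex" where "\<xi> m = (if m = 0 then 1 else 0)" for m
  have add0: "m = 0 \<and> m' = 0" if "m \<in> ?S" "m' \<in> ?S" "m + m' = 0" for m m'
  proof -
    have "m \<bullet> v = 0 \<and> m' \<bullet> v = 0" if "v \<in> {a, c}" for v
      using that pos_S \<open>m \<in> ?S\<close> \<open>m' \<in> ?S\<close> \<open>m + m' = 0\<close> by (intro split0) auto
    then show ?thesis using zero that by simp
  qed
  have \<xi>: "\<xi> \<in> chart_points N (cone_of {a, c})"
    unfolding chart_points_def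
  proof (intro CollectI conjI ballI allI impI)
    show "\<xi> (m + m') = \<xi> m * \<xi> m'" if "m \<in> ?S" "m' \<in> ?S" for m m'
      using add0[OF that] by (auto simp: \<xi>_def)
    show "\<xi> m = 0" if "m \<notin> ?S" for m
      using that cone_semigroup_0 by (auto simp: \<xi>_def)
  qed (simp add: \<xi>_def)
  \<comment> \<open>At the fixed point the product rule only constrains sums of two nonzero
    elements, where it demands the value 0; so the indicator of an indecomposable element is a
    derivation.\<close>
  define E :: "'v \<Rightarrow> 'v \<Rightarrow> complex" where "E h m = (if m = h then 1 else 0)" for h m
  let ?T = "tangent_space N (cone_of {a, c}) \<xi>"
  have E: "E h \<in> ?T" if "h \<in> H" for h
  proof -
    have *: "h \<in> ?S" "h \<noteq> 0" "\<And>m m'. m \<in> ?S \<Longrightarrow> m' \<in> ?S \<Longrightarrow> h = m + m' \<Longrightarrow> m = 0 \<or> m' = 0"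
      using irrH[OF that] unfolding irr_def by blast+
    have "E h (m + m') = \<xi> m * E h m' + \<xi> m' * E h m" if "m \<in> ?S" "m' \<in> ?S" for m m'
      using *(2) *(3)[OF that] by (auto simp: E_def \<xi>_def)
    then show ?thesis unfolding tangent_space_def using *(1) by (auto simp: E_def)
  qed
  interpret vs: vector_space "\<lambda>(c::complex) (D :: 'v \<Rightarrow> complex) m. c * D m"
    by unfold_locales (auto simp: algebra_simps fun_eq_iff)
  have "vs.dim ?T = 2" using smooth[OF \<xi>] .
  \<comment> \<open>The dimension would default to 0 if no basis were available, so the value 2
    yields a basis, which is finite because its cardinality is nonzero.\<close>
  then obtain X where X: "vs.independent X" "vs.span X = vs.span ?T" "card X = 2"
    unfolding vs.dim_def by (metis (mono_tags, lifting) someI_ex zero_neq_numeral)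
  have "finite X" using X(3) card.infinite by fastforce
  have inj: "inj_on E H"
    by (rule inj_onI) (metis E_def zero_neq_one)
  have "vs.independent (E ` H)"
  proof (rule vs.independent_if_scalars_zero)
    show "finite (E ` H)" using finH by simp
    fix f x assume z: "(\<Sum>x\<in>E ` H. (\<lambda>m. f x * x m)) = 0" and x: "x \<in> E ` H"
    obtain h where h: "h \<in> H" "x = E h" using x by auto
    have "0 = (\<Sum>x\<in>E ` H. (\<lambda>m. f x * x m)) h" using z by simp
    also have "\<dots> = (\<Sum>x\<in>E ` H. f x * x h)" by (simp add: sum_fun_apply)
    also have "\<dots> = (\<Sum>k\<in>H. f (E k) * E k h)" using inj by (simp add: sum.reindex)
    also have "\<dots> = (\<Sum>k\<in>H. if k = h then f (E h) else 0)" by (intro sum.cong) (auto simp: E_def)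
    also have "\<dots> = f (E h)" using h finH by simp
    finally show "f x = 0" using h by simp
  qed
  moreover have "E ` H \<subseteq> vs.span X" using E X(2) vs.span_base by auto
  ultimately have "card (E ` H) \<le> 2"
    using vs.independent_span_bound[OF \<open>finite X\<close>] X(3) by metis
  then show False using card inj by (simp add: card_image)
qed

text \<open>Once the edge vectors are replaced by primitive ones, the smoothness criterion leaves
  area 1 as the only possibility for a two-dimensional cone.\<close>

lemma smooth_cone_gens:
  assumes dim: "DIM('v) = 2" and \<sigma>: "\<sigma> \<in> \<Delta>" "rational_cone N \<sigma>" "strongly_convex \<sigma>"
    and smooth: "smooth_toric_variety N \<Delta>"
  shows "\<exists>A. gens A \<and> \<sigma> = cone_of A"
proof -
  obtain S where S: "finite S" "S \<subseteq> N" "\<sigma> = cone_of S" using \<sigma>(2) by (auto simp: rational_cone_def)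
  then obtain A where A: "oriented_gens A" "\<sigma> = cone_of A" using oriented_gens_exists \<sigma>(3) by metis
  then consider "A = {}" | u where "A = {u}" "u \<noteq> 0" "u \<in> N" | u w where "A = {u, w}" "0 < area u w" "u \<in> N" "w \<in> N"
    by (auto simp: oriented_gens_def)
  then show ?thesis
  proof cases
    case 1
    then show ?thesis using A e_basis unfolding gens_def by blast
  next
    case (2 u)
    then obtain a b t where ab: "basis a b" "0 < t" "u = t *\<^sub>R a" using primitive_multiple by metis
    have "\<exists>x'\<ge>0. x *\<^sub>R u = x' *\<^sub>R a" if "0 \<le> x" for x
      using that ab by (intro exI[of _ "x * t"]) auto
    moreover have "\<exists>x'\<ge>0. x *\<^sub>R a = x' *\<^sub>R u" if "0 \<le> x" for x
      using that ab by (intro exI[of _ "x / t"]) auto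
    ultimately have "\<sigma> = cone_of {a}" using A 2 by (auto simp: cone_of_single)
    then show ?thesis using ab(1) unfolding gens_def by blast
  next
    case (3 u w)
    then have "u \<noteq> 0" "w \<noteq> 0" by auto
    then obtain a b t where ab: "basis a b" "0 < t" "u = t *\<^sub>R a" using primitive_multiple 3 by metis
    obtain c d s where cd: "basis c d" "0 < s" "w = s *\<^sub>R c" using primitive_multiple 3 \<open>w \<noteq> 0\<close> by metis
    have sub: "cone_of {x, y} \<subseteq> cone_of {x', y'}" if "x = p *\<^sub>R x'" "y = q *\<^sub>R y'" "0 < p" "0 < q" for x y x' y' :: 'v and p q
      using that by (intro hull_minimal) (auto intro: cone_of_scaled convex_cone_convex_cone_hull)
    have "\<sigma> = cone_of {a, c}"
      using A 3 sub[of u t a w s c] sub[of a "1 / t" u c "1 / s" w] ab cd by auto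
    moreover have "0 < area a c" using 3 ab cd by (simp add: zero_less_mult_iff)
    ultimately have "area a c = 1"
      using smooth_imp_area_1[OF ab(1) cd(1)] smooth \<sigma>(1) dim by (simp add: smooth_toric_variety_def)
    then have "basis a c" using ab cd by (simp add: basis_def)
    then show ?thesis using \<open>\<sigma> = cone_of {a, c}\<close> unfolding gens_def by blast
  qed
qed

section \<open>From faces of cones to common generators\<close>

definition primitive :: "'v \<Rightarrow> bool" where
  "primitive a \<longleftrightarrow> a \<in> N \<and> (\<exists>b\<in>N. area a b = 1)"

lemma basis_primitive: "basis a b \<Longrightarrow> primitive a" "basis a b \<Longrightarrow> primitive b"
proof -
  assume "basis a b"
  then have "a \<in> N" "b \<in> N" "area a b = 1" "- a \<in> N" "area b (- a) = 1"
    using skew[of b a] by (auto simp: basis_def N_neg)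
  then show "primitive a" "primitive b" unfolding primitive_def by blast+
qed

lemma gens_primitive: "gens A \<Longrightarrow> a \<in> A \<Longrightarrow> primitive a"
  unfolding gens_def using basis_primitive by blast

text \<open>Testing against the partners of area 1 shows that the ratio \<open>t\<close> and its
  inverse are both integers.\<close>

lemma primitive_unique:
  assumes "primitive a" "primitive x" "a = t *\<^sub>R x" "0 \<le> t"
  shows "a = x"
proof -
  obtain b y where wit: "b \<in> N" "area a b = 1" "y \<in> N" "area x y = 1"
    using assms by (auto simp: primitive_def)
  have "area a y = t" "t * area x b = 1" using wit assms(3) by auto
  moreover have "area a y \<in> \<int>" "area x b \<in> \<int>"
    using wit assms(1,2) N_area by (simp_all add: primitive_def)
  ultimately obtain p q where pq: "t = of_int p" "area x b = of_int q" "t * area x b = 1"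
    by (metis Ints_cases)
  then have "p * q = 1" by (metis of_int_eq_1_iff of_int_mult)
  then have "p = 1" using assms(4) pq(1) by (auto simp: zmult_eq_1_iff)
  then show ?thesis using assms(3) pq(1) by simp
qed

text \<open>The sum is the midpoint of its doubled summands, and a face that meets the interior of a
  segment of the convex set contains its endpoints.\<close>

lemma midpoint_face:
  assumes F: "F face_of S" and v: "x *\<^sub>R a + y *\<^sub>R b \<in> F" and S: "(2 * x) *\<^sub>R a \<in> S" "(2 * y) *\<^sub>R b \<in> S"
    and ab: "area a b \<noteq> 0" "x \<noteq> 0"
  shows "(2 * x) *\<^sub>R a \<in> F" "(2 * y) *\<^sub>R b \<in> F"
proof -
  have "(2 * x) *\<^sub>R a \<noteq> (2 * y) *\<^sub>R b"
  proof
    assume "(2 * x) *\<^sub>R a = (2 * y) *\<^sub>R b"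
    then have "area ((2 * x) *\<^sub>R a) b = area ((2 * y) *\<^sub>R b) b" by (rule arg_cong)
    then show False using ab by simp
  qed
  then have "x *\<^sub>R a + y *\<^sub>R b \<in> open_segment ((2 * x) *\<^sub>R a) ((2 * y) *\<^sub>R b)"
    unfolding in_segment by (intro conjI exI[of _ "1/2"]) auto
  then show "(2 * x) *\<^sub>R a \<in> F" "(2 * y) *\<^sub>R b \<in> F"
    using face_ofD[OF F _ S v] by blast+
qed

text \<open>If \<open>a\<close> were interior to a two-dimensional cone of \<open>B\<close>, the
  face would contain both generators \<open>c\<close> and \<open>d\<close> of \<open>B\<close>, so
  both would lie in the cone of \<open>A\<close>. But \<open>a\<close> is a positive combination of
  them and spans an edge of that cone, so \<open>c\<close> and \<open>d\<close> would be collinear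
  with \<open>a\<close>.\<close>

lemma face_generator:
  assumes A: "gens A" and B: "gens B" and face: "(cone_of A \<inter> cone_of B) face_of cone_of B"
    and a: "a \<in> A" "a \<in> cone_of B"
  shows "a \<in> B"
proof -
  obtain a' b' where ab': "basis a' b'" "A \<subseteq> {a', b'}" using A by (auto simp: gens_def)
  obtain c d where cd: "basis c d" "B \<subseteq> {c, d}" using B by (auto simp: gens_def)
  have a_in: "a \<in> cone_of A \<inter> cone_of B" using a by (simp add: hull_inc)
  define p q where "p = area a d" and "q = area c a"
  have pq: "0 \<le> p" "0 \<le> q" "c \<notin> B \<Longrightarrow> p = 0" "d \<notin> B \<Longrightarrow> q = 0"
    using a(2) mem_cone_iff[OF cd] by (auto simp: p_def q_def)
  have eq: "a = p *\<^sub>R c + q *\<^sub>R d" using basis_expand[OF cd(1), of a] by (simp add: p_def q_def)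
  have prim: "primitive a" "primitive c" "primitive d"
    using gens_primitive[OF A a(1)] basis_primitive[OF cd(1)] by auto
  consider "p = 0" | "q = 0" | "0 < p" "0 < q" using pq by force
  then show ?thesis
  proof cases
    case 1
    then have "a = d" using primitive_unique[OF prim(1,3), of q] eq pq by simp
    moreover have "a \<noteq> 0" using prim(1) by (auto simp: primitive_def)
    moreover have "q \<noteq> 0" using 1 eq \<open>a \<noteq> 0\<close> by auto
    ultimately show ?thesis using pq by auto
  next
    case 2
    then have "a = c" using primitive_unique[OF prim(1,2), of p] eq pq by simp
    moreover have "a \<noteq> 0" using prim(1) by (auto simp: primitive_def)
    moreover have "p \<noteq> 0" using 2 eq \<open>a \<noteq> 0\<close> by auto
    ultimately show ?thesis using pq by auto
  next
    case 3
    then have "c \<in> B" "d \<in> B" using pq by auto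
    then have "(2 * p) *\<^sub>R c \<in> cone_of B" "(2 * q) *\<^sub>R d \<in> cone_of B"
      using 3 by (auto intro: cone_of_scaled)
    from midpoint_face[OF face _ this] have "(2 * p) *\<^sub>R c \<in> cone_of A" "(2 * q) *\<^sub>R d \<in> cone_of A"
      using a_in eq cd 3 by (auto simp: basis_def)
    then have cdA: "c \<in> cone_of A" "d \<in> cone_of A"
      using 3 convex_cone_hull_mul[of "(2 * p) *\<^sub>R c" A "1 / (2 * p)"]
        convex_cone_hull_mul[of "(2 * q) *\<^sub>R d" A "1 / (2 * q)"] by simp_all
    have sum0: "p * area a c + q * area a d = 0" "p * area c a + q * area d a = 0"
      using arg_cong[OF eq, of "\<lambda>v. area a v"] arg_cong[OF eq, of "\<lambda>v. area v a"] by simp_all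
    have zero: "area a c = 0" "area a d = 0"
    proof -
      \<comment> \<open>An edge generator has its whole cone on one side, so the two areas have
        equal sign, while their positive combination is 0.\<close>
      have "a = a' \<or> a = b'" using a(1) ab'(2) by blast
      then have "(0 \<le> area a c \<and> 0 \<le> area a d) \<or> (0 \<le> area c a \<and> 0 \<le> area d a)"
        using cdA mem_cone_iff[OF ab'] by auto
      then have "area a c = 0 \<and> area a d = 0 \<or> area c a = 0 \<and> area d a = 0"
        using sum0 3 by (smt (verit) mult_pos_pos mult_nonneg_nonneg)
      then show "area a c = 0" "area a d = 0" using skew[of a c] skew[of a d] by auto
    qed
    obtain b where "area a b = 1" using prim(1) by (auto simp: primitive_def)
    then have False using area_exchange[of c d a b] zero cd(1) skew[of c a] by (simp add: basis_def)
    then show ?thesis ..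
  qed
qed

text \<open>The fan axiom speaks of faces, separation needs generators. The summands of a common
  point lie in the common face by the midpoint argument, and a generator of one cone lying in the
  other is a generator of both.\<close>

lemma smooth_fan_unimodular:
  assumes dim: "DIM('v) = 2" and fan: "is_fan N \<Delta>" and smooth: "smooth_toric_variety N \<Delta>"
  defines "K \<equiv> {A. gens A \<and> cone_of A \<in> \<Delta>}"
  shows "unimodular_fan K" "cone_of ` K = \<Delta>"
proof -
  have "\<exists>A. gens A \<and> \<sigma> = cone_of A" if "\<sigma> \<in> \<Delta>" for \<sigma>
    using that fan smooth_cone_gens[OF dim that _ _ smooth] unfolding is_fan_def by blast
  then show "cone_of ` K = \<Delta>" by (auto simp: K_def image_iff)
  have "v \<in> cone_of (A \<inter> B)" if AB: "A \<in> K" "B \<in> K" and v: "v \<in> cone_of A" "v \<in> cone_of B" for A B v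
  proof -
    have g: "gens A" "gens B" using AB by (auto simp: K_def)
    have face: "(cone_of A \<inter> cone_of B) face_of cone_of A" "(cone_of A \<inter> cone_of B) face_of cone_of B"
      using fan AB unfolding is_fan_def K_def by blast+
    obtain a b where ab: "basis a b" "A \<subseteq> {a, b}" using g by (auto simp: gens_def)
    define x y where "x = area v b" and "y = area a v"
    have xy: "0 \<le> x" "0 \<le> y" "a \<notin> A \<Longrightarrow> x = 0" "b \<notin> A \<Longrightarrow> y = 0"
      using v(1) mem_cone_iff[OF ab] by (auto simp: x_def y_def)
    have eq: "v = x *\<^sub>R a + y *\<^sub>R b" using basis_expand[OF ab(1), of v] by (simp add: x_def y_def)
    have scale: "w \<in> cone_of B" if "0 < t" "t *\<^sub>R w \<in> cone_of B" for t w
      using convex_cone_hull_mul[OF that(2), of "1 / t"] that(1) by simp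
    have ab1: "area a b \<noteq> 0" using ab by (simp add: basis_def)
    have two: "(2 * x) *\<^sub>R a \<in> cone_of A" "(2 * y) *\<^sub>R b \<in> cone_of A"
    proof -
      show "(2 * x) *\<^sub>R a \<in> cone_of A"
        using xy convex_cone_hull_mul[OF hull_inc[of a A convex_cone], of "2 * x"]
        by (cases "a \<in> A") (auto simp: convex_cone_hull_contains_0)
      show "(2 * y) *\<^sub>R b \<in> cone_of A"
        using xy convex_cone_hull_mul[OF hull_inc[of b A convex_cone], of "2 * y"]
        by (cases "b \<in> A") (auto simp: convex_cone_hull_contains_0)
    qed
    have vF: "x *\<^sub>R a + y *\<^sub>R b \<in> cone_of A \<inter> cone_of B" using v eq by simp
    have in_B: "a \<in> cone_of B" if "0 < x"
      using midpoint_face(1)[OF face(1) vF two ab1] that scale[of "2 * x" a] by simp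
    have in_B': "b \<in> cone_of B" if "0 < y"
    proof (cases "x = 0")
      case True
      then show ?thesis using v(2) eq that scale[of y b] by simp
    next
      case False
      then show ?thesis using midpoint_face(2)[OF face(1) vF two ab1] that scale[of "2 * y" b] by simp
    qed
    have "x = 0" if "a \<notin> A \<inter> B"
      using face_generator[OF g face(2), of a] in_B xy that by force
    moreover have "y = 0" if "b \<notin> A \<inter> B"
      using face_generator[OF g face(2), of b] in_B' xy that by force
    moreover have "A \<inter> B \<subseteq> {a, b}" using ab by auto
    ultimately show ?thesis
      using xy mem_cone_iff[OF ab(1), of "A \<inter> B" v] by (simp add: x_def y_def)
  qed
  then show "unimodular_fan K"
    using hull_mono[OF inf_le1, of convex_cone] hull_mono[OF inf_le2, of convex_cone]
    unfolding unimodular_fan_def by (auto simp: K_def) blast+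
qed

end

section \<open>Projective toric varieties have complete fans\<close>

lemma homogeneous_form_scale:
  assumes "f \<in> homogeneous_forms n d"
  shows "f (\<lambda>i. c * x i) = c ^ d * f x"
proof -
  obtain A C where A: "finite A" "\<forall>\<alpha>\<in>A. (\<Sum>i\<le>n. \<alpha> i) = d" "f = (\<lambda>x. \<Sum>\<alpha>\<in>A. C \<alpha> * (\<Prod>i\<le>n. x i ^ \<alpha> i))"
    using assms by (auto simp: homogeneous_forms_def)
  have "(\<Prod>i\<le>n. (c * x i) ^ \<alpha> i) = c ^ d * (\<Prod>i\<le>n. x i ^ \<alpha> i)" if "\<alpha> \<in> A" for \<alpha>
    using A(2) that by (simp add: power_mult_distrib prod.distrib power_sum[symmetric])
  then show ?thesis
    unfolding A(3) by (simp add: sum_distrib_left mult.left_commute cong: sum.cong)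
qed

lemma homogeneous_form_tendsto:
  assumes "f \<in> homogeneous_forms n d" "\<And>i. ((\<lambda>k. X k i) \<longlongrightarrow> x i) F"
  shows "((\<lambda>k. f (X k)) \<longlongrightarrow> f x) F"
proof -
  obtain A C where A: "finite A" "f = (\<lambda>x. \<Sum>\<alpha>\<in>A. C \<alpha> * (\<Prod>i\<le>n. x i ^ \<alpha> i))"
    using assms by (auto simp: homogeneous_forms_def)
  show ?thesis unfolding A(2) by (intro tendsto_intros assms(2))
qed

lemma coordinate_in_homogeneous_forms:
  assumes "i \<le> n"
  shows "(\<lambda>x. x i) \<in> homogeneous_forms n 1"
proof -
  have "(\<Prod>j\<le>n. x j ^ (if j = i then 1 else 0)) = (\<Prod>j\<le>n. if j = i then x j else 1)" for x :: "nat \<Rightarrow> complex"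
    by (intro prod.cong) auto
  then have "(\<lambda>x. x i) = (\<lambda>x::nat \<Rightarrow> complex. \<Sum>\<alpha>\<in>{\<lambda>j. if j = i then 1 else 0}. 1 * (\<Prod>j\<le>n. x j ^ \<alpha> j))"
    using assms by simp
  then show ?thesis
    unfolding homogeneous_forms_def using assms
    by (intro CollectI exI[of _ "{\<lambda>j. if j = i then 1 else 0}"] exI[of _ "\<lambda>_. 1"]) auto
qed

lemma proj_point_eqD:
  assumes "proj_point x = proj_point y"
  obtains c where "c \<noteq> 0" "x = (\<lambda>i. c * y i)"
proof -
  have "x \<in> proj_point x" unfolding proj_point_def by (intro CollectI exI[of _ 1]) auto
  then show ?thesis using that assms by (auto simp: proj_point_def)
qed

lemma proj_point_scale:
  assumes "c \<noteq> 0"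
  shows "proj_point (\<lambda>i. c * x i) = proj_point x"
proof -
  have "\<exists>d'. d' \<noteq> 0 \<and> (\<lambda>i. d * x i) = (\<lambda>i. d' * (c * x i))" if "d \<noteq> 0" for d
    using assms that by (intro exI[of _ "d / c"]) auto
  moreover have "\<exists>d'. d' \<noteq> 0 \<and> (\<lambda>i. d * (c * x i)) = (\<lambda>i. d' * x i)" if "d \<noteq> 0" for d
    using assms that by (intro exI[of _ "d * c"]) auto
  ultimately show ?thesis unfolding proj_point_def by blast
qed

lemma topspace_projective_space:
  "topspace (zariski (projective_space n)) = proj_point ` homogeneous_coordinates n"
proof
  show "topspace (zariski (projective_space n)) \<subseteq> proj_point ` homogeneous_coordinates n"
    by (auto simp: projective_space_def)
  show "proj_point ` homogeneous_coordinates n \<subseteq> topspace (zariski (projective_space n))"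
  proof
    fix p assume "p \<in> proj_point ` homogeneous_coordinates n"
    then obtain x i where x: "p = proj_point x" "x \<in> homogeneous_coordinates n" "i \<le> n" "x i \<noteq> 0"
      by (auto simp: homogeneous_coordinates_def)
    then have "p \<in> proj_point ` {x \<in> homogeneous_coordinates n. x i \<noteq> 0}" by blast
    moreover have "proj_point ` {x \<in> homogeneous_coordinates n. x i \<noteq> 0} \<in>
        {proj_point ` {x \<in> homogeneous_coordinates n. f x \<noteq> 0} | f d. f \<in> homogeneous_forms n d}"
      using coordinate_in_homogeneous_forms[OF x(3)]
      by (intro CollectI exI[of _ "\<lambda>x. x i"] exI[of _ "1::nat"] conjI refl)
    ultimately show "p \<in> topspace (zariski (projective_space n))"
      unfolding projective_space_def real_variety.simps topology_generated_by_topspace by (rule UnionI[rotated])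
  qed
qed

text \<open>Zariski open sets are open for convergence of homogeneous coordinates: a form that is
  nonzero at the limit is eventually nonzero. This keeps limits of points of a closed subvariety
  inside it.\<close>

lemma projective_zariski_open_eventually:
  assumes U: "openin (zariski (projective_space n)) U"
    and x: "x \<in> homogeneous_coordinates n" "proj_point x \<in> U"
    and X: "\<And>k. X k \<in> homogeneous_coordinates n" "\<And>i. ((\<lambda>k. X k i) \<longlongrightarrow> x i) F"
  shows "\<forall>\<^sub>F k in F. proj_point (X k) \<in> U"
proof -
  have "generate_topology_on {proj_point ` {x \<in> homogeneous_coordinates n. f x \<noteq> 0} | f d. f \<in> homogeneous_forms n d} U"
    using U by (simp add: projective_space_def openin_topology_generated_by_iff)
  then show ?thesis using x(2)
  proof (induction rule: generate_topology_on.induct)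
    case Empty
    then show ?case by simp
  next
    case (Int a b)
    then show ?case by (auto intro: eventually_conj)
  next
    case (UN K)
    then obtain k where "k \<in> K" "proj_point x \<in> k" by blast
    with UN.IH have "\<forall>\<^sub>F i in F. proj_point (X i) \<in> k" by blast
    then show ?case by (rule eventually_mono) (use \<open>k \<in> K\<close> in blast)
  next
    case (Basis s)
    then obtain f d where f: "s = proj_point ` {x \<in> homogeneous_coordinates n. f x \<noteq> 0}" "f \<in> homogeneous_forms n d"
      by auto
    then obtain y where y: "f y \<noteq> 0" "proj_point x = proj_point y" using Basis by auto
    then obtain c where "c \<noteq> 0" "x = (\<lambda>i. c * y i)" using proj_point_eqD by blast
    then have "f x \<noteq> 0" using y homogeneous_form_scale[OF f(2)] by simp
    then have "\<forall>\<^sub>F k in F. f (X k) \<noteq> 0"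
      using homogeneous_form_tendsto[OF f(2) X(2)] by (rule tendsto_imp_eventually_ne[rotated])
    then show ?case by (rule eventually_mono) (use f(1) X(1) in auto)
  qed
qed

text \<open>Sequential compactness of projective space. Coordinates are scaled so that their
  absolute values sum to 1; a subsequence converges in a product of closed discs, and the limit
  keeps this sum, so not all of its coordinates vanish.\<close>

lemma projective_sequence_limit:
  assumes "\<And>k::nat. p k \<in> proj_point ` homogeneous_coordinates n"
  obtains X x r where "\<And>k. X k \<in> homogeneous_coordinates n" "\<And>k. p k = proj_point (X k)"
    "strict_mono (r :: nat \<Rightarrow> nat)" "x \<in> homogeneous_coordinates n" "\<And>i. (\<lambda>k. X (r k) i) \<longlonglongrightarrow> x i"
proof -
  have "\<forall>k. \<exists>y. y \<in> homogeneous_coordinates n \<and> p k = proj_point y"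
    using assms by auto
  then obtain Y where "\<forall>k. Y k \<in> homogeneous_coordinates n \<and> p k = proj_point (Y k)"
    by (rule choice[THEN exE])
  then have Y: "\<And>k. Y k \<in> homogeneous_coordinates n" "\<And>k. p k = proj_point (Y k)"
    by blast+
  define l where "l k = (\<Sum>i\<le>n. norm (Y k i))" for k
  have l: "0 < l k" for k
  proof -
    obtain i where i: "i \<le> n" "Y k i \<noteq> 0" using Y(1)[of k] by (auto simp: homogeneous_coordinates_def)
    then have "0 < norm (Y k i)" by simp
    also have "\<dots> \<le> l k" unfolding l_def using i by (intro member_le_sum) auto
    finally show ?thesis .
  qed
  define X where "X k i = of_real (1 / l k) * Y k i" for k i
  have X: "X k \<in> homogeneous_coordinates n" "p k = proj_point (X k)" for k
  proof -
    show "X k \<in> homogeneous_coordinates n"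
      using Y(1)[of k] l[of k] by (auto simp: homogeneous_coordinates_def X_def)
    have "of_real (1 / l k) \<noteq> (0::complex)" using l[of k] by simp
    from proj_point_scale[OF this, of "Y k"] show "p k = proj_point (X k)"
      unfolding X_def Y(2) by simp
  qed
  have norm1: "(\<Sum>i\<le>n. norm (X k i)) = 1" for k
  proof -
    have "(\<Sum>i\<le>n. norm (X k i)) = (\<Sum>i\<le>n. norm (Y k i) / l k)"
      using l[of k] by (simp add: X_def norm_mult norm_divide)
    then show ?thesis using l[of k] by (simp add: sum_divide_distrib[symmetric] l_def)
  qed
  have bound: "X k i \<in> cball 0 1" for k i
  proof (cases "i \<le> n")
    case True
    have "norm (X k i) \<le> (\<Sum>i\<le>n. norm (X k i))" using True by (intro member_le_sum) auto
    then show ?thesis using norm1[of k] by simp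
  next
    case False
    then show ?thesis using X(1)[of k] by (auto simp: homogeneous_coordinates_def)
  qed
  have "compactin (product_topology (\<lambda>i::nat. euclidean) UNIV) (\<Pi>\<^sub>E i\<in>UNIV. cball (0::complex) 1)"
    unfolding compactin_PiE by simp
  then have "compact (\<Pi>\<^sub>E i\<in>(UNIV::nat set). cball (0::complex) 1)"
    by (simp add: euclidean_product_topology)
  then have "seq_compact (\<Pi>\<^sub>E i\<in>(UNIV::nat set). cball (0::complex) 1)"
    by (rule compact_imp_seq_compact)
  moreover have "\<forall>k. X k \<in> (\<Pi>\<^sub>E i\<in>(UNIV::nat set). cball (0::complex) 1)" using bound by auto
  ultimately obtain x r where xr: "strict_mono (r :: nat \<Rightarrow> nat)" "(X \<circ> r) \<longlonglongrightarrow> x"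
    unfolding seq_compact_def by metis
  have lim: "(\<lambda>k. X (r k) i) \<longlonglongrightarrow> x i" for i
    using continuous_on_tendsto_compose[OF continuous_on_product_coordinates[of i] xr(2)] by simp
  have "(\<lambda>k. \<Sum>i\<le>n. norm (X (r k) i)) \<longlonglongrightarrow> (\<Sum>i\<le>n. norm (x i))"
    by (intro tendsto_intros lim)
  then have "(\<Sum>i\<le>n. norm (x i)) = 1"
    unfolding norm1 by (simp add: LIMSEQ_const_iff)
  then have "\<exists>i\<le>n. x i \<noteq> 0" by (metis (no_types, lifting) atMost_iff norm_zero sum.neutral zero_neq_one)
  moreover have "x i = 0" if "i > n" for i
  proof -
    have "X (r k) i = 0" for k using X(1)[of "r k"] that by (auto simp: homogeneous_coordinates_def)
    then show ?thesis using lim[of i] by (simp add: LIMSEQ_const_iff)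
  qed
  ultimately have "x \<in> homogeneous_coordinates n" by (simp add: homogeneous_coordinates_def)
  then show ?thesis using that[OF X xr(1) _ lim] by blast
qed

section \<open>Divergent sequences in the torus and the charts of their limits\<close>

context separated_fan
begin

text \<open>The torus point \<open>exp (- k v)\<close> seen in the chart of \<open>\<sigma>\<close>.
  Real exponentials replace integral powers, so that \<open>v\<close> can be any real direction and
  the whole plane is covered.\<close>

definition one_parameter_point :: "'v \<Rightarrow> nat \<Rightarrow> 'v set \<Rightarrow> ('v \<Rightarrow> complex)" where
  "one_parameter_point v k \<sigma> = chart_restrict N \<sigma> (\<lambda>m. of_real (exp (- (real k * (m \<bullet> v)))))"

lemma one_parameter_point_in: "one_parameter_point v k \<sigma> \<in> chart_points N \<sigma>"
  by (auto simp: one_parameter_point_def chart_points_def chart_restrict_def cone_semigroup_add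
      inner_add_left algebra_simps exp_add[symmetric] simp flip: of_real_mult)

lemma one_parameter_point_eq:
  assumes "\<sigma> \<in> \<Delta>" "\<tau> \<in> \<Delta>"
  shows "toric_point N \<Delta> (\<sigma>, one_parameter_point v k \<sigma>) = toric_point N \<Delta> (\<tau>, one_parameter_point v k \<tau>)"
proof -
  have "one_parameter_point v k \<sigma> = chart_restrict N \<sigma> (one_parameter_point v k (\<sigma> \<inter> \<tau>))"
    "one_parameter_point v k \<tau> = chart_restrict N \<tau> (one_parameter_point v k (\<sigma> \<inter> \<tau>))"
    using cone_semigroup_antimono[of "\<sigma> \<inter> \<tau>" \<sigma> _ N] cone_semigroup_antimono[of "\<sigma> \<inter> \<tau>" \<tau> _ N]
    by (auto simp: one_parameter_point_def chart_restrict_def fun_eq_iff)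
  then show ?thesis
    unfolding toric_point_eq_iff[OF assms(1) one_parameter_point_in assms(2) one_parameter_point_in]
    using one_parameter_point_in by blast
qed

text \<open>The one-parameter subgroup of \<open>- v\<close> has a limit in some chart.\<close>

lemma projective_imp_limit_chart:
  assumes proj: "projective_variety (toric_variety N \<Delta>)" and ne: "\<Delta> \<noteq> {}"
  shows "\<exists>\<sigma>\<in>\<Delta>. \<forall>m \<in> S \<sigma>. 0 \<le> m \<bullet> v"
proof -
  obtain n Z where Z: "closedin (zariski (projective_space n)) Z"
    and iso: "isomorphic_varieties (toric_variety N \<Delta>) (closed_subvariety (projective_space n) Z)"
    using proj unfolding projective_variety_def by (elim exE conjE)
  obtain f g where fg: "variety_morphism (toric_variety N \<Delta>) (closed_subvariety (projective_space n) Z) f"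
    "variety_morphism (closed_subvariety (projective_space n) Z) (toric_variety N \<Delta>) g"
    "\<And>p. p \<in> topspace (zariski (toric_variety N \<Delta>)) \<Longrightarrow> g (f p) = p"
    using iso unfolding isomorphic_varieties_def by (elim exE conjE) simp
  have topZ: "topspace (zariski (closed_subvariety (projective_space n) Z)) = Z"
    using closedin_subset[OF Z] by (auto simp: closed_subvariety_def)
  obtain \<sigma>0 where \<sigma>0: "\<sigma>0 \<in> \<Delta>" using ne by blast
  define P where "P k = toric_point N \<Delta> (\<sigma>0, one_parameter_point v k \<sigma>0)" for k
  have P_eq: "P k = toric_point N \<Delta> (\<sigma>, one_parameter_point v k \<sigma>)" if "\<sigma> \<in> \<Delta>" for k \<sigma>
    unfolding P_def using one_parameter_point_eq[OF \<sigma>0 that] .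
  have Ptop: "P k \<in> topspace (zariski (toric_variety N \<Delta>))" for k
    unfolding P_def topspace_toric_variety using \<sigma>0 one_parameter_point_in by blast
  have fZ: "f (P k) \<in> Z" for k
    using fg(1) Ptop[of k] topZ by (auto simp: variety_morphism_def continuous_map_def)
  then have fX: "f (P k) \<in> proj_point ` homogeneous_coordinates n" for k
    using closedin_subset[OF Z] topspace_projective_space by blast
  obtain X x r where X: "\<And>k. X k \<in> homogeneous_coordinates n" "\<And>k. f (P k) = proj_point (X k)"
    and r: "strict_mono (r :: nat \<Rightarrow> nat)" and x: "x \<in> homogeneous_coordinates n" and lim: "\<And>i. (\<lambda>k. X (r k) i) \<longlonglongrightarrow> x i"
    by (rule projective_sequence_limit[OF fX]) (rule that)
  have qZ: "proj_point x \<in> Z"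
  proof (rule ccontr)
    assume "proj_point x \<notin> Z"
    then have "\<forall>\<^sub>F k in sequentially. proj_point (X (r k)) \<in> topspace (zariski (projective_space n)) - Z"
      using Z x X lim topspace_projective_space
      by (intro projective_zariski_open_eventually[OF _ x]) (auto simp: closedin_def)
    then obtain k where "proj_point (X (r k)) \<notin> Z"
      using eventually_happens by fastforce
    then show False using fZ[of "r k"] X(2) by simp
  qed
  have "g (proj_point x) \<in> topspace (zariski (toric_variety N \<Delta>))"
    using fg(2) qZ topZ by (auto simp: variety_morphism_def continuous_map_def)
  then obtain \<sigma> \<zeta> where \<sigma>: "\<sigma> \<in> \<Delta>" "\<zeta> \<in> chart_points N \<sigma>" "g (proj_point x) = toric_point N \<Delta> (\<sigma>, \<zeta>)"
    unfolding topspace_toric_variety by blast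
  \<comment> \<open>Along the sequence the character \<open>m\<close> equals
    \<open>exp (- k (m \<bullet> v))\<close>, which tends to infinity for a negative pairing. On the
    projective side it is near the limit a quotient of two forms of equal degree with nonzero
    limiting denominator, hence convergent.\<close>
  have "0 \<le> m \<bullet> v" if m: "m \<in> S \<sigma>" for m
  proof (rule ccontr)
    assume neg: "\<not> 0 \<le> m \<bullet> v"
    define U where "U = {p \<in> Z. g p \<in> chart_image \<sigma>}"
    have reg: "regular_on (closed_subvariety (projective_space n) Z) U (character \<sigma> m \<circ> g)"
      using fg(2) openin_chart_image[OF \<sigma>(1)] regular_character[OF \<sigma>(1) m]
      unfolding variety_morphism_def topZ U_def by blast
    have xU: "proj_point x \<in> U" using qZ \<sigma> by (auto simp: U_def chart_image_def)
    obtain W h where W: "openin (zariski (projective_space n)) W" "proj_point x \<in> W"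
      "regular_on (projective_space n) W h" "\<And>q. q \<in> U \<inter> W \<Longrightarrow> (character \<sigma> m \<circ> g) q = h q"
      using bspec[OF reg[unfolded closed_subvariety_def real_variety.simps] xU]
      by (elim exE conjE) (rule that, assumption+, erule bspec)
    obtain d F H where FH: "F \<in> homogeneous_forms n d" "H \<in> homogeneous_forms n d" "H x \<noteq> 0"
      "\<And>y. y \<in> homogeneous_coordinates n \<Longrightarrow> proj_point y \<in> W \<Longrightarrow> H y \<noteq> 0 \<Longrightarrow> h (proj_point y) = F y / H y"
      using W(3)[unfolded projective_space_def real_variety.simps, rule_format, OF x W(2)]
      by (elim exE bexE conjE) (rule that, assumption+, blast)
    have evW: "\<forall>\<^sub>F k in sequentially. proj_point (X (r k)) \<in> W"
      by (rule projective_zariski_open_eventually[OF W(1) x W(2) X(1) lim])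
    have evH: "\<forall>\<^sub>F k in sequentially. H (X (r k)) \<noteq> 0"
      using homogeneous_form_tendsto[OF FH(2) lim] FH(3) by (rule tendsto_imp_eventually_ne)
    have "(\<lambda>k. F (X (r k)) / H (X (r k))) \<longlonglongrightarrow> F x / H x"
      by (intro tendsto_divide homogeneous_form_tendsto[OF FH(1) lim] homogeneous_form_tendsto[OF FH(2) lim] FH(3))
    moreover have "\<forall>\<^sub>F k in sequentially. F (X (r k)) / H (X (r k)) = of_real (exp (- (real (r k) * (m \<bullet> v))))"
      using evW evH
    proof eventually_elim
      case (elim k)
      have "f (P (r k)) \<in> U"
        using fZ fg(3)[OF Ptop] P_eq[OF \<sigma>(1)] one_parameter_point_in by (auto simp: U_def chart_image_def)
      then have "h (proj_point (X (r k))) = character \<sigma> m (P (r k))"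
        using W(4)[of "proj_point (X (r k))"] elim(1) fg(3)[OF Ptop] X(2) by (metis IntI comp_apply)
      also have "\<dots> = of_real (exp (- (real (r k) * (m \<bullet> v))))"
        unfolding P_eq[OF \<sigma>(1)] character_toric_point[OF \<sigma>(1) one_parameter_point_in]
        using m by (simp add: one_parameter_point_def chart_restrict_def)
      finally show ?case using FH(4)[OF X(1) elim] by simp
    qed
    ultimately have "(\<lambda>k. complex_of_real (exp (- (real (r k) * (m \<bullet> v))))) \<longlonglongrightarrow> F x / H x"
      by (rule Lim_transform_eventually)
    then have "(\<lambda>k. exp (real (r k) * - (m \<bullet> v))) \<longlonglongrightarrow> norm (F x / H x)"
      using tendsto_norm by fastforce
    moreover have "filterlim (\<lambda>k. exp (real (r k) * - (m \<bullet> v))) at_top sequentially"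
    proof (rule filterlim_compose[OF exp_at_top])
      have "filterlim (\<lambda>k. real (r k)) at_top sequentially"
        using filterlim_compose[OF filterlim_real_sequentially filterlim_subseq[OF r]] .
      then show "filterlim (\<lambda>k. real (r k) * - (m \<bullet> v)) at_top sequentially"
        using neg by (intro filterlim_at_top_mult_tendsto_pos[OF tendsto_const, of "- (m \<bullet> v)"] ) auto
    qed
    ultimately show False
      using not_tendsto_and_filterlim_at_infinity[OF sequentially_bot]
      by (metis filterlim_at_top_imp_at_infinity)
  qed
  then show ?thesis using \<sigma>(1) by blast
qed

end

text \<open>Biduality. The coordinate forms \<open>J (- b)\<close> and \<open>J a\<close> serve as
  tests; when a generator is missing, the corresponding form may be used with either sign, which
  forces that coordinate to 0.\<close>

lemma (in plane_lattice) dual_cone: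
  assumes "gens A" "\<And>m. m \<in> cone_semigroup N (cone_of A) \<Longrightarrow> 0 \<le> m \<bullet> v"
  shows "v \<in> cone_of A"
proof -
  obtain a b where ab: "basis a b" "A \<subseteq> {a, b}" using assms(1) by (auto simp: gens_def)
  have val: "area a b = 1" "area b a = - 1" "a \<in> N" "b \<in> N" "- a \<in> N" "- b \<in> N"
    using ab skew[of b a] N_neg by (auto simp: basis_def)
  have *: "0 \<le> area n v"
    if "n \<in> N" "a \<in> A \<Longrightarrow> 0 \<le> area n a" "b \<in> A \<Longrightarrow> 0 \<le> area n b" for n
  proof -
    have "\<forall>x\<in>A. 0 \<le> area n x" using ab(2) that by blast
    then show ?thesis
      using assms(2)[of "J n"] that by (simp add: cone_semigroup_cone_of mem_dual)
  qed
  have "0 \<le> area v b" using *[of "- b"] val skew[of b v] by simp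
  moreover have "0 \<le> area a v" using *[of a] val by simp
  moreover have "area v b \<le> 0" if "a \<notin> A" using *[of b] val that skew[of b v] by simp
  moreover have "area a v \<le> 0" if "b \<notin> A" using *[of "- a"] val that by simp
  ultimately show ?thesis using mem_cone_iff[OF ab, of v] by force
qed

lemma (in plane_lattice) projective_imp_complete:
  assumes K: "unimodular_fan K" "K \<noteq> {}" and proj: "projective_variety (toric_variety N (cone_of ` K))"
  shows "\<exists>A\<in>K. v \<in> cone_of A"
proof -
  interpret separated_fan N "cone_of ` K" by (rule unimodular_separated[OF K(1)])
  obtain A where "A \<in> K" "\<forall>m\<in>S (cone_of A). 0 \<le> m \<bullet> v"
    using projective_imp_limit_chart[OF proj, of v] K(2) by auto
  then show ?thesis using dual_cone[of A v] K(1) by (auto simp: unimodular_fan_def)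
qed

section \<open>Complete smooth fans in the plane\<close>

context plane_lattice
begin

text \<open>A complete smooth fan is recorded by the positively oriented pairs of primitive generators of
  its two-dimensional cones.\<close>

definition oriented_fan :: "('v \<times> 'v) set \<Rightarrow> bool" where
  "oriented_fan C \<longleftrightarrow> finite C \<and> (\<forall>(a, b)\<in>C. basis a b) \<and>
     (\<forall>(a, b)\<in>C. \<forall>(c, d)\<in>C. (a, b) \<noteq> (c, d) \<longrightarrow>
        cone_of {a, b} \<inter> cone_of {c, d} \<subseteq> cone_of ({a, b} \<inter> {c, d})) \<and>
     (\<forall>v. \<exists>(a, b)\<in>C. v \<in> cone_of {a, b})"

definition faces :: "('v \<times> 'v) set \<Rightarrow> 'v set set" where
  "faces C = {A. \<exists>(a, b)\<in>C. A \<subseteq> {a, b}}"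

lemma mem_cone_pair: "basis a b \<Longrightarrow> v \<in> cone_of {a, b} \<longleftrightarrow> 0 \<le> area v b \<and> 0 \<le> area a v"
  using mem_cone_iff[of a b "{a, b}" v] by simp

lemma basis_facts:
  assumes "basis a b"
  shows "area a b = 1" "area b a = - 1" "a \<noteq> b" "a \<noteq> 0" "b \<noteq> 0" "a \<in> N" "b \<in> N" "a \<noteq> - b"
  using assms skew[of b a] by (auto simp: basis_def)

lemma oriented_fanD:
  assumes "oriented_fan C"
  shows "finite C" "\<And>a b. (a, b) \<in> C \<Longrightarrow> basis a b"
    "\<And>a b c d. (a, b) \<in> C \<Longrightarrow> (c, d) \<in> C \<Longrightarrow> (a, b) \<noteq> (c, d) \<Longrightarrow>
        cone_of {a, b} \<inter> cone_of {c, d} \<subseteq> cone_of ({a, b} \<inter> {c, d})"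
    "\<And>v. \<exists>a b. (a, b) \<in> C \<and> v \<in> cone_of {a, b}"
proof -
  note C = assms[unfolded oriented_fan_def]
  show "finite C" using C by simp
  show "basis a b" if "(a, b) \<in> C" for a b using bspec[OF C[THEN conjunct2, THEN conjunct1] that] by simp
  show "cone_of {a, b} \<inter> cone_of {c, d} \<subseteq> cone_of ({a, b} \<inter> {c, d})"
    if "(a, b) \<in> C" "(c, d) \<in> C" "(a, b) \<noteq> (c, d)" for a b c d
    using bspec[OF bspec[OF C[THEN conjunct2, THEN conjunct2, THEN conjunct1] that(1), simplified] that(2)] that(3)
    by simp
  show "\<exists>a b. (a, b) \<in> C \<and> v \<in> cone_of {a, b}" for v
    using spec[OF C[THEN conjunct2, THEN conjunct2, THEN conjunct2], of v] by auto
qed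

lemma generator_not_in_cone:
  assumes "gens A" "a \<in> A" "a \<notin> B" "B \<subseteq> A"
  shows "a \<notin> cone_of B"
proof -
  obtain c d where cd: "basis c d" "A \<subseteq> {c, d}" using assms(1) by (auto simp: gens_def)
  then have "B \<subseteq> {c, d}" using assms(4) by blast
  then show ?thesis
    using mem_cone_iff[OF cd(1), of B a] cd assms(2,3) basis_facts[OF cd(1)] by auto
qed

lemma cone_of_eq_iff:
  assumes K: "unimodular_fan K" "A \<in> K" "B \<in> K"
  shows "cone_of A = cone_of B \<longleftrightarrow> A = B"
proof
  assume eq: "cone_of A = cone_of B"
  have g: "gens A" "gens B" and int: "cone_of A \<inter> cone_of B = cone_of (A \<inter> B)"
    using K by (auto simp: unimodular_fan_def)
  have "a \<in> A \<inter> B" if "a \<in> A" for a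
  proof (rule ccontr)
    assume "a \<notin> A \<inter> B"
    then have "a \<notin> cone_of (A \<inter> B)" by (intro generator_not_in_cone[OF g(1) that]) auto
    then show False using int eq hull_inc[OF that, of convex_cone] by auto
  qed
  moreover have "a \<in> A \<inter> B" if "a \<in> B" for a
  proof (rule ccontr)
    assume "a \<notin> A \<inter> B"
    then have "a \<notin> cone_of (A \<inter> B)" by (intro generator_not_in_cone[OF g(2) that]) auto
    then show False using int eq hull_inc[OF that, of convex_cone] by auto
  qed
  ultimately show "A = B" by blast
qed simp

text \<open>The intersection of two faces is first confined to the intersection of the two maximal
  cones and then cut down inside each of them, where membership is read from coordinates.\<close>

lemma unimodular_faces:
  assumes C: "oriented_fan C"
  shows "unimodular_fan (faces C)"
  unfolding unimodular_fan_def
proof (intro conjI ballI)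
  fix A assume "A \<in> faces C"
  then obtain a b where "(a, b) \<in> C" "A \<subseteq> {a, b}" by (auto simp: faces_def)
  moreover from this have "basis a b" using oriented_fanD(2)[OF C] by blast
  ultimately show "gens A" unfolding gens_def by blast
next
  fix A B assume "A \<in> faces C" "B \<in> faces C"
  then obtain a b c d where ab: "(a, b) \<in> C" "A \<subseteq> {a, b}" and cd: "(c, d) \<in> C" "B \<subseteq> {c, d}"
    by (auto simp: faces_def)
  have bas: "basis a b" "basis c d" using oriented_fanD(2)[OF C] ab cd by auto
  have same: "cone_of X \<inter> cone_of Y \<subseteq> cone_of (X \<inter> Y)" if "basis x y" "X \<subseteq> {x, y}" "Y \<subseteq> {x, y}" for x y X Y
  proof -
    have "X \<inter> Y \<subseteq> {x, y}" using that by auto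
    then show ?thesis using mem_cone_iff[OF that(1)] that by auto
  qed
  have "cone_of A \<inter> cone_of B \<subseteq> cone_of (A \<inter> B)"
  proof (cases "(a, b) = (c, d)")
    case True
    then show ?thesis using same[OF bas(1) ab(2)] cd by auto
  next
    case False
    let ?I = "{a, b} \<inter> {c, d}"
    have 1: "cone_of {a, b} \<inter> cone_of {c, d} \<subseteq> cone_of ?I"
      using oriented_fanD(3)[OF C ab(1) cd(1) False] .
    have "cone_of A \<subseteq> cone_of {a, b}" "cone_of B \<subseteq> cone_of {c, d}"
      using ab cd by (auto intro!: hull_mono)
    then have "cone_of A \<inter> cone_of B \<subseteq> cone_of A \<inter> cone_of ?I \<inter> cone_of B" using 1 by blast
    also have "\<dots> \<subseteq> cone_of (A \<inter> ?I) \<inter> cone_of B"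
      using same[OF bas(1) ab(2), of ?I] by blast
    also have "\<dots> \<subseteq> cone_of (A \<inter> ?I \<inter> B)"
      using cd by (intro same[OF bas(2)]) auto
    also have "\<dots> \<subseteq> cone_of (A \<inter> B)" by (intro hull_mono) auto
    finally show ?thesis .
  qed
  moreover have "cone_of (A \<inter> B) \<subseteq> cone_of A" "cone_of (A \<inter> B) \<subseteq> cone_of B"
    by (auto intro!: hull_mono)
  ultimately show "cone_of A \<inter> cone_of B = cone_of (A \<inter> B)" by blast
qed

text \<open>The points \<open>X k\<close> tend to \<open>a\<close> and cones with finitely many
  generators are closed, so for large \<open>k\<close> any cone of \<open>K\<close> containing
  \<open>X k\<close> also contains \<open>a\<close>. It finds the cone that adjoins a ray on a
  prescribed side.\<close>

lemma cone_near:
  assumes "finite K" "\<And>A. A \<in> K \<Longrightarrow> finite A" "\<And>v. \<exists>A\<in>K. v \<in> cone_of A"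
  obtains B \<epsilon> where "B \<in> K" "0 < \<epsilon>" "a \<in> cone_of B" "a + \<epsilon> *\<^sub>R w \<in> cone_of B"
proof -
  define X where "X k = a + (1 / real (Suc k)) *\<^sub>R w" for k
  have "X \<longlonglongrightarrow> a + 0 *\<^sub>R w"
    unfolding X_def by (intro tendsto_intros LIMSEQ_Suc[OF lim_1_over_n])
  then have lim: "X \<longlonglongrightarrow> a" by simp
  have "\<forall>\<^sub>F k in sequentially. X k \<notin> cone_of B" if "B \<in> K" "a \<notin> cone_of B" for B
    using topological_tendstoD[OF lim, of "- cone_of B"] that assms(2) closed_convex_cone_hull by auto
  then have "\<forall>\<^sub>F k in sequentially. \<forall>B\<in>{B \<in> K. a \<notin> cone_of B}. X k \<notin> cone_of B"
    using assms(1) by (intro eventually_ball_finite) auto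
  then obtain k where k: "\<And>B. B \<in> K \<Longrightarrow> a \<notin> cone_of B \<Longrightarrow> X k \<notin> cone_of B"
    using eventually_happens by fastforce
  obtain B where "B \<in> K" "X k \<in> cone_of B" using assms(3) by blast
  then show ?thesis using that[of B "1 / real (Suc k)"] k[of B] by (auto simp: X_def)
qed

text \<open>The supporting hyperplane is the zero set of the sum of the coordinate forms that belong
  to basis vectors outside \<open>B\<close>.\<close>

lemma cone_subset_face:
  assumes "gens A" "B \<subseteq> A"
  shows "cone_of B face_of cone_of A"
proof -
  obtain a b where ab: "basis a b" "A \<subseteq> {a, b}" using assms(1) by (auto simp: gens_def)
  have ab': "B \<subseteq> {a, b}" using ab assms by auto
  define h where "h = (if a \<in> B then 0 else J (- b)) + (if b \<in> B then 0 else J a)"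
  have h: "h \<bullet> v = (if a \<in> B then 0 else area v b) + (if b \<in> B then 0 else area a v)" for v
    using skew[of v b] by (auto simp: h_def inner_add_left)
  have "cone_of A \<inter> {v. h \<bullet> v = 0} face_of cone_of A"
    using mem_cone_iff[OF ab] by (intro face_of_Int_supporting_hyperplane_ge convex_convex_cone_hull) (auto simp: h)
  moreover have "cone_of A \<inter> {v. h \<bullet> v = 0} = cone_of B"
    using mem_cone_iff[OF ab] mem_cone_iff[OF ab(1) ab'] assms(2) by (auto simp: h split: if_splits)
  ultimately show ?thesis by simp
qed

text \<open>Completeness forces purity: moving from a ray a little in a transversal direction ends
  in a cone that has this ray as a generator, and that cone must be two-dimensional. So the maximal
  cones determine all others.\<close>

lemma complete_fan_oriented:
  assumes K: "unimodular_fan K" "finite (cone_of ` K)"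
    and cover: "\<And>v. \<exists>A\<in>K. v \<in> cone_of A"
    and sub: "\<And>A B. A \<in> K \<Longrightarrow> B \<subseteq> A \<Longrightarrow> B \<in> K"
  defines "C \<equiv> {(a, b). basis a b \<and> {a, b} \<in> K}"
  shows "oriented_fan C" "faces C = K"
proof -
  have inj: "inj_on cone_of K" using cone_of_eq_iff[OF K(1)] by (auto intro: inj_onI)
  then have finK: "finite K" using K(2) finite_imageD by blast
  have gK: "gens A" if "A \<in> K" for A using K(1) that by (auto simp: unimodular_fan_def)
  have ray: "\<exists>(c, d)\<in>C. a \<in> {c, d}" if "{a} \<in> K" for a
  proof -
    have "primitive a" using gens_primitive[OF gK[OF that]] by simp
    then obtain w where w: "area a w = 1" by (auto simp: primitive_def)
    obtain B \<epsilon> where B: "B \<in> K" "0 < \<epsilon>" "a \<in> cone_of B" "a + \<epsilon> *\<^sub>R w \<in> cone_of B"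
      using cone_near[OF finK gens_finite[OF gK] cover] by blast
    have "cone_of {a} \<inter> cone_of B = cone_of ({a} \<inter> B)" using K(1) that B by (auto simp: unimodular_fan_def)
    then have "a \<in> cone_of ({a} \<inter> B)" using B(3) hull_inc[of a "{a}" convex_cone] by auto
    then have aB: "a \<in> B" using generator_not_in_cone[OF gK[OF that], of a "{a} \<inter> B"] by blast
    obtain c d where cd: "basis c d" "B \<subseteq> {c, d}" using gK[OF B(1)] by (auto simp: gens_def)
    have "B \<noteq> {a}"
    proof
      assume "B = {a}"
      then obtain x where "a + \<epsilon> *\<^sub>R w = x *\<^sub>R a" using B(4) by (auto simp: cone_of_single)
      then have "area a (a + \<epsilon> *\<^sub>R w) = area a (x *\<^sub>R a)" by simp
      then show False using B(2) w by simp
    qed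
    then have "B = {c, d}" using aB cd by blast
    then show ?thesis using B(1) cd aB by (auto simp: C_def)
  qed
  have pure: "\<exists>(c, d)\<in>C. A \<subseteq> {c, d}" if A: "A \<in> K" for A
  proof -
    obtain a b where ab: "basis a b" "A \<subseteq> {a, b}" using gK[OF A] by (auto simp: gens_def)
    then consider "A = {}" | x where "A = {x}" | "A = {a, b}" by blast
    then show ?thesis
    proof cases
      case 1
      obtain B where B: "B \<in> K" "e1 \<in> cone_of B" using cover by blast
      then have "B \<noteq> {}" using e_basis basis_facts by auto
      then obtain x where "{x} \<in> K" using sub[OF B(1)] by (metis empty_subsetI insert_subset ex_in_conv)
      then show ?thesis using ray[of x] 1 by auto
    next
      case (2 x)
      then show ?thesis using ray[of x] A by auto
    next
      case 3
      then show ?thesis using A ab by (auto simp: C_def)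
    qed
  qed
  show faces: "faces C = K"
    using pure sub unfolding faces_def C_def by blast
  show "oriented_fan C"
    unfolding oriented_fan_def
  proof (intro conjI)
    have "C \<subseteq> (\<Union>K) \<times> (\<Union>K)" by (auto simp: C_def)
    moreover have "finite (\<Union>K)" using finK gens_finite[OF gK] by auto
    ultimately show "finite C" by (meson finite_SigmaI finite_subset)
    show "\<forall>(a, b)\<in>C. basis a b" by (auto simp: C_def)
    show "\<forall>(a, b)\<in>C. \<forall>(c, d)\<in>C. (a, b) \<noteq> (c, d) \<longrightarrow>
        cone_of {a, b} \<inter> cone_of {c, d} \<subseteq> cone_of ({a, b} \<inter> {c, d})"
      using K(1) unfolding unimodular_fan_def C_def by blast
    show "\<forall>v. \<exists>(a, b)\<in>C. v \<in> cone_of {a, b}"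
    proof
      fix v
      obtain A where A: "A \<in> K" "v \<in> cone_of A" using cover by blast
      then obtain a b where ab: "(a, b) \<in> C" "A \<subseteq> {a, b}" using pure by blast
      then have "v \<in> cone_of {a, b}" using A(2) hull_mono by blast
      then show "\<exists>(a, b)\<in>C. v \<in> cone_of {a, b}" using ab by blast
    qed
  qed
qed

section \<open>Neighbouring rays and contraction\<close>

lemma ray_in_cone:
  assumes C: "oriented_fan C" and ab: "(a, b) \<in> C" "r \<in> {a, b}" and cd: "(c, d) \<in> C" "r \<in> cone_of {c, d}"
  shows "r \<in> {c, d}"
proof (rule ccontr)
  assume r: "r \<notin> {c, d}"
  then have "cone_of {a, b} \<inter> cone_of {c, d} \<subseteq> cone_of ({a, b} \<inter> {c, d})"
    using oriented_fanD(3)[OF C ab(1) cd(1)] ab by blast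
  moreover have "r \<in> cone_of {a, b}" using ab(2) by (rule hull_inc)
  ultimately have "r \<in> cone_of ({a, b} \<inter> {c, d})" using cd by blast
  moreover have "gens {a, b}" using oriented_fanD(2)[OF C ab(1)] by (auto simp: gens_def)
  ultimately show False using generator_not_in_cone[of "{a, b}" r "{a, b} \<inter> {c, d}"] ab r by blast
qed

text \<open>Both successors have area 1 with \<open>a\<close>, so they differ by a multiple of
  \<open>a\<close> and one lies in the cone of the other, where a ray can only be an edge.\<close>

lemma successor_unique:
  assumes C: "oriented_fan C" and "(a, b) \<in> C" "(a, c) \<in> C"
  shows "b = c"
proof -
  have bas: "basis a b" "basis a c" using oriented_fanD(2)[OF C] assms by auto
  have c: "c = b + area c b *\<^sub>R a" using basis_expand[OF bas(1), of c] basis_facts[OF bas(2)] by (simp add: add.commute)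
  have "c \<in> cone_of {a, b} \<or> b \<in> cone_of {a, c}"
    using mem_cone_pair[OF bas(1), of c] mem_cone_pair[OF bas(2), of b] basis_facts[OF bas(1)] basis_facts[OF bas(2)]
      skew[of b c] by auto
  then show ?thesis
    using ray_in_cone[OF C assms(3) _ assms(2), of c] ray_in_cone[OF C assms(2) _ assms(3), of b]
      basis_facts(3)[OF bas(1)] basis_facts(3)[OF bas(2)] by auto
qed

lemma predecessor_unique:
  assumes C: "oriented_fan C" and "(b, a) \<in> C" "(c, a) \<in> C"
  shows "b = c"
proof -
  have bas: "basis b a" "basis c a" using oriented_fanD(2)[OF C] assms by auto
  have "c \<in> cone_of {b, a} \<or> b \<in> cone_of {c, a}"
    using mem_cone_pair[OF bas(1), of c] mem_cone_pair[OF bas(2), of b] basis_facts[OF bas(1)] basis_facts[OF bas(2)]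
      skew[of b c] by auto
  then show ?thesis
    using ray_in_cone[OF C assms(3) _ assms(2), of c] ray_in_cone[OF C assms(2) _ assms(3), of b]
      basis_facts(3)[OF bas(1)] basis_facts(3)[OF bas(2)] by auto
qed

text \<open>Points close to \<open>a\<close> on its two sides lie in cones having \<open>a\<close>
  as an edge; the sign of the area tells whether \<open>a\<close> comes first or second in the
  oriented pair.\<close>

lemma neighbours_exist:
  assumes C: "oriented_fan C" and pq: "(p, q) \<in> C" "a \<in> {p, q}"
  shows "\<exists>b. (a, b) \<in> C" "\<exists>b. (b, a) \<in> C"
proof -
  let ?K = "(\<lambda>(a, b). {a, b}) ` C"
  have "primitive a" using oriented_fanD(2)[OF C pq(1)] pq(2) basis_primitive by blast
  then obtain w where w: "area a w = 1" by (auto simp: primitive_def)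
  have near: "\<exists>c d \<epsilon>. (c, d) \<in> C \<and> 0 < \<epsilon> \<and> a \<in> {c, d} \<and> a + \<epsilon> *\<^sub>R u \<in> cone_of {c, d}" for u
  proof -
    have "\<exists>A\<in>?K. v \<in> cone_of A" for v using oriented_fanD(4)[OF C, of v] by force
    moreover have "finite ?K" "\<And>A. A \<in> ?K \<Longrightarrow> finite A" using oriented_fanD(1)[OF C] by auto
    ultimately obtain B \<epsilon> where B: "B \<in> ?K" "0 < \<epsilon>" "a \<in> cone_of B" "a + \<epsilon> *\<^sub>R u \<in> cone_of B"
      using cone_near[of ?K a u] by blast
    then obtain c d where "(c, d) \<in> C" "B = {c, d}" by auto
    then show ?thesis using B ray_in_cone[OF C pq, of c d] by blast
  qed
  have w': "area w a = - 1" using skew[of w a] w by simp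
  obtain c d \<epsilon> where 1: "(c, d) \<in> C" "0 < \<epsilon>" "a \<in> {c, d}" "a + \<epsilon> *\<^sub>R w \<in> cone_of {c, d}"
    using near[of w] by blast
  then have "a \<noteq> d" using mem_cone_pair[OF oriented_fanD(2)[OF C 1(1)]] w' by auto
  then show "\<exists>b. (a, b) \<in> C" using 1 by blast
  obtain c d \<epsilon> where 2: "(c, d) \<in> C" "0 < \<epsilon>" "a \<in> {c, d}" "a + \<epsilon> *\<^sub>R (- w) \<in> cone_of {c, d}"
    using near[of "- w"] by blast
  then have "a \<noteq> c" using mem_cone_pair[OF oriented_fanD(2)[OF C 2(1)]] w by auto
  then show "\<exists>b. (b, a) \<in> C" using 2 by blast
qed

text \<open>The interior point \<open>c + d\<close> of any cone lies in some cone of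
  \<open>C0\<close>, and two cones of a fan sharing an interior point agree. So the classification
  is finished as soon as a complete standard fan is found inside \<open>C\<close>.\<close>

lemma covering_subfan:
  assumes C: "oriented_fan C" and sub: "C0 \<subseteq> C" and cover: "\<And>v. \<exists>a b. (a, b) \<in> C0 \<and> v \<in> cone_of {a, b}"
  shows "C = C0"
proof -
  have "(c, d) \<in> C0" if cd: "(c, d) \<in> C" for c d
  proof -
    have bas: "basis c d" using oriented_fanD(2)[OF C cd] .
    obtain a b where ab: "(a, b) \<in> C0" "c + d \<in> cone_of {a, b}" using cover by blast
    have bas': "basis a b" using oriented_fanD(2)[OF C] ab sub by blast
    show ?thesis
    proof (cases "(a, b) = (c, d)")
      case False
      have "c + d \<in> cone_of {c, d}" using mem_cone_pair[OF bas] basis_facts[OF bas] by simp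
      then have "c + d \<in> cone_of ({c, d} \<inter> {a, b})"
        using oriented_fanD(3)[OF C cd, of a b] ab sub False by blast
      then have "c \<in> {a, b}" "d \<in> {a, b}"
        using mem_cone_iff[OF bas, of "{c, d} \<inter> {a, b}" "c + d"] basis_facts[OF bas] by auto
      then show ?thesis using False basis_facts[OF bas] basis_facts[OF bas'] by auto
    qed (use ab in auto)
  qed
  then show ?thesis using sub by auto
qed

text \<open>Star subdivision of the cone of \<open>(p, q)\<close>, the fan of the blow-up of a torus fixed point.\<close>

definition blowup :: "('v \<times> 'v) set \<Rightarrow> 'v \<Rightarrow> 'v \<Rightarrow> ('v \<times> 'v) set" where
  "blowup C p q = insert (p, p + q) (insert (p + q, q) (C - {(p, q)}))"

lemma subdivide_cone:
  assumes "basis p q"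
  shows "cone_of {p, q} = cone_of {p, p + q} \<union> cone_of {p + q, q}"
proof -
  have "basis p (p + q)" "basis (p + q) q" using assms by (auto simp: basis_def N_add)
  then show ?thesis
    using skew[of _ p] skew[of _ q] assms by (auto simp: mem_cone_pair)
qed

text \<open>Inverts a star subdivision. By uniqueness of neighbours no further cone contains the ray
  \<open>p + q\<close>, so its removal does not disturb the other intersections.\<close>

lemma contract:
  assumes C: "oriented_fan C" and pa: "(p, p + q) \<in> C" and aq: "(p + q, q) \<in> C"
  defines "C0 \<equiv> insert (p, q) (C - {(p, p + q), (p + q, q)})"
  shows "oriented_fan C0" "C = blowup C0 p q" "Suc (card C0) = card C"
proof -
  let ?a = "p + q"
  have bas: "basis p ?a" "basis ?a q" using oriented_fanD(2)[OF C] pa aq by auto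
  then have pq: "basis p q" by (auto simp: basis_def)
  note pqf = basis_facts[OF pq]
  have pq_notin: "(p, q) \<notin> C"
    using successor_unique[OF C pa, of q] pqf by auto
  have ne: "(p, ?a) \<noteq> (?a, q)" using pqf by auto
  have mem: "c \<noteq> ?a \<and> d \<noteq> ?a" if "(c, d) \<in> C" "(c, d) \<noteq> (p, ?a)" "(c, d) \<noteq> (?a, q)" for c d
    using successor_unique[OF C aq, of d] predecessor_unique[OF C pa, of c] that by auto
  show "C = blowup C0 p q"
    using pa aq pq_notin by (auto simp: blowup_def C0_def)
  have "card C0 = Suc (card (C - {(p, ?a), (?a, q)}))"
    unfolding C0_def using oriented_fanD(1)[OF C] pq_notin by simp
  also have "card (C - {(p, ?a), (?a, q)}) = card C - 2"
    using pa aq ne oriented_fanD(1)[OF C] by (subst card_Diff_subset) auto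
  finally show "Suc (card C0) = card C"
    using card_mono[OF oriented_fanD(1)[OF C], of "{(p, ?a), (?a, q)}"] pa aq ne by auto
  have new: "cone_of {p, q} \<inter> cone_of {c, d} \<subseteq> cone_of ({p, q} \<inter> {c, d})"
    if cd: "(c, d) \<in> C" "(c, d) \<noteq> (p, ?a)" "(c, d) \<noteq> (?a, q)" for c d
  proof -
    have "cone_of {p, q} \<inter> cone_of {c, d} \<subseteq> cone_of ({p, ?a} \<inter> {c, d}) \<union> cone_of ({?a, q} \<inter> {c, d})"
      unfolding subdivide_cone[OF pq] using oriented_fanD(3)[OF C pa cd(1)] oriented_fanD(3)[OF C aq cd(1)] cd by blast
    also have "\<dots> \<subseteq> cone_of ({p, q} \<inter> {c, d})"
      using mem[OF cd] by (intro Un_least hull_mono) auto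
    finally show ?thesis .
  qed
  show "oriented_fan C0"
    unfolding oriented_fan_def
  proof (intro conjI)
    show "finite C0" using oriented_fanD(1)[OF C] by (simp add: C0_def)
    show "\<forall>(a, b)\<in>C0. basis a b" using oriented_fanD(2)[OF C] pq by (auto simp: C0_def)
    show "\<forall>v. \<exists>(a, b)\<in>C0. v \<in> cone_of {a, b}"
    proof
      fix v
      obtain a b where "(a, b) \<in> C" "v \<in> cone_of {a, b}" using oriented_fanD(4)[OF C] by blast
      then show "\<exists>(a, b)\<in>C0. v \<in> cone_of {a, b}"
        using subdivide_cone[OF pq] unfolding C0_def by blast
    qed
    show "\<forall>(a, b)\<in>C0. \<forall>(c, d)\<in>C0. (a, b) \<noteq> (c, d) \<longrightarrow>
        cone_of {a, b} \<inter> cone_of {c, d} \<subseteq> cone_of ({a, b} \<inter> {c, d})"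
    proof (clarify, goal_cases)
      case (1 a b c d v)
      consider "(a, b) = (p, q)" "(c, d) \<in> C" "(c, d) \<noteq> (p, ?a)" "(c, d) \<noteq> (?a, q)"
        | "(c, d) = (p, q)" "(a, b) \<in> C" "(a, b) \<noteq> (p, ?a)" "(a, b) \<noteq> (?a, q)"
        | "(a, b) \<in> C" "(c, d) \<in> C" "(a, b) \<noteq> (c, d)"
        using 1 by (auto simp: C0_def)
      then show ?case
      proof cases
        case 1
        then show ?thesis using new[OF 1(2-4)] \<open>v \<in> cone_of {a, b}\<close> \<open>v \<in> cone_of {c, d}\<close> by blast
      next
        case 2
        then have "v \<in> cone_of ({p, q} \<inter> {a, b})"
          using new[OF 2(2-4)] \<open>v \<in> cone_of {a, b}\<close> \<open>v \<in> cone_of {c, d}\<close> by blast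
        then show ?thesis using 2(1) by (simp add: Int_commute)
      next
        case 3
        then show ?thesis using oriented_fanD(3)[OF C 3] \<open>v \<in> cone_of {a, b}\<close> \<open>v \<in> cone_of {c, d}\<close> by blast
      qed
    qed
  qed
qed

section \<open>Standard fans\<close>

definition plane_fan :: "'v \<Rightarrow> 'v \<Rightarrow> ('v \<times> 'v) set" where
  "plane_fan u w = {(u, w), (w, - u - w), (- u - w, u)}"

text \<open>For the standard basis and \<open>x = a\<close> these are the maximal cones of the fan
  of the surface with index \<open>a\<close>. Negative \<open>x\<close> occurs during the descent
  and is turned positive by reading the cyclic order from the opposite ray.\<close>

definition hirz_fan :: "'v \<Rightarrow> 'v \<Rightarrow> int \<Rightarrow> ('v \<times> 'v) set" where
  "hirz_fan u w x = {(u, w), (w, - u + of_int x *\<^sub>R w), (- u + of_int x *\<^sub>R w, - w), (- w, u)}"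

lemma plane_fan_cover:
  assumes "basis u w"
  shows "\<exists>a b. (a, b) \<in> plane_fan u w \<and> v \<in> cone_of {a, b}"
proof -
  note uw = basis_facts[OF assms]
  have bas: "basis w (- u - w)" "basis (- u - w) u"
    using uw by (auto simp: basis_def intro!: N_diff N_neg)
  have "0 \<le> area v w \<and> 0 \<le> area u v \<or> area v w \<le> 0 \<and> area v w \<le> area u v \<or> area u v \<le> 0 \<and> area u v \<le> area v w"
    by linarith
  then have "v \<in> cone_of {u, w} \<or> v \<in> cone_of {w, - u - w} \<or> v \<in> cone_of {- u - w, u}"
    using skew[of v u] skew[of w v]
    unfolding mem_cone_pair[OF assms] mem_cone_pair[OF bas(1)] mem_cone_pair[OF bas(2)] by auto
  then show ?thesis unfolding plane_fan_def by blast
qed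

lemma hirz_fan_cones:
  fixes x :: int
  assumes "basis u w"
  defines "w' \<equiv> - u + of_int x *\<^sub>R w"
  shows "basis w w'" "basis w' (- w)" "basis (- w) u"
    "v \<in> cone_of {u, w} \<longleftrightarrow> 0 \<le> area v w \<and> 0 \<le> area u v"
    "v \<in> cone_of {w, w'} \<longleftrightarrow> area v w \<le> 0 \<and> 0 \<le> area u v + of_int x * area v w"
    "v \<in> cone_of {w', - w} \<longleftrightarrow> area v w \<le> 0 \<and> area u v + of_int x * area v w \<le> 0"
    "v \<in> cone_of {- w, u} \<longleftrightarrow> 0 \<le> area v w \<and> area u v \<le> 0"
proof -
  note uw = basis_facts[OF assms(1)]
  have "w' \<in> N" using uw unfolding w'_def by (intro N_add N_neg N_scale) auto
  then show bas: "basis w w'" "basis w' (- w)" "basis (- w) u"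
    using uw by (auto simp: basis_def w'_def N_neg)
  have sk: "area v u = - area u v" "area w v = - area v w" by (rule skew)+
  show "v \<in> cone_of {u, w} \<longleftrightarrow> 0 \<le> area v w \<and> 0 \<le> area u v"
    "v \<in> cone_of {w, w'} \<longleftrightarrow> area v w \<le> 0 \<and> 0 \<le> area u v + of_int x * area v w"
    "v \<in> cone_of {w', - w} \<longleftrightarrow> area v w \<le> 0 \<and> area u v + of_int x * area v w \<le> 0"
    "v \<in> cone_of {- w, u} \<longleftrightarrow> 0 \<le> area v w \<and> area u v \<le> 0"
    unfolding mem_cone_pair[OF assms(1)] mem_cone_pair[OF bas(1)] mem_cone_pair[OF bas(2)] mem_cone_pair[OF bas(3)]
    by (auto simp: w'_def sk)
qed

lemma hirz_fan_cover:
  assumes "basis u w"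
  shows "\<exists>a b. (a, b) \<in> hirz_fan u w x \<and> v \<in> cone_of {a, b}"
proof -
  let ?w' = "- u + of_int x *\<^sub>R w"
  have "v \<in> cone_of {u, w} \<or> v \<in> cone_of {w, ?w'} \<or> v \<in> cone_of {?w', - w} \<or> v \<in> cone_of {- w, u}"
    using hirz_fan_cones(4,7)[OF assms, of v] hirz_fan_cones(5,6)[OF assms, of v x] by linarith
  then show ?thesis unfolding hirz_fan_def by blast
qed

lemma oriented_hirz_fan:
  assumes "basis u w"
  shows "oriented_fan (hirz_fan u w x)"
  unfolding oriented_fan_def
proof (intro conjI)
  let ?w' = "- u + of_int x *\<^sub>R w"
  note H = hirz_fan_cones(4-7)[OF assms]
  note bas = hirz_fan_cones(1-2)[OF assms, of x] hirz_fan_cones(3)[OF assms]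
  show "finite (hirz_fan u w x)" by (simp add: hirz_fan_def)
  show "\<forall>(a, b)\<in>hirz_fan u w x. basis a b" using assms bas by (auto simp: hirz_fan_def)
  show "\<forall>v. \<exists>(a, b)\<in>hirz_fan u w x. v \<in> cone_of {a, b}"
    using hirz_fan_cover[OF assms, of x] by blast
  have i1: "cone_of {u, w} \<inter> cone_of {w, ?w'} \<subseteq> cone_of {w}"
  proof
    fix v assume "v \<in> cone_of {u, w} \<inter> cone_of {w, ?w'}"
    then show "v \<in> cone_of {w}"
      using mem_cone_iff[OF assms, of "{w}" v] unfolding Int_iff H by simp
  qed
  have i2: "cone_of {u, w} \<inter> cone_of {?w', - w} \<subseteq> cone_of {}"
  proof
    fix v assume "v \<in> cone_of {u, w} \<inter> cone_of {?w', - w}"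
    then have "area v w = 0" "area u v = 0" unfolding Int_iff H by auto
    then show "v \<in> cone_of {}" using basis_expand[OF assms, of v] by simp
  qed
  have i3: "cone_of {u, w} \<inter> cone_of {- w, u} \<subseteq> cone_of {u}"
  proof
    fix v assume "v \<in> cone_of {u, w} \<inter> cone_of {- w, u}"
    then show "v \<in> cone_of {u}"
      using mem_cone_iff[OF assms, of "{u}" v] unfolding Int_iff H by simp
  qed
  have i4: "cone_of {w, ?w'} \<inter> cone_of {?w', - w} \<subseteq> cone_of {?w'}"
  proof
    fix v assume "v \<in> cone_of {w, ?w'} \<inter> cone_of {?w', - w}"
    then have "area v w \<le> 0" "area u v + of_int x * area v w = 0" unfolding Int_iff H by auto
    then show "v \<in> cone_of {?w'}"
      using mem_cone_iff[OF bas(1), of "{?w'}" v] skew[of v u] skew[of w v] by simp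
  qed
  have i5: "cone_of {w, ?w'} \<inter> cone_of {- w, u} \<subseteq> cone_of {}"
  proof
    fix v assume "v \<in> cone_of {w, ?w'} \<inter> cone_of {- w, u}"
    then have "area v w = 0" "area u v = 0" unfolding Int_iff H by auto
    then show "v \<in> cone_of {}" using basis_expand[OF assms, of v] by simp
  qed
  have i6: "cone_of {?w', - w} \<inter> cone_of {- w, u} \<subseteq> cone_of {- w}"
  proof
    fix v assume "v \<in> cone_of {?w', - w} \<inter> cone_of {- w, u}"
    then have "area v w = 0" "area u v \<le> 0" unfolding Int_iff H by auto
    then show "v \<in> cone_of {- w}"
      using mem_cone_iff[OF bas(3), of "{- w}" v] skew[of v u] skew[of w v] by simp
  qed
  have i: "cone_of {a, b} \<inter> cone_of {c, d} \<subseteq> cone_of ({a, b} \<inter> {c, d})"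
    if "cone_of {a, b} \<inter> cone_of {c, d} \<subseteq> cone_of X" "X \<subseteq> {a, b} \<inter> {c, d}" for a b c d :: 'v and X
    using that hull_mono[OF that(2)] by blast
  show "\<forall>(a, b)\<in>hirz_fan u w x. \<forall>(c, d)\<in>hirz_fan u w x. (a, b) \<noteq> (c, d) \<longrightarrow>
        cone_of {a, b} \<inter> cone_of {c, d} \<subseteq> cone_of ({a, b} \<inter> {c, d})"
    using i[OF i1] i[OF i2] i[OF i3] i[OF i4] i[OF i5] i[OF i6]
    unfolding hirz_fan_def by (simp add: Int_commute)
qed

end

context plane_lattice
begin

section \<open>Classification by extremal rays\<close>

definition fan_rays :: "('v \<times> 'v) set \<Rightarrow> 'v set" where
  "fan_rays C = fst ` C"

lemma fan_rays_iff: "oriented_fan C \<Longrightarrow> a \<in> fan_rays C \<longleftrightarrow> (\<exists>p q. (p, a) \<in> C \<and> (a, q) \<in> C)"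
  unfolding fan_rays_def using neighbours_exist[of C a _ a] by force

lemma edge_rays: "oriented_fan C \<Longrightarrow> (p, q) \<in> C \<Longrightarrow> p \<in> fan_rays C \<and> q \<in> fan_rays C"
  unfolding fan_rays_def using neighbours_exist(1)[of C p q q] by force

lemma fan_rays_N:
  assumes "oriented_fan C" "r \<in> fan_rays C"
  shows "r \<in> N" "r \<noteq> 0"
proof -
  obtain b where "(r, b) \<in> C" using assms(2) by (auto simp: fan_rays_def)
  from basis_facts[OF oriented_fanD(2)[OF assms(1) this]] show "r \<in> N" "r \<noteq> 0" by auto
qed

text \<open>The coefficient is the negative of the self-intersection number of the invariant curve
  of \<open>a\<close>; the value 1 means that this curve is exceptional and can be
  contracted.\<close>

lemma neighbour_sum:
  assumes C: "oriented_fan C" and "(p, a) \<in> C" "(a, q) \<in> C"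
  shows "p + q = area p q *\<^sub>R a"
proof -
  have bas: "basis p a" "basis a q" using oriented_fanD(2)[OF C] assms by auto
  have "q = area q a *\<^sub>R p + area p q *\<^sub>R a" by (rule basis_expand[OF bas(1)])
  then have "q = area p q *\<^sub>R a - p" using basis_facts[OF bas(2)] by simp
  then show ?thesis by (metis add.commute diff_add_cancel)
qed

lemma finite_max_exists:
  fixes f :: "'a \<Rightarrow> real"
  assumes "finite X" "X \<noteq> {}"
  obtains a where "a \<in> X" "\<And>b. b \<in> X \<Longrightarrow> f b \<le> f a"
proof -
  have "Max (f ` X) \<in> f ` X" using assms by simp
  then obtain a where "a \<in> X" "Max (f ` X) = f a" by auto
  then show ?thesis using that[of a] assms(1) by (metis Max_ge finite_imageI imageI)
qed

text \<open>A ray on which an integral linear form attains a maximum of at least 2 is the sum of its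
  neighbours: three neighbours on one level would make the form divisible.\<close>

lemma top_level_contractible:
  assumes C: "oriented_fan C" and pr: "(p, r) \<in> C" and rq: "(r, q) \<in> C"
    and z: "z \<in> N" "y \<in> N" "area z y = 1"
    and h: "2 \<le> area z r" "area z p \<le> area z r" "area z q \<le> area z r" "0 < area z p + area z q"
  shows "p + q = r"
proof -
  have bas: "basis p r" "basis r q" using oriented_fanD(2)[OF C] pr rq by auto
  obtain k where k: "area p q = of_int k" using N_area bas by (metis Ints_cases basis_facts(6,7))
  have sum: "p + q = of_int k *\<^sub>R r" using neighbour_sum[OF C pr rq] k by simp
  then have eq: "area z p + area z q = of_int k * area z r"
  proof -
    have "area z (p + q) = area z (of_int k *\<^sub>R r)" by (simp only: sum)
    then show ?thesis by simp
  qed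
  have "0 < of_int k * area z r" "of_int k * area z r \<le> 2 * area z r" using eq h by linarith+
  then have "0 < k" "k \<le> 2" using h(1) by (auto simp: zero_less_mult_iff)
  then consider "k = 1" | "k = 2" by linarith
  then show ?thesis
  proof cases
    case 2
    then have lev: "area z q = area z r" using eq h by simp
    have "z = area z q *\<^sub>R r + area r z *\<^sub>R q"
      using pluecker[of r q z] basis_facts(1)[OF bas(2)] by simp
    also have "\<dots> = area z r *\<^sub>R (r - q)"
      using skew[of r z] lev by (simp add: algebra_simps)
    finally have "area z y = area z r * area (r - q) y"
      by (metis area_simps(5))
    moreover have "area z r \<in> \<int>" "area (r - q) y \<in> \<int>"
      using z basis_facts[OF bas(2)] by (auto intro: N_area N_diff simp del: area_simps)
    ultimately obtain i j where "area z r = of_int i" "of_int (i * j) = (1::real)"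
      using z(3) by (metis Ints_cases of_int_mult)
    then have "area z r = of_int i" "i * j = 1" by (simp_all only: of_int_eq_1_iff)
    then show ?thesis using h(1) by (auto simp: zmult_eq_1_iff)
  qed (use sum in simp)
qed

text \<open>The cones at \<open>a\<close> leave only the cone of \<open>q\<close> and
  \<open>p\<close> to be covered. If it is not itself a cone of the fan, some ray lies in its
  interior, and an interior ray with the largest coordinate sum is the sum of its
  neighbours.\<close>

lemma plane_case:
  assumes C: "oriented_fan C" and pa: "(p, a) \<in> C" and aq: "(a, q) \<in> C" and sum: "p + q = - a"
  shows "(\<exists>p q. (p, p + q) \<in> C \<and> (p + q, q) \<in> C) \<or> C = plane_fan p a"
proof (cases "(q, p) \<in> C")
  case True
  have q: "q = - p - a" using sum by (metis add_diff_cancel_left' uminus_add_conv_diff diff_conv_add_uminus add.commute)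
  have bas: "basis p a" using oriented_fanD(2)[OF C pa] .
  have "plane_fan p a \<subseteq> C" using True pa aq unfolding plane_fan_def q by simp
  then have "C = plane_fan p a"
    using covering_subfan[OF C] plane_fan_cover[OF bas] by blast
  then show ?thesis ..
next
  case False
  have bas: "basis p a" "basis a q" using oriented_fanD(2)[OF C] pa aq by auto
  note f = basis_facts[OF bas(1)] basis_facts[OF bas(2)]
  have q: "q = - p - a" using sum by (metis add_diff_cancel_left' uminus_add_conv_diff diff_conv_add_uminus add.commute)
  have qp: "basis q p" using f by (auto simp: basis_def q)
  note fq = basis_facts[OF qp]
  \<comment> \<open>\<open>area z\<close> is the sum of the two coordinates in the basis
    \<open>q\<close>, \<open>p\<close>: 1 on the edges and at least 2 on every ray strictly between
    them.\<close>
  define z where "z = q - p"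
  have L: "area z v = area v p + area q v" for v using skew[of p v] by (simp add: z_def)
  have zN: "z \<in> N" using f by (simp add: z_def N_diff)
  have Lq: "area z q = 1" "area z p = 1" using fq by (simp_all add: L)
  have region: "r \<in> cone_of {q, p}" if r: "r \<in> fan_rays C" "r \<notin> {p, a, q}" for r
  proof -
    obtain s where rs: "(r, s) \<in> C" using r(1) by (auto simp: fan_rays_def)
    have "r \<notin> cone_of {p, a}" using ray_in_cone[OF C rs _ pa, of r] r by auto
    moreover have "r \<notin> cone_of {a, q}" using ray_in_cone[OF C rs _ aq, of r] r by auto
    ultimately show ?thesis
      using plane_fan_cover[OF bas(1), of r] unfolding plane_fan_def q by auto
  qed
  note rN = fan_rays_N[OF C]
  have L2: "2 \<le> area z r" if r: "r \<in> fan_rays C" "r \<notin> {p, a, q}" for r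
  proof -
    obtain x y where xy: "area r p = of_int x" "area q r = of_int y"
      using N_area rN(1)[OF r(1)] f by (meson Ints_cases)
    have nn: "0 \<le> x" "0 \<le> y" using region[OF r] mem_cone_pair[OF qp] xy by auto
    have ex: "r = of_int x *\<^sub>R q + of_int y *\<^sub>R p" using basis_expand[OF qp, of r] xy by simp
    have "r \<noteq> 0" using rN(2)[OF r(1)] .
    then have "\<not> (x = 0 \<and> y = 0)" "\<not> (x = 1 \<and> y = 0)" "\<not> (x = 0 \<and> y = 1)" using ex r(2) by auto
    then have "2 \<le> x + y" using nn by linarith
    then show ?thesis unfolding L xy by linarith
  qed
  have L1: "0 < area z r" if "r \<in> fan_rays C" "r \<noteq> a" for r
    using L2[OF that(1)] Lq that(2) by fastforce
  obtain r0 where r0: "(q, r0) \<in> C" using neighbours_exist(1)[OF C aq, of q] by blast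
  have "r0 \<noteq> p" "r0 \<noteq> q" "r0 \<noteq> a" using False r0 basis_facts[OF oriented_fanD(2)[OF C r0]] f by auto
  then have r0': "r0 \<in> fan_rays C - {a}" "2 \<le> area z r0" using L2[of r0] edge_rays[OF C r0] by auto
  have "finite (fan_rays C - {a})" using oriented_fanD(1)[OF C] by (simp add: fan_rays_def)
  then obtain r where r: "r \<in> fan_rays C - {a}" "\<And>s. s \<in> fan_rays C - {a} \<Longrightarrow> area z s \<le> area z r"
    using finite_max_exists[of "fan_rays C - {a}" "area z"] r0' by blast
  have h: "2 \<le> area z r" using r(2)[OF r0'(1)] r0'(2) by simp
  then have rne: "r \<noteq> p" "r \<noteq> q" using Lq by auto
  obtain p' q' where n: "(p', r) \<in> C" "(r, q') \<in> C" using r(1) fan_rays_iff[OF C] by blast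
  have "p' \<noteq> a" "q' \<noteq> a"
    using successor_unique[OF C aq, of r] predecessor_unique[OF C pa, of r] n rne by auto
  then have pq': "p' \<in> fan_rays C - {a}" "q' \<in> fan_rays C - {a}"
    using edge_rays[OF C n(1)] edge_rays[OF C n(2)] by auto
  have "p' + q' = r"
    using top_level_contractible[OF C n zN _ Lq(1) h r(2)[OF pq'(1)] r(2)[OF pq'(2)]] f
      L1[of p'] L1[of q'] pq' by (simp add: add_pos_pos)
  then show ?thesis using n by blast
qed

text \<open>The rays \<open>- e\<close>, \<open>a\<close>, \<open>e\<close> bound a half plane
  already covered by two cones, and every ray beyond it has positive height \<open>area e\<close>. A
  ray of maximal height at least 2 is contractible.\<close>

lemma hirz_case:
  assumes C: "oriented_fan C" and pa: "(- e, a) \<in> C" and ae: "(a, e) \<in> C"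
  shows "(\<exists>p q. (p, p + q) \<in> C \<and> (p + q, q) \<in> C) \<or> (\<exists>x. C = hirz_fan a e x)"
proof -
  have bas: "basis (- e) a" "basis a e" using oriented_fanD(2)[OF C] pa ae by auto
  note f = basis_facts[OF bas(2)]
  note rN = fan_rays_N[OF C]
  have y_pos: "0 < area e r" if r: "r \<in> fan_rays C" "r \<notin> {a, e, - e}" for r
  proof (rule ccontr)
    assume neg: "\<not> 0 < area e r"
    obtain s where rs: "(r, s) \<in> C" using r(1) by (auto simp: fan_rays_def)
    have "r \<in> cone_of {a, e} \<or> r \<in> cone_of {- e, a}"
      using neg skew[of r e] skew[of r a] mem_cone_pair[OF bas(1), of r] mem_cone_pair[OF bas(2), of r] by auto
    then show False using ray_in_cone[OF C rs _ pa, of r] ray_in_cone[OF C rs _ ae, of r] r by auto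
  qed
  obtain g where ef: "(e, g) \<in> C" using neighbours_exist(1)[OF C ae, of e] by blast
  have eg: "area e g = 1" using basis_facts(1)[OF oriented_fanD(2)[OF C ef]] .
  have gne: "g \<noteq> a" "g \<noteq> e" "g \<noteq> - e" using eg f by auto
  have gR: "g \<in> fan_rays C" using edge_rays[OF C ef] by simp
  have "finite (fan_rays C)" "fan_rays C \<noteq> {}" using oriented_fanD(1)[OF C] gR by (auto simp: fan_rays_def)
  then obtain r where r: "r \<in> fan_rays C" "\<And>s. s \<in> fan_rays C \<Longrightarrow> area e s \<le> area e r"
    using finite_max_exists[of "fan_rays C" "area e"] by blast
  obtain h where h: "area e r = of_int h" using N_area rN(1)[OF r(1)] f by (meson Ints_cases)
  have "1 \<le> h" using r(2)[OF gR] eg h by simp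
  then consider "h = 1" | "2 \<le> h" by linarith
  then show ?thesis
  proof cases
    case 2
    then have rh: "2 \<le> area e r" using h by simp
    then have rne: "r \<noteq> a" "r \<noteq> e" "r \<noteq> - e" using f by auto
    obtain p q where n: "(p, r) \<in> C" "(r, q) \<in> C" using r(1) fan_rays_iff[OF C] by blast
    have pqR: "p \<in> fan_rays C" "q \<in> fan_rays C" using edge_rays[OF C n(1)] edge_rays[OF C n(2)] by auto
    have "p \<noteq> a" "q \<noteq> a"
      using successor_unique[OF C ae, of r] predecessor_unique[OF C pa, of r] n rne by auto
    have "p \<noteq> e" "p \<noteq> - e"
      using basis_facts[OF oriented_fanD(2)[OF C n(1)]] rh by auto
    then have "0 < area e p" using y_pos[OF pqR(1)] \<open>p \<noteq> a\<close> by simp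
    moreover have "0 \<le> area e q" using y_pos[OF pqR(2)] \<open>q \<noteq> a\<close> by (cases "q \<in> {e, - e}") auto
    ultimately have "p + q = r"
      using top_level_contractible[OF C n _ _ eg rh r(2)[OF pqR(1)] r(2)[OF pqR(2)]] f rN(1)[OF gR] by simp
    then show ?thesis using n by blast
  next
    case 1
    \<comment> \<open>All heights are now at most 1, and \<open>g\<close> is the successor of
      \<open>e\<close>. Either the next ray is \<open>- e\<close> and a Hirzebruch fan closes up, or
      it has height 1 as well, which makes \<open>g\<close> the sum of its neighbours.\<close>
    define x where "x = area a g"
    obtain xi where xi: "x = of_int xi" unfolding x_def using N_area rN(1)[OF gR] f by (meson Ints_cases)
    have gx: "g = - a + x *\<^sub>R e"
      using basis_expand[OF bas(2), of g] eg skew[of g e] by (simp add: x_def)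
    obtain s where gs: "(g, s) \<in> C" using gR by (auto simp: fan_rays_def)
    have sR: "s \<in> fan_rays C" using edge_rays[OF C gs] by simp
    note fg = basis_facts[OF oriented_fanD(2)[OF C gs]]
    have "s \<noteq> a" using predecessor_unique[OF C pa, of g] gs gne by auto
    have "s \<noteq> e" using fg(2) eg by auto
    show ?thesis
    proof (cases "s = - e")
      case True
      have "hirz_fan a e xi \<subseteq> C"
        unfolding hirz_fan_def using ae ef gs pa True gx xi by simp
      then have "C = hirz_fan a e xi"
        using covering_subfan[OF C] hirz_fan_cover[OF bas(2)] by blast
      then show ?thesis by blast
    next
      case False
      then have "0 < area e s" using y_pos[OF sR] \<open>s \<noteq> a\<close> \<open>s \<noteq> e\<close> by simp
      moreover have "area e s \<le> 1" using r(2)[OF sR] h 1 by simp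
      moreover obtain j where "area e s = of_int j" using N_area rN(1)[OF sR] f by (meson Ints_cases)
      ultimately have es: "area e s = 1" by simp
      have "e = area e s *\<^sub>R g + area g e *\<^sub>R s"
        using pluecker[of g s e] fg(1) by simp
      then have "e + s = g" using es eg skew[of g e] by (simp add: algebra_simps)
      then show ?thesis using ef gs by blast
    qed
  qed
qed

text \<open>At a longest ray generator \<open>a\<close> with neighbours \<open>p\<close>,
  \<open>q\<close>, the parallelogram law makes \<open>p + q\<close> strictly shorter than twice
  \<open>a\<close>. As \<open>p + q\<close> is an integral multiple of \<open>a\<close>, only 1, 0
  and -1 remain: a contraction, opposite neighbours, or the shape of the projective plane.\<close>

lemma oriented_fan_classification:
  assumes C: "oriented_fan C"
  shows "(\<exists>p q. (p, p + q) \<in> C \<and> (p + q, q) \<in> C) \<or> (\<exists>u w. basis u w \<and> C = plane_fan u w) \<or>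
    (\<exists>u w x. basis u w \<and> C = hirz_fan u w x)"
proof -
  have "finite (fan_rays C)" "fan_rays C \<noteq> {}"
    using oriented_fanD(1,4)[OF C] by (auto simp: fan_rays_def)
  then obtain a where a: "a \<in> fan_rays C" "\<And>b. b \<in> fan_rays C \<Longrightarrow> norm b \<le> norm a"
    using finite_max_exists[of "fan_rays C" norm] by blast
  obtain p q where n: "(p, a) \<in> C" "(a, q) \<in> C" using a(1) fan_rays_iff[OF C] by blast
  have bas: "basis p a" "basis a q" using oriented_fanD(2)[OF C] n by auto
  note f = basis_facts[OF bas(1)] basis_facts[OF bas(2)]
  have pqR: "p \<in> fan_rays C" "q \<in> fan_rays C" using edge_rays[OF C n(1)] edge_rays[OF C n(2)] by auto
  obtain k where k: "area p q = of_int k" using N_area f by (meson Ints_cases)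
  have sum: "p + q = of_int k *\<^sub>R a" using neighbour_sum[OF C n] k by simp
  have "p \<noteq> q" using f by auto
  have "(norm (p + q))\<^sup>2 + (norm (p - q))\<^sup>2 = 2 * (norm p)\<^sup>2 + 2 * (norm q)\<^sup>2"
    by (simp add: power2_norm_eq_inner inner_add_left inner_add_right inner_diff_left inner_diff_right inner_commute)
  moreover have "0 < (norm (p - q))\<^sup>2" using \<open>p \<noteq> q\<close> by simp
  moreover have "(norm p)\<^sup>2 \<le> (norm a)\<^sup>2" "(norm q)\<^sup>2 \<le> (norm a)\<^sup>2"
    using a(2) pqR by (auto intro: power_mono)
  ultimately have "(norm (p + q))\<^sup>2 < 4 * (norm a)\<^sup>2" by linarith
  then have "(of_int k)\<^sup>2 * (norm a)\<^sup>2 < 4 * (norm a)\<^sup>2"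
    unfolding sum by (simp add: power_mult_distrib)
  then have "(real_of_int k)\<^sup>2 < 2\<^sup>2" using f by simp
  then have "\<bar>real_of_int k\<bar>\<^sup>2 < 2\<^sup>2" by simp
  then have "\<bar>real_of_int k\<bar> < 2" by (rule power2_less_imp_less) simp
  then consider "k = 1" | "k = 0" | "k = - 1" by linarith
  then show ?thesis
  proof cases
    case 1
    then have "p + q = a" using sum by simp
    then show ?thesis using n by blast
  next
    case 2
    then have "p = - q" using sum by (simp add: eq_neg_iff_add_eq_0)
    then show ?thesis using hirz_case[OF C, of q a] n bas(2) by blast
  next
    case 3
    then have "p + q = - a" using sum by simp
    then show ?thesis using plane_case[OF C n] bas(1) by blast
  qed
qed

section \<open>Elementary transformations and the induction principle\<close>

lemma hirz_fan_distinct: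
  assumes "basis u w"
  shows "distinct [u, w, - u + of_int x *\<^sub>R w, - w]"
proof -
  let ?w' = "- u + of_int x *\<^sub>R w"
  note f = basis_facts[OF assms(1)]
  have v: "area u w = 1" "area w w = 0" "area ?w' w = - 1" "area (- w) w = 0" using f by simp_all
  have "u \<noteq> ?w'" using v by (metis one_neq_neg_one)
  moreover have "w \<noteq> ?w'" "?w' \<noteq> - w" using v by (metis zero_neq_neg_one)+
  moreover have "w \<noteq> - w" using f(5) by (simp add: eq_neg_iff_add_eq_0 flip: scaleR_2)
  ultimately show ?thesis using f by simp
qed

lemma hirz_fan_rotate: "hirz_fan u w x = hirz_fan (- u + of_int x *\<^sub>R w) (- w) (- x)"
  unfolding hirz_fan_def by auto

text \<open>An elementary transformation: after the blow-up of a fixed point the ray of the fibre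
  through it is the sum of its neighbours. Contracting it instead of the new ray gives a Hirzebruch
  fan whose index has the other parity.\<close>

lemma blowup_hirz_swap:
  assumes uw: "basis u w" and pq: "(p, q) \<in> hirz_fan u w x"
  shows "\<exists>u' w' p' q'. basis u' w' \<and> (p', q') \<in> hirz_fan u' w' (x + 1) \<and>
      blowup (hirz_fan u w x) p q = blowup (hirz_fan u' w' (x + 1)) p' q' \<or>
    basis u' w' \<and> (p', q') \<in> hirz_fan u' w' (1 - x) \<and>
      blowup (hirz_fan u w x) p q = blowup (hirz_fan u' w' (1 - x)) p' q'"
proof -
  \<comment> \<open>Two of the four cones are treated directly; the other two become these after
    rotating the fan, which negates the index and accounts for the alternative
    \<open>1 - x\<close>.\<close>
  have base: "\<exists>u' w' p' q'. basis u' w' \<and> (p', q') \<in> hirz_fan u' w' (x + 1) \<and>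
      blowup (hirz_fan u w x) p q = blowup (hirz_fan u' w' (x + 1)) p' q'"
    if uw: "basis u w" and pq: "(p, q) = (u, w) \<or> (p, q) = (w, - u + of_int x *\<^sub>R w)" for u w x p q
  proof -
    let ?w' = "- u + of_int x *\<^sub>R w"
    note f = basis_facts[OF uw]
    note d = hirz_fan_distinct[OF uw, of x]
    consider "(p, q) = (u, w)" | "(p, q) = (w, ?w')" using pq by blast
    then show ?thesis
    proof cases
      case 1
      have b': "basis (u + w) w" using f by (simp add: basis_def N_add)
      note d' = hirz_fan_distinct[OF b', of "x + 1"]
      \<comment> \<open>With \<open>u + w\<close> in the role of \<open>u\<close>, raising the index
        by one keeps the opposite fibre ray; the old ray \<open>u\<close> reappears as the sum of
        \<open>- w\<close> and \<open>u + w\<close>.\<close>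
      have e: "- (u + w) + of_int (x + 1) *\<^sub>R w = ?w'" by (simp add: algebra_simps)
      have "blowup (hirz_fan u w x) p q = {(u, u + w), (u + w, w), (w, ?w'), (?w', - w), (- w, u)}"
        using 1 d unfolding blowup_def hirz_fan_def by auto
      moreover have "blowup (hirz_fan (u + w) w (x + 1)) (- w) (u + w) =
          {(- w, u), (u, u + w), (u + w, w), (w, ?w'), (?w', - w)}"
        using d' unfolding blowup_def hirz_fan_def e by auto
      moreover have "(- w, u + w) \<in> hirz_fan (u + w) w (x + 1)" by (simp add: hirz_fan_def)
      ultimately show ?thesis using b' by (metis insert_commute)
    next
      case 2
      note d' = hirz_fan_distinct[OF uw, of "x + 1"]
      have e: "- u + of_int (x + 1) *\<^sub>R w = w + ?w'" by (simp add: algebra_simps)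
      have "blowup (hirz_fan u w x) p q = {(w, w + ?w'), (w + ?w', ?w'), (u, w), (?w', - w), (- w, u)}"
        using 2 d unfolding blowup_def hirz_fan_def by auto
      moreover have "blowup (hirz_fan u w (x + 1)) (w + ?w') (- w) =
          {(w + ?w', ?w'), (?w', - w), (u, w), (w, w + ?w'), (- w, u)}"
        using d' unfolding blowup_def hirz_fan_def e by auto
      moreover have "(w + ?w', - w) \<in> hirz_fan u w (x + 1)" unfolding hirz_fan_def e by blast
      ultimately show ?thesis using uw by (metis insert_commute)
    qed
  qed
  let ?w' = "- u + of_int x *\<^sub>R w"
  have "(p, q) = (u, w) \<or> (p, q) = (w, ?w') \<or> (p, q) = (?w', - w) \<or> (p, q) = (- w, - ?w' + of_int (- x) *\<^sub>R (- w))"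
    using pq unfolding hirz_fan_def by auto
  then consider "(p, q) = (u, w) \<or> (p, q) = (w, ?w')"
    | "(p, q) = (?w', - w) \<or> (p, q) = (- w, - ?w' + of_int (- x) *\<^sub>R (- w))" by blast
  then show ?thesis
  proof cases
    case 1
    then show ?thesis using base[OF uw, of p q x] by blast
  next
    case 2
    show ?thesis
      using base[OF hirz_fan_cones(2)[OF uw, of x], of p q "- x"] 2 hirz_fan_rotate[of u w x] by (simp add: add.commute) blast
  qed
qed

text \<open>Even Hirzebruch fans are split off, because the intended property fails for them. When
  the descent contracts to such a fan, the present fan is presented as the blow-up of an odd one
  instead, which is a base case.\<close>

theorem oriented_fan_induct [consumes 1, case_names plane hirz blowup]:
  assumes C: "oriented_fan C"
    and plane: "\<And>u w. basis u w \<Longrightarrow> P (plane_fan u w)"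
    and hirz: "\<And>u w x. basis u w \<Longrightarrow> odd x \<Longrightarrow> P (hirz_fan u w x)"
    and blowup: "\<And>C p q. oriented_fan C \<Longrightarrow> P C \<Longrightarrow> (p, q) \<in> C \<Longrightarrow> oriented_fan (blowup C p q) \<Longrightarrow>
      card (blowup C p q) = Suc (card C) \<Longrightarrow> P (blowup C p q)"
  shows "(\<exists>u w x. basis u w \<and> even x \<and> C = hirz_fan u w x) \<or> P C"
  using C
proof (induction "card C" arbitrary: C rule: less_induct)
  case less
  consider (sum_ray) p q where "(p, p + q) \<in> C" "(p + q, q) \<in> C" | (plane) u w where "basis u w" "C = plane_fan u w"
    | (hirz) u w x where "basis u w" "C = hirz_fan u w x"
    using oriented_fan_classification[OF less.prems] by blast
  then show ?case
  proof cases
    case sum_ray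
    define C0 where "C0 = insert (p, q) (C - {(p, p + q), (p + q, q)})"
    have C0: "oriented_fan C0" "C = blowup C0 p q" "Suc (card C0) = card C" "(p, q) \<in> C0"
      using contract[OF less.prems sum_ray] by (auto simp: C0_def)
    show ?thesis
    proof (cases "P C0")
      case True
      then show ?thesis using blowup[OF C0(1) True C0(4)] C0 less.prems by simp
    next
      case False
      then obtain u w x where e: "basis u w" "even x" "C0 = hirz_fan u w x"
        using less.hyps[of C0] C0 by auto
      obtain u' w' x' p' q' where s: "basis u' w'" "odd x'" "(p', q') \<in> hirz_fan u' w' x'"
        "C = blowup (hirz_fan u' w' x') p' q'"
      proof -
        have "odd (x + 1)" "odd (1 - x)" using e(2) by auto
        then show ?thesis using that blowup_hirz_swap[OF e(1), of p q x] C0(2,4) e(3) by metis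
      qed
      \<comment> \<open>Both fans have four cones, so the count known for the even fan carries over
        to the odd one.\<close>
      have "card (hirz_fan u' w' x') = card C0"
        using hirz_fan_distinct[OF s(1), of x'] hirz_fan_distinct[OF e(1), of x] unfolding e(3) hirz_fan_def by simp
      then show ?thesis
        using blowup[OF oriented_hirz_fan[OF s(1)] hirz[OF s(1,2)] s(3)] less.prems s(4) C0(3) by simp
    qed
  next
    case plane
    then show ?thesis using assms(2) by blast
  next
    case hirz
    then show ?thesis using assms(3) by blast
  qed
qed

end

section \<open>Charts of real toric surfaces\<close>

context plane_lattice
begin

definition fan_cones :: "('v \<times> 'v) set \<Rightarrow> 'v set set" where
  "fan_cones C = cone_of ` faces C"

definition surface :: "('v \<times> 'v) set \<Rightarrow> ('v set \<times> ('v \<Rightarrow> real)) set topology" where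
  "surface C = toric_real_points N (fan_cones C)"

text \<open>The floor only converts an integral pairing into an exponent. On the semigroup of the
  cone of \<open>a\<close> and \<open>b\<close> the exponents are nonnegative and a zeroth power is
  1, so the same formula covers the points with vanishing coordinates.\<close>

definition torus_char :: "'v \<Rightarrow> 'v \<Rightarrow> real \<times> real \<Rightarrow> 'v \<Rightarrow> real" where
  "torus_char a b z m = fst z powi \<lfloor>m \<bullet> a\<rfloor> * snd z powi \<lfloor>m \<bullet> b\<rfloor>"

definition chart :: "('v \<times> 'v) set \<Rightarrow> 'v \<Rightarrow> 'v \<Rightarrow> real \<times> real \<Rightarrow> ('v set \<times> ('v \<Rightarrow> real)) set" where
  "chart C a b z = toric_point N (fan_cones C) (cone_of {a, b}, chart_restrict N (cone_of {a, b}) (torus_char a b z))"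

lemma separated_fan_cones: "oriented_fan C \<Longrightarrow> separated_fan N (fan_cones C)"
  unfolding fan_cones_def by (intro unimodular_separated unimodular_faces)

lemma Hausdorff_surface: "oriented_fan C \<Longrightarrow> Hausdorff_space (surface C)"
  unfolding surface_def by (rule separated_fan.Hausdorff_toric_real_points[OF separated_fan_cones])

lemma cone_in_fan: "(a, b) \<in> C \<Longrightarrow> cone_of {a, b} \<in> fan_cones C"
  by (auto simp: fan_cones_def faces_def)

lemma semigroup_dual: "m \<in> cone_semigroup N \<sigma> \<Longrightarrow> m \<in> dual_lattice N"
  by (simp add: cone_semigroup_def)

lemma floor_dual_add:
  assumes "m \<in> dual_lattice N" "m' \<in> dual_lattice N" "v \<in> N"
  shows "\<lfloor>(m + m') \<bullet> v\<rfloor> = \<lfloor>m \<bullet> v\<rfloor> + \<lfloor>m' \<bullet> v\<rfloor>"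
  using dual_int[OF assms(1,3)] dual_int[OF assms(2,3)] by (auto simp: inner_add_left elim!: Ints_cases)

lemma powi_add_nonneg: "0 \<le> m \<Longrightarrow> 0 \<le> n \<Longrightarrow> (x::real) powi (m + n) = x powi m * x powi n"
  by (simp add: power_int_def nat_add_distrib power_add)

text \<open>A coordinate may vanish only where its exponents are nonnegative; there powers of 0 are
  still multiplicative, while with negative exponents they would not be.\<close>

lemma torus_char_restrict:
  assumes N: "a \<in> N" "b \<in> N"
    and x: "fst z \<noteq> 0 \<or> (\<forall>m\<in>cone_semigroup N \<gamma>. 0 \<le> m \<bullet> a)"
    and y: "snd z \<noteq> 0 \<or> (\<forall>m\<in>cone_semigroup N \<gamma>. 0 \<le> m \<bullet> b)"
  shows "chart_restrict N \<gamma> (torus_char a b z) \<in> chart_points N \<gamma>"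
proof -
  have pw: "t powi \<lfloor>(m + m') \<bullet> v\<rfloor> = t powi \<lfloor>m \<bullet> v\<rfloor> * t powi \<lfloor>m' \<bullet> v\<rfloor>"
    if "v \<in> N" "t \<noteq> 0 \<or> (\<forall>m\<in>cone_semigroup N \<gamma>. 0 \<le> m \<bullet> v)" "m \<in> cone_semigroup N \<gamma>" "m' \<in> cone_semigroup N \<gamma>"
    for t :: real and v m m'
    unfolding floor_dual_add[OF semigroup_dual[OF that(3)] semigroup_dual[OF that(4)] that(1)]
    using that by (cases "t = 0") (auto simp: power_int_add intro: powi_add_nonneg)
  show ?thesis
    unfolding chart_points_def
    using pw[OF N(1) x] pw[OF N(2) y]
    by (auto simp: chart_restrict_def torus_char_def cone_semigroup_add)
qed

lemma chart_in_points:
  assumes "basis a b"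
  shows "chart_restrict N (cone_of {a, b}) (torus_char a b z) \<in> chart_points N (cone_of {a, b})"
  using basis_facts[OF assms] by (intro torus_char_restrict) (auto simp: cone_semigroup_cone_of)

lemma coordinate_characters:
  assumes "basis a b"
  shows "J (- b) \<in> cone_semigroup N (cone_of {a, b})" "J a \<in> cone_semigroup N (cone_of {a, b})"
    "torus_char a b z (J (- b)) = fst z" "torus_char a b z (J a) = snd z"
  using basis_facts[OF assms] by (auto simp: cone_semigroup_cone_of torus_char_def mem_dual N_neg)

text \<open>For a lattice basis the semigroup is freely generated by \<open>J (- b)\<close> and
  \<open>J a\<close>, so two values determine the point and the chart is an affine plane.\<close>

lemma chart_point_unique:
  assumes ab: "basis a b" and \<xi>: "\<xi> \<in> chart_points N (cone_of {a, b})"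
  shows "\<xi> = chart_restrict N (cone_of {a, b}) (torus_char a b (\<xi> (J (- b)), \<xi> (J a)))"
proof
  fix m
  note f = basis_facts[OF ab] and cc = coordinate_characters[OF ab]
  show "\<xi> m = chart_restrict N (cone_of {a, b}) (torus_char a b (\<xi> (J (- b)), \<xi> (J a))) m"
  proof (cases "m \<in> cone_semigroup N (cone_of {a, b})")
    case True
    then have m: "m \<in> dual_lattice N" "0 \<le> m \<bullet> a" "0 \<le> m \<bullet> b" by (auto simp: cone_semigroup_cone_of)
    then obtain n where n: "n \<in> N" "m = J n" using dual_eq by auto
    obtain i j where ij: "m \<bullet> a = of_int i" "m \<bullet> b = of_int j" using dual_int[OF m(1)] f by (meson Ints_cases)
    have nn: "0 \<le> i" "0 \<le> j" using m ij by auto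
    have "J n = area n b *\<^sub>R J a + area a n *\<^sub>R J b"
      using arg_cong[OF basis_expand[OF ab, of n], of J] linear_add[OF linear_J] linear_scale[OF linear_J] by simp
    then have "m = real (nat i) *\<^sub>R J (- b) + real (nat j) *\<^sub>R J a"
      using n ij nn skew[of a n] linear_neg[OF linear_J] by simp
    then have "\<xi> m = \<xi> (real (nat i) *\<^sub>R J (- b)) * \<xi> (real (nat j) *\<^sub>R J a)"
      using chart_points_add[OF \<xi>] cc by (simp add: cone_semigroup_scale del: area_simps)
    also have "\<dots> = \<xi> (J (- b)) ^ nat i * \<xi> (J a) ^ nat j"
      using chart_points_scale[OF \<xi>] cc by simp
    finally show ?thesis using True ij nn by (simp add: chart_restrict_def torus_char_def power_int_def)
  next
    case False
    then show ?thesis using \<xi> by (simp add: chart_restrict_def chart_points_outside)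
  qed
qed

lemma chart_inj:
  assumes C: "oriented_fan C" and ab: "(a, b) \<in> C" and eq: "chart C a b z = chart C a b z'"
  shows "z = z'"
proof -
  interpret separated_fan N "fan_cones C" by (rule separated_fan_cones[OF C])
  have bas: "basis a b" using oriented_fanD(2)[OF C ab] .
  have "chart_restrict N (cone_of {a, b}) (torus_char a b z) = chart_restrict N (cone_of {a, b}) (torus_char a b z')"
    using toric_point_inj[OF cone_in_fan[OF ab] chart_in_points[OF bas] chart_in_points[OF bas]] eq
    unfolding chart_def by blast
  note fun_cong[OF this, of "J (- b)"] fun_cong[OF this, of "J a"]
  then show ?thesis using coordinate_characters[OF bas] by (simp add: chart_restrict_def prod_eq_iff)
qed

lemma continuous_torus_char:
  "continuous_on UNIV (\<lambda>z. chart_restrict N (cone_of {a, b}) (torus_char a b z))"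
proof (rule continuous_on_coordinatewise_then_product)
  fix m
  show "continuous_on UNIV (\<lambda>z. chart_restrict N (cone_of {a, b}) (torus_char a b z) m)"
  proof (cases "m \<in> cone_semigroup N (cone_of {a, b})")
    case True
    then have "0 \<le> \<lfloor>m \<bullet> a\<rfloor>" "0 \<le> \<lfloor>m \<bullet> b\<rfloor>" by (auto simp: cone_semigroup_cone_of)
    then show ?thesis using True
      by (auto simp: chart_restrict_def torus_char_def intro!: continuous_intros)
  qed (simp add: chart_restrict_def)
qed

lemma chart_continuous:
  assumes C: "oriented_fan C" and ab: "(a, b) \<in> C"
  shows "continuous_map euclidean (surface C) (chart C a b)"
proof -
  have bas: "basis a b" using oriented_fanD(2)[OF C ab] .
  have "continuous_map euclidean (top_of_set (chart_points N (cone_of {a, b})))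
      (\<lambda>z. chart_restrict N (cone_of {a, b}) (torus_char a b z))"
    using continuous_torus_char chart_in_points[OF bas] by (auto simp: continuous_map_in_subtopology)
  from continuous_map_compose[OF this toric_real_points_continuous[OF cone_in_fan[OF ab]]]
  show ?thesis unfolding surface_def chart_def[abs_def] o_def .
qed

lemma chart_open:
  assumes C: "oriented_fan C" and ab: "(a, b) \<in> C" and W: "open W"
  shows "openin (surface C) (chart C a b ` W)"
proof -
  interpret separated_fan N "fan_cones C" by (rule separated_fan_cones[OF C])
  have bas: "basis a b" using oriented_fanD(2)[OF C ab] .
  let ?P = "chart_points N (cone_of {a, b}) :: ('v \<Rightarrow> real) set"
  let ?inv = "\<lambda>\<xi>::'v \<Rightarrow> real. (\<xi> (J (- b)), \<xi> (J a))"
  have "open (?inv -` W)"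
    by (intro open_vimage[OF W] continuous_on_Pair continuous_on_product_coordinates)
  then have "openin (top_of_set ?P) (?P \<inter> ?inv -` W)" by (simp add: openin_open_Int)
  moreover have "?P \<inter> ?inv -` W = (\<lambda>z. chart_restrict N (cone_of {a, b}) (torus_char a b z)) ` W"
  proof (intro equalityI subsetI)
    fix \<xi> assume "\<xi> \<in> ?P \<inter> ?inv -` W"
    then show "\<xi> \<in> (\<lambda>z. chart_restrict N (cone_of {a, b}) (torus_char a b z)) ` W"
      using chart_point_unique[OF bas, of \<xi>] by (intro image_eqI[of _ _ "?inv \<xi>"]) auto
  next
    fix \<xi> assume "\<xi> \<in> (\<lambda>z. chart_restrict N (cone_of {a, b}) (torus_char a b z)) ` W"
    then show "\<xi> \<in> ?P \<inter> ?inv -` W"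
      using chart_in_points[OF bas] coordinate_characters[OF bas] by (auto simp: chart_restrict_def)
  qed
  ultimately have "openin (top_of_set ?P) ((\<lambda>z. chart_restrict N (cone_of {a, b}) (torus_char a b z)) ` W)" by simp
  then have "openin (surface C) ((\<lambda>\<xi>. toric_point N (fan_cones C) (cone_of {a, b}, \<xi>)) `
      (\<lambda>z. chart_restrict N (cone_of {a, b}) (torus_char a b z)) ` W)"
    using chart_open_map[OF cone_in_fan[OF ab]] unfolding open_map_def surface_def by blast
  then show ?thesis unfolding image_image chart_def[abs_def] .
qed

lemma chart_in_surface: "oriented_fan C \<Longrightarrow> (a, b) \<in> C \<Longrightarrow> chart C a b z \<in> topspace (surface C)"
  using chart_continuous[of C a b] by (auto simp: continuous_map_def)

text \<open>A chart of a smaller cone sits inside the chart of any maximal cone having it as a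
  face.\<close>

lemma surface_cover:
  assumes C: "oriented_fan C" and P: "P \<in> topspace (surface C)"
  obtains a b z where "(a, b) \<in> C" "P = chart C a b z"
proof -
  interpret separated_fan N "fan_cones C" by (rule separated_fan_cones[OF C])
  obtain \<tau> \<xi> where \<tau>: "\<tau> \<in> fan_cones C" "\<xi> \<in> chart_points N \<tau>" "P = toric_point N (fan_cones C) (\<tau>, \<xi>)"
    using P by (auto simp: surface_def topspace_toric_real_points)
  then obtain a b A where ab: "(a, b) \<in> C" "A \<subseteq> {a, b}" "\<tau> = cone_of A" by (auto simp: fan_cones_def faces_def)
  have bas: "basis a b" using oriented_fanD(2)[OF C ab(1)] .
  have sub: "\<tau> \<subseteq> cone_of {a, b}" unfolding ab(3) using ab(2) by (rule hull_mono)
  define \<psi> where "\<psi> = chart_restrict N (cone_of {a, b}) \<xi>"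
  have \<psi>: "\<psi> \<in> chart_points N (cone_of {a, b})" unfolding \<psi>_def by (rule chart_restrict_in[OF \<tau>(2) sub])
  have "P = toric_point N (fan_cones C) (cone_of {a, b}, \<psi>)"
    unfolding \<tau>(3) toric_point_eq_iff[OF \<tau>(1,2) cone_in_fan[OF ab(1)] \<psi>]
    using sub \<tau>(2) by (intro bexI[of _ \<xi>]) (auto simp: chart_restrict_self \<psi>_def inf.absorb1)
  then show ?thesis
    using that[OF ab(1)] chart_point_unique[OF bas \<psi>] unfolding chart_def by metis
qed

lemma chart_eqI:
  assumes C: "oriented_fan C" and ab: "(a, b) \<in> C" and cd: "(c, d) \<in> C"
    and x: "fst z \<noteq> 0 \<or> a \<in> {c, d}" and y: "snd z \<noteq> 0 \<or> b \<in> {c, d}"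
    and eq: "\<And>m. m \<in> cone_semigroup N (cone_of {c, d}) \<Longrightarrow> torus_char a b z m = torus_char c d z' m"
  shows "chart C a b z = chart C c d z'"
proof -
  interpret separated_fan N "fan_cones C" by (rule separated_fan_cones[OF C])
  have bas: "basis a b" "basis c d" using oriented_fanD(2)[OF C] ab cd by auto
  let ?\<gamma> = "cone_of {a, b} \<inter> cone_of {c, d}"
  define \<omega> where "\<omega> = chart_restrict N ?\<gamma> (torus_char a b z)"
  have "a \<in> {c, d} \<Longrightarrow> a \<in> ?\<gamma>" "b \<in> {c, d} \<Longrightarrow> b \<in> ?\<gamma>" by (auto intro: hull_inc)
  then have \<omega>: "\<omega> \<in> chart_points N ?\<gamma>"
    unfolding \<omega>_def using x y basis_facts[OF bas(1)]
    by (intro torus_char_restrict) (auto simp: cone_semigroup_def)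
  have mono: "m \<in> S ?\<gamma>" if "m \<in> S (cone_of {a, b}) \<or> m \<in> S (cone_of {c, d})" for m
    using that cone_semigroup_antimono[of ?\<gamma>] by (metis inf_le1 inf_le2)
  have "chart_restrict N (cone_of {a, b}) (torus_char a b z) = chart_restrict N (cone_of {a, b}) \<omega>"
    using mono by (auto simp: \<omega>_def chart_restrict_def fun_eq_iff)
  moreover have "chart_restrict N (cone_of {c, d}) (torus_char c d z') = chart_restrict N (cone_of {c, d}) \<omega>"
    using mono eq by (auto simp: \<omega>_def chart_restrict_def fun_eq_iff)
  ultimately show ?thesis
    unfolding chart_def
      toric_point_eq_iff[OF cone_in_fan[OF ab] chart_in_points[OF bas(1)] cone_in_fan[OF cd] chart_in_points[OF bas(2)]]
    using \<omega> by blast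
qed

text \<open>The exponents are the coordinates of \<open>a\<close> and \<open>b\<close> in the basis
  \<open>c\<close>, \<open>d\<close>: the monomial map dual to the change of basis.\<close>

definition transition :: "'v \<Rightarrow> 'v \<Rightarrow> 'v \<Rightarrow> 'v \<Rightarrow> real \<times> real \<Rightarrow> real \<times> real" where
  "transition a b c d z =
     (fst z powi \<lfloor>area a d\<rfloor> * snd z powi \<lfloor>area b d\<rfloor>, fst z powi \<lfloor>area c a\<rfloor> * snd z powi \<lfloor>area c b\<rfloor>)"

lemma torus_transition:
  assumes C: "oriented_fan C" and ab: "(a, b) \<in> C" and cd: "(c, d) \<in> C" and z: "fst z \<noteq> 0" "snd z \<noteq> 0"
  shows "chart C a b z = chart C c d (transition a b c d z)"
proof (rule chart_eqI[OF C ab cd])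
  have bas: "basis a b" "basis c d" using oriented_fanD(2)[OF C] ab cd by auto
  note f = basis_facts[OF bas(1)] basis_facts[OF bas(2)]
  fix m assume "m \<in> cone_semigroup N (cone_of {c, d})"
  then have m: "m \<in> dual_lattice N" by (rule semigroup_dual)
  obtain i j k l where ij: "area a d = of_int i" "area c a = of_int j" "area b d = of_int k" "area c b = of_int l"
    using N_area f by (meson Ints_cases)
  obtain p q where pq: "m \<bullet> c = of_int p" "m \<bullet> d = of_int q" using dual_int[OF m] f by (meson Ints_cases)
  have "m \<bullet> a = of_int (i * p + j * q)" "m \<bullet> b = of_int (k * p + l * q)"
    using arg_cong[OF basis_expand[OF bas(2), of a], of "\<lambda>v. m \<bullet> v"] arg_cong[OF basis_expand[OF bas(2), of b], of "\<lambda>v. m \<bullet> v"]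
    by (simp_all add: ij pq inner_add_right)
  then have fl: "\<lfloor>m \<bullet> a\<rfloor> = i * p + j * q" "\<lfloor>m \<bullet> b\<rfloor> = k * p + l * q" by (simp_all only: floor_of_int)
  show "torus_char a b z m = torus_char c d (transition a b c d z) m"
    using z by (simp add: torus_char_def transition_def ij pq fl power_int_add power_int_mult power_int_mult_distrib)
qed (use z in auto)

text \<open>Across the shared ray \<open>b\<close> only the coordinate of \<open>a\<close> has to be
  nonzero, so the formula includes the curve \<open>y = 0\<close>. It is the gluing map of the line
  bundle with degree \<open>- k\<close>, the normal bundle of that curve.\<close>

lemma adjacent_transition:
  assumes C: "oriented_fan C" and ab: "(a, b) \<in> C" and bd: "(b, d) \<in> C"
    and sum: "a + d = of_int k *\<^sub>R b" and x: "x \<noteq> 0"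
  shows "chart C a b (x, y) = chart C b d (y * x powi k, 1 / x)"
proof (rule chart_eqI[OF C ab bd])
  have bas: "basis a b" "basis b d" using oriented_fanD(2)[OF C] ab bd by auto
  note f = basis_facts[OF bas(1)] basis_facts[OF bas(2)]
  fix m assume "m \<in> cone_semigroup N (cone_of {b, d})"
  then have m: "m \<in> dual_lattice N" by (rule semigroup_dual)
  obtain p q where pq: "m \<bullet> b = of_int p" "m \<bullet> d = of_int q" using dual_int[OF m] f by (meson Ints_cases)
  have "m \<bullet> a + m \<bullet> d = of_int k * (m \<bullet> b)"
    using arg_cong[OF sum, of "\<lambda>v. m \<bullet> v"] by (simp add: inner_add_right)
  then have "m \<bullet> a = of_int (k * p - q)" by (simp add: pq)
  then have fl: "\<lfloor>m \<bullet> a\<rfloor> = k * p - q" by (simp only: floor_of_int)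
  show "torus_char a b (x, y) m = torus_char b d (y * x powi k, 1 / x) m"
    using x by (simp add: torus_char_def fl pq power_int_diff power_int_mult power_int_mult_distrib power_int_divide_distrib field_simps)
qed (use x in auto)

text \<open>Membership of a point in the invariant curve of the ray \<open>r\<close>.\<close>

definition on_curve :: "'v \<Rightarrow> ('v set \<times> ('v \<Rightarrow> real)) set \<Rightarrow> bool" where
  "on_curve r P \<longleftrightarrow> (\<exists>(\<sigma>, \<xi>)\<in>P. r \<in> \<sigma> \<and> (\<forall>m\<in>cone_semigroup N \<sigma>. 0 < m \<bullet> r \<longrightarrow> \<xi> m = 0))"

text \<open>The curve condition has to be carried from an unknown representative to the given chart
  through the overlap. Together with injectivity of charts this later determines the fibres of the
  quotient maps.\<close>

lemma on_curve_chart: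
  assumes C: "oriented_fan C" and ab: "(a, b) \<in> C" and r: "r \<in> fan_rays C"
  shows "on_curve r (chart C a b (x, y)) \<longleftrightarrow> (r = a \<and> x = 0) \<or> (r = b \<and> y = 0)"
proof -
  interpret separated_fan N "fan_cones C" by (rule separated_fan_cones[OF C])
  have bas: "basis a b" using oriented_fanD(2)[OF C ab] .
  note f = basis_facts[OF bas] and cc = coordinate_characters(1,2)[OF bas] coordinate_characters(3,4)[OF bas, of "(x, y)"]
  let ?\<sigma> = "cone_of {a, b}"
  define \<xi> where "\<xi> = chart_restrict N ?\<sigma> (torus_char a b (x, y))"
  have \<xi>: "\<xi> \<in> chart_points N ?\<sigma>" unfolding \<xi>_def by (rule chart_in_points[OF bas])
  have P: "chart C a b (x, y) = toric_point N (fan_cones C) (?\<sigma>, \<xi>)" by (simp add: chart_def \<xi>_def)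
  have self: "(?\<sigma>, \<xi>) \<in> chart C a b (x, y)"
    unfolding P by (rule toric_point_refl[OF cone_in_fan[OF ab] \<xi>])
  show ?thesis
  proof
    assume "on_curve r (chart C a b (x, y))"
    then obtain \<tau> \<psi> where \<tau>: "(\<tau>, \<psi>) \<in> chart C a b (x, y)" "r \<in> \<tau>" and van: "\<And>m. m \<in> S \<tau> \<Longrightarrow> 0 < m \<bullet> r \<Longrightarrow> \<psi> m = 0"
      unfolding on_curve_def by auto
    then obtain \<omega> where \<omega>: "\<tau> \<in> fan_cones C" "\<omega> \<in> chart_points N (?\<sigma> \<inter> \<tau>)" "\<xi> = chart_restrict N ?\<sigma> \<omega>" "\<psi> = chart_restrict N \<tau> \<omega>"
      unfolding P toric_point_iff by blast
    define s where "s = separator ?\<sigma> \<tau>"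
    note sep = separator[OF cone_in_fan[OF ab] \<omega>(1), folded s_def]
    have unit: "\<omega> (- s) \<noteq> 0" using separator_nonzero[OF cone_in_fan[OF ab] \<omega>(1,2)] by (simp add: s_def)
    have val: "\<omega> m = 0" if m: "m \<in> S (?\<sigma> \<inter> \<tau>)" "0 < m \<bullet> r" for m
    proof -
      obtain k where k: "m + real k *\<^sub>R - s \<in> S \<tau>" using sep(4)[OF m(1)] by blast
      have "0 \<le> (- s) \<bullet> r" using sep(2) \<tau>(2) by (auto simp: cone_semigroup_def)
      then have "0 \<le> real k * ((- s) \<bullet> r)" by (rule mult_nonneg_nonneg[OF of_nat_0_le_iff])
      then have "0 < (m + real k *\<^sub>R - s) \<bullet> r"
        using m(2) by (simp add: inner_diff_left)
      then have "\<omega> (m + real k *\<^sub>R - s) = 0" using van[OF k] k \<omega>(4) by (metis restrict_apply)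
      then have "\<omega> m * \<omega> (- s) ^ k = 0"
        using chart_points_add[OF \<omega>(2) m(1) cone_semigroup_scale[OF sep(6)]] chart_points_scale[OF \<omega>(2) sep(6)] by simp
      then show ?thesis using unit by simp
    qed
    \<comment> \<open>Otherwise the character \<open>- s\<close>, positive on \<open>r\<close>,
      would have to vanish, although it is invertible on the overlap.\<close>
    have "(- s) \<bullet> r = 0"
    proof (rule ccontr)
      assume "(- s) \<bullet> r \<noteq> 0"
      then have "0 < (- s) \<bullet> r" using sep(2) \<tau>(2) unfolding cone_semigroup_def by force
      then show False using val[OF sep(6)] unit by simp
    qed
    then have sr: "s \<bullet> r = 0" by simp
    have r_in: "0 \<le> m \<bullet> r" if "m \<in> S ?\<sigma>" for m
    proof -
      have "m \<in> S (?\<sigma> \<inter> \<tau>)" using that by (meson cone_semigroup_antimono inf_le1)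
      then obtain k where k: "m + real k *\<^sub>R - s \<in> S \<tau>" using sep(4) by blast
      then have "0 \<le> (m + real k *\<^sub>R - s) \<bullet> r" using \<tau>(2) by (auto simp: cone_semigroup_def)
      then show ?thesis by (simp add: inner_diff_left sr)
    qed
    have "r \<in> ?\<sigma>" using r_in by (intro dual_cone) (use bas in \<open>auto simp: gens_def\<close>)
    moreover obtain t where "(r, t) \<in> C" using r by (auto simp: fan_rays_def)
    ultimately have "r = a \<or> r = b" using ray_in_cone[OF C _ _ ab, of r t r] by simp
    moreover have "x = 0" if "r = a"
    proof -
      have "J (- b) \<in> S (?\<sigma> \<inter> \<tau>)" using cc(1) by (meson cone_semigroup_antimono inf_le1)
      moreover have "0 < J (- b) \<bullet> r" using that f by simp
      ultimately have "\<xi> (J (- b)) = 0" using val \<omega>(3) cc(1) by (simp add: restrict_apply)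
      then show ?thesis using cc by (simp add: \<xi>_def restrict_apply)
    qed
    moreover have "y = 0" if "r = b"
    proof -
      have "J a \<in> S (?\<sigma> \<inter> \<tau>)" using cc(2) by (meson cone_semigroup_antimono inf_le1)
      moreover have "0 < J a \<bullet> r" using that f by simp
      ultimately have "\<xi> (J a) = 0" using val \<omega>(3) cc(2) by (simp add: restrict_apply)
      then show ?thesis using cc by (simp add: \<xi>_def restrict_apply)
    qed
    ultimately show "(r = a \<and> x = 0) \<or> (r = b \<and> y = 0)" by blast
  next
    assume as: "(r = a \<and> x = 0) \<or> (r = b \<and> y = 0)"
    have "\<xi> m = 0" if "m \<in> S ?\<sigma>" "0 < m \<bullet> r" for m
    proof -
      have "m \<bullet> r \<in> \<int>" using dual_int[OF semigroup_dual[OF that(1)]] as f by auto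
      then have "1 \<le> m \<bullet> r" using that(2) by (rule Ints_pos_ge_1)
      then have "\<lfloor>m \<bullet> r\<rfloor> \<noteq> 0" by linarith
      then have "(0::real) powi \<lfloor>m \<bullet> r\<rfloor> = 0" by simp
      then show ?thesis using as by (auto simp: \<xi>_def chart_restrict_def torus_char_def)
    qed
    moreover have "r \<in> ?\<sigma>" using as by (auto intro: hull_inc)
    ultimately show "on_curve r (chart C a b (x, y))" unfolding on_curve_def using self by blast
  qed
qed

section \<open>Gluing continuous maps from chart formulas\<close>

lemma open_plane_torus_point:
  fixes W :: "(real \<times> real) set"
  assumes "open W" "W \<noteq> {}"
  obtains x y where "(x, y) \<in> W" "x \<noteq> 0" "y \<noteq> 0"
proof -
  have nz: "\<exists>x\<in>A. x \<noteq> 0" if "open A" "A \<noteq> {}" for A :: "real set"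
  proof (rule ccontr)
    assume "\<not> ?thesis"
    then have "A = {0}" using that(2) by auto
    then show False using that(1) not_open_singleton by metis
  qed
  obtain w where "w \<in> W" using assms(2) by blast
  then obtain A B where "open A" "open B" "w \<in> A \<times> B" "A \<times> B \<subseteq> W"
    using assms(1) by (metis open_prod_elim)
  moreover from this obtain x y where "x \<in> A" "x \<noteq> 0" "y \<in> B" "y \<noteq> 0"
    using nz[of A] nz[of B] by auto
  ultimately show ?thesis using that by blast
qed

text \<open>Agreement on the torus suffices, since it is dense and the target is Hausdorff.\<close>

lemma glue_charts:
  assumes C: "oriented_fan C" and U: "openin (surface C) U" and Y: "Hausdorff_space Y"
    and cont: "\<And>a b. (a, b) \<in> C \<Longrightarrow> continuous_map (top_of_set (chart C a b -` U)) Y (f a b)"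
    and agree: "\<And>a b c d z. (a, b) \<in> C \<Longrightarrow> (c, d) \<in> C \<Longrightarrow> fst z \<noteq> 0 \<Longrightarrow> snd z \<noteq> 0 \<Longrightarrow> chart C a b z \<in> U \<Longrightarrow>
      f a b z = f c d (transition a b c d z)"
  obtains g where "continuous_map (subtopology (surface C) U) Y g"
    "\<And>a b z. (a, b) \<in> C \<Longrightarrow> chart C a b z \<in> U \<Longrightarrow> g (chart C a b z) = f a b z"
proof -
  have opU: "open (chart C a b -` U)" if "(a, b) \<in> C" for a b
    using openin_continuous_map_preimage[OF chart_continuous[OF C that] U] by (simp add: vimage_def)
  have op: "open {z. chart C a b z \<in> U \<and> f a b z \<in> V}" if "(a, b) \<in> C" "openin Y V" for a b V
  proof -
    have "openin (top_of_set (chart C a b -` U)) {z \<in> topspace (top_of_set (chart C a b -` U)). f a b z \<in> V}"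
      using cont[OF that(1)] that(2) by (rule openin_continuous_map_preimage)
    then show ?thesis using openin_open_trans[OF _ opU[OF that(1)]] by (simp add: vimage_def)
  qed
  have fY: "f a b z \<in> topspace Y" if "(a, b) \<in> C" "chart C a b z \<in> U" for a b z
    using continuous_map_funspace[OF cont[OF that(1)]] that(2) by auto
  have eq: "f a b z = f c d z'"
    if ab: "(a, b) \<in> C" and cd: "(c, d) \<in> C" and z: "chart C a b z = chart C c d z'" "chart C a b z \<in> U" for a b c d z z'
  proof (rule ccontr)
    assume "f a b z \<noteq> f c d z'"
    moreover have "f a b z \<in> topspace Y" "f c d z' \<in> topspace Y"
      using fY[OF ab] fY[OF cd] z by auto
    ultimately obtain A B where AB: "openin Y A" "openin Y B" "f a b z \<in> A" "f c d z' \<in> B" "disjnt A B"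
      using Y unfolding Hausdorff_space_def by blast
    \<comment> \<open>If the two formulas disagreed at a point, neighbourhoods with disjoint values
      would still overlap in this nonempty open set. It contains a torus point, where the formulas
      agree.\<close>
    let ?V = "chart C a b ` {z. chart C a b z \<in> U \<and> f a b z \<in> A} \<inter> chart C c d ` {z. chart C c d z \<in> U \<and> f c d z \<in> B}"
    have "openin (surface C) ?V"
      using chart_open[OF C ab op[OF ab AB(1)]] chart_open[OF C cd op[OF cd AB(2)]] by (rule openin_Int)
    then have opV: "open (chart C a b -` ?V)"
      using openin_continuous_map_preimage[OF chart_continuous[OF C ab], of ?V] by (simp add: vimage_def)
    have "z \<in> chart C a b -` ?V" using z AB by auto
    then have "chart C a b -` ?V \<noteq> {}" by (rule ex_in_conv[THEN iffD1, OF exI])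
    then obtain x y where xy: "(x, y) \<in> chart C a b -` ?V" "x \<noteq> 0" "y \<noteq> 0"
      by (rule open_plane_torus_point[OF opV])
    obtain z1 where z1: "chart C a b (x, y) = chart C a b z1" "chart C a b z1 \<in> U" "f a b z1 \<in> A" using xy(1) by auto
    obtain z2 where z2: "chart C a b (x, y) = chart C c d z2" "f c d z2 \<in> B" using xy(1) by auto
    have 1: "z1 = (x, y)" using chart_inj[OF C ab] z1(1) by metis
    have 2: "z2 = transition a b c d (x, y)"
      using torus_transition[OF C ab cd, of "(x, y)"] xy z2(1) by (intro chart_inj[OF C cd]) simp
    have "chart C a b (x, y) \<in> U" using z1(2) unfolding 1 .
    then have "f a b (x, y) = f c d z2"
      unfolding 2 by (intro agree[OF ab cd]) (simp_all add: xy)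
    then have "f a b (x, y) \<in> A \<inter> B" using z1(3) z2(2) unfolding 1 by simp
    then show False using AB(5) by (auto simp: disjnt_def)
  qed
  define g where "g P = (SOME w. \<exists>a b z. (a, b) \<in> C \<and> P = chart C a b z \<and> w = f a b z)" for P
  have g: "g (chart C a b z) = f a b z" if ab: "(a, b) \<in> C" and z: "chart C a b z \<in> U" for a b z
    unfolding g_def
  proof (rule some_equality)
    show "\<exists>c d z'. (c, d) \<in> C \<and> chart C a b z = chart C c d z' \<and> f a b z = f c d z'" using ab by blast
    fix w assume "\<exists>c d z'. (c, d) \<in> C \<and> chart C a b z = chart C c d z' \<and> w = f c d z'"
    then obtain c d z' where "(c, d) \<in> C" "chart C a b z = chart C c d z'" "w = f c d z'" by blast
    then show "w = f a b z" using eq[OF ab, of c d z z'] z by simp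
  qed
  have "continuous_map (subtopology (surface C) U) Y g"
    unfolding continuous_map_def
  proof (intro conjI allI impI)
    have top: "topspace (subtopology (surface C) U) = U" using openin_subset[OF U] by auto
    show "g \<in> topspace (subtopology (surface C) U) \<rightarrow> topspace Y"
    proof
      fix P assume "P \<in> topspace (subtopology (surface C) U)"
      then have P: "P \<in> U" "P \<in> topspace (surface C)" by auto
      then obtain a b z where abz: "(a, b) \<in> C" "P = chart C a b z" using surface_cover[OF C] by metis
      show "g P \<in> topspace Y"
        using g[OF abz(1), of z] fY[OF abz(1), of z] P(1) unfolding abz(2) by simp
    qed
    fix V assume V: "openin Y V"
    have "{P \<in> topspace (subtopology (surface C) U). g P \<in> V} =
        (\<Union>(a, b)\<in>C. chart C a b ` {z. chart C a b z \<in> U \<and> f a b z \<in> V})" (is "?l = ?r")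
    proof (intro equalityI subsetI)
      fix P assume "P \<in> ?l"
      then have P: "P \<in> U" "P \<in> topspace (surface C)" "g P \<in> V" by auto
      then obtain a b z where ab: "(a, b) \<in> C" "P = chart C a b z" using surface_cover[OF C] by metis
      have "z \<in> {z. chart C a b z \<in> U \<and> f a b z \<in> V}"
        using g[OF ab(1), of z] P unfolding ab(2) by simp
      then show "P \<in> ?r"
        unfolding ab(2) by (intro UN_I[OF ab(1)]) (unfold prod.case, rule imageI)
    next
      fix P assume "P \<in> ?r"
      then obtain a b z where *: "(a, b) \<in> C" "P = chart C a b z" "chart C a b z \<in> U" "f a b z \<in> V"
        by (elim UN_E) (auto split: prod.splits)
      then show "P \<in> ?l" using g[OF *(1,3)] top by simp
    qed
    moreover have "openin (surface C) ?r"
      using chart_open[OF C _ op[OF _ V]] by (intro openin_Union) auto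
    ultimately show "openin (subtopology (surface C) U) {P \<in> topspace (subtopology (surface C) U). g P \<in> V}"
      unfolding openin_open_subtopology[OF U] using top by (metis (no_types, lifting) mem_Collect_eq subsetI)
  qed
  then show ?thesis using g by (rule that)
qed

end

section \<open>The projective plane and the Hirzebruch surfaces\<close>

lemma continuous_map_pieces:
  assumes "\<And>x. x \<in> S \<Longrightarrow> \<exists>T. open T \<and> x \<in> T \<and> continuous_map (top_of_set (S \<inter> T)) Y H"
  shows "continuous_map (top_of_set S) Y H"
proof (rule continuous_map_locally)
  fix x assume "x \<in> topspace (top_of_set S)"
  then obtain T where T: "open T" "x \<in> T" "continuous_map (top_of_set (S \<inter> T)) Y H" and x: "x \<in> S"
    using assms by auto
  have "openin (top_of_set S) (S \<inter> T)" using T(1) by (simp add: openin_open_Int)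
  then show "\<exists>T. openin (top_of_set S) T \<and> x \<in> T \<and> continuous_map (subtopology (top_of_set S) T) Y H"
    using T x by (intro exI[of _ "S \<inter> T"]) (auto simp: subtopology_subtopology inf.assoc)
qed

lemma compact_space_continuous_image:
  assumes "compact_space X" "continuous_map X Y f" "f ` topspace X = topspace Y"
  shows "compact_space Y"
  using image_compactin[of X "topspace X" Y f] assms by (simp add: compact_space_def)

lemma sphere_real2: "x \<in> sphere (0::real^2) 1 \<longleftrightarrow> (x $ 1)\<^sup>2 + (x $ 2)\<^sup>2 = 1"
  by (simp add: norm_eq_1 inner_vec_def sum_2 power2_eq_square)

lemma sphere_real3: "x \<in> sphere (0::real^3) 1 \<longleftrightarrow> (x $ 1)\<^sup>2 + (x $ 2)\<^sup>2 + (x $ 3)\<^sup>2 = 1"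
  by (simp add: norm_eq_1 inner_vec_def sum_3 power2_eq_square)

lemma sphere_proportional:
  fixes x y :: "'a::real_normed_vector"
  assumes "x \<in> sphere 0 1" "y \<in> sphere 0 1" "y = c *\<^sub>R x"
  shows "y = x \<or> y = - x"
proof -
  have "\<bar>c\<bar> = 1" using assms by (simp add: norm_scaleR)
  then show ?thesis using assms(3) by (auto simp: abs_if split: if_splits)
qed

lemma collinear_real2:
  fixes s s' :: "real^2"
  assumes "s \<in> sphere 0 1" "s' \<in> sphere 0 1" "s $ 1 * s' $ 2 = s $ 2 * s' $ 1"
  shows "s' = s \<or> s' = - s"
proof (cases "s $ 1 = 0")
  case False
  then have "s' = (s' $ 1 / s $ 1) *\<^sub>R s" using assms(3) by (simp add: vec_eq_iff forall_2 field_simps)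
  then show ?thesis by (rule sphere_proportional[OF assms(1,2)])
next
  case True
  then have "s $ 2 \<noteq> 0" using assms(1) unfolding sphere_real2 by auto
  then have "s' = (s' $ 2 / s $ 2) *\<^sub>R s" using assms(3) True by (simp add: vec_eq_iff forall_2 field_simps)
  then show ?thesis by (rule sphere_proportional[OF assms(1,2)])
qed

context plane_lattice
begin

section \<open>Homogeneous coordinates on the standard surfaces\<close>

lemma continuous_map_chart:
  assumes "oriented_fan C" "(a, b) \<in> C" "continuous_on S f"
  shows "continuous_map (top_of_set S) (surface C) (\<lambda>x. chart C a b (f x))"
  using continuous_map_compose[of "top_of_set S" euclidean f "surface C" "chart C a b"] chart_continuous[OF assms(1,2)] assms(3)
  by (simp add: o_def)

text \<open>The three homogeneous coordinates belong to the rays \<open>p\<close>, \<open>a\<close>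
  and \<open>- p - a\<close> in this order; each chart divides by the coordinate of the ray that it
  misses.\<close>

definition plane_map :: "'v \<Rightarrow> 'v \<Rightarrow> real^3 \<Rightarrow> ('v set \<times> ('v \<Rightarrow> real)) set" where
  "plane_map p a x = (let C = plane_fan p a; q = - p - a in
     if x $ 3 \<noteq> 0 then chart C p a (x $ 1 / x $ 3, x $ 2 / x $ 3)
     else if x $ 1 \<noteq> 0 then chart C a q (x $ 2 / x $ 1, x $ 3 / x $ 1)
     else chart C q p (x $ 3 / x $ 2, x $ 1 / x $ 2))"

lemma plane_map_charts:
  assumes C: "oriented_fan (plane_fan p a)"
  defines "q \<equiv> - p - a"
  shows "x $ 3 \<noteq> 0 \<Longrightarrow> plane_map p a x = chart (plane_fan p a) p a (x $ 1 / x $ 3, x $ 2 / x $ 3)"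
    "x $ 1 \<noteq> 0 \<Longrightarrow> plane_map p a x = chart (plane_fan p a) a q (x $ 2 / x $ 1, x $ 3 / x $ 1)"
    "x $ 2 \<noteq> 0 \<Longrightarrow> plane_map p a x = chart (plane_fan p a) q p (x $ 3 / x $ 2, x $ 1 / x $ 2)"
proof -
  have e: "(p, a) \<in> plane_fan p a" "(a, q) \<in> plane_fan p a" "(q, p) \<in> plane_fan p a"
    by (auto simp: plane_fan_def q_def)
  have s: "p + q = of_int (- 1) *\<^sub>R a" "a + p = of_int (- 1) *\<^sub>R q" "q + a = of_int (- 1) *\<^sub>R p"
    by (auto simp: q_def)
  note tr = adjacent_transition[OF C e(1,2) s(1)] adjacent_transition[OF C e(2,3) s(2)] adjacent_transition[OF C e(3,1) s(3)]
  show h3: "x $ 3 \<noteq> 0 \<Longrightarrow> plane_map p a x = chart (plane_fan p a) p a (x $ 1 / x $ 3, x $ 2 / x $ 3)"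
    by (simp add: plane_map_def)
  show h1: "plane_map p a x = chart (plane_fan p a) a q (x $ 2 / x $ 1, x $ 3 / x $ 1)" if "x $ 1 \<noteq> 0"
  proof (cases "x $ 3 = 0")
    case False
    then show ?thesis
      using h3 tr(1)[of "x $ 1 / x $ 3" "x $ 2 / x $ 3"] that by (simp add: power_int_minus field_simps)
  qed (use that in \<open>simp add: plane_map_def q_def Let_def\<close>)
  show "plane_map p a x = chart (plane_fan p a) q p (x $ 3 / x $ 2, x $ 1 / x $ 2)" if "x $ 2 \<noteq> 0"
  proof -
    consider "x $ 1 \<noteq> 0" | "x $ 1 = 0" "x $ 3 \<noteq> 0" | "x $ 1 = 0" "x $ 3 = 0" by blast
    then show ?thesis
    proof cases
      case 1
      then show ?thesis
        using h1[OF 1] tr(2)[of "x $ 2 / x $ 1" "x $ 3 / x $ 1"] that by (simp add: power_int_minus field_simps)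
    next
      case 2
      then show ?thesis
        using h3 tr(3)[of "x $ 3 / x $ 2" "x $ 1 / x $ 2"] that by (simp add: power_int_minus field_simps)
    next
      case 3
      then show ?thesis by (simp add: plane_map_def q_def Let_def)
    qed
  qed
qed

lemma plane_fan_rays:
  assumes "basis p a"
  shows "fan_rays (plane_fan p a) = {p, a, - p - a}" "distinct [p, a, - p - a]"
proof -
  note f = basis_facts[OF assms]
  show "fan_rays (plane_fan p a) = {p, a, - p - a}" by (auto simp: fan_rays_def plane_fan_def)
  have "area p (- p - a) = - 1" "area a (- p - a) = 1" "area p p = 0" "area a a = 0" using f by auto
  then have "p \<noteq> - p - a" "a \<noteq> - p - a" by (metis zero_neq_neg_one, metis zero_neq_one)
  then show "distinct [p, a, - p - a]" using f by simp
qed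

text \<open>The sphere covers the surface by homogeneous coordinates. The invariant curves record
  which coordinates vanish, so two points with equal image can be compared in one chart; there they
  are proportional, and on the sphere this means equal or antipodal.\<close>

theorem plane_surface:
  assumes C: "oriented_fan (plane_fan p a)" and bas: "basis p a"
  shows "surface (plane_fan p a) homeomorphic_space real_projective_plane" "compact_space (surface (plane_fan p a))"
proof -
  let ?S = "sphere (0::real^3) 1" and ?C = "plane_fan p a"
  define q where "q = - p - a"
  note pm = plane_map_charts[OF C, folded q_def]
  have e: "(p, a) \<in> ?C" "(a, q) \<in> ?C" "(q, p) \<in> ?C" by (auto simp: plane_fan_def q_def)
  have nz: "x $ 1 \<noteq> 0 \<or> x $ 2 \<noteq> 0 \<or> x $ 3 \<noteq> 0" if "x \<in> ?S" for x
    using that unfolding sphere_real3 by auto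
  have cont: "continuous_map (top_of_set ?S) (surface ?C) (plane_map p a)"
  proof (rule continuous_map_pieces)
    fix x assume "x \<in> ?S"
    have piece: "continuous_map (top_of_set (?S \<inter> {x. x $ i \<noteq> 0})) (surface ?C) (plane_map p a)"
      if "(b, d) \<in> ?C" "\<And>x. x $ i \<noteq> 0 \<Longrightarrow> plane_map p a x = chart ?C b d (x $ j / x $ i, x $ k / x $ i)" for b d i j k
    proof (rule continuous_map_eq)
      show "continuous_map (top_of_set (?S \<inter> {x. x $ i \<noteq> 0})) (surface ?C) (\<lambda>x. chart ?C b d (x $ j / x $ i, x $ k / x $ i))"
        by (intro continuous_map_chart[OF C that(1)] continuous_intros) auto
    qed (use that in auto)
    have op: "open {x::real^3. x $ i \<noteq> 0}" for i
      by (intro open_Collect_neq continuous_intros)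
    show "\<exists>T. open T \<and> x \<in> T \<and> continuous_map (top_of_set (?S \<inter> T)) (surface ?C) (plane_map p a)"
      using nz[OF \<open>x \<in> ?S\<close>] piece[OF e(1) pm(1)] piece[OF e(2) pm(2)] piece[OF e(3) pm(3)] op by blast
  qed
  have scale: "plane_map p a (c *\<^sub>R x) = plane_map p a x" if "c \<noteq> 0" for c x
    using that by (simp add: plane_map_def Let_def)
  have surj: "plane_map p a ` ?S = topspace (surface ?C)"
  proof
    show "plane_map p a ` ?S \<subseteq> topspace (surface ?C)"
      using continuous_map_image_subset_topspace[OF cont] by simp
    have onto: "plane_map p a x \<in> plane_map p a ` ?S" if "x \<noteq> 0" for x
    proof
      show "plane_map p a x = plane_map p a ((1 / norm x) *\<^sub>R x)" using that by (intro scale[symmetric]) auto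
    qed (use that in simp)
    show "topspace (surface ?C) \<subseteq> plane_map p a ` ?S"
    proof
      fix P assume "P \<in> topspace (surface ?C)"
      then obtain b d z where bd: "(b, d) \<in> ?C" "P = chart ?C b d z" using surface_cover[OF C] by metis
      obtain s t where z: "z = (s, t)" by (cases z)
      have v: "(vector [x, y, r] :: real^3) \<noteq> 0" if "x \<noteq> 0 \<or> y \<noteq> 0 \<or> r \<noteq> 0" for x y r :: real
      proof
        assume "(vector [x, y, r] :: real^3) = 0"
        then have "(vector [x, y, r] :: real^3) $ 1 = 0" "(vector [x, y, r] :: real^3) $ 2 = 0" "(vector [x, y, r] :: real^3) $ 3 = 0"
          by simp_all
        then show False using that by (simp add: vector_3)
      qed
      consider "(b, d) = (p, a)" | "(b, d) = (a, q)" | "(b, d) = (q, p)" using bd(1) by (auto simp: plane_fan_def q_def)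
      then show "P \<in> plane_map p a ` ?S"
      proof cases
        case 1
        then show ?thesis using onto[OF v, of s t 1] pm(1)[of "vector [s, t, 1]"] bd z by (simp add: vector_3)
      next
        case 2
        then show ?thesis using onto[OF v, of 1 s t] pm(2)[of "vector [1, s, t]"] bd z by (simp add: vector_3)
      next
        case 3
        then show ?thesis using onto[OF v, of t 1 s] pm(3)[of "vector [t, 1, s]"] bd z by (simp add: vector_3)
      qed
    qed
  qed
  have rays: "p \<in> fan_rays ?C" "a \<in> fan_rays ?C" "q \<in> fan_rays ?C" and ne: "p \<noteq> a" "p \<noteq> q" "a \<noteq> q"
    using plane_fan_rays[OF bas] by (auto simp: q_def)
  have curve: "on_curve p (plane_map p a x) \<longleftrightarrow> x $ 1 = 0" "on_curve a (plane_map p a x) \<longleftrightarrow> x $ 2 = 0"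
    "on_curve q (plane_map p a x) \<longleftrightarrow> x $ 3 = 0" if "x \<in> ?S" for x
    using nz[OF that] pm[of x] on_curve_chart[OF C e(1)] on_curve_chart[OF C e(2)] on_curve_chart[OF C e(3)] rays ne
    by (metis divide_eq_0_iff)+
  have fibres: "plane_map p a x = plane_map p a y \<longleftrightarrow> {x, - x} = {y, - y}" if xy: "x \<in> ?S" "y \<in> ?S" for x y
  proof
    assume eq: "plane_map p a x = plane_map p a y"
    have same: "x $ i = 0 \<longleftrightarrow> y $ i = 0" for i
      using curve[OF xy(1)] curve[OF xy(2)] eq exhaust_3[of i] by metis
    have prp: "y = (y $ i / x $ i) *\<^sub>R x"
      if "x $ i \<noteq> 0" "\<And>l. x $ l / x $ i = y $ l / y $ i" for i
    proof -
      have "y $ l = y $ i / x $ i * x $ l" for l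
        using that(1) that(2)[of l] same[of i] by (simp add: field_simps)
      then show ?thesis unfolding vec_eq_iff vector_scaleR_component real_scaleR_def by blast
    qed
    have "\<exists>c. y = c *\<^sub>R x"
    proof -
      consider "x $ 3 \<noteq> 0" | "x $ 1 \<noteq> 0" | "x $ 2 \<noteq> 0" using nz[OF xy(1)] by blast
      then show ?thesis
      proof cases
        case 1
        then have "(x $ 1 / x $ 3, x $ 2 / x $ 3) = (y $ 1 / y $ 3, y $ 2 / y $ 3)"
          using eq pm(1) same by (intro chart_inj[OF C e(1)]) metis
        then have "x $ l / x $ 3 = y $ l / y $ 3" for l using exhaust_3[of l] 1 same[of 3] by auto
        then show ?thesis using prp[OF 1] by blast
      next
        case 2
        then have "(x $ 2 / x $ 1, x $ 3 / x $ 1) = (y $ 2 / y $ 1, y $ 3 / y $ 1)"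
          using eq pm(2) same by (intro chart_inj[OF C e(2)]) metis
        then have "x $ l / x $ 1 = y $ l / y $ 1" for l using exhaust_3[of l] 2 same[of 1] by auto
        then show ?thesis using prp[OF 2] by blast
      next
        case 3
        then have "(x $ 3 / x $ 2, x $ 1 / x $ 2) = (y $ 3 / y $ 2, y $ 1 / y $ 2)"
          using eq pm(3) same by (intro chart_inj[OF C e(3)]) metis
        then have "x $ l / x $ 2 = y $ l / y $ 2" for l using exhaust_3[of l] 3 same[of 2] by auto
        then show ?thesis using prp[OF 3] by blast
      qed
    qed
    then have "y = x \<or> y = - x" using sphere_proportional[OF xy] by blast
    then show "{x, - x} = {y, - y}" by auto
  next
    assume "{x, - x} = {y, - y}"
    then have "y = x \<or> y = (- 1) *\<^sub>R x" by (auto simp: doubleton_eq_iff)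
    then show "plane_map p a x = plane_map p a y" using scale[of "- 1" x] by auto
  qed
  have comp: "compact_space (top_of_set ?S)" by (simp add: compact_space_subtopology)
  have quo: "quotient_map (top_of_set ?S) (surface ?C) (plane_map p a)"
    using compact_to_Hausdorff_quotient_map[OF comp Hausdorff_surface[OF C] cont] surj by simp
  show "surface ?C homeomorphic_space real_projective_plane"
    unfolding real_projective_plane_def
    by (rule homeomorphic_space_of_quotient_maps[OF quo quotient_map_quotient_topology]) (use fibres in auto)
  show "compact_space (surface ?C)"
    using compact_space_continuous_image[OF comp cont] surj by simp
qed

text \<open>Homogeneous coordinates in pairs: \<open>s\<close> for the fibre rays \<open>u\<close>
  and \<open>w'\<close>, \<open>t\<close> for the section rays \<open>w\<close> and
  \<open>- w\<close>. Restricting both pairs to circles fixes the positive scalings and leaves only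
  signs, which is why a torus covers the surface.\<close>

definition hirz_map :: "'v \<Rightarrow> 'v \<Rightarrow> int \<Rightarrow> (real^2) \<times> (real^2) \<Rightarrow> ('v set \<times> ('v \<Rightarrow> real)) set" where
  "hirz_map u w x z = (let C = hirz_fan u w x; w' = - u + of_int x *\<^sub>R w; s = fst z; t = snd z in
     if s $ 2 \<noteq> 0 \<and> t $ 2 \<noteq> 0 then chart C u w (s $ 1 / s $ 2, t $ 1 * (s $ 2) powi x / t $ 2)
     else if s $ 1 \<noteq> 0 \<and> t $ 2 \<noteq> 0 then chart C w w' (t $ 1 * (s $ 1) powi x / t $ 2, s $ 2 / s $ 1)
     else if s $ 1 \<noteq> 0 \<and> t $ 1 \<noteq> 0 then chart C w' (- w) (s $ 2 / s $ 1, t $ 2 * (s $ 1) powi (- x) / t $ 1)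
     else chart C (- w) u (t $ 2 * (s $ 2) powi (- x) / t $ 1, s $ 1 / s $ 2))"

lemma hirz_map_charts:
  fixes x :: int
  assumes uw: "basis u w"
  defines "C \<equiv> hirz_fan u w x" and "w' \<equiv> - u + of_int x *\<^sub>R w"
  shows "s $ 2 \<noteq> 0 \<Longrightarrow> t $ 2 \<noteq> 0 \<Longrightarrow> hirz_map u w x (s, t) = chart C u w (s $ 1 / s $ 2, t $ 1 * (s $ 2) powi x / t $ 2)"
    "s $ 1 \<noteq> 0 \<Longrightarrow> t $ 2 \<noteq> 0 \<Longrightarrow> hirz_map u w x (s, t) = chart C w w' (t $ 1 * (s $ 1) powi x / t $ 2, s $ 2 / s $ 1)"
    "s $ 1 \<noteq> 0 \<Longrightarrow> t $ 1 \<noteq> 0 \<Longrightarrow> hirz_map u w x (s, t) = chart C w' (- w) (s $ 2 / s $ 1, t $ 2 * (s $ 1) powi (- x) / t $ 1)"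
    "s $ 2 \<noteq> 0 \<Longrightarrow> t $ 1 \<noteq> 0 \<Longrightarrow> hirz_map u w x (s, t) = chart C (- w) u (t $ 2 * (s $ 2) powi (- x) / t $ 1, s $ 1 / s $ 2)"
proof -
  have C: "oriented_fan C" unfolding C_def by (rule oriented_hirz_fan[OF uw])
  have e: "(u, w) \<in> C" "(w, w') \<in> C" "(w', - w) \<in> C" "(- w, u) \<in> C" by (auto simp: C_def hirz_fan_def w'_def)
  have "u + w' = of_int x *\<^sub>R w" "w + - w = of_int 0 *\<^sub>R w'" "w' + u = of_int (- x) *\<^sub>R (- w)" "- w + w = of_int 0 *\<^sub>R u"
    by (auto simp: w'_def)
  note tr = adjacent_transition[OF C e(1,2) this(1)] adjacent_transition[OF C e(2,3) this(2)]
    adjacent_transition[OF C e(3,4) this(3)] adjacent_transition[OF C e(4,1) this(4)]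
  note pw = power_int_minus power_int_divide_distrib power_int_mult_distrib
  have t12: "chart C u w (s $ 1 / s $ 2, t $ 1 * (s $ 2) powi x / t $ 2) = chart C w w' (t $ 1 * (s $ 1) powi x / t $ 2, s $ 2 / s $ 1)"
    if "s $ 1 \<noteq> 0" "s $ 2 \<noteq> 0" "t $ 2 \<noteq> 0"
    using tr(1)[of "s $ 1 / s $ 2" "t $ 1 * (s $ 2) powi x / t $ 2"] that by (simp add: pw)
  have t23: "chart C w w' (t $ 1 * (s $ 1) powi x / t $ 2, s $ 2 / s $ 1) = chart C w' (- w) (s $ 2 / s $ 1, t $ 2 * (s $ 1) powi (- x) / t $ 1)"
    if "s $ 1 \<noteq> 0" "t $ 1 \<noteq> 0" "t $ 2 \<noteq> 0"
    using tr(2)[of "t $ 1 * (s $ 1) powi x / t $ 2" "s $ 2 / s $ 1"] that by (simp add: pw field_simps)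
  have t34: "chart C w' (- w) (s $ 2 / s $ 1, t $ 2 * (s $ 1) powi (- x) / t $ 1) = chart C (- w) u (t $ 2 * (s $ 2) powi (- x) / t $ 1, s $ 1 / s $ 2)"
    if "s $ 1 \<noteq> 0" "s $ 2 \<noteq> 0" "t $ 1 \<noteq> 0"
    using tr(3)[of "s $ 2 / s $ 1" "t $ 2 * (s $ 1) powi (- x) / t $ 1"] that by (simp add: pw field_simps)
  have t41: "chart C (- w) u (t $ 2 * (s $ 2) powi (- x) / t $ 1, s $ 1 / s $ 2) = chart C u w (s $ 1 / s $ 2, t $ 1 * (s $ 2) powi x / t $ 2)"
    if "s $ 2 \<noteq> 0" "t $ 1 \<noteq> 0" "t $ 2 \<noteq> 0"
    using tr(4)[of "t $ 2 * (s $ 2) powi (- x) / t $ 1" "s $ 1 / s $ 2"] that by (simp add: pw field_simps)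
  note d = hirz_map_def Let_def fst_conv snd_conv C_def[symmetric] w'_def[symmetric]
  show 1: "hirz_map u w x (s, t) = chart C u w (s $ 1 / s $ 2, t $ 1 * (s $ 2) powi x / t $ 2)"
    if "s $ 2 \<noteq> 0" "t $ 2 \<noteq> 0"
    unfolding d using that by simp
  show 2: "hirz_map u w x (s, t) = chart C w w' (t $ 1 * (s $ 1) powi x / t $ 2, s $ 2 / s $ 1)"
    if "s $ 1 \<noteq> 0" "t $ 2 \<noteq> 0"
    unfolding d using that t12 by simp
  show 3: "hirz_map u w x (s, t) = chart C w' (- w) (s $ 2 / s $ 1, t $ 2 * (s $ 1) powi (- x) / t $ 1)"
    if "s $ 1 \<noteq> 0" "t $ 1 \<noteq> 0"
  proof (cases "t $ 2 = 0")
    case True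
    then show ?thesis unfolding d using that by simp
  next
    case False
    then show ?thesis using 2 t23 that by simp
  qed
  show "hirz_map u w x (s, t) = chart C (- w) u (t $ 2 * (s $ 2) powi (- x) / t $ 1, s $ 1 / s $ 2)"
    if "s $ 2 \<noteq> 0" "t $ 1 \<noteq> 0"
  proof (cases "t $ 2 = 0")
    case True
    then show ?thesis unfolding d using that t34 by simp
  next
    case False
    then show ?thesis using 1 t41 that by simp
  qed
qed

text \<open>The fibres of \<open>hirz_map u w x\<close>; they only depend on the parity of \<open>x\<close>.\<close>

definition hirz_fibre :: "int \<Rightarrow> (real^2) \<times> (real^2) \<Rightarrow> (real^2) \<times> (real^2) \<Rightarrow> bool" where
  "hirz_fibre x z z' \<longleftrightarrow> (\<exists>c d. (c = 1 \<or> c = - 1) \<and> (d = 1 \<or> d = - 1) \<and> fst z' = c *\<^sub>R fst z \<and>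
     snd z' $ 1 = d * c powi x * snd z $ 1 \<and> snd z' $ 2 = d * snd z $ 2)"

lemma hirz_fibre_parity: "even x \<longleftrightarrow> even y \<Longrightarrow> hirz_fibre x = hirz_fibre y"
proof -
  assume p: "even x \<longleftrightarrow> even y"
  have "(1::real) powi x = 1 powi y" "(- 1::real) powi x = (- 1) powi y"
    using p by (cases "even y"; simp add: power_int_minus_left)+
  then have "c powi x = c powi y" if "c = 1 \<or> c = - 1" for c :: real using that by blast
  then show "hirz_fibre x = hirz_fibre y"
    unfolding hirz_fibre_def by (intro ext) (metis (no_types, lifting))
qed

text \<open>Surjectivity is checked chart by chart with explicit preimages. Equal images have the
  same vanishing coordinates, so one chart suffices to compare them: it gives the sign relating the
  \<open>s\<close> parts, and then collinearity gives the sign relating the \<open>t\<close>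
  parts.\<close>

theorem hirz_quotient:
  assumes uw: "basis u w"
  defines "S \<equiv> sphere (0::real^2) 1 \<times> sphere (0::real^2) 1"
  shows "quotient_map (top_of_set S) (surface (hirz_fan u w x)) (hirz_map u w x)"
    "\<And>z z'. z \<in> S \<Longrightarrow> z' \<in> S \<Longrightarrow> hirz_map u w x z = hirz_map u w x z' \<longleftrightarrow> hirz_fibre x z z'"
proof -
  let ?C = "hirz_fan u w x"
  define w' where "w' = - u + of_int x *\<^sub>R w"
  have C: "oriented_fan ?C" by (rule oriented_hirz_fan[OF uw])
  note hm = hirz_map_charts[OF uw, of _ _ x, folded w'_def]
  have e: "(u, w) \<in> ?C" "(w, w') \<in> ?C" "(w', - w) \<in> ?C" "(- w, u) \<in> ?C" by (auto simp: hirz_fan_def w'_def)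
  have nz: "fst z $ 1 \<noteq> 0 \<or> fst z $ 2 \<noteq> 0" "snd z $ 1 \<noteq> 0 \<or> snd z $ 2 \<noteq> 0" if "z \<in> S" for z
  proof -
    have "fst z \<in> sphere 0 1" "snd z \<in> sphere 0 1" using that by (auto simp: S_def mem_Times_iff)
    then show "fst z $ 1 \<noteq> 0 \<or> fst z $ 2 \<noteq> 0" "snd z $ 1 \<noteq> 0 \<or> snd z $ 2 \<noteq> 0" unfolding sphere_real2 by auto
  qed
  have cont: "continuous_map (top_of_set S) (surface ?C) (hirz_map u w x)"
  proof (rule continuous_map_pieces)
    fix z assume z: "z \<in> S"
    have op: "open {z::(real^2)\<times>(real^2). fst z $ i \<noteq> 0 \<and> snd z $ j \<noteq> 0}" for i j
      by (intro open_Collect_conj open_Collect_neq continuous_intros)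
    have piece: "continuous_map (top_of_set (S \<inter> T)) (surface ?C) (hirz_map u w x)"
      if "(b, d) \<in> ?C" "\<And>z. z \<in> T \<Longrightarrow> hirz_map u w x z = chart ?C b d (f z)" "continuous_on (S \<inter> T) f" for b d f T
      by (rule continuous_map_eq[OF continuous_map_chart[OF C that(1,3)]]) (use that(2) in auto)
    have p1: "continuous_map (top_of_set (S \<inter> {z. fst z $ 2 \<noteq> 0 \<and> snd z $ 2 \<noteq> 0})) (surface ?C) (hirz_map u w x)"
      by (rule piece[OF e(1), of _ "\<lambda>z. (fst z $ 1 / fst z $ 2, snd z $ 1 * (fst z $ 2) powi x / snd z $ 2)"])
        (use hm(1) in \<open>auto intro!: continuous_intros\<close>)
    have p2: "continuous_map (top_of_set (S \<inter> {z. fst z $ 1 \<noteq> 0 \<and> snd z $ 2 \<noteq> 0})) (surface ?C) (hirz_map u w x)"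
      by (rule piece[OF e(2), of _ "\<lambda>z. (snd z $ 1 * (fst z $ 1) powi x / snd z $ 2, fst z $ 2 / fst z $ 1)"])
        (use hm(2) in \<open>auto intro!: continuous_intros\<close>)
    have p3: "continuous_map (top_of_set (S \<inter> {z. fst z $ 1 \<noteq> 0 \<and> snd z $ 1 \<noteq> 0})) (surface ?C) (hirz_map u w x)"
      by (rule piece[OF e(3), of _ "\<lambda>z. (fst z $ 2 / fst z $ 1, snd z $ 2 * (fst z $ 1) powi (- x) / snd z $ 1)"])
        (use hm(3) in \<open>auto intro!: continuous_intros\<close>)
    have p4: "continuous_map (top_of_set (S \<inter> {z. fst z $ 2 \<noteq> 0 \<and> snd z $ 1 \<noteq> 0})) (surface ?C) (hirz_map u w x)"
      by (rule piece[OF e(4), of _ "\<lambda>z. (snd z $ 2 * (fst z $ 2) powi (- x) / snd z $ 1, fst z $ 1 / fst z $ 2)"])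
        (use hm(4) in \<open>auto intro!: continuous_intros\<close>)
    show "\<exists>T. open T \<and> z \<in> T \<and> continuous_map (top_of_set (S \<inter> T)) (surface ?C) (hirz_map u w x)"
      using nz[OF z] p1 p2 p3 p4 op by blast
  qed
  have surj: "hirz_map u w x ` S = topspace (surface ?C)"
  proof
    show "hirz_map u w x ` S \<subseteq> topspace (surface ?C)"
      using continuous_map_image_subset_topspace[OF cont] by simp
    show "topspace (surface ?C) \<subseteq> hirz_map u w x ` S"
    proof
      fix P assume "P \<in> topspace (surface ?C)"
      then obtain b d z where bd: "(b, d) \<in> ?C" "P = chart ?C b d z" using surface_cover[OF C] by metis
      obtain p q where z: "z = (p, q)" by (cases z)
      \<comment> \<open>The factor that normalises \<open>(r, 1)\<close> to the unit circle without
        changing the ratio \<open>r\<close>.\<close>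
      define n where "n r = sqrt (r\<^sup>2 + 1)" for r
      have n: "n r > 0" "(n r)\<^sup>2 = r\<^sup>2 + 1" for r :: real
        by (simp_all add: n_def add_nonneg_pos)
      have n0: "r\<^sup>2 + 1 \<noteq> 0" for r :: real using zero_le_power2[of r] by linarith
      have sph: "vector [r / n r, 1 / n r] \<in> sphere (0::real^2) 1" "vector [1 / n r, r / n r] \<in> sphere (0::real^2) 1" for r
        unfolding sphere_real2 using n[of r] n0[of r] by (simp_all add: power_divide add_divide_distrib[symmetric] add.commute)
      consider "(b, d) = (u, w)" | "(b, d) = (w, w')" | "(b, d) = (w', - w)" | "(b, d) = (- w, u)"
        using bd(1) by (auto simp: hirz_fan_def w'_def)
      then show "P \<in> hirz_map u w x ` S"
      proof cases
        case 1
        \<comment> \<open>Normalising the first pair changes \<open>s $ 2\<close> to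
          \<open>1 / n p\<close>, whose power enters the second chart coordinate; the ratio of the
          second pair has to compensate for it.\<close>
        define r where "r = q / (1 / n p) powi x"
        let ?s = "vector [p / n p, 1 / n p] :: real^2" and ?t = "vector [r / n r, 1 / n r] :: real^2"
        have "P = hirz_map u w x (?s, ?t)"
          using hm(1)[of ?s ?t] 1 bd z n(1)[of p] n(1)[of r] by (simp add: r_def)
        moreover have "(?s, ?t) \<in> S" using sph by (simp add: S_def)
        ultimately show ?thesis by blast
      next
        case 2
        define r where "r = p / (1 / n q) powi x"
        let ?s = "vector [1 / n q, q / n q] :: real^2" and ?t = "vector [r / n r, 1 / n r] :: real^2"
        have "P = hirz_map u w x (?s, ?t)"
          using hm(2)[of ?s ?t] 2 bd z n(1)[of q] n(1)[of r] by (simp add: r_def)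
        moreover have "(?s, ?t) \<in> S" using sph by (simp add: S_def)
        ultimately show ?thesis by blast
      next
        case 3
        define r where "r = q / (1 / n p) powi (- x)"
        let ?s = "vector [1 / n p, p / n p] :: real^2" and ?t = "vector [1 / n r, r / n r] :: real^2"
        have "P = hirz_map u w x (?s, ?t)"
          using hm(3)[of ?s ?t] 3 bd z n(1)[of p] n(1)[of r] by (simp add: r_def)
        moreover have "(?s, ?t) \<in> S" using sph by (simp add: S_def)
        ultimately show ?thesis by blast
      next
        case 4
        define r where "r = p / (1 / n q) powi (- x)"
        let ?s = "vector [q / n q, 1 / n q] :: real^2" and ?t = "vector [1 / n r, r / n r] :: real^2"
        have "P = hirz_map u w x (?s, ?t)"
          using hm(4)[of ?s ?t] 4 bd z n(1)[of q] n(1)[of r] by (simp add: r_def)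
        moreover have "(?s, ?t) \<in> S" using sph by (simp add: S_def)
        ultimately show ?thesis by blast
      qed
    qed
  qed
  have comp: "compact_space (top_of_set S)" by (simp add: compact_space_subtopology compact_Times S_def)
  show "quotient_map (top_of_set S) (surface ?C) (hirz_map u w x)"
    using compact_to_Hausdorff_quotient_map[OF comp Hausdorff_surface[OF C] cont] surj by simp
  have rays: "u \<in> fan_rays ?C" "w \<in> fan_rays ?C" "w' \<in> fan_rays ?C" "- w \<in> fan_rays ?C"
    using e by (force simp: fan_rays_def)+
  have ne: "u \<noteq> w" "u \<noteq> w'" "u \<noteq> - w" "w \<noteq> w'" "w \<noteq> - w" "w' \<noteq> - w"
    using hirz_fan_distinct[OF uw, of x] by (simp_all add: w'_def)
  have curve: "on_curve u (hirz_map u w x (s, t)) \<longleftrightarrow> s $ 1 = 0" "on_curve w' (hirz_map u w x (s, t)) \<longleftrightarrow> s $ 2 = 0"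
    "on_curve w (hirz_map u w x (s, t)) \<longleftrightarrow> t $ 1 = 0" "on_curve (- w) (hirz_map u w x (s, t)) \<longleftrightarrow> t $ 2 = 0"
    if st: "(s, t) \<in> S" for s t
  proof -
    consider "s $ 2 \<noteq> 0" "t $ 2 \<noteq> 0" | "s $ 1 \<noteq> 0" "t $ 2 \<noteq> 0" | "s $ 1 \<noteq> 0" "t $ 1 \<noteq> 0" | "s $ 2 \<noteq> 0" "t $ 1 \<noteq> 0"
      using nz[OF st] by auto
    then have "(on_curve u (hirz_map u w x (s, t)) \<longleftrightarrow> s $ 1 = 0) \<and> (on_curve w' (hirz_map u w x (s, t)) \<longleftrightarrow> s $ 2 = 0) \<and>
      (on_curve w (hirz_map u w x (s, t)) \<longleftrightarrow> t $ 1 = 0) \<and> (on_curve (- w) (hirz_map u w x (s, t)) \<longleftrightarrow> t $ 2 = 0)"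
    proof cases
      case 1
      then show ?thesis
        using on_curve_chart[OF C e(1)] rays ne by (simp add: hm(1))
    next
      case 2
      then show ?thesis
        using on_curve_chart[OF C e(2)] rays ne by (simp add: hm(2))
    next
      case 3
      then show ?thesis
        using on_curve_chart[OF C e(3)] rays ne by (simp add: hm(3))
    next
      case 4
      then show ?thesis
        using on_curve_chart[OF C e(4)] rays ne by (simp add: hm(4))
    qed
    then show "on_curve u (hirz_map u w x (s, t)) \<longleftrightarrow> s $ 1 = 0" "on_curve w' (hirz_map u w x (s, t)) \<longleftrightarrow> s $ 2 = 0"
      "on_curve w (hirz_map u w x (s, t)) \<longleftrightarrow> t $ 1 = 0" "on_curve (- w) (hirz_map u w x (s, t)) \<longleftrightarrow> t $ 2 = 0"
      by blast+
  qed
  have fwd: "hirz_fibre x (s, t) (s', t')"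
    if st: "(s, t) \<in> S" "(s', t') \<in> S" and eq: "hirz_map u w x (s, t) = hirz_map u w x (s', t')" for s t s' t'
  proof -
    have unit: "s \<in> sphere 0 1" "t \<in> sphere 0 1" "s' \<in> sphere 0 1" "t' \<in> sphere 0 1" using st by (auto simp: S_def)
    have same: "s $ 1 = 0 \<longleftrightarrow> s' $ 1 = 0" "s $ 2 = 0 \<longleftrightarrow> s' $ 2 = 0" "t $ 1 = 0 \<longleftrightarrow> t' $ 1 = 0" "t $ 2 = 0 \<longleftrightarrow> t' $ 2 = 0"
      using curve[OF st(1)] curve[OF st(2)] eq by auto
    have c_exists: "\<exists>c. (c = 1 \<or> c = - 1) \<and> s' = c *\<^sub>R s" if "s $ 1 * s' $ 2 = s $ 2 * s' $ 1"
      using collinear_real2[OF unit(1,3) that] by (metis scaleR_minus1_left scaleR_one)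
    have final: ?thesis if c: "c = 1 \<or> c = - 1" "s' = c *\<^sub>R s" and t: "c powi x * t $ 1 * t' $ 2 = t $ 2 * t' $ 1" for c
    proof -
      have e: "(c powi x)\<^sup>2 = 1" using c(1) by (auto simp: power_int_minus_left)
      let ?t = "vector [c powi x * t $ 1, t $ 2] :: real^2"
      have "?t \<in> sphere 0 1" using unit(2) e unfolding sphere_real2 by (simp add: power_mult_distrib)
      then have "t' = ?t \<or> t' = - ?t" using unit(4) t by (intro collinear_real2) auto
      then obtain d where "d = 1 \<or> d = - 1" "t' = d *\<^sub>R ?t" by (metis scaleR_minus1_left scaleR_one)
      then show ?thesis unfolding hirz_fibre_def using c by (intro exI[of _ c] exI[of _ d]) auto
    qed
    have final': ?thesis if c: "c = 1 \<or> c = - 1" "s' = c *\<^sub>R s" and t: "t $ 1 * t' $ 2 = c powi x * t $ 2 * t' $ 1" for c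
    proof (rule final[OF c])
      have "c powi x * c powi x = 1" using c(1) by (auto simp: power_int_minus_left)
      then show "c powi x * t $ 1 * t' $ 2 = t $ 2 * t' $ 1"
        using arg_cong[OF t, of "\<lambda>r. c powi x * r"] by (metis mult.assoc mult_1)
    qed
    have inv: "(c::real) powi (- x) = c powi x" if "c = 1 \<or> c = - 1" for c
      using that by (auto simp: power_int_minus power_int_minus_left)
    have nzp: "r powi x \<noteq> 0" if "r \<noteq> 0" for r :: real using that by simp
    consider "s $ 2 \<noteq> 0" "t $ 2 \<noteq> 0" | "s $ 1 \<noteq> 0" "t $ 2 \<noteq> 0" | "s $ 1 \<noteq> 0" "t $ 1 \<noteq> 0" | "s $ 2 \<noteq> 0" "t $ 1 \<noteq> 0"
      using nz[OF st(1)] by auto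
    then show ?thesis
    proof cases
      case 1
      then have "(s $ 1 / s $ 2, t $ 1 * (s $ 2) powi x / t $ 2) = (s' $ 1 / s' $ 2, t' $ 1 * (s' $ 2) powi x / t' $ 2)"
        using eq same by (intro chart_inj[OF C e(1)]) (simp add: hm(1))
      then have co: "s $ 1 / s $ 2 = s' $ 1 / s' $ 2" "t $ 1 * (s $ 2) powi x / t $ 2 = t' $ 1 * (s' $ 2) powi x / t' $ 2" by auto
      then obtain c where c: "c = 1 \<or> c = - 1" "s' = c *\<^sub>R s"
        using c_exists 1 same by (auto simp: field_simps)
      have t': "t' $ 2 \<noteq> 0" using 1 same by simp
      have "t $ 1 / t $ 2 = t' $ 1 * c powi x / t' $ 2"
        using co(2) 1 t' nzp[OF 1(1)] by (simp add: c(2) power_int_mult_distrib field_simps)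
      then show ?thesis using 1 t' by (intro final'[OF c]) (simp add: frac_eq_eq mult_ac)
    next
      case 2
      then have "(t $ 1 * (s $ 1) powi x / t $ 2, s $ 2 / s $ 1) = (t' $ 1 * (s' $ 1) powi x / t' $ 2, s' $ 2 / s' $ 1)"
        using eq same by (intro chart_inj[OF C e(2)]) (simp add: hm(2))
      then have co: "s $ 2 / s $ 1 = s' $ 2 / s' $ 1" "t $ 1 * (s $ 1) powi x / t $ 2 = t' $ 1 * (s' $ 1) powi x / t' $ 2" by auto
      then obtain c where c: "c = 1 \<or> c = - 1" "s' = c *\<^sub>R s"
        using c_exists 2 same by (auto simp: field_simps)
      have t': "t' $ 2 \<noteq> 0" using 2 same by simp
      have "t $ 1 / t $ 2 = t' $ 1 * c powi x / t' $ 2"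
        using co(2) 2 t' nzp[OF 2(1)] by (simp add: c(2) power_int_mult_distrib field_simps)
      then show ?thesis using 2 t' by (intro final'[OF c]) (simp add: frac_eq_eq mult_ac)
    next
      case 3
      then have "(s $ 2 / s $ 1, t $ 2 * (s $ 1) powi (- x) / t $ 1) = (s' $ 2 / s' $ 1, t' $ 2 * (s' $ 1) powi (- x) / t' $ 1)"
        using eq same by (intro chart_inj[OF C e(3)]) (simp add: hm(3))
      then have co: "s $ 2 / s $ 1 = s' $ 2 / s' $ 1" "t $ 2 * (s $ 1) powi (- x) / t $ 1 = t' $ 2 * (s' $ 1) powi (- x) / t' $ 1" by auto
      then obtain c where c: "c = 1 \<or> c = - 1" "s' = c *\<^sub>R s"
        using c_exists 3 same by (auto simp: field_simps)
      have "t $ 2 * (s $ 1) powi (- x) / t $ 1 = t' $ 2 * (c powi (- x) * (s $ 1) powi (- x)) / t' $ 1"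
        using co(2) by (simp only: c(2) vector_scaleR_component real_scaleR_def power_int_mult_distrib)
      moreover have t': "t' $ 1 \<noteq> 0" using 3 same by simp
      ultimately have "t $ 2 / t $ 1 = t' $ 2 * c powi x / t' $ 1"
        unfolding inv[OF c(1)] using 3 nzp[OF 3(1)] by (simp add: power_int_minus field_simps)
      then show ?thesis using 3 t' by (intro final[OF c]) (simp add: frac_eq_eq mult_ac)
    next
      case 4
      then have "(t $ 2 * (s $ 2) powi (- x) / t $ 1, s $ 1 / s $ 2) = (t' $ 2 * (s' $ 2) powi (- x) / t' $ 1, s' $ 1 / s' $ 2)"
        using eq same by (intro chart_inj[OF C e(4)]) (simp add: hm(4))
      then have co: "s $ 1 / s $ 2 = s' $ 1 / s' $ 2" "t $ 2 * (s $ 2) powi (- x) / t $ 1 = t' $ 2 * (s' $ 2) powi (- x) / t' $ 1" by auto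
      then obtain c where c: "c = 1 \<or> c = - 1" "s' = c *\<^sub>R s"
        using c_exists 4 same by (auto simp: field_simps)
      have "t $ 2 * (s $ 2) powi (- x) / t $ 1 = t' $ 2 * (c powi (- x) * (s $ 2) powi (- x)) / t' $ 1"
        using co(2) by (simp only: c(2) vector_scaleR_component real_scaleR_def power_int_mult_distrib)
      moreover have t': "t' $ 1 \<noteq> 0" using 4 same by simp
      ultimately have "t $ 2 / t $ 1 = t' $ 2 * c powi x / t' $ 1"
        unfolding inv[OF c(1)] using 4 nzp[OF 4(1)] by (simp add: power_int_minus field_simps)
      then show ?thesis using 4 t' by (intro final[OF c]) (simp add: frac_eq_eq mult_ac)
    qed
  qed
  have bwd: "hirz_map u w x (s, t) = hirz_map u w x (s', t')"
    if st: "(s, t) \<in> S" and fib: "hirz_fibre x (s, t) (s', t')" for s t s' t'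
  proof -
    obtain c d where cd: "c = 1 \<or> c = - 1" "d = 1 \<or> d = - 1" "s' = c *\<^sub>R s" "t' $ 1 = d * c powi x * t $ 1" "t' $ 2 = d * t $ 2"
      using fib by (auto simp: hirz_fibre_def)
    have nzc: "c \<noteq> 0" "d \<noteq> 0" "c powi x \<noteq> 0" using cd by auto
    consider "s $ 2 \<noteq> 0" "t $ 2 \<noteq> 0" | "s $ 1 \<noteq> 0" "t $ 2 \<noteq> 0" | "s $ 1 \<noteq> 0" "t $ 1 \<noteq> 0" | "s $ 2 \<noteq> 0" "t $ 1 \<noteq> 0"
      using nz[OF st] by auto
    then show ?thesis
    proof cases
      case 1
      then show ?thesis using hm(1)[of s t] hm(1)[of s' t'] nzc cd(1,2)
        by (cases "even x") (auto simp: cd(3-5) power_int_mult_distrib)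
    next
      case 2
      then show ?thesis using hm(2)[of s t] hm(2)[of s' t'] nzc cd(1,2)
        by (cases "even x") (auto simp: cd(3-5) power_int_mult_distrib)
    next
      case 3
      then show ?thesis using hm(3)[of s t] hm(3)[of s' t'] nzc cd(1,2)
        by (cases "even x") (auto simp: cd(3-5) power_int_mult_distrib)
    next
      case 4
      then show ?thesis using hm(4)[of s t] hm(4)[of s' t'] nzc cd(1,2)
        by (cases "even x") (auto simp: cd(3-5) power_int_mult_distrib)
    qed
  qed
  show "hirz_map u w x z = hirz_map u w x z' \<longleftrightarrow> hirz_fibre x z z'" if "z \<in> S" "z' \<in> S" for z z'
    using fwd bwd that by (metis prod.exhaust)
qed

lemma compact_hirz_surface:
  assumes uw: "basis u w"
  shows "compact_space (surface (hirz_fan u w x))"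
proof -
  have "compact_space (top_of_set (sphere (0::real^2) 1 \<times> sphere (0::real^2) 1))"
    by (simp add: compact_space_subtopology compact_Times)
  then show ?thesis
    using hirz_quotient(1)[OF uw, of x]
    by (meson compact_space_continuous_image quotient_imp_continuous_map quotient_imp_surjective_map)
qed

lemma hirz_surface_parity:
  assumes uw: "basis u w" and xy: "even x \<longleftrightarrow> even y"
  shows "surface (hirz_fan u w x) homeomorphic_space surface (hirz_fan u w y)"
  by (rule homeomorphic_space_of_quotient_maps[OF hirz_quotient(1)[OF uw] hirz_quotient(1)[OF uw]])
    (simp add: hirz_quotient(2)[OF uw] hirz_fibre_parity[OF xy])

text \<open>The squaring map of the circle identifies antipodes, hence has the fibres of an even Hirzebruch surface.\<close>

theorem even_hirz_surface:
  assumes uw: "basis u w" and x: "even x"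
  shows "surface (hirz_fan u w x) homeomorphic_space
     prod_topology (top_of_set (sphere (0::real^2) 1)) (top_of_set (sphere (0::real^2) 1))"
proof -
  define S where "S = sphere (0::real^2) 1"
  define sq where "sq v = ((v $ 1)\<^sup>2 - (v $ 2)\<^sup>2) *\<^sub>R axis 1 1 + (2 * v $ 1 * v $ 2) *\<^sub>R (axis 2 1 :: real^2)" for v :: "real^2"
  have sq12: "sq v $ 1 = (v $ 1)\<^sup>2 - (v $ 2)\<^sup>2" "sq v $ 2 = 2 * v $ 1 * v $ 2" for v
    by (simp_all add: sq_def axis_def)
  have cont: "continuous_on UNIV sq"
    unfolding sq_def by (intro continuous_intros)
  have sqS: "sq v \<in> S" if "v \<in> S" for v
  proof -
    have "((v $ 1)\<^sup>2 - (v $ 2)\<^sup>2)\<^sup>2 + (2 * v $ 1 * v $ 2)\<^sup>2 = ((v $ 1)\<^sup>2 + (v $ 2)\<^sup>2)\<^sup>2"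
      by (simp add: power2_eq_square algebra_simps)
    then show ?thesis using that unfolding S_def sphere_real2 by (simp add: sq12)
  qed
  have onto: "\<exists>v\<in>S. sq v = y" if y: "y \<in> S" for y
  proof -
    define z where "z = csqrt (Complex (y $ 1) (y $ 2))"
    have z: "z\<^sup>2 = Complex (y $ 1) (y $ 2)" by (simp add: z_def)
    have "cmod (z\<^sup>2) = 1" using y unfolding z S_def sphere_real2 by (simp add: complex_norm)
    then have "cmod z = 1" by (simp add: norm_power abs_square_eq_1)
    then have "(Re z)\<^sup>2 + (Im z)\<^sup>2 = 1" by (metis cmod_power2 one_power2)
    then have "vector [Re z, Im z] \<in> S" unfolding S_def sphere_real2 by simp
    moreover have "sq (vector [Re z, Im z]) = y"
      using arg_cong[OF z, of Re] arg_cong[OF z, of Im] by (simp add: sq12 vec_eq_iff forall_2 power2_eq_square mult_ac)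
    ultimately show ?thesis by blast
  qed
  have fib: "sq v = sq v' \<longleftrightarrow> v' = v \<or> v' = - v" if v: "v \<in> S" "v' \<in> S" for v v'
  proof
    assume eq: "sq v = sq v'"
    have "sq v $ 1 = sq v' $ 1" "sq v $ 2 = sq v' $ 2" using eq by simp_all
    then have "(Complex (v $ 1) (v $ 2))\<^sup>2 = (Complex (v' $ 1) (v' $ 2))\<^sup>2"
      by (simp add: sq12 complex_eq_iff power2_eq_square mult_ac)
    then have "Complex (v' $ 1) (v' $ 2) = Complex (v $ 1) (v $ 2) \<or> Complex (v' $ 1) (v' $ 2) = - Complex (v $ 1) (v $ 2)"
      by (metis power2_eq_iff)
    then show "v' = v \<or> v' = - v" by (auto simp: vec_eq_iff forall_2 complex_eq_iff)
  qed (auto simp: sq_def)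
  define Q where "Q z = (sq (fst z), sq (snd z))" for z
  have "quotient_map (top_of_set (S \<times> S)) (top_of_set (S \<times> S)) Q"
  proof (rule compact_to_Hausdorff_quotient_map)
    show "compact_space (top_of_set (S \<times> S))" by (simp add: compact_space_subtopology compact_Times S_def)
    show "Hausdorff_space (top_of_set (S \<times> S))" by (simp add: Hausdorff_space_subtopology)
    have "continuous_on (S \<times> S) Q"
      unfolding Q_def by (intro continuous_on_Pair continuous_on_compose2[OF cont] continuous_intros) auto
    then show "continuous_map (top_of_set (S \<times> S)) (top_of_set (S \<times> S)) Q"
      using sqS by (auto simp: Q_def)
    show "Q ` topspace (top_of_set (S \<times> S)) = topspace (top_of_set (S \<times> S))"
      using sqS onto by (force simp: Q_def image_iff)
  qed
  moreover have "hirz_fibre x z z' \<longleftrightarrow> Q z = Q z'" if "z \<in> S \<times> S" "z' \<in> S \<times> S" for z z'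
  proof -
    have one: "(c::real) powi x = 1" if "c = 1 \<or> c = - 1" for c using that x by auto
    have "hirz_fibre x z z' \<longleftrightarrow> (fst z' = fst z \<or> fst z' = - fst z) \<and> (snd z' = snd z \<or> snd z' = - snd z)"
      (is "?l \<longleftrightarrow> ?r")
    proof
      assume ?l
      then show ?r by (auto simp: hirz_fibre_def one vec_eq_iff forall_2)
    next
      assume ?r
      then obtain c d where cd: "c = 1 \<or> c = - 1" "d = 1 \<or> d = - 1" "fst z' = c *\<^sub>R fst z" "snd z' = d *\<^sub>R snd z"
        by (metis scaleR_minus1_left scaleR_one)
      then show ?l unfolding hirz_fibre_def by (intro exI[of _ c] exI[of _ d]) (simp add: one)
    qed
    then show ?thesis using fib that by (auto simp: Q_def mem_Times_iff)
  qed
  ultimately have "surface (hirz_fan u w x) homeomorphic_space top_of_set (S \<times> S)"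
    using hirz_quotient(2)[OF uw, of _ _ x, folded S_def]
    by (intro homeomorphic_space_of_quotient_maps[OF hirz_quotient(1)[OF uw, of x, folded S_def], of _ Q]) simp_all
  then show ?thesis by (simp add: S_def)
qed

end

section \<open>Blowing up a fixed point\<close>

lemma topspace_disjoint_sum: "topspace (disjoint_sum X Y) = Inl ` topspace X \<union> Inr ` topspace Y" (is "_ = ?T")
proof
  have "openin (disjoint_sum X Y) (topspace (disjoint_sum X Y))" by simp
  then have sub: "Inl -` topspace (disjoint_sum X Y) \<subseteq> topspace X" "Inr -` topspace (disjoint_sum X Y) \<subseteq> topspace Y"
    unfolding openin_disjoint_sum by (auto dest: openin_subset)
  show "topspace (disjoint_sum X Y) \<subseteq> ?T"
  proof
    fix z assume "z \<in> topspace (disjoint_sum X Y)"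
    then show "z \<in> ?T" using sub by (cases z) auto
  qed
  have "Inl -` ?T = topspace X" "Inr -` ?T = topspace Y" by auto
  then have "openin (disjoint_sum X Y) ?T" unfolding openin_disjoint_sum by simp
  then show "?T \<subseteq> topspace (disjoint_sum X Y)" by (rule openin_subset)
qed

lemma continuous_map_disjoint_sum:
  assumes "continuous_map X Z (f \<circ> Inl)" "continuous_map Y Z (f \<circ> Inr)"
  shows "continuous_map (disjoint_sum X Y) Z f"
  unfolding continuous_map_def
proof (intro conjI allI impI)
  show "f \<in> topspace (disjoint_sum X Y) \<rightarrow> topspace Z"
    using assms by (auto simp: topspace_disjoint_sum continuous_map_def)
  fix U assume U: "openin Z U"
  have "Inl -` {x \<in> topspace (disjoint_sum X Y). f x \<in> U} = {x \<in> topspace X. (f \<circ> Inl) x \<in> U}"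
    "Inr -` {x \<in> topspace (disjoint_sum X Y). f x \<in> U} = {x \<in> topspace Y. (f \<circ> Inr) x \<in> U}"
    by (auto simp: topspace_disjoint_sum)
  then show "openin (disjoint_sum X Y) {x \<in> topspace (disjoint_sum X Y). f x \<in> U}"
    unfolding openin_disjoint_sum
    using openin_continuous_map_preimage[OF assms(1) U] openin_continuous_map_preimage[OF assms(2) U] by simp
qed

lemma compact_space_disjoint_sum:
  assumes "compact_space X" "compact_space Y"
  shows "compact_space (disjoint_sum X Y)"
proof -
  have "{x \<in> topspace X. Inl x \<in> U} = Inl -` U" "{y \<in> topspace Y. Inr y \<in> U} = Inr -` U"
    if "openin (disjoint_sum X Y) U" for U
    using that openin_subset unfolding openin_disjoint_sum by blast+
  then have "continuous_map X (disjoint_sum X Y) Inl" "continuous_map Y (disjoint_sum X Y) Inr"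
    unfolding continuous_map_def by (auto simp: topspace_disjoint_sum openin_disjoint_sum)
  then show ?thesis
    using assms unfolding compact_space_def topspace_disjoint_sum
    by (intro compactin_Un image_compactin)
qed

lemma coordinate_discI:
  assumes "continuous_map euclidean M \<phi>" "\<And>W. open W \<Longrightarrow> openin M (\<phi> ` W)" "inj \<phi>"
  shows "coordinate_disc M \<phi>"
  unfolding coordinate_disc_def
proof
  show "embedding_map (top_of_set (ball 0 2)) M \<phi>"
  proof (rule injective_open_imp_embedding_map)
    show "continuous_map (top_of_set (ball 0 2)) M \<phi>" using assms(1) by (rule continuous_map_from_subtopology)
    show "open_map (top_of_set (ball 0 2)) M \<phi>"
      unfolding open_map_def using assms(2) by (metis open_ball openin_open_eq)
    show "inj_on \<phi> (topspace (top_of_set (ball 0 2)))" using assms(3) by (rule inj_on_subset) auto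
  qed
  show "openin M (\<phi> ` ball 0 2)" using assms(2) by simp
qed

section \<open>An affine disc in the projective plane and its complement\<close>

lemma continuous_real2_of_pair: "continuous_on UNIV (\<lambda>z::real \<times> real. vector [fst z, snd z] :: real^2)"
proof -
  have eq: "(\<lambda>z::real \<times> real. vector [fst z, snd z] :: real^2) = (\<lambda>z. fst z *\<^sub>R axis 1 1 + snd z *\<^sub>R axis 2 1)"
    by (auto simp: vec_eq_iff forall_2 axis_def)
  show ?thesis unfolding eq by (intro continuous_intros)
qed

definition affine_point :: "real^2 \<Rightarrow> (real^3) set" where
  "affine_point v = (let x = (1 / sqrt ((v $ 1)\<^sup>2 + (v $ 2)\<^sup>2 + 1)) *\<^sub>R (vector [v $ 1, v $ 2, 1] :: real^3) in {x, - x})"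

lemma affine_point_iff:
  assumes x: "x \<in> sphere (0::real^3) 1"
  shows "{x, - x} = affine_point v \<longleftrightarrow> x $ 3 \<noteq> 0 \<and> x $ 1 = v $ 1 * x $ 3 \<and> x $ 2 = v $ 2 * x $ 3"
proof -
  define n where "n = sqrt ((v $ 1)\<^sup>2 + (v $ 2)\<^sup>2 + 1)"
  have n: "0 < n" "(v $ 1)\<^sup>2 + (v $ 2)\<^sup>2 + 1 = n\<^sup>2" by (simp_all add: n_def add_nonneg_pos)
  define y where "y = (1 / n) *\<^sub>R (vector [v $ 1, v $ 2, 1] :: real^3)"
  have yc: "y $ 1 = v $ 1 / n" "y $ 2 = v $ 2 / n" "y $ 3 = 1 / n" by (simp_all add: y_def vector_3)
  have ap: "affine_point v = {y, - y}" by (simp add: affine_point_def y_def n_def Let_def)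
  have ys: "y \<in> sphere 0 1" unfolding sphere_real3 yc using n(1) by (simp add: power_divide add_divide_distrib[symmetric] n(2))
  show ?thesis
  proof
    assume "{x, - x} = affine_point v"
    then have "x = y \<or> x = - y" unfolding ap by (auto simp: doubleton_eq_iff)
    then show "x $ 3 \<noteq> 0 \<and> x $ 1 = v $ 1 * x $ 3 \<and> x $ 2 = v $ 2 * x $ 3" using n(1) by (auto simp: yc)
  next
    assume r: "x $ 3 \<noteq> 0 \<and> x $ 1 = v $ 1 * x $ 3 \<and> x $ 2 = v $ 2 * x $ 3"
    then have "x = (x $ 3 * n) *\<^sub>R y" using n(1) by (simp add: vec_eq_iff forall_3 yc)
    then have "x = y \<or> x = - y" by (rule sphere_proportional[OF ys x])
    then show "{x, - x} = affine_point v" unfolding ap by auto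
  qed
qed

lemma affine_point_sphere: "\<exists>x\<in>sphere (0::real^3) 1. affine_point v = {x, - x}"
proof -
  define n where "n = sqrt ((v $ 1)\<^sup>2 + (v $ 2)\<^sup>2 + 1)"
  have n: "0 < n" "(v $ 1)\<^sup>2 + (v $ 2)\<^sup>2 + 1 = n\<^sup>2" by (simp_all add: n_def add_nonneg_pos)
  define y where "y = (1 / n) *\<^sub>R (vector [v $ 1, v $ 2, 1] :: real^3)"
  have yc: "y $ 1 = v $ 1 / n" "y $ 2 = v $ 2 / n" "y $ 3 = 1 / n" by (simp_all add: y_def vector_3)
  have "y \<in> sphere 0 1" unfolding sphere_real3 yc using n(1) by (simp add: power_divide add_divide_distrib[symmetric] n(2))
  moreover have "affine_point v = {y, - y}" by (simp add: affine_point_def y_def n_def Let_def)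
  ultimately show ?thesis by blast
qed

lemma topspace_projective_plane: "topspace real_projective_plane = (\<lambda>x. {x, - x}) ` sphere (0::real^3) 1"
  by (simp add: real_projective_plane_def topspace_quotient_topology)

lemma quotient_map_projective_plane:
  "quotient_map (top_of_set (sphere (0::real^3) 1)) real_projective_plane (\<lambda>x. {x, - x})"
  unfolding real_projective_plane_def by (rule quotient_map_quotient_topology)

lemma inj_affine_point: "inj affine_point"
proof (rule injI)
  fix v w assume eq: "affine_point v = affine_point w"
  obtain x where "x \<in> sphere 0 1" "affine_point v = {x, - x}" using affine_point_sphere by blast
  then have "x $ 3 \<noteq> 0" "x $ 1 = v $ 1 * x $ 3 \<and> x $ 2 = v $ 2 * x $ 3" "x $ 1 = w $ 1 * x $ 3 \<and> x $ 2 = w $ 2 * x $ 3"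
    using affine_point_iff[of x v] affine_point_iff[of x w] eq by auto
  then show "v = w" by (auto simp: vec_eq_iff forall_2)
qed

lemma open_affine_point_image:
  assumes W: "open W"
  shows "openin real_projective_plane (affine_point ` W)"
proof -
  let ?S = "sphere (0::real^3) 1"
  let ?g = "\<lambda>x::real^3. (vector [x $ 1 / x $ 3, x $ 2 / x $ 3] :: real^2)"
  have sub: "affine_point ` W \<subseteq> topspace real_projective_plane"
    using affine_point_sphere unfolding topspace_projective_plane by blast
  have "{x \<in> ?S. {x, - x} \<in> affine_point ` W} = ?S \<inter> ({x. x $ 3 \<noteq> 0} \<inter> ?g -` W)"
  proof (intro equalityI subsetI)
    fix x assume "x \<in> {x \<in> ?S. {x, - x} \<in> affine_point ` W}"
    then obtain v where x: "x \<in> ?S" "{x, - x} = affine_point v" "v \<in> W" by auto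
    then have "x $ 3 \<noteq> 0" "x $ 1 = v $ 1 * x $ 3" "x $ 2 = v $ 2 * x $ 3" using affine_point_iff[OF x(1)] by auto
    then have "?g x = v" by (simp add: vec_eq_iff forall_2)
    then show "x \<in> ?S \<inter> ({x. x $ 3 \<noteq> 0} \<inter> ?g -` W)" using x \<open>x $ 3 \<noteq> 0\<close> by simp
  next
    fix x assume x: "x \<in> ?S \<inter> ({x. x $ 3 \<noteq> 0} \<inter> ?g -` W)"
    then have "{x, - x} = affine_point (?g x)" using affine_point_iff[of x "?g x"] by simp
    then show "x \<in> {x \<in> ?S. {x, - x} \<in> affine_point ` W}" using x by blast
  qed
  moreover have "open ({x. x $ 3 \<noteq> 0} \<inter> ?g -` W)"
  proof (rule continuous_open_preimage[OF _ _ W])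
    show "open {x::real^3. x $ 3 \<noteq> 0}" by (intro open_Collect_neq continuous_intros)
    have "continuous_on {x::real^3. x $ 3 \<noteq> 0} (\<lambda>x. (x $ 1 / x $ 3, x $ 2 / x $ 3))"
      by (intro continuous_intros) auto
    from continuous_on_compose2[OF continuous_real2_of_pair this]
    show "continuous_on {x::real^3. x $ 3 \<noteq> 0} ?g" by simp
  qed
  ultimately show ?thesis
    unfolding real_projective_plane_def openin_quotient_topology
    using sub by (simp add: openin_open_Int topspace_projective_plane)
qed

lemma continuous_map_euclidean_subset:
  "continuous_on UNIV f \<Longrightarrow> (\<And>v. f v \<in> T) \<Longrightarrow> continuous_map euclidean (top_of_set T) f"
  by (auto simp: continuous_map_in_subtopology)

lemma affine_point_disc: "coordinate_disc real_projective_plane affine_point"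
proof (rule coordinate_discI[OF _ open_affine_point_image inj_affine_point])
  let ?n = "\<lambda>v::real^2. (1 / sqrt ((v $ 1)\<^sup>2 + (v $ 2)\<^sup>2 + 1)) *\<^sub>R (vector [v $ 1, v $ 2, 1] :: real^3)"
  have "?n = (\<lambda>v. (1 / sqrt ((v $ 1)\<^sup>2 + (v $ 2)\<^sup>2 + 1)) *\<^sub>R (v $ 1 *\<^sub>R axis 1 1 + v $ 2 *\<^sub>R axis 2 1 + axis 3 1))"
    by (auto simp: vec_eq_iff forall_3 axis_def vector_3)
  moreover have "sqrt ((v $ 1)\<^sup>2 + (v $ 2)\<^sup>2 + 1) \<noteq> 0" for v :: "real^2"
  proof -
    have "0 < (v $ 1)\<^sup>2 + (v $ 2)\<^sup>2 + 1" by (simp add: add_nonneg_pos)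
    then show ?thesis by simp
  qed
  then have "continuous_on UNIV (\<lambda>v::real^2. (1 / sqrt ((v $ 1)\<^sup>2 + (v $ 2)\<^sup>2 + 1)) *\<^sub>R (v $ 1 *\<^sub>R axis 1 1 + v $ 2 *\<^sub>R axis 2 1 + axis 3 1 :: real^3))"
    by (intro continuous_intros) auto
  ultimately have cont: "continuous_on UNIV ?n" by (simp only:)
  have sph: "?n v \<in> sphere 0 1" for v
  proof -
    define n where "n = sqrt ((v $ 1)\<^sup>2 + (v $ 2)\<^sup>2 + 1)"
    have n: "0 < n" "(v $ 1)\<^sup>2 + (v $ 2)\<^sup>2 + 1 = n\<^sup>2" by (simp_all add: n_def add_nonneg_pos)
    show ?thesis unfolding sphere_real3 n_def[symmetric]
      using n(1) by (simp add: vector_3 power_divide add_divide_distrib[symmetric] n(2))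
  qed
  have "continuous_map euclidean (top_of_set (sphere 0 1)) ?n"
    by (rule continuous_map_euclidean_subset[OF cont sph])
  from continuous_map_compose[OF this quotient_imp_continuous_map[OF quotient_map_projective_plane]]
  show "continuous_map euclidean real_projective_plane affine_point"
    unfolding o_def affine_point_def[abs_def] Let_def .
qed

text \<open>In homogeneous coordinates the affine disc is an inequality between squares; its
  complement is the closed Moebius band around the line at infinity.\<close>

lemma affine_disc_complement:
  assumes "x \<in> sphere (0::real^3) 1"
  shows "{x, - x} \<notin> affine_point ` ball 0 1 \<longleftrightarrow> (x $ 3)\<^sup>2 \<le> (x $ 1)\<^sup>2 + (x $ 2)\<^sup>2"
proof -
  have norm2: "norm v < 1 \<longleftrightarrow> (v $ 1)\<^sup>2 + (v $ 2)\<^sup>2 < 1" for v :: "real^2"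
    by (simp add: norm_eq_sqrt_inner inner_vec_def sum_2 power2_eq_square)
  have "{x, - x} \<in> affine_point ` ball 0 1 \<longleftrightarrow> (x $ 1)\<^sup>2 + (x $ 2)\<^sup>2 < (x $ 3)\<^sup>2"
  proof
    assume "{x, - x} \<in> affine_point ` ball 0 1"
    then obtain v where v: "norm v < 1" "{x, - x} = affine_point v" by auto
    then have x: "x $ 3 \<noteq> 0" "x $ 1 = v $ 1 * x $ 3" "x $ 2 = v $ 2 * x $ 3" using affine_point_iff[OF assms] by auto
    have "((v $ 1)\<^sup>2 + (v $ 2)\<^sup>2) * (x $ 3)\<^sup>2 < 1 * (x $ 3)\<^sup>2"
      using v(1) x(1) unfolding norm2 by (intro mult_strict_right_mono) auto
    then show "(x $ 1)\<^sup>2 + (x $ 2)\<^sup>2 < (x $ 3)\<^sup>2" by (simp add: x(2,3) power_mult_distrib algebra_simps)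
  next
    assume lt: "(x $ 1)\<^sup>2 + (x $ 2)\<^sup>2 < (x $ 3)\<^sup>2"
    then have nz: "x $ 3 \<noteq> 0" by (auto simp: not_sum_power2_lt_zero)
    let ?v = "vector [x $ 1 / x $ 3, x $ 2 / x $ 3] :: real^2"
    have "{x, - x} = affine_point ?v" using nz affine_point_iff[OF assms, of ?v] by simp
    moreover have "norm ?v < 1" unfolding norm2 using lt nz by (simp add: power_divide add_divide_distrib[symmetric])
    ultimately show "{x, - x} \<in> affine_point ` ball 0 1" by auto
  qed
  then show ?thesis by auto
qed

section \<open>Maps between surfaces with a common torus\<close>

context plane_lattice
begin

lemma torus_char_transition:
  assumes ab: "basis a b" and cd: "basis c d" and z: "fst z \<noteq> 0" "snd z \<noteq> 0" and m: "m \<in> dual_lattice N"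
  shows "torus_char a b z m = torus_char c d (transition a b c d z) m"
proof -
  note f = basis_facts[OF ab] basis_facts[OF cd]
  obtain i j k l where ij: "area a d = of_int i" "area c a = of_int j" "area b d = of_int k" "area c b = of_int l"
    using N_area f by (meson Ints_cases)
  obtain p q where pq: "m \<bullet> c = of_int p" "m \<bullet> d = of_int q" using dual_int[OF m] f by (meson Ints_cases)
  have "m \<bullet> a = of_int (i * p + j * q)" "m \<bullet> b = of_int (k * p + l * q)"
    using arg_cong[OF basis_expand[OF cd, of a], of "\<lambda>v. m \<bullet> v"] arg_cong[OF basis_expand[OF cd, of b], of "\<lambda>v. m \<bullet> v"]
    by (simp_all add: ij pq inner_add_right)
  then have fl: "\<lfloor>m \<bullet> a\<rfloor> = i * p + j * q" "\<lfloor>m \<bullet> b\<rfloor> = k * p + l * q" by (simp_all only: floor_of_int)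
  show ?thesis
    using z by (simp add: torus_char_def transition_def ij pq fl power_int_add power_int_mult power_int_mult_distrib)
qed

text \<open>Names a point of the open torus by its character values alone, independently of fan and
  chart, so that chart formulas on different surfaces can be compared.\<close>

definition torus_point :: "('v \<times> 'v) set \<Rightarrow> ('v \<Rightarrow> real) \<Rightarrow> ('v set \<times> ('v \<Rightarrow> real)) set" where
  "torus_point C \<theta> = (SOME P. \<exists>a b z. (a, b) \<in> C \<and> fst z \<noteq> 0 \<and> snd z \<noteq> 0 \<and>
     (\<forall>m\<in>dual_lattice N. torus_char a b z m = \<theta> m) \<and> P = chart C a b z)"

lemma torus_point_eq:
  assumes C: "oriented_fan C" and ab: "(a, b) \<in> C" "fst z \<noteq> 0" "snd z \<noteq> 0"
    and \<theta>: "\<And>m. m \<in> dual_lattice N \<Longrightarrow> torus_char a b z m = \<theta> m"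
  shows "torus_point C \<theta> = chart C a b z"
  unfolding torus_point_def
proof (rule some_equality)
  show "\<exists>a' b' z'. (a', b') \<in> C \<and> fst z' \<noteq> 0 \<and> snd z' \<noteq> 0 \<and>
     (\<forall>m\<in>dual_lattice N. torus_char a' b' z' m = \<theta> m) \<and> chart C a b z = chart C a' b' z'"
    using ab \<theta> by blast
  fix P assume "\<exists>a' b' z'. (a', b') \<in> C \<and> fst z' \<noteq> 0 \<and> snd z' \<noteq> 0 \<and>
     (\<forall>m\<in>dual_lattice N. torus_char a' b' z' m = \<theta> m) \<and> P = chart C a' b' z'"
  then obtain a' b' z' where *: "(a', b') \<in> C" "fst z' \<noteq> 0" "snd z' \<noteq> 0"
     "\<forall>m\<in>dual_lattice N. torus_char a' b' z' m = \<theta> m" "P = chart C a' b' z'" by blast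
  show "P = chart C a b z"
    unfolding *(5) using * ab \<theta> semigroup_dual by (intro chart_eqI[OF C *(1) ab(1)]) auto
qed

text \<open>Formulas that are the identity on the common torus are automatically compatible, since
  torus points do not depend on the chart.\<close>

lemma glue_toric:
  fixes f :: "'v \<Rightarrow> 'v \<Rightarrow> real \<times> real \<Rightarrow> ('v set \<times> ('v \<Rightarrow> real)) set"
  assumes C: "oriented_fan C" and U: "openin (surface C) U" and C': "oriented_fan C'"
    and cont: "\<And>a b. (a, b) \<in> C \<Longrightarrow> continuous_map (top_of_set (chart C a b -` U)) (surface C') (f a b)"
    and tor: "\<And>a b z. (a, b) \<in> C \<Longrightarrow> fst z \<noteq> 0 \<Longrightarrow> snd z \<noteq> 0 \<Longrightarrow> f a b z = torus_point C' (torus_char a b z)"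
  obtains g where "continuous_map (subtopology (surface C) U) (surface C') g"
    "\<And>a b z. (a, b) \<in> C \<Longrightarrow> chart C a b z \<in> U \<Longrightarrow> g (chart C a b z) = f a b z"
proof (rule glue_charts[OF C U Hausdorff_surface[OF C'] cont])
  fix a b c d and z :: "real \<times> real"
  assume ab: "(a, b) \<in> C" and cd: "(c, d) \<in> C" and z: "fst z \<noteq> 0" "snd z \<noteq> 0"
  have bas: "basis a b" "basis c d" using oriented_fanD(2)[OF C] ab cd by auto
  have tz: "fst (transition a b c d z) \<noteq> 0" "snd (transition a b c d z) \<noteq> 0" using z by (auto simp: transition_def)
  have "torus_point C' (torus_char a b z) = torus_point C' (torus_char c d (transition a b c d z))"
    unfolding torus_point_def using torus_char_transition[OF bas z] by simp
  then show "f a b z = f c d (transition a b c d z)" using tor[OF ab z] tor[OF cd tz] by simp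
qed (use that in blast)+

lemma torus_char_blowup:
  assumes N: "p \<in> N" "q \<in> N" and xy: "x \<noteq> 0" "y \<noteq> 0" and m: "m \<in> dual_lattice N"
  shows "torus_char (p + q) q (x, y / x) m = torus_char p q (x, y) m"
    "torus_char p (p + q) (x, y) m = torus_char p q (x * y, y) m" (is ?t2)
    "torus_char (p + q) q (x, y) m = torus_char p q (x, x * y) m"
proof -
  obtain i j where ij: "m \<bullet> p = of_int i" "m \<bullet> q = of_int j" using dual_int[OF m] N by (meson Ints_cases)
  have "m \<bullet> (p + q) = of_int (i + j)" by (simp add: ij inner_add_right)
  then have fl: "\<lfloor>m \<bullet> (p + q)\<rfloor> = i + j" "\<lfloor>m \<bullet> p\<rfloor> = i" "\<lfloor>m \<bullet> q\<rfloor> = j" by (simp_all only: floor_of_int ij)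
  show "torus_char (p + q) q (x, y / x) m = torus_char p q (x, y) m"
    "torus_char p (p + q) (x, y) m = torus_char p q (x * y, y) m"
    "torus_char (p + q) q (x, y) m = torus_char p q (x, x * y) m"
    using xy by (simp_all add: torus_char_def fl power_int_add power_int_mult_distrib power_int_divide_distrib)
qed

lemma chart_disc_open:
  assumes "oriented_fan C" "(p, q) \<in> C" "open W"
  shows "openin (surface C) ((\<lambda>v::real^2. chart C p q (v $ 1, v $ 2)) ` W)"
proof -
  have "(\<lambda>v::real^2. (v $ 1, v $ 2)) ` W = (\<lambda>z. vector [fst z, snd z]) -` W"
  proof (intro equalityI subsetI)
    fix z assume "z \<in> (\<lambda>v::real^2. (v $ 1, v $ 2)) ` W"
    then obtain v :: "real^2" where v: "v \<in> W" "z = (v $ 1, v $ 2)" by blast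
    have "(vector [v $ 1, v $ 2] :: real^2) = v" by (simp add: vec_eq_iff forall_2)
    then show "z \<in> (\<lambda>z. vector [fst z, snd z]) -` W" using v by simp
  next
    fix z :: "real \<times> real" assume "z \<in> (\<lambda>z. vector [fst z, snd z]) -` W"
    then show "z \<in> (\<lambda>v::real^2. (v $ 1, v $ 2)) ` W" by (intro image_eqI[of _ _ "vector [fst z, snd z]"]) auto
  qed
  then have "open ((\<lambda>v::real^2. (v $ 1, v $ 2)) ` W)" using open_vimage[OF assms(3) continuous_real2_of_pair] by simp
  from chart_open[OF assms(1,2) this] show ?thesis by (simp add: image_image)
qed

lemma chart_disc:
  assumes C: "oriented_fan C" and pq: "(p, q) \<in> C"
  shows "coordinate_disc (surface C) (\<lambda>v::real^2. chart C p q (v $ 1, v $ 2))"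
proof (rule coordinate_discI)
  have "continuous_on UNIV (\<lambda>v::real^2. (v $ 1, v $ 2))" by (intro continuous_intros)
  from continuous_map_chart[OF C pq this]
  show "continuous_map euclidean (surface C) (\<lambda>v::real^2. chart C p q (v $ 1, v $ 2))" by simp
  show "inj (\<lambda>v::real^2. chart C p q (v $ 1, v $ 2))"
    using chart_inj[OF C pq] by (auto simp: inj_def vec_eq_iff forall_2)
qed (rule chart_disc_open[OF C pq])

end

text \<open>No homeomorphism onto the glued space is written down. The maps \<open>i\<close> and
  \<open>j\<close> together form a surjection from the compact disjoint sum of the two pieces onto a
  Hausdorff space, hence a quotient map, and \<open>cross\<close> says that its fibres are those of
  the gluing map.\<close>

lemma is_connected_sumI:
  fixes M :: "'a topology" and N :: "'b topology" and P :: "'c topology"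
    and \<phi> :: "real^2 \<Rightarrow> 'a" and \<psi> :: "real^2 \<Rightarrow> 'b"
  defines "M0 \<equiv> topspace M - \<phi> ` ball 0 1" and "N0 \<equiv> topspace N - \<psi> ` ball 0 1"
  assumes cpt: "compact_space M" "compact_space N" and Hausdorff: "Hausdorff_space P"
    and disc: "coordinate_disc M \<phi>" "coordinate_disc N \<psi>" "inj \<phi>" "inj \<psi>"
    and op: "openin M (\<phi> ` ball 0 1)" "openin N (\<psi> ` ball 0 1)"
    and cont: "continuous_map (subtopology M M0) P i" "continuous_map (subtopology N N0) P j"
    and inj: "inj_on i M0" "inj_on j N0"
    and cross: "\<And>x y. x \<in> M0 \<Longrightarrow> y \<in> N0 \<Longrightarrow> i x = j y \<longleftrightarrow> (\<exists>v\<in>sphere 0 1. x = \<phi> v \<and> y = \<psi> v)"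
    and onto: "topspace P \<subseteq> i ` M0 \<union> j ` N0"
  shows "is_connected_sum M N P" "compact_space P"
proof -
  define D where "D = disjoint_sum (subtopology M M0) (subtopology N N0)"
  define F where "F = (\<lambda>z. case z of Inl x \<Rightarrow> i x | Inr y \<Rightarrow> j y)"
  define h where "h = (\<lambda>z. case z of Inl x \<Rightarrow> Inl x
    | Inr y \<Rightarrow> if y \<in> \<psi> ` sphere 0 1 then Inl (\<phi> (the_inv_into (sphere 0 1) \<psi> y)) else Inr y)"
  have sub: "topspace (subtopology M M0) = M0" "topspace (subtopology N N0) = N0"
    by (auto simp: M0_def N0_def)
  have tD: "topspace D = Inl ` M0 \<union> Inr ` N0" unfolding D_def topspace_disjoint_sum sub ..
  have hl: "h (Inl x) = Inl x" for x by (simp add: h_def)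
  have hr: "h (Inr (\<psi> v)) = Inl (\<phi> v)" if "v \<in> sphere 0 1" for v
  proof -
    have "the_inv_into (sphere 0 1) \<psi> (\<psi> v) = v"
      using that disc(4) by (intro the_inv_into_f_f) (auto simp: inj_def inj_on_def)
    then show ?thesis using that by (simp add: h_def)
  qed
  have hn: "h (Inr y) = Inr y" if "y \<notin> \<psi> ` sphere 0 1" for y using that by (simp add: h_def)
  have lr: "h (Inl x) = h (Inr y) \<longleftrightarrow> (\<exists>v\<in>sphere 0 1. x = \<phi> v \<and> y = \<psi> v)" for x y
  proof (cases "y \<in> \<psi> ` sphere 0 1")
    case True
    then obtain v where v: "v \<in> sphere 0 1" "y = \<psi> v" by blast
    then show ?thesis using hr[OF v(1)] injD[OF disc(4)] by (auto simp: hl)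
  next
    case False
    then show ?thesis using hn[OF False] by (auto simp: hl)
  qed
  have rr: "h (Inr x) = h (Inr y) \<longleftrightarrow> x = y" for x y
  proof
    assume eq: "h (Inr x) = h (Inr y)"
    show "x = y"
    proof (cases "x \<in> \<psi> ` sphere 0 1")
      case True
      then obtain v where v: "v \<in> sphere 0 1" "x = \<psi> v" by blast
      have "h (Inl (\<phi> v)) = h (Inr y)" using eq unfolding v(2) hr[OF v(1)] hl .
      then obtain w where "\<phi> v = \<phi> w" "y = \<psi> w" unfolding lr by blast
      then show ?thesis using v injD[OF disc(3)] by blast
    next
      case False
      then have "h (Inr y) = Inr x" using eq hn[OF False] by simp
      then show ?thesis by (auto simp: h_def split: if_splits)
    qed
  qed simp
  have Fl: "F (Inl x) = i x" and Fr: "F (Inr y) = j y" for x y by (simp_all add: F_def)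
  have fibres: "F z = F w \<longleftrightarrow> h z = h w" if z: "z \<in> topspace D" and w: "w \<in> topspace D" for z w
  proof -
    consider x y where "z = Inl x" "w = Inl y" "x \<in> M0" "y \<in> M0"
      | x y where "z = Inl x" "w = Inr y" "x \<in> M0" "y \<in> N0"
      | x y where "z = Inr y" "w = Inl x" "x \<in> M0" "y \<in> N0"
      | x y where "z = Inr x" "w = Inr y" "x \<in> N0" "y \<in> N0"
      using z w unfolding tD by blast
    then show ?thesis
    proof cases
      case 1
      then show ?thesis using inj(1) by (auto simp: hl Fl inj_on_def)
    next
      case 2
      then show ?thesis using lr[of x y] cross[of x y] by (simp only: Fl Fr)
    next
      case 3
      then show ?thesis using lr[of x y] cross[of x y] by (simp only: Fl Fr eq_commute[of "j y"] eq_commute[of "h (Inr y)"])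
    next
      case 4
      then show ?thesis using inj(2) by (simp only: rr Fr) (auto simp: inj_on_def)
    qed
  qed
  have contF: "continuous_map D P F"
    unfolding D_def using cont by (intro continuous_map_disjoint_sum) (simp_all add: F_def o_def)
  have "closedin M M0" "closedin N N0" unfolding M0_def N0_def using op by (simp_all add: closedin_def Diff_Diff_Int Int_absorb1 openin_subset)
  then have cD: "compact_space D" unfolding D_def
    using cpt by (intro compact_space_disjoint_sum compact_space_subtopology closedin_compact_space)
  have surj: "F ` topspace D = topspace P"
  proof
    show "F ` topspace D \<subseteq> topspace P" using continuous_map_image_subset_topspace[OF contF] .
    show "topspace P \<subseteq> F ` topspace D"
      using onto unfolding tD image_Un image_image Fl Fr .
  qed
  have "P homeomorphic_space quotient_topology D h"
    using fibres
    by (intro homeomorphic_space_of_quotient_maps[OF compact_to_Hausdorff_quotient_map[OF cD Hausdorff contF surj]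
      quotient_map_quotient_topology])
  then have "P homeomorphic_space connected_sum_along M \<phi> N \<psi>"
    unfolding connected_sum_along_def D_def h_def M0_def N0_def .
  then show "is_connected_sum M N P" unfolding is_connected_sum_def using disc(1,2) by blast
  show "compact_space P" using compact_space_continuous_image[OF cD contF surj] .
qed

lemma compact_projective_plane: "compact_space real_projective_plane"
proof (rule compact_space_continuous_image)
  show "compact_space (top_of_set (sphere (0::real^3) 1))" by (simp add: compact_space_subtopology)
  show "continuous_map (top_of_set (sphere (0::real^3) 1)) real_projective_plane (\<lambda>x. {x, - x})"
    using quotient_imp_continuous_map[OF quotient_map_projective_plane] .
qed (simp add: topspace_projective_plane)

section \<open>The blow-up of a fixed point as a connected sum\<close>

locale fan_blowup = plane_lattice N J e1 e2
  for N :: "'v::euclidean_space set" and J :: "'v \<Rightarrow> 'v" and e1 e2 :: 'v +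
  fixes C :: "('v \<times> 'v) set" and p q :: 'v
  assumes C: "oriented_fan C" and pq: "(p, q) \<in> C" and C': "oriented_fan (blowup C p q)"
begin

abbreviation "s \<equiv> p + q"
abbreviation "C' \<equiv> blowup C p q"
abbreviation "centre \<equiv> chart C p q (0, 0)"

lemma new_edges: "(p, s) \<in> C'" "(s, q) \<in> C'"
  by (auto simp: blowup_def)

lemma bases: "basis p q" "basis p s" "basis s q"
  using oriented_fanD(2)[OF C pq] oriented_fanD(2)[OF C'] new_edges by auto

lemma new_edges_distinct: "(p, s) \<notin> C" "(s, q) \<notin> C" "(p, s) \<noteq> (s, q)" "(p, q) \<noteq> (p, s)" "(p, q) \<noteq> (s, q)"
  using successor_unique[OF C pq, of s] predecessor_unique[OF C pq, of s] basis_facts(4,5)[OF bases(1)] by auto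

lemma old_edge: "(a, b) \<in> C \<Longrightarrow> (a, b) \<noteq> (p, q) \<Longrightarrow> (a, b) \<in> C'"
  by (auto simp: blowup_def)

lemma blowup_cases:
  assumes "(a, b) \<in> C'"
  obtains "a = p" "b = s" | "a = s" "b = q" | "(a, b) \<in> C" "(a, b) \<noteq> (p, q)"
  using assms by (auto simp: blowup_def)

text \<open>The centre lies on the curves of both \<open>p\<close> and \<open>q\<close>, which only
  happens in the chart of this pair and only at its origin.\<close>

lemma centre_chart:
  assumes "(a, b) \<in> C"
  shows "chart C a b z = centre \<longleftrightarrow> (a, b) = (p, q) \<and> z = (0, 0)"
proof
  assume eq: "chart C a b z = centre"
  have r: "p \<in> fan_rays C" "q \<in> fan_rays C" using edge_rays[OF C pq] by auto
  have "on_curve p centre" "on_curve q centre" using on_curve_chart[OF C pq r(1)] on_curve_chart[OF C pq r(2)] by auto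
  then have "p = a \<or> p = b" "q = a \<or> q = b"
    using on_curve_chart[OF C assms r(1), of "fst z" "snd z"] on_curve_chart[OF C assms r(2), of "fst z" "snd z"] eq by auto
  moreover have "(q, p) \<notin> C" using oriented_fanD(2)[OF C, of q p] basis_facts(2)[OF bases(1)] by (auto simp: basis_def)
  ultimately have ab: "(a, b) = (p, q)" using assms basis_facts(3)[OF bases(1)] by auto
  then show "(a, b) = (p, q) \<and> z = (0, 0)" using eq chart_inj[OF C pq] by auto
qed auto

lemma exceptional_transition: "x \<noteq> 0 \<Longrightarrow> chart C' p s (x, y) = chart C' s q (y * x, 1 / x)"
  using adjacent_transition[OF C' new_edges, of 1 x y] by simp

text \<open>The inverse of the blow-down away from the centre. The formulas
  \<open>(x, y / x)\<close> and \<open>(x / y, y)\<close> cover the punctured chart and match by the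
  transition across the exceptional curve.\<close>

lemma section_exists:
  obtains i where "continuous_map (subtopology (surface C) (topspace (surface C) - {centre})) (surface C') i"
    "\<And>x y. x \<noteq> 0 \<Longrightarrow> i (chart C p q (x, y)) = chart C' s q (x, y / x)"
    "\<And>x y. y \<noteq> 0 \<Longrightarrow> i (chart C p q (x, y)) = chart C' p s (x / y, y)"
    "\<And>a b z. (a, b) \<in> C \<Longrightarrow> (a, b) \<noteq> (p, q) \<Longrightarrow> i (chart C a b z) = chart C' a b z"
proof -
  define f where "f = (\<lambda>a b z. if (a, b) = (p, q) then
      (if fst z \<noteq> 0 then chart C' s q (fst z, snd z / fst z) else chart C' p s (fst z / snd z, snd z)) else chart C' a b z)"
  have f1: "f p q (x, y) = chart C' s q (x, y / x)" if "x \<noteq> 0" for x y using that by (simp add: f_def)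
  have f2: "f p q (x, y) = chart C' p s (x / y, y)" if "y \<noteq> 0" for x y
    using that exceptional_transition[of "x / y" y] by (simp add: f_def)
  have U: "openin (surface C) (topspace (surface C) - {centre})"
    using Hausdorff_imp_t1_space[OF Hausdorff_surface[OF C]] chart_in_surface[OF C pq]
    by (intro openin_diff) (auto simp: t1_space_closedin_singleton)
  have dom: "chart C a b -` (topspace (surface C) - {centre}) = (if (a, b) = (p, q) then - {(0, 0)} else UNIV)"
    if "(a, b) \<in> C" for a b
    using that chart_in_surface[OF C that] centre_chart[OF that] by auto
  show ?thesis
  proof (rule glue_toric[OF C U C', of f])
    fix a b assume ab: "(a, b) \<in> C"
    show "continuous_map (top_of_set (chart C a b -` (topspace (surface C) - {centre}))) (surface C') (f a b)"
    proof (cases "(a, b) = (p, q)")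
      case True
      have "continuous_map (top_of_set (- {(0, 0)})) (surface C') (f p q)"
      proof (rule continuous_map_pieces)
        fix z :: "real \<times> real" assume "z \<in> - {(0, 0)}"
        then consider "fst z \<noteq> 0" | "snd z \<noteq> 0" by (auto simp: prod_eq_iff)
        then show "\<exists>T. open T \<and> z \<in> T \<and> continuous_map (top_of_set (- {(0, 0)} \<inter> T)) (surface C') (f p q)"
        proof cases
          case 1
          have "continuous_map (top_of_set (- {(0, 0)} \<inter> {z. fst z \<noteq> 0})) (surface C') (f p q)"
          proof (rule continuous_map_eq)
            show "continuous_map (top_of_set (- {(0, 0)} \<inter> {z. fst z \<noteq> 0})) (surface C')
                (\<lambda>z. chart C' s q (fst z, snd z / fst z))"
              by (intro continuous_map_chart[OF C' new_edges(2)] continuous_intros) auto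
          qed (use f1 in auto)
          moreover have "open {z::real \<times> real. fst z \<noteq> 0}" by (intro open_Collect_neq continuous_intros)
          ultimately show ?thesis using 1 by blast
        next
          case 2
          have "continuous_map (top_of_set (- {(0, 0)} \<inter> {z. snd z \<noteq> 0})) (surface C') (f p q)"
          proof (rule continuous_map_eq)
            show "continuous_map (top_of_set (- {(0, 0)} \<inter> {z. snd z \<noteq> 0})) (surface C')
                (\<lambda>z. chart C' p s (fst z / snd z, snd z))"
              by (intro continuous_map_chart[OF C' new_edges(1)] continuous_intros) auto
          qed (use f2 in auto)
          moreover have "open {z::real \<times> real. snd z \<noteq> 0}" by (intro open_Collect_neq continuous_intros)
          ultimately show ?thesis using 2 by blast
        qed
      qed
      then show ?thesis using dom[OF ab] True by simp
    next
      case False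
      then have "f a b = chart C' a b" by (auto simp: f_def)
      moreover have "chart C a b -` (topspace (surface C) - {centre}) = UNIV" using dom[OF ab] False by auto
      ultimately show ?thesis using chart_continuous[OF C' old_edge[OF ab False]] by simp
    qed
  next
    fix a b and z :: "real \<times> real" assume ab: "(a, b) \<in> C" and z: "fst z \<noteq> 0" "snd z \<noteq> 0"
    show "f a b z = torus_point C' (torus_char a b z)"
    proof (cases "(a, b) = (p, q)")
      case True
      have "torus_point C' (torus_char p q z) = chart C' s q (fst z, snd z / fst z)"
        using z torus_char_blowup(1)[OF basis_facts(6,7)[OF bases(1)] z]
        by (intro torus_point_eq[OF C' new_edges(2)]) auto
      then show ?thesis using True z by (simp add: f_def)
    next
      case False
      then have "f a b z = chart C' a b z" by (auto simp: f_def)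
      then show ?thesis using torus_point_eq[OF C' old_edge[OF ab False] z, of "torus_char a b z"] by simp
    qed
  next
    fix g assume g: "continuous_map (subtopology (surface C) (topspace (surface C) - {centre})) (surface C') g"
      "\<And>a b z. (a, b) \<in> C \<Longrightarrow> chart C a b z \<in> topspace (surface C) - {centre} \<Longrightarrow> g (chart C a b z) = f a b z"
    have g': "g (chart C a b z) = f a b z" if "(a, b) \<in> C" "(a, b) \<noteq> (p, q) \<or> z \<noteq> (0, 0)" for a b z
      using that chart_in_surface[OF C that(1)] centre_chart[OF that(1)] by (intro g(2)) auto
    show ?thesis
    proof (rule that[OF g(1)])
      show "x \<noteq> 0 \<Longrightarrow> g (chart C p q (x, y)) = chart C' s q (x, y / x)" for x y using g'[OF pq] f1 by simp
      show "y \<noteq> 0 \<Longrightarrow> g (chart C p q (x, y)) = chart C' p s (x / y, y)" for x y using g'[OF pq] f2 by simp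
      show "(a, b) \<in> C \<Longrightarrow> (a, b) \<noteq> (p, q) \<Longrightarrow> g (chart C a b z) = chart C' a b z" for a b z
        using g'[of a b z] by (auto simp: f_def)
    qed
  qed
qed

text \<open>The blow-down serves as a left inverse of the section, which gives injectivity, and it
  recovers the point of the original surface from a point of the band.\<close>

lemma blowdown_exists:
  obtains \<pi> where "continuous_map (surface C') (surface C) \<pi>"
    "\<And>x y. \<pi> (chart C' p s (x, y)) = chart C p q (x * y, y)"
    "\<And>x y. \<pi> (chart C' s q (x, y)) = chart C p q (x, x * y)"
    "\<And>a b z. (a, b) \<in> C \<Longrightarrow> (a, b) \<noteq> (p, q) \<Longrightarrow> \<pi> (chart C' a b z) = chart C a b z"
proof -
  define f where "f = (\<lambda>a b z. if (a, b) = (p, s) then chart C p q (fst z * snd z, snd z)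
      else if (a, b) = (s, q) then chart C p q (fst z, fst z * snd z) else chart C a b z)"
  have f1: "f p s = (\<lambda>z. chart C p q (fst z * snd z, snd z))" by (simp add: f_def)
  have f2: "f s q = (\<lambda>z. chart C p q (fst z, fst z * snd z))" using new_edges_distinct(3) by (auto simp: f_def)
  have f3: "f a b = chart C a b" if "(a, b) \<in> C" for a b
    using that new_edges_distinct by (auto simp: f_def fun_eq_iff)
  show ?thesis
  proof (rule glue_toric[OF C' openin_topspace C, of f])
    fix a b assume ab: "(a, b) \<in> C'"
    have dom: "chart C' a b -` topspace (surface C') = UNIV" using chart_in_surface[OF C' ab] by auto
    have "continuous_map (top_of_set UNIV) (surface C) (f a b)"
      using ab
    proof (cases rule: blowup_cases)
      case 1
      show ?thesis unfolding 1 f1 by (intro continuous_map_chart[OF C pq] continuous_intros)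
    next
      case 2
      show ?thesis unfolding 2 f2 by (intro continuous_map_chart[OF C pq] continuous_intros)
    next
      case 3
      then show ?thesis using f3 chart_continuous[OF C 3(1)] by simp
    qed
    then show "continuous_map (top_of_set (chart C' a b -` topspace (surface C'))) (surface C) (f a b)" unfolding dom .
  next
    fix a b and z :: "real \<times> real" assume ab: "(a, b) \<in> C'" and z: "fst z \<noteq> 0" "snd z \<noteq> 0"
    note tb = torus_char_blowup[OF basis_facts(6,7)[OF bases(1)] z]
    show "f a b z = torus_point C (torus_char a b z)"
      using ab
    proof (cases rule: blowup_cases)
      case 1
      have "torus_point C (torus_char p s z) = chart C p q (fst z * snd z, snd z)"
        using z tb(2)[symmetric] by (intro torus_point_eq[OF C pq]) auto
      then show ?thesis unfolding 1 f1 by simp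
    next
      case 2
      have "torus_point C (torus_char s q z) = chart C p q (fst z, fst z * snd z)"
        using z tb(3)[symmetric] by (intro torus_point_eq[OF C pq]) auto
      then show ?thesis unfolding 2 f2 by simp
    next
      case 3
      then show ?thesis using torus_point_eq[OF C 3(1) z, of "torus_char a b z"] f3 by simp
    qed
  next
    fix g assume g: "continuous_map (subtopology (surface C') (topspace (surface C'))) (surface C) g"
      "\<And>a b z. (a, b) \<in> C' \<Longrightarrow> chart C' a b z \<in> topspace (surface C') \<Longrightarrow> g (chart C' a b z) = f a b z"
    have g': "g (chart C' a b z) = f a b z" if "(a, b) \<in> C'" for a b z
      using that chart_in_surface[OF C' that] by (rule g(2))
    show ?thesis
    proof (rule that)
      show "continuous_map (surface C') (surface C) g" using g(1) by simp
      show "g (chart C' p s (x, y)) = chart C p q (x * y, y)" for x y using g'[OF new_edges(1)] f1 by simp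
      show "g (chart C' s q (x, y)) = chart C p q (x, x * y)" for x y using g'[OF new_edges(2)] f2 by simp
      show "(a, b) \<in> C \<Longrightarrow> (a, b) \<noteq> (p, q) \<Longrightarrow> g (chart C' a b z) = chart C a b z" for a b z
        using g'[OF old_edge] f3 by simp
    qed
  qed
qed

text \<open>The map from the Moebius band \<open>z\<^sup>2 \<le> x\<^sup>2 + y\<^sup>2\<close> in the projective plane onto the preimage of a closed
  disc around the centre, the core \<open>z = 0\<close> being the exceptional curve.\<close>

definition band_point :: "real \<Rightarrow> real \<Rightarrow> real \<Rightarrow> ('v set \<times> ('v \<Rightarrow> real)) set" where
  "band_point x y z = (if y \<noteq> 0 then chart C' p s (x / y, y * z / (x\<^sup>2 + y\<^sup>2))
     else chart C' s q (x * z / (x\<^sup>2 + y\<^sup>2), y / x))"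

lemma band_point_alt:
  assumes "x \<noteq> 0"
  shows "band_point x y z = chart C' s q (x * z / (x\<^sup>2 + y\<^sup>2), y / x)"
proof (cases "y = 0")
  case False
  have "y * z / (x\<^sup>2 + y\<^sup>2) * (x / y) = x * z / (x\<^sup>2 + y\<^sup>2)" using False by simp
  then show ?thesis
    using exceptional_transition[of "x / y" "y * z / (x\<^sup>2 + y\<^sup>2)"] assms False by (simp add: band_point_def mult.commute)
qed (simp add: band_point_def)

text \<open>Homogeneity of degree 0: the formula descends from the sphere to the projective
  plane.\<close>

lemma band_point_scale:
  assumes "c \<noteq> 0"
  shows "band_point (c * x) (c * y) (c * z) = band_point x y z"
proof -
  have "(c * x)\<^sup>2 + (c * y)\<^sup>2 = c\<^sup>2 * (x\<^sup>2 + y\<^sup>2)" by (simp add: power_mult_distrib algebra_simps)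
  then have sc: "c * t * (c * z) / ((c * x)\<^sup>2 + (c * y)\<^sup>2) = t * z / (x\<^sup>2 + y\<^sup>2)" for t
    using assms by (simp add: power2_eq_square)
  show ?thesis unfolding band_point_def sc using assms by simp
qed

text \<open>The curve of \<open>q\<close> tells whether \<open>y\<close> vanishes and hence in which
  of the two new charts both points can be compared.\<close>

lemma band_point_inj:
  assumes nz: "x \<noteq> 0 \<or> y \<noteq> 0" "x' \<noteq> 0 \<or> y' \<noteq> 0" and eq: "band_point x y z = band_point x' y' z'"
  shows "\<exists>c. x' = c * x \<and> y' = c * y \<and> z' = c * z"
proof -
  have q: "q \<in> fan_rays C'" using edge_rays[OF C' new_edges(2)] by simp
  have on: "on_curve q (band_point x y z) \<longleftrightarrow> y = 0" if "x \<noteq> 0 \<or> y \<noteq> 0" for x y z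
    using that on_curve_chart[OF C' new_edges(1) q] on_curve_chart[OF C' new_edges(2) q]
      basis_facts(3)[OF bases(1)] basis_facts(3)[OF bases(3)] basis_facts(4)[OF bases(1)]
    by (auto simp: band_point_def)
  show ?thesis
  proof (cases "y = 0")
    case True
    then have y: "y = 0" "y' = 0" using on[OF nz(1), of z] on[OF nz(2), of z'] eq by auto
    then have x: "x \<noteq> 0" "x' \<noteq> 0" using nz by auto
    have "x * z / (x\<^sup>2 + y\<^sup>2) = x' * z' / (x'\<^sup>2 + y'\<^sup>2)"
      using chart_inj[OF C' new_edges(2)] eq unfolding band_point_alt[OF x(1)] band_point_alt[OF x(2)] by blast
    then have "z' = x' / x * z" using x y by (simp add: power2_eq_square field_simps)
    then show ?thesis using x y by (intro exI[of _ "x' / x"]) simp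
  next
    case False
    then have y: "y \<noteq> 0" "y' \<noteq> 0" using on[OF nz(1), of z] on[OF nz(2), of z'] eq by auto
    have e: "x / y = x' / y'" "y * z / (x\<^sup>2 + y\<^sup>2) = y' * z' / (x'\<^sup>2 + y'\<^sup>2)"
      using chart_inj[OF C' new_edges(1)] eq y unfolding band_point_def by auto
    define c where "c = y' / y"
    have c: "c \<noteq> 0" "y' = c * y" "x' = c * x" using e(1) y by (auto simp: c_def field_simps)
    have r: "x\<^sup>2 + y\<^sup>2 \<noteq> 0" using y by (simp add: sum_power2_eq_zero_iff)
    have "x'\<^sup>2 + y'\<^sup>2 = c\<^sup>2 * (x\<^sup>2 + y\<^sup>2)" by (simp add: c power_mult_distrib algebra_simps)
    then have "y * z / (x\<^sup>2 + y\<^sup>2) = y * (z' / c) / (x\<^sup>2 + y\<^sup>2)" using e(2) c by (simp add: power2_eq_square)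
    then have "y * z = y * (z' / c)" using r unfolding divide_cancel_right by blast
    then have "z = z' / c" using y by (metis mult_cancel_left)
    then show ?thesis using c by (intro exI[of _ c]) simp
  qed
qed

text \<open>The band is closed in the projective plane, so the antipodal quotient map of the sphere
  restricts to a quotient map onto it, and an even function on the preimage factors through
  it.\<close>

lemma band_map_exists:
  obtains G where
    "continuous_map (subtopology real_projective_plane (topspace real_projective_plane - affine_point ` ball 0 1)) (surface C') G"
    "\<And>x. x \<in> sphere 0 1 \<Longrightarrow> (x $ 3)\<^sup>2 \<le> (x $ 1)\<^sup>2 + (x $ 2)\<^sup>2 \<Longrightarrow> G {x, - x} = band_point (x $ 1) (x $ 2) (x $ 3)"
proof -
  define A where "A = {x \<in> sphere (0::real^3) 1. (x $ 3)\<^sup>2 \<le> (x $ 1)\<^sup>2 + (x $ 2)\<^sup>2}"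
  define g where "g = (\<lambda>x::real^3. band_point (x $ 1) (x $ 2) (x $ 3))"
  let ?V = "topspace real_projective_plane - affine_point ` ball 0 1"
  have nz: "x $ 1 \<noteq> 0 \<or> x $ 2 \<noteq> 0" if "x \<in> A" for x
    using that unfolding A_def sphere_real3 by auto
  have cont: "continuous_map (top_of_set A) (surface C') g"
  proof (rule continuous_map_pieces)
    fix x assume "x \<in> A"
    then consider "x $ 1 \<noteq> 0" | "x $ 2 \<noteq> 0" using nz by blast
    then show "\<exists>T. open T \<and> x \<in> T \<and> continuous_map (top_of_set (A \<inter> T)) (surface C') g"
    proof cases
      case 1
      have "continuous_map (top_of_set (A \<inter> {x. x $ 1 \<noteq> 0})) (surface C') g"
      proof (rule continuous_map_eq)
        show "continuous_map (top_of_set (A \<inter> {x. x $ 1 \<noteq> 0})) (surface C')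
            (\<lambda>x. chart C' s q (x $ 1 * x $ 3 / ((x $ 1)\<^sup>2 + (x $ 2)\<^sup>2), x $ 2 / x $ 1))"
          by (intro continuous_map_chart[OF C' new_edges(2)] continuous_intros) (auto simp: sum_power2_eq_zero_iff)
      qed (auto simp: g_def band_point_alt)
      moreover have "open {x::real^3. x $ 1 \<noteq> 0}" by (intro open_Collect_neq continuous_intros)
      ultimately show ?thesis using 1 by blast
    next
      case 2
      have "continuous_map (top_of_set (A \<inter> {x. x $ 2 \<noteq> 0})) (surface C') g"
      proof (rule continuous_map_eq)
        show "continuous_map (top_of_set (A \<inter> {x. x $ 2 \<noteq> 0})) (surface C')
            (\<lambda>x. chart C' p s (x $ 1 / x $ 2, x $ 2 * x $ 3 / ((x $ 1)\<^sup>2 + (x $ 2)\<^sup>2)))"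
          by (intro continuous_map_chart[OF C' new_edges(1)] continuous_intros) (auto simp: sum_power2_eq_zero_iff)
      qed (auto simp: g_def band_point_def)
      moreover have "open {x::real^3. x $ 2 \<noteq> 0}" by (intro open_Collect_neq continuous_intros)
      ultimately show ?thesis using 2 by blast
    qed
  qed
  have closed: "closedin real_projective_plane ?V"
    using open_affine_point_image[OF open_ball[of 0 1]] by (simp add: closedin_def Diff_Diff_Int Int_absorb1 openin_subset)
  have pre: "{x \<in> topspace (top_of_set (sphere 0 1)). {x, - x} \<in> ?V} = A"
    using affine_disc_complement unfolding A_def topspace_projective_plane by auto
  have quo: "quotient_map (top_of_set A) (subtopology real_projective_plane ?V) (\<lambda>x. {x, - x})"
  proof -
    have "A \<subseteq> sphere 0 1" by (auto simp: A_def)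
    then show ?thesis
      using quotient_map_restriction[OF quotient_map_projective_plane pre] closed
      by (simp add: subtopology_subtopology Int_absorb1)
  qed
  have neg: "g (- x) = g x" for x
    using band_point_scale[of "- 1" "x $ 1" "x $ 2" "x $ 3"] by (simp add: g_def)
  have "g x = g y" if "{x, - x} = {y, - y}" for x y
  proof -
    have "x = y \<or> x = - y" using that by (auto simp: doubleton_eq_iff)
    then show ?thesis using neg by auto
  qed
  then obtain G where G: "continuous_map (subtopology real_projective_plane ?V) (surface C') G"
    "\<And>x. x \<in> A \<Longrightarrow> G {x, - x} = g x"
    using quotient_map_lift_exists[OF quo cont] by (metis topspace_euclidean_subtopology)
  show ?thesis
    by (rule that[OF G(1)]) (use G(2) in \<open>simp add: A_def g_def\<close>)
qed

lemma band_representative: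
  assumes "x \<noteq> 0 \<or> y \<noteq> 0" "z\<^sup>2 \<le> x\<^sup>2 + y\<^sup>2"
  shows "\<exists>w\<in>sphere (0::real^3) 1. (w $ 3)\<^sup>2 \<le> (w $ 1)\<^sup>2 + (w $ 2)\<^sup>2 \<and> band_point x y z = band_point (w $ 1) (w $ 2) (w $ 3)"
proof -
  define n where "n = sqrt (x\<^sup>2 + y\<^sup>2 + z\<^sup>2)"
  have "0 < x\<^sup>2 + y\<^sup>2" using assms(1) by (simp add: sum_power2_gt_zero_iff)
  then have pos: "0 < x\<^sup>2 + y\<^sup>2 + z\<^sup>2" by (rule add_pos_nonneg) simp
  have n: "0 < n" "x\<^sup>2 + y\<^sup>2 + z\<^sup>2 = n\<^sup>2" using pos by (simp_all add: n_def)
  let ?w = "vector [x / n, y / n, z / n] :: real^3"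
  have "?w \<in> sphere 0 1" unfolding sphere_real3
    using n(1) by (simp add: vector_3 power_divide add_divide_distrib[symmetric] n(2))
  moreover have "(?w $ 3)\<^sup>2 \<le> (?w $ 1)\<^sup>2 + (?w $ 2)\<^sup>2"
    using assms(2) n(1) by (simp add: vector_3 power_divide add_divide_distrib[symmetric] divide_right_mono)
  moreover have "band_point x y z = band_point (?w $ 1) (?w $ 2) (?w $ 3)"
    using n(1) band_point_scale[of "1 / n" x y z] by (simp add: vector_3)
  ultimately show ?thesis by blast
qed

text \<open>The old surface outside the open disc enters by the section, the Moebius band by
  \<open>G\<close>. On the unit circle the section has band coordinates \<open>(v1, v2, 1)\<close>,
  exactly the affine point of \<open>v\<close>, so the two boundaries match without a twist of the
  gluing map.\<close>

theorem blowup_surface: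
  assumes compact: "compact_space (surface C)"
  shows "is_connected_sum (surface C) real_projective_plane (surface C')" "compact_space (surface C')"
proof -
  obtain i where i: "continuous_map (subtopology (surface C) (topspace (surface C) - {centre})) (surface C') i"
    "\<And>x y. x \<noteq> 0 \<Longrightarrow> i (chart C p q (x, y)) = chart C' s q (x, y / x)"
    "\<And>x y. y \<noteq> 0 \<Longrightarrow> i (chart C p q (x, y)) = chart C' p s (x / y, y)"
    "\<And>a b z. (a, b) \<in> C \<Longrightarrow> (a, b) \<noteq> (p, q) \<Longrightarrow> i (chart C a b z) = chart C' a b z"
    by (rule section_exists) (rule that)
  obtain \<pi> where \<pi>: "continuous_map (surface C') (surface C) \<pi>"
    "\<And>x y. \<pi> (chart C' p s (x, y)) = chart C p q (x * y, y)"
    "\<And>x y. \<pi> (chart C' s q (x, y)) = chart C p q (x, x * y)"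
    "\<And>a b z. (a, b) \<in> C \<Longrightarrow> (a, b) \<noteq> (p, q) \<Longrightarrow> \<pi> (chart C' a b z) = chart C a b z"
    by (rule blowdown_exists) (rule that)
  obtain G where G: "continuous_map (subtopology real_projective_plane (topspace real_projective_plane - affine_point ` ball 0 1)) (surface C') G"
    "\<And>x. x \<in> sphere 0 1 \<Longrightarrow> (x $ 3)\<^sup>2 \<le> (x $ 1)\<^sup>2 + (x $ 2)\<^sup>2 \<Longrightarrow> G {x, - x} = band_point (x $ 1) (x $ 2) (x $ 3)"
    by (rule band_map_exists) (rule that)
  let ?X = "surface C" and ?R = real_projective_plane
  define \<phi> where "\<phi> = (\<lambda>v::real^2. chart C p q (v $ 1, v $ 2))"
  let ?M = "topspace ?X - \<phi> ` ball 0 1" and ?N = "topspace ?R - affine_point ` ball 0 1"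
  have \<phi>_inj: "inj \<phi>" using chart_inj[OF C pq] by (auto simp: \<phi>_def inj_def vec_eq_iff forall_2)
  have \<phi>_chart: "chart C p q (x, y) = \<phi> (vector [x, y])" for x y by (simp add: \<phi>_def)
  have norm2: "norm v < 1 \<longleftrightarrow> (v $ 1)\<^sup>2 + (v $ 2)\<^sup>2 < 1" for v :: "real^2"
    by (simp add: norm_eq_sqrt_inner inner_vec_def sum_2 power2_eq_square)
  have centre: "centre = \<phi> 0" by (simp add: \<phi>_def)
  have op: "openin ?X (\<phi> ` ball 0 1)"
    using chart_disc_open[OF C pq open_ball] unfolding \<phi>_def .
  \<comment> \<open>The blow-down multiplies \<open>(x, y)\<close> by
    \<open>z / (x^2 + y^2)\<close>, so third coordinate equal to the squared norm is what returns
    \<open>v\<close> itself.\<close>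
  have section_band: "i (\<phi> v) = band_point (v $ 1) (v $ 2) ((v $ 1)\<^sup>2 + (v $ 2)\<^sup>2)" if "v \<noteq> 0" for v
  proof (cases "v $ 1 = 0")
    case True
    then have "v $ 2 \<noteq> 0" using that by (auto simp: vec_eq_iff forall_2)
    then show ?thesis using True i(3) by (simp add: \<phi>_def band_point_def power2_eq_square)
  next
    case False
    then have "(v $ 1)\<^sup>2 + (v $ 2)\<^sup>2 \<noteq> 0" by (simp add: sum_power2_eq_zero_iff)
    then show ?thesis using False i(2) by (simp add: \<phi>_def band_point_alt)
  qed
  have band_down: "\<pi> (band_point x y z) = chart C p q (x * z / (x\<^sup>2 + y\<^sup>2), y * z / (x\<^sup>2 + y\<^sup>2))"
    if "x \<noteq> 0 \<or> y \<noteq> 0" for x y z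
    using that \<pi>(2,3) by (auto simp: band_point_def)
  have retract: "\<pi> (i P) = P" if P: "P \<in> topspace ?X" "P \<noteq> centre" for P
  proof -
    obtain a b z where ab: "(a, b) \<in> C" "P = chart C a b z" by (rule surface_cover[OF C P(1)]) (rule that)
    show ?thesis
    proof (cases "(a, b) = (p, q)")
      case True
      then have "fst z \<noteq> 0 \<or> snd z \<noteq> 0" using P(2) ab by (cases z) auto
      then show ?thesis using True ab(2) i(2,3) \<pi>(2,3) by (cases z) auto
    next
      case False
      then show ?thesis using ab i(4) \<pi>(4) by simp
    qed
  qed
  have M: "P \<in> topspace ?X" "P \<noteq> centre" if "P \<in> ?M" for P using that centre by auto
  have N: "\<exists>x\<in>sphere 0 1. (x $ 3)\<^sup>2 \<le> (x $ 1)\<^sup>2 + (x $ 2)\<^sup>2 \<and> (x $ 1 \<noteq> 0 \<or> x $ 2 \<noteq> 0) \<and> R = {x, - x} \<and> G R = band_point (x $ 1) (x $ 2) (x $ 3)"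
    if R: "R \<in> ?N" for R
  proof -
    obtain x where x: "x \<in> sphere 0 1" "R = {x, - x}" using R unfolding topspace_projective_plane by blast
    then have le: "(x $ 3)\<^sup>2 \<le> (x $ 1)\<^sup>2 + (x $ 2)\<^sup>2" using R affine_disc_complement[OF x(1)] by auto
    then have "x $ 1 \<noteq> 0 \<or> x $ 2 \<noteq> 0" using x(1) unfolding sphere_real3 by auto
    then show ?thesis using x le G(2)[OF x(1) le] by blast
  qed
  have band_range: "band_point x y z \<in> G ` ?N" if xyz: "x \<noteq> 0 \<or> y \<noteq> 0" "z\<^sup>2 \<le> x\<^sup>2 + y\<^sup>2" for x y z
  proof -
    obtain w where w: "w \<in> sphere (0::real^3) 1" "(w $ 3)\<^sup>2 \<le> (w $ 1)\<^sup>2 + (w $ 2)\<^sup>2"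
      "band_point x y z = band_point (w $ 1) (w $ 2) (w $ 3)" using band_representative[OF xyz] by blast
    have "{w, - w} \<in> ?N" using w(1,2) affine_disc_complement[OF w(1)] unfolding topspace_projective_plane by blast
    then show ?thesis using G(2)[OF w(1,2)] w(3) by blast
  qed
  \<comment> \<open>Points of the punctured open disc have squared norm at most 1, so their band
    coordinates satisfy the band inequality and they are reached from the second piece.\<close>
  have section_range: "i P \<in> i ` ?M \<union> G ` ?N" if P: "P \<in> topspace ?X" "P \<noteq> centre" for P
  proof (cases "P \<in> \<phi> ` ball 0 1")
    case True
    then obtain v where v: "norm v < 1" "P = \<phi> v" by auto
    then have "v \<noteq> 0" using P(2) centre by auto
    moreover have "((v $ 1)\<^sup>2 + (v $ 2)\<^sup>2)\<^sup>2 \<le> (v $ 1)\<^sup>2 + (v $ 2)\<^sup>2"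
      using v(1) unfolding norm2 by (simp add: power2_eq_square[of "_ + _"] mult_left_le)
    ultimately show ?thesis
      using band_range section_band[of v] v(2) by (auto simp: vec_eq_iff forall_2)
  qed (use P in blast)
  have e0: "chart C' p s (x, 0) = band_point x 1 0" "chart C' s q (0, y) = band_point 1 y 0" for x y
    by (simp_all add: band_point_alt) (simp add: band_point_def)
  have disc: "coordinate_disc ?X \<phi>" unfolding \<phi>_def by (rule chart_disc[OF C pq])
  have ci: "continuous_map (subtopology ?X ?M) (surface C') i"
    using M by (intro continuous_map_from_subtopology_mono[OF i(1)]) auto
  have ii: "inj_on i ?M"
  proof (rule inj_onI)
    fix P Q assume P: "P \<in> ?M" and Q: "Q \<in> ?M" and eq: "i P = i Q"
    show "P = Q" using retract[OF M[OF P]] retract[OF M[OF Q]] unfolding eq by (rule trans[OF sym])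
  qed
  have iG: "inj_on G ?N"
  proof (rule inj_onI)
    fix R R' assume R: "R \<in> ?N" "R' \<in> ?N" and eq: "G R = G R'"
    obtain x where x: "x \<in> sphere 0 1" "x $ 1 \<noteq> 0 \<or> x $ 2 \<noteq> 0" "R = {x, - x}" "G R = band_point (x $ 1) (x $ 2) (x $ 3)"
      using N[OF R(1)] by blast
    obtain y where y: "y \<in> sphere 0 1" "y $ 1 \<noteq> 0 \<or> y $ 2 \<noteq> 0" "R' = {y, - y}" "G R' = band_point (y $ 1) (y $ 2) (y $ 3)"
      using N[OF R(2)] by blast
    obtain c where "y $ 1 = c * x $ 1 \<and> y $ 2 = c * x $ 2 \<and> y $ 3 = c * x $ 3"
      using band_point_inj[OF x(2) y(2)] eq x(4) y(4) by metis
    then have "y = c *\<^sub>R x" by (simp add: vec_eq_iff forall_3)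
    then have "y = x \<or> y = - x" by (rule sphere_proportional[OF x(1) y(1)])
    then show "R = R'" using x(3) y(3) by auto
  qed
  have cross: "i P = G R \<longleftrightarrow> (\<exists>v\<in>sphere 0 1. P = \<phi> v \<and> R = affine_point v)" if P: "P \<in> ?M" and R: "R \<in> ?N" for P R
  proof -
    obtain x where x: "x \<in> sphere 0 1" "(x $ 3)\<^sup>2 \<le> (x $ 1)\<^sup>2 + (x $ 2)\<^sup>2" "x $ 1 \<noteq> 0 \<or> x $ 2 \<noteq> 0" "R = {x, - x}"
      "G R = band_point (x $ 1) (x $ 2) (x $ 3)"
      using N[OF R] by blast
    define r where "r = (x $ 1)\<^sup>2 + (x $ 2)\<^sup>2"
    have r: "0 < r" using x(3) by (simp add: r_def sum_power2_gt_zero_iff)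
    show ?thesis
    proof
      assume eq: "i P = G R"
      define v where "v = (vector [x $ 1 * x $ 3 / r, x $ 2 * x $ 3 / r] :: real^2)"
      have "P = \<phi> v" using retract[OF M[OF P]] eq x(5) band_down[OF x(3)] unfolding v_def \<phi>_def r_def by simp
      moreover have "(v $ 1)\<^sup>2 + (v $ 2)\<^sup>2 = (x $ 3)\<^sup>2 / r"
      proof -
        have "(v $ 1)\<^sup>2 + (v $ 2)\<^sup>2 = r * (x $ 3)\<^sup>2 / r\<^sup>2"
          by (simp add: v_def power_divide power_mult_distrib add_divide_distrib r_def algebra_simps)
        then show ?thesis using r by (simp add: power2_eq_square)
      qed
      moreover have "\<not> norm v < 1" using P \<open>P = \<phi> v\<close> by auto
      ultimately have "r \<le> (x $ 3)\<^sup>2" using r by (simp add: norm2)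
      \<comment> \<open>Being outside the open disc and inside the band are opposite inequalities,
        so a common point lies on the unit circle.\<close>
      then have sq: "(x $ 3)\<^sup>2 = r" using x(2) r_def by simp
      then have "norm v = 1" using \<open>(v $ 1)\<^sup>2 + (v $ 2)\<^sup>2 = (x $ 3)\<^sup>2 / r\<close> r sphere_real2[of v] by simp
      moreover have "R = affine_point v"
        unfolding x(4) affine_point_iff[OF x(1)] using r sq by (auto simp: v_def power2_eq_square)
      ultimately show "\<exists>v\<in>sphere 0 1. P = \<phi> v \<and> R = affine_point v" using \<open>P = \<phi> v\<close> by auto
    next
      assume "\<exists>v\<in>sphere 0 1. P = \<phi> v \<and> R = affine_point v"
      then obtain v where v: "v \<in> sphere 0 1" "P = \<phi> v" "R = affine_point v" by blast
      have xv: "x $ 3 \<noteq> 0" "x $ 1 = x $ 3 * v $ 1" "x $ 2 = x $ 3 * v $ 2"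
        using v(3) unfolding x(4) affine_point_iff[OF x(1)] by auto
      have "v \<noteq> 0" using v(1) by auto
      then have "i P = band_point (v $ 1) (v $ 2) 1" using section_band v(1,2) unfolding sphere_real2 by simp
      also have "\<dots> = G R" using x(5) band_point_scale[OF xv(1), of "v $ 1" "v $ 2" 1] xv by simp
      finally show "i P = G R" .
    qed
  qed
  have onto: "topspace (surface C') \<subseteq> i ` ?M \<union> G ` ?N"
  proof
    fix Q assume "Q \<in> topspace (surface C')"
    then obtain a b z where ab: "(a, b) \<in> C'" "Q = chart C' a b z" by (rule surface_cover[OF C']) (rule that)
    obtain x y where z: "z = (x, y)" by (cases z)
    show "Q \<in> i ` ?M \<union> G ` ?N"
      using ab(1)
    proof (cases rule: blowup_cases)
      case 1
      show ?thesis
      proof (cases "y = 0")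
        case True
        then show ?thesis using ab(2) 1 z e0(1)[of x] band_range[of x 1 0] by simp
      next
        case False
        then have "Q = i (chart C p q (x * y, y))" using i(3)[OF False, of "x * y"] ab(2) 1 z by simp
        then show ?thesis using section_range[OF chart_in_surface[OF C pq], of "(x * y, y)"] centre_chart[OF pq, of "(x * y, y)"] False by auto
      qed
    next
      case 2
      show ?thesis
      proof (cases "x = 0")
        case True
        then show ?thesis using ab(2) 2 z e0(2)[of y] band_range[of 1 y 0] by simp
      next
        case False
        then have "Q = i (chart C p q (x, x * y))" using i(2)[OF False, of "x * y"] ab(2) 2 z by simp
        then show ?thesis using section_range[OF chart_in_surface[OF C pq], of "(x, x * y)"] centre_chart[OF pq, of "(x, x * y)"] False by auto
      qed
    next
      case 3
      then have "Q = i (chart C a b z)" using i(4) ab(2) by simp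
      moreover have "chart C a b z \<noteq> centre" using centre_chart[OF 3(1), of z] 3(2) by auto
        ultimately show ?thesis using section_range[OF chart_in_surface[OF C 3(1)]] by (simp only:)
    qed
  qed
  note sum = is_connected_sumI[OF compact compact_projective_plane Hausdorff_surface[OF C'] disc affine_point_disc \<phi>_inj inj_affine_point
        op open_affine_point_image[OF open_ball] ci G(1) ii iG cross onto]
  show "is_connected_sum ?X ?R (surface C')" by (rule sum(1))
  show "compact_space (surface C')" by (rule sum(2))
qed

end

section \<open>Identification of the fan and of the surface\<close>

lemma subset_pair_iff: "A \<subseteq> {a, b} \<longleftrightarrow> A \<in> {{}, {a}, {b}, {a, b}}"
  by auto

lemma is_connected_sum_homeomorphic:
  "is_connected_sum M N P \<Longrightarrow> P' homeomorphic_space P \<Longrightarrow> is_connected_sum M N P'"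
  unfolding is_connected_sum_def using homeomorphic_space_trans by blast

text \<open>Both introduction rules mention the final surface only up to homeomorphism, so a case
  distinction on the last rule suffices.\<close>

lemma connected_sum_homeomorphic:
  fixes M M' :: "'a topology"
  assumes "connected_sum_of_projective_planes k M" "M' homeomorphic_space M"
  shows "connected_sum_of_projective_planes k M'"
  using assms
proof cases
  case one
  show ?thesis unfolding one(1)
    by (rule connected_sum_of_projective_planes.one[OF homeomorphic_space_trans[OF assms(2) one(2)]])
next
  case (step k M0)
  show ?thesis unfolding step(1)
    by (rule connected_sum_of_projective_planes.step[OF step(2) is_connected_sum_homeomorphic[OF step(3) assms(2)]])
qed

section \<open>Comparison with the standard Hirzebruch fans\<close>

interpretation integer_plane: plane_lattice integer_lattice
  "\<lambda>x. vector [- (x $ 2), x $ 1]" "vector [1, 0]" "vector [0, 1]"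
proof
  let ?J = "\<lambda>x::real^2. vector [- (x $ 2), x $ 1] :: real^2"
  have inner: "x \<bullet> y = x $ 1 * y $ 1 + x $ 2 * y $ 2" for x y :: "real^2"
    by (simp add: inner_vec_def sum_2)
  show "?J (x + y) = ?J x + ?J y" "?J (r *\<^sub>R x) = r *\<^sub>R ?J x" for x y r
    by (simp_all add: vec_eq_iff forall_2)
  show "?J x \<bullet> y = - (?J y \<bullet> x)" for x y by (simp add: inner algebra_simps)
  show "?J (vector [1, 0]) \<bullet> vector [0, 1] = 1" by (simp add: inner)
  show "v = (?J v \<bullet> vector [0, 1]) *\<^sub>R vector [1, 0] + (?J (vector [1, 0]) \<bullet> v) *\<^sub>R vector [0, 1]" for v
    by (simp add: inner vec_eq_iff forall_2)
  show "integer_lattice = {v. ?J v \<bullet> vector [0, 1] \<in> \<int> \<and> ?J (vector [1, 0]) \<bullet> v \<in> \<int>}"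
    by (simp add: integer_lattice_def inner forall_2)
  show "dual_lattice integer_lattice = ?J ` integer_lattice"
  proof (intro equalityI subsetI)
    fix m assume m: "m \<in> dual_lattice integer_lattice"
    have "vector [1, 0] \<in> integer_lattice" "vector [0, 1] \<in> integer_lattice" by (simp_all add: integer_lattice_def forall_2)
    then have "m \<bullet> vector [1, 0] \<in> \<int>" "m \<bullet> vector [0, 1] \<in> \<int>" using m by (auto simp: dual_lattice_def)
    then have "(vector [m $ 2, - (m $ 1)] :: real^2) \<in> integer_lattice" by (simp add: integer_lattice_def inner forall_2)
    moreover have "m = ?J (vector [m $ 2, - (m $ 1)])" by (simp add: vec_eq_iff forall_2)
    ultimately show "m \<in> ?J ` integer_lattice" by blast
  next
    fix m assume "m \<in> ?J ` integer_lattice"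
    then obtain v where v: "v \<in> integer_lattice" "m = ?J v" by blast
    show "m \<in> dual_lattice integer_lattice"
      using v(1) unfolding v(2) by (auto simp: dual_lattice_def integer_lattice_def inner forall_2)
  qed
qed

lemma integer_basis: "integer_plane.basis (vector [1, 0]) (vector [0, 1])"
  unfolding integer_plane.basis_def by (simp add: integer_lattice_def forall_2 inner_vec_def sum_2)

context plane_lattice
begin

lemma faces_hirz_fan:
  fixes u w :: 'v and x :: int
  defines "w' \<equiv> - u + of_int x *\<^sub>R w"
  shows "faces (hirz_fan u w x) =
    {{}, {u}, {w}, {w'}, {- w}, {u, w}, {w, w'}, {w', - w}, {- w, u}}"
proof -
  have "faces (hirz_fan u w x) = {A. A \<subseteq> {u, w} \<or> A \<subseteq> {w, w'} \<or> A \<subseteq> {w', - w} \<or> A \<subseteq> {- w, u}}"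
    unfolding faces_def hirz_fan_def w'_def by auto
  then show ?thesis
    unfolding subset_pair_iff by (intro set_eqI) (simp only: mem_Collect_eq insert_iff empty_iff, argo)
qed

text \<open>The lattice isomorphism \<open>T\<close> reads off coordinates in the basis
  \<open>u\<close>, \<open>w\<close>, with inverse \<open>U\<close>; \<open>A\<close> and
  \<open>B\<close> are their transposes and act on characters.\<close>

lemma hirz_fan_isomorphic:
  assumes uw: "basis u w"
  shows "isomorphic_varieties (toric_variety N (fan_cones (hirz_fan u w (int a)))) (hirzebruch_surface a)"
proof -
  define T where "T = (\<lambda>v. vector [area v w, area u v] :: real^2)"
  define U where "U = (\<lambda>c::real^2. c $ 1 *\<^sub>R u + c $ 2 *\<^sub>R w)"
  define A where "A = (\<lambda>m::real^2. m $ 2 *\<^sub>R J u - m $ 1 *\<^sub>R J w)"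
  define B where "B = (\<lambda>m. vector [m \<bullet> u, m \<bullet> w] :: real^2)"
  note f = basis_facts[OF uw]
  have UT: "U (T v) = v" for v using basis_expand[OF uw, of v] by (simp add: U_def T_def)
  have TU: "T (U c) = c" for c using f by (simp add: U_def T_def vec_eq_iff forall_2)
  have A: "A m \<bullet> v = m \<bullet> T v" for m v
    using skew[of w v] by (simp add: A_def T_def inner_vec_def sum_2 inner_diff_left)
  have B: "B m \<bullet> c = m \<bullet> U c" for m c
    by (simp add: B_def U_def inner_vec_def sum_2 inner_add_right)
  have AB: "A (B m) = m" for m
  proof -
    have "A (B m) \<bullet> v = m \<bullet> v" for v by (simp add: A B UT)
    then show ?thesis using vector_eq_rdot by blast
  qed
  have BA: "B (A m) = m" for m
  proof -
    have "B (A m) \<bullet> v = m \<bullet> v" for v by (simp add: A B TU)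
    then show ?thesis using vector_eq_rdot by blast
  qed
  have linA: "linear A" by (rule linearI) (simp_all add: A_def algebra_simps)
  have linB: "linear B" by (rule linearI) (simp_all add: B_def vec_eq_iff forall_2 algebra_simps)
  have linT: "linear T" by (rule linearI) (simp_all add: T_def vec_eq_iff forall_2)
  have TN: "T ` N = integer_lattice"
  proof (intro equalityI subsetI)
    fix c assume "c \<in> T ` N"
    then show "c \<in> integer_lattice" using N_area f by (auto simp: T_def integer_lattice_def forall_2)
  next
    fix c assume c: "c \<in> integer_lattice"
    then obtain i j where "c $ 1 = of_int i" "c $ 2 = of_int j"
      unfolding integer_lattice_def by (auto simp: forall_2 elim!: Ints_cases)
    then have "U c \<in> N" using f by (simp add: U_def N_add N_scale)
    then show "c \<in> T ` N" using TU[of c] by (metis image_eqI)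
  qed
  have Tu: "T u = vector [1, 0]" "T w = vector [0, 1]" using f by (simp_all add: T_def)
  have Tw: "T (- u + of_int (int a) *\<^sub>R w) = - vector [1, 0] + real a *\<^sub>R vector [0, 1]" "T (- w) = - vector [0, 1]"
    by (simp_all only: linear_add[OF linT] linear_neg[OF linT] linear_scale[OF linT] Tu of_int_of_nat_eq)
  have cone: "T ` cone_of S = convex_cone hull (T ` S)" for S using convex_cone_hull_linear_image[OF linT] by simp
  have fan: "(`) T ` fan_cones (hirz_fan u w (int a)) = hirzebruch_fan a"
    unfolding fan_cones_def faces_hirz_fan hirzebruch_fan_def Let_def image_insert image_empty cone Tu Tw ..
  have "fan_isomorphism N (fan_cones (hirz_fan u w (int a))) integer_lattice (hirzebruch_fan a) T U A B"
    by (rule fan_isomorphism.intro) (rule UT TU AB BA A B linA linB TN fan)+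
  then show ?thesis unfolding hirzebruch_surface_def by (rule fan_isomorphism.isomorphic_toric_varieties)
qed

text \<open>A negative index is made positive by rotating the fan, which preserves parity.\<close>

lemma even_hirz_fan_isomorphic:
  assumes uw: "basis u w" and x: "even x"
  shows "\<exists>a. isomorphic_varieties (toric_variety N (fan_cones (hirz_fan u w x))) (hirzebruch_surface (2 * a))"
proof (cases "0 \<le> x")
  case True
  then have "int (2 * nat (x div 2)) = x" using x by simp
  then show ?thesis using hirz_fan_isomorphic[OF uw, of "2 * nat (x div 2)"] by auto
next
  case False
  then have "int (2 * nat (- x div 2)) = - x" using x by simp
  then show ?thesis
    using hirz_fan_isomorphic[OF hirz_fan_cones(2)[OF uw, of x], of "2 * nat (- x div 2)"]
    unfolding hirz_fan_rotate[of u w x] by auto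
qed

text \<open>After the blow-up the new ray \<open>u + w\<close> is opposite to the third ray of the
  plane, so the four rays form a Hirzebruch fan of index 1. Orientation and subdivision are read off
  by contracting that fan.\<close>

lemma plane_fan_blowup:
  assumes uw: "basis u w"
  shows "oriented_fan (plane_fan u w)" "(u, w) \<in> plane_fan u w"
    "hirz_fan u (u + w) 1 = blowup (plane_fan u w) u w" "card (plane_fan u w) = 3"
proof -
  have bas: "basis u (u + w)" using uw by (auto simp: basis_def intro: N_add)
  have H: "hirz_fan u (u + w) 1 = {(u, u + w), (u + w, w), (w, - u - w), (- u - w, u)}"
    by (auto simp: hirz_fan_def)
  note d = hirz_fan_distinct[OF bas, of 1]
  have d': "u \<noteq> w" "u \<noteq> u + w" "u + w \<noteq> w" "w \<noteq> - u - w" "u \<noteq> - u - w" "u + w \<noteq> - u - w"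
    using d by (auto simp: algebra_simps)
  have e: "(u, u + w) \<in> hirz_fan u (u + w) 1" "(u + w, w) \<in> hirz_fan u (u + w) 1" unfolding H by auto
  have C0: "insert (u, w) (hirz_fan u (u + w) 1 - {(u, u + w), (u + w, w)}) = plane_fan u w"
    unfolding H plane_fan_def using d' by auto
  note c = contract[OF oriented_hirz_fan[OF bas] e, unfolded C0]
  show "oriented_fan (plane_fan u w)" "hirz_fan u (u + w) 1 = blowup (plane_fan u w) u w" using c by auto
  show "(u, w) \<in> plane_fan u w" "card (plane_fan u w) = 3" using d' by (simp_all add: plane_fan_def)
qed

text \<open>Besides the connected sum, the induction carries compactness, which the recognition of
  the next sum requires, and a lower bound on the number of cones. Odd Hirzebruch fans reduce to
  index 1 by parity.\<close>

lemma connected_sum_surface: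
  assumes C: "oriented_fan C" and n: "\<And>u w x. basis u w \<Longrightarrow> even x \<Longrightarrow> C \<noteq> hirz_fan u w x"
  shows "connected_sum_of_projective_planes (card C - 2) (surface C)"
proof -
  define P where "P C \<longleftrightarrow> compact_space (surface C) \<and> 3 \<le> card C \<and>
    connected_sum_of_projective_planes (card C - 2) (surface C)" for C
  have plane: "P (plane_fan u w)" if uw: "basis u w" for u w
    using plane_surface[OF plane_fan_blowup(1)[OF uw] uw] connected_sum_of_projective_planes.one
    by (simp add: P_def plane_fan_blowup(4)[OF uw])
  have step: "P (blowup C p q)" if C: "oriented_fan C" and PC: "P C" and pq: "(p, q) \<in> C"
    and C': "oriented_fan (blowup C p q)" and card: "card (blowup C p q) = Suc (card C)" for C p q
  proof -
    interpret fan_blowup N J e1 e2 C p q using C pq C' by unfold_locales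
    \<comment> \<open>The bound makes the truncated subtraction of 2 commute with the
      successor.\<close>
    have "3 \<le> card C" using PC by (simp add: P_def)
    then have "card (blowup C p q) - 2 = Suc (card C - 2)" using card by linarith
    then show ?thesis using blowup_surface connected_sum_of_projective_planes.step PC card unfolding P_def by auto
  qed
  have hirz: "P (hirz_fan u w x)" if uw: "basis u w" and x: "odd x" for u w x
  proof -
    \<comment> \<open>With this basis the new ray \<open>u + (w - u)\<close> is \<open>w\<close>, so
      blowing up the plane yields index 1 in the given basis \<open>u\<close>,
      \<open>w\<close>.\<close>
    have bas: "basis u (w - u)" using uw by (auto simp: basis_def intro: N_diff)
    note b = plane_fan_blowup[OF bas, simplified]
    have card: "card (hirz_fan u w y) = 4" for y
      using hirz_fan_distinct[OF uw, of y] by (simp add: hirz_fan_def)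
    have "P (hirz_fan u w 1)"
      using step[OF b(1) plane[OF bas] b(2)] b(3) oriented_hirz_fan[OF uw, of 1] card[of 1] plane_fan_blowup(4)[OF bas]
      by simp
    then show ?thesis
      using connected_sum_homeomorphic[OF _ hirz_surface_parity[OF uw, of x 1]] x compact_hirz_surface[OF uw]
      unfolding P_def card by simp
  qed
  have "(\<exists>u w x. basis u w \<and> even x \<and> C = hirz_fan u w x) \<or> P C"
    by (rule oriented_fan_induct[OF C plane hirz step])
  then show ?thesis using n P_def by blast
qed

section \<open>Counting rays and assembling the hypotheses\<close>

lemma dim_cone_of: "dim (cone_of A) = dim A"
proof -
  have "convex_cone (span A)" by (intro subspace_imp_convex_cone subspace_span)
  then have "cone_of A \<subseteq> span A" by (intro hull_minimal span_superset)
  moreover have "A \<subseteq> cone_of A" by (rule hull_subset)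
  ultimately show ?thesis
    using dim_subset[of "cone_of A" "span A"] dim_subset[of A "cone_of A"] by simp
qed

text \<open>In a complete fan every ray is the first edge of exactly one oriented two-dimensional
  cone, so rays and maximal cones are equinumerous.\<close>

lemma card_rays:
  assumes dim: "DIM('v) = 2" and C: "oriented_fan C"
  shows "card (rays (fan_cones C)) = card C"
proof -
  have pair: "dim {a, b} = 2" if "basis a b" for a b
  proof -
    have "v \<in> span {a, b}" for v
      by (subst basis_expand[OF that, of v]) (intro span_add span_scale span_base; simp)
    then have "span {a, b} = UNIV" by blast
    then show ?thesis using dim dim_span[of "{a, b}"] by simp
  qed
  have nz: "a \<noteq> 0" "b \<noteq> 0" if "(a, b) \<in> C" for a b
    using basis_facts(4,5)[OF oriented_fanD(2)[OF C that]] .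
  have single: "dim {a} = 1" if "a \<noteq> 0" for a :: 'v using that by (simp add: dim_eq_card_independent)
  have "rays (fan_cones C) = cone_of ` {A \<in> faces C. dim A = 1}"
    unfolding rays_def fan_cones_def by (auto simp: dim_cone_of)
  moreover have "{A \<in> faces C. dim A = 1} = (\<lambda>a. {a}) ` fan_rays C"
  proof (intro equalityI subsetI)
    fix A assume "A \<in> {A \<in> faces C. dim A = 1}"
    then obtain a b where ab: "(a, b) \<in> C" "A \<subseteq> {a, b}" "dim A = 1" by (auto simp: faces_def)
    then have "A = {a} \<or> A = {b}" using pair[OF oriented_fanD(2)[OF C ab(1)]] unfolding subset_pair_iff by auto
    then show "A \<in> (\<lambda>a. {a}) ` fan_rays C" using edge_rays[OF C ab(1)] by auto
  next
    fix A assume "A \<in> (\<lambda>a. {a}) ` fan_rays C"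
    then obtain a b where "(a, b) \<in> C" "A = {a}" by (auto simp: fan_rays_def)
    then show "A \<in> {A \<in> faces C. dim A = 1}" using single[OF nz(1)] by (auto simp: faces_def)
  qed
  moreover have "inj_on cone_of {A \<in> faces C. dim A = 1}"
    using cone_of_eq_iff[OF unimodular_faces[OF C]] by (auto intro: inj_onI)
  moreover have "inj_on fst C" using successor_unique[OF C] by (auto intro!: inj_onI)
  moreover have "inj_on (\<lambda>a. {a}) (fan_rays C)" by simp
  ultimately show ?thesis by (metis card_image fan_rays_def)
qed

lemma smooth_projective_fan:
  assumes dim: "DIM('v) = 2" and fan: "is_fan N \<Delta>" and smooth: "smooth_toric_variety N \<Delta>"
    and proj: "projective_variety (toric_variety N \<Delta>)"
  obtains C where "oriented_fan C" "\<Delta> = fan_cones C"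
proof -
  define K where "K = {A. gens A \<and> cone_of A \<in> \<Delta>}"
  note K = smooth_fan_unimodular[OF dim fan smooth, folded K_def]
  have "K \<noteq> {}" using K(2) fan by (auto simp: is_fan_def)
  then have cover: "\<exists>A\<in>K. v \<in> cone_of A" for v
    using projective_imp_complete[OF K(1)] proj K(2) by simp
  have sub: "B \<in> K" if AB: "A \<in> K" "B \<subseteq> A" for A B
  proof -
    have A: "gens A" "cone_of A \<in> \<Delta>" using AB(1) by (auto simp: K_def)
    have "cone_of B \<noteq> {}" using convex_cone_hull_contains_0[of B] by blast
    then have "cone_of B \<in> \<Delta>" using fan cone_subset_face[OF A(1) AB(2)] A(2) unfolding is_fan_def by blast
    then show ?thesis using gens_subset[OF A(1) AB(2)] by (simp add: K_def)
  qed
  have fin: "finite (cone_of ` K)" using K(2) fan by (simp add: is_fan_def)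
  define C where "C = {(a, b). basis a b \<and> {a, b} \<in> K}"
  have C: "oriented_fan C" "faces C = K"
    unfolding C_def by (rule complete_fan_oriented[OF K(1) fin cover], erule (1) sub)+
  show ?thesis by (rule that[OF C(1)]) (unfold fan_cones_def C(2) K(2), rule refl)
qed

end

theorem mainTheorem1:
  fixes N :: "'v::euclidean_space set" and \<Delta> :: "'v set set"
  assumes "DIM('v) = 2"
    and "is_lattice N"
    and "is_fan N \<Delta>"
    and "smooth_toric_variety N \<Delta>"
    and "projective_variety (toric_variety N \<Delta>)"
  shows "((\<exists>a::nat. isomorphic_varieties (toric_variety N \<Delta>) (hirzebruch_surface (2 * a))) \<longrightarrow>
            toric_real_points N \<Delta> homeomorphic_space
              prod_topology (top_of_set (sphere (0::real^2) 1)) (top_of_set (sphere (0::real^2) 1))) \<and>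
         (\<not> (\<exists>a::nat. isomorphic_varieties (toric_variety N \<Delta>) (hirzebruch_surface (2 * a))) \<longrightarrow>
            connected_sum_of_projective_planes (card (rays \<Delta>) - 2) (toric_real_points N \<Delta>))"
proof -
  obtain J e1 e2 where "plane_lattice N J e1 e2" using plane_lattice_exists[OF assms(1,2)] .
  then interpret plane_lattice N J e1 e2 .
  obtain C where C: "oriented_fan C" "\<Delta> = fan_cones C" using smooth_projective_fan[OF assms(1,3-5)] .
  show ?thesis
  proof (intro conjI impI)
    assume "\<exists>a::nat. isomorphic_varieties (toric_variety N \<Delta>) (hirzebruch_surface (2 * a))"
    then obtain a where iso: "isomorphic_varieties (toric_variety N \<Delta>) (hirzebruch_surface (2 * a))" by blast
    \<comment> \<open>The given isomorphism need not come from an identification of fans; it only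
      transports the real points to those of the standard even Hirzebruch surface, whose topology is
      known.\<close>
    define H where "H = integer_plane.hirz_fan (vector [1, 0]) (vector [0, 1]) (int (2 * a))"
    have fan: "integer_plane.fan_cones H = hirzebruch_fan (2 * a)"
      unfolding H_def integer_plane.fan_cones_def integer_plane.faces_hirz_fan hirzebruch_fan_def Let_def
      by (simp only: of_int_of_nat_eq)
    have "separated_fan integer_lattice (hirzebruch_fan (2 * a))"
      using integer_plane.separated_fan_cones[OF integer_plane.oriented_hirz_fan[OF integer_basis]]
      unfolding fan[symmetric] H_def .
    then have "toric_real_points N \<Delta> homeomorphic_space toric_real_points integer_lattice (hirzebruch_fan (2 * a))"
      using iso unfolding C(2) hirzebruch_surface_def
      by (intro isomorphic_imp_real_points_homeomorphic[OF separated_fan_cones[OF C(1)]])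
    also have "toric_real_points integer_lattice (hirzebruch_fan (2 * a)) = integer_plane.surface H"
      unfolding integer_plane.surface_def fan ..
    also have "\<dots> homeomorphic_space
        prod_topology (top_of_set (sphere (0::real^2) 1)) (top_of_set (sphere (0::real^2) 1))"
      unfolding H_def by (rule integer_plane.even_hirz_surface[OF integer_basis]) simp
    finally (homeomorphic_space_trans) show "toric_real_points N \<Delta> homeomorphic_space
        prod_topology (top_of_set (sphere (0::real^2) 1)) (top_of_set (sphere (0::real^2) 1))" .
  next
    assume n: "\<not> (\<exists>a::nat. isomorphic_varieties (toric_variety N \<Delta>) (hirzebruch_surface (2 * a)))"
    \<comment> \<open>An even Hirzebruch fan in any lattice basis would produce an isomorphism that
      has just been excluded.\<close>
    have "C \<noteq> hirz_fan u w x" if "basis u w" "even x" for u w x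
      using even_hirz_fan_isomorphic[OF that] n C(2) by blast
    from connected_sum_surface[OF C(1) this]
    show "connected_sum_of_projective_planes (card (rays \<Delta>) - 2) (toric_real_points N \<Delta>)"
      using card_rays[OF assms(1) C(1)] unfolding C(2) surface_def by simp
  qed
qed

end
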